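(* Let $K$ be a field, let $\Sigma$ be a rational pointed shellable fan in $\mathbb{R}^d$ and let $\mathcal{M}_\Sigma$ be a Cohen--Macaulay monoidal complex supported by $\Sigma$. Then $K[\mathcal{M}_\Sigma]$ is Cohen--Macaulay. In particular, the toric face ring $K[\Sigma]$ is Cohen--Macaulay (for every field $K$, independent of $\operatorname{char}K$).
   Context: A rational pointed fan $\Sigma$ in $\mathbb{R}^d$ is a finite collection of rational pointed polyhedral cones closed under taking faces, such that the intersection of two cones of $\Sigma$ is a common face of both. Its facets are its maximal cones; $\Sigma$ is pure $k$-dimensional if all facets have dimension $k$. For a cone $C$, $\mathrm{fan}(C)$ is the fan of all faces of $C$ and $\mathrm{fan}(\partial C)$ the fan of all proper faces of $C$. A shelling of a pure $k$-dimensional fan $\Sigma$ is a linear ordering $C_1,\dots,C_s$ of its facets such that either $k=0$, or: (1) $\mathrm{fan}(\partial C_1)$ has a shelling, and (2) for $1<j\le s$ the fan $\mathrm{fan}(\partial C_j)$ is pure $(k-1)$-dimensional and there is a shelling $D_1,\dots,D_{t_j}$ of $\mathrm{fan}(\partial C_j)$ with $\emptyset\neq\bigcup_{i=1}^{j-1}[\mathrm{fan}(C_i)\cap\mathrm{fan}(C_j)]=\bigcup_{l=1}^{r_j}\mathrm{fan}(D_l)$ for some $1\le r_j\le t_j$. $\Sigma$ is shellable if it is pure and has a shelling. A monoidal complex supported by $\Sigma$ is a set $\mathcal{M}_\Sigma=\{M_C\subseteq\mathbb{Z}^d : C\in\Sigma\}$ of affine monoids such that the cone generated by $M_C$ is $C$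 and $M_{C'}=M_C\cap C'$ whenever $C'\subseteq C$ are in $\Sigma$; it is Cohen--Macaulay if every monoid ring $K[M_C]$ is Cohen--Macaulay. With $|\mathcal{M}_\Sigma|=\bigcup_C M_C$, the toric face ring $K[\mathcal{M}_\Sigma]$ has $K$-basis $\{x^a: a\in|\mathcal{M}_\Sigma|\}$ with $x^ax^b=x^{a+b}$ if $a,b$ lie in a common $M_C$ and $0$ otherwise. $K[\Sigma]$ denotes $K[\mathcal{M}_\Sigma]$ for $\mathcal{M}_\Sigma=\{C\cap\mathbb{Z}^d : C\in\Sigma\}$. *)

theory Defs
  imports "HOL-Analysis.Analysis" "HOL-Algebra.Ring_Divisibility" "HOL-Library.Extended_Nat"
begin

type_synonym 'n cone = "(real ^ 'n) set"

definition rvec :: "int ^ ('n::finite) \<Rightarrow> real ^ 'n" where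
  "rvec a = (\<chi> i. of_int (a $ i))"

definition cone_gen :: "(real ^ ('n::finite)) set \<Rightarrow> (real ^ 'n) set" where
  "cone_gen S = {x. \<exists>T c. finite T \<and> T \<subseteq> S \<and> (\<forall>v\<in>T. 0 \<le> c v) \<and> x = (\<Sum>v\<in>T. c v *\<^sub>R v)}"

definition rational_cone :: "('n::finite) cone \<Rightarrow> bool" where
  "rational_cone C \<longleftrightarrow> (\<exists>G. finite G \<and> C = cone_gen (rvec ` G))"

definition pointed_cone :: "('n::finite) cone \<Rightarrow> bool" where
  "pointed_cone C \<longleftrightarrow> C \<inter> uminus ` C = {0}"

definition rational_pointed_cone :: "('n::finite) cone \<Rightarrow> bool" where
  "rational_pointed_cone C \<longleftrightarrow> rational_cone C \<and> pointed_cone C"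

text \<open>Faces of a cone (nonempty faces; every face contains the apex 0).\<close>
definition cone_faces :: "('n::finite) cone \<Rightarrow> 'n cone set" ("fan") where
  "fan C = {F. F face_of C \<and> F \<noteq> {}}"

definition bd_fan :: "('n::finite) cone \<Rightarrow> 'n cone set" where
  "bd_fan C = {F \<in> fan C. F \<noteq> C}"

definition rational_pointed_fan :: "('n::finite) cone set \<Rightarrow> bool" where
  "rational_pointed_fan \<Sigma> \<longleftrightarrow> finite \<Sigma> \<and> (\<forall>C\<in>\<Sigma>. rational_pointed_cone C)
     \<and> (\<forall>C\<in>\<Sigma>. fan C \<subseteq> \<Sigma>)
     \<and> (\<forall>C\<in>\<Sigma>. \<forall>D\<in>\<Sigma>. C \<inter> D \<in> fan C \<and> C \<inter> D \<in> fan D)"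

definition facets :: "('n::finite) cone set \<Rightarrow> 'n cone set" where
  "facets \<Sigma> = {C \<in> \<Sigma>. \<forall>D\<in>\<Sigma>. C \<subseteq> D \<longrightarrow> D = C}"

definition pure_fan :: "nat \<Rightarrow> ('n::finite) cone set \<Rightarrow> bool" where
  "pure_fan k \<Sigma> \<longleftrightarrow> (\<forall>C\<in>facets \<Sigma>. aff_dim C = int k)"

fun is_shelling :: "nat \<Rightarrow> ('n::finite) cone set \<Rightarrow> 'n cone list \<Rightarrow> bool" where
  "is_shelling 0 \<Sigma> Cs \<longleftrightarrow> pure_fan 0 \<Sigma> \<and> distinct Cs \<and> set Cs = facets \<Sigma>"
| "is_shelling (Suc k) \<Sigma> Cs \<longleftrightarrow> pure_fan (Suc k) \<Sigma> \<and> distinct Cs \<and> set Cs = facets \<Sigma>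
     \<and> (Cs \<noteq> [] \<longrightarrow> (\<exists>Ds. is_shelling k (bd_fan (Cs ! 0)) Ds))
     \<and> (\<forall>j. 0 < j \<and> j < length Cs \<longrightarrow>
          pure_fan k (bd_fan (Cs ! j)) \<and>
          (\<exists>Ds r. is_shelling k (bd_fan (Cs ! j)) Ds \<and> 1 \<le> r \<and> r \<le> length Ds \<and>
             (\<Union>i<j. fan (Cs ! i) \<inter> fan (Cs ! j)) \<noteq> {} \<and>
             (\<Union>i<j. fan (Cs ! i) \<inter> fan (Cs ! j)) = (\<Union>l<r. fan (Ds ! l))))"

definition shellable :: "('n::finite) cone set \<Rightarrow> bool" where
  "shellable \<Sigma> \<longleftrightarrow> (\<exists>k Cs. is_shelling k \<Sigma> Cs)"

definition affine_monoid :: "(int ^ ('n::finite)) set \<Rightarrow> bool" where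
  "affine_monoid M \<longleftrightarrow> (\<exists>G. finite G \<and> M = {x. \<exists>m :: int ^ 'n \<Rightarrow> nat. x = (\<Sum>g\<in>G. of_nat (m g) * g)})"

definition monoidal_complex :: "('n::finite) cone set \<Rightarrow> ('n cone \<Rightarrow> (int ^ 'n) set) \<Rightarrow> bool" where
  "monoidal_complex \<Sigma> M \<longleftrightarrow>
     (\<forall>C\<in>\<Sigma>. affine_monoid (M C) \<and> cone_gen (rvec ` M C) = C)
     \<and> (\<forall>C\<in>\<Sigma>. \<forall>C'\<in>\<Sigma>. C' \<subseteq> C \<longrightarrow> M C' = {a \<in> M C. rvec a \<in> C'})"

section \<open>Rings K[...] with basis x^a, x^a x^b = x^(a+b) if a, b lie in a common
  member of a family of monoids, and 0 otherwise\<close>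

text \<open>Elements: finitely supported K-valued functions on Z^d (coefficient of x^a at a)
  with support in the union of the family.\<close>
definition patch_ring :: "(int ^ ('n::finite)) set set \<Rightarrow> (int ^ 'n \<Rightarrow> 'k::field) ring" where
  "patch_ring \<M> = \<lparr>
     carrier = {f. finite {a. f a \<noteq> 0} \<and> {a. f a \<noteq> 0} \<subseteq> \<Union>\<M>},
     monoid.mult = (\<lambda>f g c. \<Sum>p\<in>{(a, b). f a \<noteq> 0 \<and> g b \<noteq> 0 \<and> a + b = c \<and> (\<exists>N\<in>\<M>. a \<in> N \<and> b \<in> N)}.
                       f (fst p) * g (snd p)),
     one = (\<lambda>a. if a = 0 \<and> a \<in> \<Union>\<M> then 1 else 0),
     zero = (\<lambda>a. 0),
     add = (\<lambda>f g a. f a + g a) \<rparr>"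

definition monoid_ring :: "(int ^ ('n::finite)) set \<Rightarrow> (int ^ 'n \<Rightarrow> 'k::field) ring" where
  "monoid_ring M = patch_ring {M}"

definition toric_face_ring :: "('n::finite) cone set \<Rightarrow> ('n cone \<Rightarrow> (int ^ 'n) set) \<Rightarrow> (int ^ 'n \<Rightarrow> 'k::field) ring" where
  "toric_face_ring \<Sigma> M = patch_ring (M ` \<Sigma>)"

definition lattice_points :: "('n::finite) cone \<Rightarrow> (int ^ 'n) set" where
  "lattice_points C = {a. rvec a \<in> C}"

definition regular_sequence :: "('a, 'b) ring_scheme \<Rightarrow> 'a list \<Rightarrow> bool" where
  "regular_sequence R xs \<longleftrightarrow> set xs \<subseteq> carrier R
     \<and> (\<forall>i < length xs. \<forall>y\<in>carrier R.
          xs ! i \<otimes>\<^bsub>R\<^esub> y \<in> Idl\<^bsub>R\<^esub> (set (take i xs)) \<longrightarrow> y \<in> Idl\<^bsub>R\<^esub> (set (take i xs)))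
     \<and> Idl\<^bsub>R\<^esub> (set xs) \<noteq> carrier R"

definition grade :: "('a, 'b) ring_scheme \<Rightarrow> 'a set \<Rightarrow> enat" where
  "grade R I = Sup {enat (length xs) | xs. regular_sequence R xs \<and> set xs \<subseteq> I}"

definition height :: "('a, 'b) ring_scheme \<Rightarrow> 'a set \<Rightarrow> enat" where
  "height R P = Sup {enat n | n. \<exists>Q :: nat \<Rightarrow> 'a set.
       (\<forall>i\<le>n. primeideal (Q i) R) \<and> (\<forall>i<n. Q i \<subset> Q (Suc i)) \<and> Q n = P}"

text \<open>A Noetherian ring R is Cohen--Macaulay iff all localizations R_m at maximal
  ideals are Cohen--Macaulay local rings, i.e. depth R_m = dim R_m.  Here
  depth R_m = grade m and dim R_m = height m.\<close>
definition cohen_macaulay :: "('a, 'b) ring_scheme \<Rightarrow> bool" where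
  "cohen_macaulay R \<longleftrightarrow> cring R \<and> noetherian_ring R
     \<and> (\<forall>m. maximalideal m R \<longrightarrow> grade R m = height R m)"

end

theory Submission
  imports Defs "HOL-Library.Function_Algebras" "HOL-Library.Poly_Mapping"
begin

text \<open>
  At a maximal ideal \<open>m\<close> of the toric face ring \<open>R\<close>, let \<open>k\<close> be the dimension of the fan, let \<open>B\<close> be a
  maximal linearly independent set of lattice points \<open>a\<close> with \<open>x\<^sup>a \<notin> m\<close> and \<open>J \<subseteq> B\<close> a maximal subset
  whose monomials are algebraically independent modulo \<open>m\<close>. Counting lattice points in boxes shows that
  prime chains ending in \<open>m\<close> have length at most \<open>k - card J\<close>, so it suffices to find a regular sequence of
  that length in \<open>m\<close>.

  The set \<open>M C\<close> of a cone \<open>C\<close> spans a quotient of \<open>R\<close>. It is enough that each such quotient has depth at least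
  \<open>dim C - card J\<close>: a shelling \<open>C\<^sub>1, \<dots>, C\<^sub>s\<close> gives exact sequences in which the face ring of \<open>C\<^sub>j\<close> is glued to
  that of \<open>C\<^sub>1 \<union> \<dots> \<union> C\<^sub>j\<^sub>-\<^sub>1\<close> along an initial segment of a shelling of the boundary of \<open>C\<^sub>j\<close>, and the depth
  lemma applies by induction on the dimension.

  If \<open>K[M C]\<close> is Cohen--Macaulay, its depth at the contraction of \<open>m\<close> is at least the length of the following
  prime chain. The elements of \<open>B - J\<close> are algebraic over \<open>J\<close> modulo \<open>m\<close>, which yields \<open>card B - card J\<close>
  steps; the other \<open>dim C - card B\<close> come from a chain of faces between the smallest face containing \<open>B\<close> and \<open>C\<close>.

  For \<open>M C = C \<inter> \<int>\<^sup>d\<close> the bound is proved for all translates \<open>v + C\<close> with \<open>v \<in> C\<close> at once. If \<open>x\<^sup>a \<in> m\<close> for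
  an interior lattice point \<open>a\<close> of \<open>C\<close>, then multiplication by \<open>x\<^sup>a\<close> is injective and its cokernel is filtered by
  the boundary layers \<open>v + s a + \<partial>C\<close> with \<open>0 \<le> s < 1\<close>, whose depth is known from the shelling of \<open>\<partial>C\<close>.
  Otherwise \<open>dim C \<le> card B\<close>, and the elements of \<open>B - J\<close> already provide a sequence of the required length.
\<close>

section \<open>Depth over a commutative ring\<close>

text \<open>The ideal \<open>m\<close> is not assumed homogeneous, so monomials may become units at
  \<open>m\<close>. \<open>J\<close> absorbs a possible transcendence degree of the residue field:
  \<open>card J\<close> is subtracted both from the bound on prime chains and from every depth, so
  its size never has to be determined (by the Nullstellensatz \<open>J\<close> is empty). Sequences
  are only weakly regular, hence a quotient that vanishes at \<open>m\<close> has every depth, and a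
  face missing one of the units cannot harm the gluing. As \<open>m\<close> is maximal, sequences
  found after localisation can be replaced by sequences in \<open>m\<close> that are regular before
  it. The depth lemma is derived from prime avoidance: one element of \<open>m\<close> is regular on
  all the quotients involved, and any regular element can begin a longest sequence. Dimension enters
  only through chains of primes: one long chain bounds the depth of a Cohen-Macaulay face ring from
  below, and algebraic independence bounds all chains of the toric face ring from above. In the case
  of all lattice points the translations are by real vectors, because the boundary layers occur at
  non-integral heights \<open>s\<close>.\<close>

definition plus_mult :: "'a::comm_ring_1 set \<Rightarrow> 'a \<Rightarrow> 'a set \<Rightarrow> 'a set" where
  "plus_mult B x A = {b + x * a | b a. b \<in> B \<and> a \<in> A}"

definition regular_on :: "'a::comm_ring_1 \<Rightarrow> 'a set \<Rightarrow> 'a set \<Rightarrow> bool" where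
  "regular_on x A B \<longleftrightarrow> (\<forall>a\<in>A. x * a \<in> B \<longrightarrow> a \<in> B)"

text \<open>Modules are represented as quotients \<open>A / B\<close> of ideals \<open>B \<subseteq> A\<close>: \<open>depth_ge m n A B\<close> means that \<open>m\<close>
  contains a sequence of length \<open>n\<close> that is weakly regular on \<open>A / B\<close>, and \<open>loc_depth_ge S m n A B\<close> that it is
  so after localisation at \<open>S\<close>.\<close>

fun depth_ge :: "'a::comm_ring_1 set \<Rightarrow> nat \<Rightarrow> 'a set \<Rightarrow> 'a set \<Rightarrow> bool" where
  "depth_ge m 0 A B \<longleftrightarrow> True"
| "depth_ge m (Suc n) A B \<longleftrightarrow> (\<exists>x\<in>m. regular_on x A B \<and> depth_ge m n A (plus_mult B x A))"

definition loc_regular_on :: "'a::comm_ring_1 set \<Rightarrow> 'a \<Rightarrow> 'a set \<Rightarrow> 'a set \<Rightarrow> bool" where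
  "loc_regular_on S x A B \<longleftrightarrow> (\<forall>a\<in>A. x * a \<in> B \<longrightarrow> (\<exists>s\<in>S. s * a \<in> B))"

fun loc_depth_ge :: "'a::comm_ring_1 set \<Rightarrow> 'a set \<Rightarrow> nat \<Rightarrow> 'a set \<Rightarrow> 'a set \<Rightarrow> bool" where
  "loc_depth_ge S m 0 A B \<longleftrightarrow> True"
| "loc_depth_ge S m (Suc n) A B \<longleftrightarrow>
     (\<exists>x\<in>m. loc_regular_on S x A B \<and> loc_depth_ge S m n A (plus_mult B x A))"

section \<open>Ideals, primes and zero divisors\<close>

lemma plus_multI: "b \<in> B \<Longrightarrow> a \<in> A \<Longrightarrow> y = b + x * a \<Longrightarrow> y \<in> plus_mult B x A"
  by (auto simp: plus_mult_def)

lemma plus_multE: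
  assumes "y \<in> plus_mult B x A"
  obtains b a where "b \<in> B" "a \<in> A" "y = b + x * a"
  using assms by (auto simp: plus_mult_def)

lemma plus_mult_commute: "plus_mult (plus_mult B x A) y A = plus_mult (plus_mult B y A) x A"
proof -
  have "plus_mult (plus_mult B x A) y A \<subseteq> plus_mult (plus_mult B y A) x A" for x y
    by (auto simp: plus_mult_def) (metis (no_types, lifting) add.assoc add.commute)
  thus ?thesis by blast
qed

text \<open>The ring is a subset of an ambient type of class \<open>comm_ring_1\<close>, so that
  subrings, face rings and finitely generated extensions share its operations and
  \<open>algebra_simps\<close> applies to all of them.\<close>

locale comm_subring =
  fixes R :: "'a::comm_ring_1 set"
  assumes one_mem: "1 \<in> R"
    and add_mem: "x \<in> R \<Longrightarrow> y \<in> R \<Longrightarrow> x + y \<in> R"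
    and uminus_mem: "x \<in> R \<Longrightarrow> - x \<in> R"
    and mult_mem: "x \<in> R \<Longrightarrow> y \<in> R \<Longrightarrow> x * y \<in> R"
begin

lemma zero_mem: "0 \<in> R"
  using add_mem[OF one_mem uminus_mem[OF one_mem]] by simp

lemma diff_mem: "x \<in> R \<Longrightarrow> y \<in> R \<Longrightarrow> x - y \<in> R"
  using add_mem[of x "- y"] uminus_mem[of y] by simp

lemma power_mem: "x \<in> R \<Longrightarrow> x ^ n \<in> R"
  by (induction n) (auto intro: one_mem mult_mem)

lemma sum_mem: "(\<And>i. i \<in> I \<Longrightarrow> f i \<in> R) \<Longrightarrow> sum f I \<in> R"
  by (induction I rule: infinite_finite_induct) (auto intro: zero_mem add_mem)

definition is_ideal :: "'a set \<Rightarrow> bool" where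
  "is_ideal I \<longleftrightarrow> I \<subseteq> R \<and> 0 \<in> I \<and> (\<forall>x\<in>I. \<forall>y\<in>I. x + y \<in> I) \<and> (\<forall>r\<in>R. \<forall>x\<in>I. r * x \<in> I)"

definition is_prime :: "'a set \<Rightarrow> bool" where
  "is_prime P \<longleftrightarrow> is_ideal P \<and> 1 \<notin> P \<and> (\<forall>x\<in>R. \<forall>y\<in>R. x * y \<in> P \<longrightarrow> x \<in> P \<or> y \<in> P)"

definition is_maximal :: "'a set \<Rightarrow> bool" where
  "is_maximal M \<longleftrightarrow> is_ideal M \<and> 1 \<notin> M \<and> (\<forall>x\<in>R - M. \<exists>r\<in>R. \<exists>u\<in>M. 1 = u + r * x)"

definition is_noetherian :: bool where
  "is_noetherian \<longleftrightarrow>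
     (\<forall>I. is_ideal I \<longrightarrow> (\<exists>G. finite G \<and> G \<subseteq> I \<and> (\<forall>J. is_ideal J \<longrightarrow> G \<subseteq> J \<longrightarrow> I \<subseteq> J)))"

lemma ideal_sub: "is_ideal I \<Longrightarrow> x \<in> I \<Longrightarrow> x \<in> R"
  by (auto simp: is_ideal_def)
lemma ideal_zero: "is_ideal I \<Longrightarrow> 0 \<in> I"
  by (auto simp: is_ideal_def)
lemma ideal_add: "is_ideal I \<Longrightarrow> x \<in> I \<Longrightarrow> y \<in> I \<Longrightarrow> x + y \<in> I"
  by (auto simp: is_ideal_def)
lemma ideal_mult: "is_ideal I \<Longrightarrow> r \<in> R \<Longrightarrow> x \<in> I \<Longrightarrow> r * x \<in> I"
  by (auto simp: is_ideal_def)
lemma ideal_uminus: "is_ideal I \<Longrightarrow> x \<in> I \<Longrightarrow> - x \<in> I"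
  using ideal_mult[of I "-1" x] uminus_mem[OF one_mem] by simp
lemma ideal_diff: "is_ideal I \<Longrightarrow> x \<in> I \<Longrightarrow> y \<in> I \<Longrightarrow> x - y \<in> I"
  using ideal_add[of I x "- y"] ideal_uminus[of I y] by simp
lemma ideal_sum: "is_ideal I \<Longrightarrow> (\<And>i. i \<in> S \<Longrightarrow> f i \<in> I) \<Longrightarrow> sum f S \<in> I"
  by (induction S rule: infinite_finite_induct) (auto intro: ideal_zero ideal_add)
lemma ideal_add_cancel: "is_ideal I \<Longrightarrow> x + y \<in> I \<Longrightarrow> x \<in> I \<Longrightarrow> y \<in> I"
  using ideal_diff[of I "x + y" x] by simp

lemma ideal_R: "is_ideal R"
  by (auto simp: is_ideal_def zero_mem add_mem mult_mem)
lemma ideal_zero_set: "is_ideal {0}"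
  by (auto simp: is_ideal_def zero_mem)

lemma ideal_Int: "is_ideal I \<Longrightarrow> is_ideal J \<Longrightarrow> is_ideal (I \<inter> J)"
  by (auto simp: is_ideal_def)

lemma ideal_Inter: "\<I> \<noteq> {} \<Longrightarrow> (\<And>I. I \<in> \<I> \<Longrightarrow> is_ideal I) \<Longrightarrow> is_ideal (\<Inter>\<I>)"
  unfolding is_ideal_def by blast

lemma ideal_directed_Union:
  assumes "\<I> \<noteq> {}" "\<And>I. I \<in> \<I> \<Longrightarrow> is_ideal I"
    and "\<And>I J. I \<in> \<I> \<Longrightarrow> J \<in> \<I> \<Longrightarrow> \<exists>K\<in>\<I>. I \<subseteq> K \<and> J \<subseteq> K"
  shows "is_ideal (\<Union>\<I>)"
  unfolding is_ideal_def
proof (intro conjI ballI)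
  fix x y assume "x \<in> \<Union>\<I>" "y \<in> \<Union>\<I>"
  then obtain I J where "I \<in> \<I>" "J \<in> \<I>" "x \<in> I" "y \<in> J" by blast
  moreover obtain K where "K \<in> \<I>" "I \<subseteq> K" "J \<subseteq> K" using assms(3) calculation by blast
  ultimately show "x + y \<in> \<Union>\<I>" using assms(2) ideal_add by blast
qed (use assms(1,2) ideal_sub ideal_zero ideal_mult in blast)+

lemma ideal_colon: "is_ideal B \<Longrightarrow> is_ideal {r \<in> R. r * a \<in> B}"
  by (auto simp: is_ideal_def distrib_right zero_mem add_mem mult_mem mult.assoc)

lemma ideal_plus_mult: "is_ideal A \<Longrightarrow> is_ideal B \<Longrightarrow> x \<in> R \<Longrightarrow> is_ideal (plus_mult B x A)"
  unfolding is_ideal_def[of "plus_mult B x A"]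
proof (intro conjI ballI)
  assume a: "is_ideal A" "is_ideal B" "x \<in> R"
  show "plus_mult B x A \<subseteq> R"
    using a by (auto elim!: plus_multE intro!: add_mem mult_mem dest: ideal_sub)
  show "0 \<in> plus_mult B x A"
    using a by (intro plus_multI[of 0 _ 0]) (auto simp: ideal_zero)
  show "y + z \<in> plus_mult B x A" if yz: "y \<in> plus_mult B x A" "z \<in> plus_mult B x A" for y z
  proof -
    from yz(1) obtain b a1 where 1: "b \<in> B" "a1 \<in> A" "y = b + x * a1" by (rule plus_multE)
    from yz(2) obtain b' a2 where 2: "b' \<in> B" "a2 \<in> A" "z = b' + x * a2" by (rule plus_multE)
    show ?thesis
      by (rule plus_multI[of "b + b'" _ "a1 + a2"])
        (use 1 2 a in \<open>auto intro: ideal_add simp: algebra_simps\<close>)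
  qed
  show "r * z \<in> plus_mult B x A" if "r \<in> R" and z: "z \<in> plus_mult B x A" for r z
  proof -
    from z obtain b a1 where 1: "b \<in> B" "a1 \<in> A" "z = b + x * a1" by (rule plus_multE)
    show ?thesis
      by (rule plus_multI[of "r * b" _ "r * a1"])
        (use 1 a that in \<open>auto intro: ideal_mult simp: distrib_left mult.left_commute\<close>)
  qed
qed

lemma plus_mult_base: "is_ideal A \<Longrightarrow> B \<subseteq> plus_mult B x A"
  by (auto intro!: plus_multI[of _ _ 0] simp: ideal_zero)

lemma plus_mult_mult: "is_ideal B \<Longrightarrow> a \<in> A \<Longrightarrow> x * a \<in> plus_mult B x A"
  by (auto intro!: plus_multI[of 0 _ a] simp: ideal_zero)

lemma plus_mult_subset: "is_ideal A \<Longrightarrow> B \<subseteq> A \<Longrightarrow> x \<in> R \<Longrightarrow> plus_mult B x A \<subseteq> A"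
  by (auto elim!: plus_multE intro!: ideal_add ideal_mult)

lemma prime_ideal: "is_prime P \<Longrightarrow> is_ideal P"
  by (simp add: is_prime_def)

lemma maximal_ideal: "is_maximal P \<Longrightarrow> is_ideal P"
  by (simp add: is_maximal_def)

lemma maximalE:
  assumes "is_maximal m" "s \<in> R" "s \<notin> m"
  obtains r u where "r \<in> R" "u \<in> m" "1 = u + r * s"
  using assms unfolding is_maximal_def by blast

lemma maximal_prime:
  assumes "is_maximal M" shows "is_prime M"
  unfolding is_prime_def
proof (intro conjI ballI impI)
  show I: "is_ideal M" and "1 \<notin> M" using assms by (auto simp: is_maximal_def)
  fix x y assume xy: "x \<in> R" "y \<in> R" "x * y \<in> M"
  show "x \<in> M \<or> y \<in> M"
  proof (rule disjCI)
    assume "y \<notin> M"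
    then obtain r u where "r \<in> R" "u \<in> M" "1 = u + r * y"
      using assms xy unfolding is_maximal_def by blast
    then have "x = x * u + r * (x * y)" by (metis mult.left_commute mult.right_neutral distrib_left)
    thus "x \<in> M" using I xy \<open>r \<in> R\<close> \<open>u \<in> M\<close> by (metis ideal_add ideal_mult)
  qed
qed

lemma prime_power: "is_prime P \<Longrightarrow> x \<in> R \<Longrightarrow> x ^ n \<in> P \<Longrightarrow> x \<in> P"
proof (induction n)
  case (Suc n)
  thus ?case using power_mem[of x n] unfolding is_prime_def by auto
qed (simp add: is_prime_def)

lemma noetherianE:
  assumes is_noetherian "is_ideal I"
  obtains G where "finite G" "G \<subseteq> I" "\<And>J. is_ideal J \<Longrightarrow> G \<subseteq> J \<Longrightarrow> I \<subseteq> J"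
  using assms unfolding is_noetherian_def by auto

text \<open>Zorn's lemma applies because the union of a chain of ideals is finitely generated, hence
  already equal to a member of the chain.\<close>

lemma exists_maximal_element:
  assumes "is_noetherian" "\<And>I. I \<in> \<P> \<Longrightarrow> is_ideal I" "I \<in> \<P>"
  obtains P where "P \<in> \<P>" "I \<subseteq> P" "\<And>Q. Q \<in> \<P> \<Longrightarrow> P \<subseteq> Q \<Longrightarrow> Q = P"
proof -
  let ?A = "{J \<in> \<P>. I \<subseteq> J}"
  have "\<exists>M\<in>?A. \<forall>X\<in>?A. M \<subseteq> X \<longrightarrow> X = M"
  proof (rule subset_Zorn_nonempty)
    show "?A \<noteq> {}" using assms by auto
    fix C assume C: "C \<noteq> {}" "subset.chain ?A C"
    then have Cs: "C \<subseteq> ?A" "\<And>X Y. X \<in> C \<Longrightarrow> Y \<in> C \<Longrightarrow> X \<subseteq> Y \<or> Y \<subseteq> X"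
      by (auto simp: subset_chain_def)
    have idC: "is_ideal (\<Union>C)"
    proof (rule ideal_directed_Union[OF C(1)])
      show "is_ideal I" if "I \<in> C" for I using that Cs(1) assms(2) by auto
      show "\<exists>K\<in>C. I \<subseteq> K \<and> J \<subseteq> K" if "I \<in> C" "J \<in> C" for I J
        using Cs(2)[OF that] that by auto
    qed
    obtain G where G: "finite G" "G \<subseteq> \<Union>C" "\<And>J. is_ideal J \<Longrightarrow> G \<subseteq> J \<Longrightarrow> \<Union>C \<subseteq> J"
      using noetherianE[OF assms(1) idC] by blast
    obtain J where J: "J \<in> C" "G \<subseteq> J"
      using finite_subset_Union_chain[OF G(1,2) C(1,2)] by metis
    have "J \<in> ?A" using J(1) Cs(1) by (rule subsetD[rotated])
    then have "is_ideal J" using assms(2) by simp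
    then have "\<Union>C \<subseteq> J" using G(3) J(2) by simp
    then have "\<Union>C = J" using J(1) by auto
    thus "\<Union>C \<in> ?A" using \<open>J \<in> ?A\<close> by simp
  qed
  then obtain P where P: "P \<in> ?A" "\<forall>X\<in>?A. P \<subseteq> X \<longrightarrow> X = P" by (rule bexE)
  show ?thesis
  proof (rule that[of P])
    show "Q = P" if "Q \<in> \<P>" "P \<subseteq> Q" for Q
    proof -
      have "Q \<in> ?A" using that P(1) by auto
      thus ?thesis using P(2) that(2) by simp
    qed
  qed (use P(1) in auto)
qed

text \<open>If no \<open>Q\<close> in \<open>F\<close> were contained in \<open>P\<close>, elements
  outside of \<open>P\<close> chosen from these ideals would have a product in the intersection but
  not in \<open>P\<close>. The factor \<open>R\<close> gives the empty intersection its
  meaning.\<close>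

lemma prime_contains_Inter:
  assumes "finite F" "\<And>Q. Q \<in> F \<Longrightarrow> is_ideal Q" "is_prime P" "R \<inter> \<Inter>F \<subseteq> P"
  shows "\<exists>Q\<in>F. Q \<subseteq> P"
  using assms
proof (induction F rule: finite_induct)
  case empty
  thus ?case using one_mem by (auto simp: is_prime_def)
next
  case (insert Q F)
  show ?case
  proof (rule ccontr)
    assume neg: "\<not> ?case"
    then have "\<not> R \<inter> \<Inter>F \<subseteq> P" using insert by blast
    then obtain y where y: "y \<in> R" "y \<in> \<Inter>F" "y \<notin> P" by blast
    obtain x where x: "x \<in> Q" "x \<notin> P" using neg by blast
    have Q: "is_ideal Q" using insert by blast
    have xR: "x \<in> R" using ideal_sub[OF Q x(1)] .
    have "x * y \<in> Q" using ideal_mult[OF Q y(1) x(1)] by (simp add: mult.commute)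
    moreover have "x * y \<in> Q'" if "Q' \<in> F" for Q'
      using insert.prems(1)[of Q'] that y(2) xR by (auto intro: ideal_mult)
    ultimately have "x * y \<in> R \<inter> \<Inter>(insert Q F)" using mult_mem[OF xR y(1)] by simp
    then have "x * y \<in> P" using insert.prems(3) by (rule subsetD[rotated])
    thus False using insert.prems(2) x y xR unfolding is_prime_def by auto
  qed
qed

lemma prime_avoidance:
  assumes "finite \<S>" "\<And>P. P \<in> \<S> \<Longrightarrow> is_prime P" "is_ideal I" "\<And>P. P \<in> \<S> \<Longrightarrow> \<not> I \<subseteq> P"
  shows "\<exists>x\<in>I. \<forall>P\<in>\<S>. x \<notin> P"
  using assms
proof (induction "card \<S>" arbitrary: \<S> rule: less_induct)
  case less
  show ?case
  proof (cases "\<exists>P\<in>\<S>. \<exists>Q\<in>\<S>. P \<noteq> Q \<and> Q \<subseteq> P")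
    case True
    then obtain P Q where PQ: "P \<in> \<S>" "Q \<in> \<S>" "P \<noteq> Q" "Q \<subseteq> P" by blast
    have "card (\<S> - {Q}) < card \<S>" using PQ less.prems(1) by (meson card_Diff1_less)
    from less.hyps[OF this] less.prems obtain x where x: "x \<in> I" "\<And>P. P \<in> \<S> - {Q} \<Longrightarrow> x \<notin> P"
      by (metis DiffD1 finite_Diff)
    thus ?thesis using PQ by blast
  next
    case False
    show ?thesis
    proof (cases "\<S> = {}")
      case True thus ?thesis using less.prems ideal_zero by blast
    next
      case nonempty: False
      then obtain P where P: "P \<in> \<S>" by blast
      have "card (\<S> - {P}) < card \<S>" using P less.prems(1) by (meson card_Diff1_less)
      from less.hyps[OF this] less.prems obtain x where x: "x \<in> I" "\<And>Q. Q \<in> \<S> - {P} \<Longrightarrow> x \<notin> Q"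
        by (metis DiffD1 finite_Diff)
      show ?thesis
      proof (cases "x \<in> P")
        case xP: True
        have "\<not> R \<inter> \<Inter>(insert I (\<S> - {P})) \<subseteq> P"
        proof
          assume "R \<inter> \<Inter>(insert I (\<S> - {P})) \<subseteq> P"
          then have "\<exists>Q\<in>insert I (\<S> - {P}). Q \<subseteq> P"
            by (intro prime_contains_Inter) (use less.prems P prime_ideal in auto)
          thus False using False P less.prems(4)[OF P] by auto
        qed
        then obtain y where y: "y \<in> I" "\<And>Q. Q \<in> \<S> - {P} \<Longrightarrow> y \<in> Q" "y \<notin> P" by blast
        have "x + y \<notin> Q" if "Q \<in> \<S>" for Q
        proof (cases "Q = P")
          case True
          thus ?thesis using xP y(3) ideal_add_cancel[OF prime_ideal[OF less.prems(2)[OF P]], of x y] by auto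
        next
          case False
          thus ?thesis using x(2)[of Q] y(2)[of Q] that
              ideal_add_cancel[OF prime_ideal[OF less.prems(2)[OF that]], of y x] by (auto simp: add.commute)
        qed
        thus ?thesis using ideal_add[OF less.prems(3) x(1) y(1)] by auto
      qed (use x in auto)
    qed
  qed
qed

text \<open>The maximal elements among the annihilators of nonzero elements of \<open>A / B\<close>.
  They are associated primes, and in a Noetherian ring their union is the set of zero divisors on
  \<open>A / B\<close>.\<close>

definition ann_primes :: "'a set \<Rightarrow> 'a set \<Rightarrow> 'a set set" where
  "ann_primes A B = {P. (\<exists>a\<in>A - B. P = {r \<in> R. r * a \<in> B}) \<and>
      (\<forall>a\<in>A - B. P \<subseteq> {r \<in> R. r * a \<in> B} \<longrightarrow> {r \<in> R. r * a \<in> B} = P)}"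

text \<open>For \<open>y \<notin> P\<close> the annihilator of \<open>y * a\<close> contains that of
  \<open>a\<close>, so by maximality both are equal; \<open>x\<close> kills \<open>y * a\<close>,
  hence it kills \<open>a\<close>.\<close>

lemma ann_primes_prime:
  assumes "is_ideal A" "is_ideal B" "P \<in> ann_primes A B"
  shows "is_prime P"
proof -
  obtain a where a: "a \<in> A" "a \<notin> B" "P = {r \<in> R. r * a \<in> B}"
    and mx: "\<And>a. a \<in> A - B \<Longrightarrow> P \<subseteq> {r \<in> R. r * a \<in> B} \<Longrightarrow> {r \<in> R. r * a \<in> B} = P"
    using assms(3) unfolding ann_primes_def by auto
  show ?thesis unfolding is_prime_def
  proof (intro conjI ballI impI)
    show "is_ideal P" using a ideal_colon assms by auto
    show "1 \<notin> P" using a by auto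
    fix x y assume xy: "x \<in> R" "y \<in> R" "x * y \<in> P"
    show "x \<in> P \<or> y \<in> P"
    proof (rule disjCI)
      assume "y \<notin> P"
      then have "y * a \<in> A - B" using a xy assms ideal_mult by auto
      moreover have "P \<subseteq> {r \<in> R. r * (y * a) \<in> B}"
      proof
        fix r assume "r \<in> P"
        then have "r \<in> R" "y * (r * a) \<in> B" using a assms xy ideal_mult by auto
        thus "r \<in> {r \<in> R. r * (y * a) \<in> B}" by (simp add: mult.left_commute)
      qed
      ultimately have "{r \<in> R. r * (y * a) \<in> B} = P" by (rule mx)
      thus "x \<in> P" using xy a by (auto simp: mult.assoc)
    qed
  qed
qed

lemma finite_subset_directed_Union:
  assumes "finite G" "G \<subseteq> \<Union>\<I>" "\<I> \<noteq> {}"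
    and "\<And>I J. I \<in> \<I> \<Longrightarrow> J \<in> \<I> \<Longrightarrow> \<exists>K\<in>\<I>. I \<subseteq> K \<and> J \<subseteq> K"
  shows "\<exists>I\<in>\<I>. G \<subseteq> I"
  using assms(1,2)
proof (induction G rule: finite_induct)
  case empty thus ?case using assms(3) by auto
next
  case (insert x G)
  then obtain I J where "I \<in> \<I>" "G \<subseteq> I" "J \<in> \<I>" "x \<in> J" by auto
  thus ?case using assms(4)[of I J] by blast
qed

text \<open>Choose for every prime \<open>P\<close> an element \<open>a P\<close> with annihilator
  \<open>P\<close>. Finitely many of these elements, those for the primes in \<open>F\<close>,
  generate the same ideal as all of them. Whatever lies in all primes of \<open>F\<close> then kills
  every \<open>a P\<close> modulo \<open>B\<close>, so every \<open>P\<close> contains the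
  intersection of \<open>F\<close>, hence some \<open>Q\<close> in \<open>F\<close>, and equals it
  by maximality.\<close>

lemma finite_ann_primes:
  assumes noeth: is_noetherian and A: "is_ideal A" and B: "is_ideal B" "B \<subseteq> A"
  shows "finite (ann_primes A B)"
proof -
  let ?S = "ann_primes A B"
  have "\<forall>P\<in>?S. \<exists>a. a \<in> A - B \<and> P = {r \<in> R. r * a \<in> B}"
    unfolding ann_primes_def by blast
  then obtain a where "\<forall>P\<in>?S. a P \<in> A - B \<and> P = {r \<in> R. r * a P \<in> B}"
    by (rule bchoice[THEN exE])
  then have a: "\<And>P. P \<in> ?S \<Longrightarrow> a P \<in> A - B \<and> P = {r \<in> R. r * a P \<in> B}" by blast
  define W where "W F = \<Inter>{I. is_ideal I \<and> a ` F \<subseteq> I}" for F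
  let ?W = "W ` {F. finite F \<and> F \<subseteq> ?S}"
  have W1: "is_ideal (W F)" if "F \<subseteq> ?S" for F
    unfolding W_def using that a ideal_R A ideal_sub by (intro ideal_Inter) blast+
  have W2: "W F \<subseteq> W F'" if "F \<subseteq> F'" for F F' unfolding W_def using that by blast
  have W3: "a P \<in> W F" if "P \<in> F" for P F unfolding W_def using that by blast
  have dir: "\<exists>K\<in>?W. I \<subseteq> K \<and> J \<subseteq> K" if "I \<in> ?W" "J \<in> ?W" for I J
  proof -
    from that obtain F F' where "I = W F" "J = W F'" "finite F" "F \<subseteq> ?S" "finite F'" "F' \<subseteq> ?S" by auto
    thus ?thesis using W2[of F "F \<union> F'"] W2[of F' "F \<union> F'"] by (intro bexI[of _ "W (F \<union> F')"]) auto
  qed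
  define U where "U = \<Union>?W"
  have idW: "is_ideal U" unfolding U_def by (rule ideal_directed_Union) (use W1 dir in auto)
  obtain G where G: "finite G" "G \<subseteq> U" "\<And>J. is_ideal J \<Longrightarrow> G \<subseteq> J \<Longrightarrow> U \<subseteq> J"
    using noetherianE[OF noeth idW] by blast
  have "\<exists>I\<in>?W. G \<subseteq> I" by (rule finite_subset_directed_Union[OF G(1) G(2)[unfolded U_def] _ dir]) auto
  then obtain I where "I \<in> ?W" "G \<subseteq> I" by blast
  then obtain F where F: "finite F" "F \<subseteq> ?S" "G \<subseteq> W F" by auto
  have F3: "U \<subseteq> W F" by (rule G(3)[OF W1[OF F(2)] F(3)])
  have "P \<in> F" if P: "P \<in> ?S" for P
  proof -
    have aP: "a P \<in> W F" using W3[of P "{P}"] P F3 unfolding U_def by blast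
    have "R \<inter> \<Inter>F \<subseteq> P"
    proof
      fix r assume r: "r \<in> R \<inter> \<Inter>F"
      have "is_ideal {v \<in> R. v * r \<in> B}" by (rule ideal_colon[OF B(1)])
      moreover have "a ` F \<subseteq> {v \<in> R. v * r \<in> B}"
      proof
        fix v assume "v \<in> a ` F"
        then obtain Q where Q: "Q \<in> F" "v = a Q" by auto
        then have "r \<in> Q" using r by blast
        thus "v \<in> {v \<in> R. v * r \<in> B}" using a[of Q] Q F A ideal_sub by (auto simp: mult.commute)
      qed
      ultimately have "W F \<subseteq> {v \<in> R. v * r \<in> B}" unfolding W_def by blast
      then have "r \<in> {r \<in> R. r * a P \<in> B}" using aP r by (auto simp: mult.commute)
      thus "r \<in> P" using a[OF P] by blast
    qed
    moreover have "is_ideal Q" if "Q \<in> F" for Q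
      using that F(2) ann_primes_prime[OF A B(1)] prime_ideal by blast
    ultimately have "\<exists>Q\<in>F. Q \<subseteq> P"
      by (intro prime_contains_Inter[OF F(1) _ ann_primes_prime[OF A B(1) P]])
    then obtain Q where Q: "Q \<in> F" "Q \<subseteq> P" by blast
    then have "Q \<in> ?S" using F(2) by blast
    then have "\<forall>a\<in>A - B. Q \<subseteq> {r \<in> R. r * a \<in> B} \<longrightarrow> {r \<in> R. r * a \<in> B} = Q"
      unfolding ann_primes_def by simp
    moreover have Peq: "a P \<in> A - B" "P = {r \<in> R. r * a P \<in> B}" using a[OF P] by blast+
    moreover have "Q \<subseteq> {r \<in> R. r * a P \<in> B}" using Q(2) equalityD1[OF Peq(2)] by (rule subset_trans)
    ultimately have "{r \<in> R. r * a P \<in> B} = Q" by blast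
    then have "P = Q" by (rule trans[OF Peq(2)])
    thus ?thesis using Q(1) by simp
  qed
  then have "?S \<subseteq> F" by (rule subsetI)
  thus ?thesis using F(1) by (rule finite_subset)
qed

text \<open>Every zero divisor on \<open>A / B\<close> lies in a member of
  \<open>ann_primes A B\<close>, and these primes are finite in number. If one of them contained
  \<open>m\<close>, its defining element would be annihilated by \<open>m\<close> modulo
  \<open>B\<close>, contrary to \<open>socle\<close>; so prime avoidance provides
  \<open>x\<close>.\<close>

lemma common_regular:
  assumes noeth: is_noetherian and m: "is_ideal m" and fin: "finite F"
    and F: "\<And>A B. (A, B) \<in> F \<Longrightarrow> is_ideal A \<and> is_ideal B \<and> B \<subseteq> A"
    and socle: "\<And>A B a. (A, B) \<in> F \<Longrightarrow> a \<in> A \<Longrightarrow> (\<And>x. x \<in> m \<Longrightarrow> x * a \<in> B) \<Longrightarrow> a \<in> B"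
  shows "\<exists>x\<in>m. \<forall>(A, B)\<in>F. regular_on x A B"
proof -
  let ?S = "\<Union>(A, B)\<in>F. ann_primes A B"
  have "\<exists>x\<in>m. \<forall>P\<in>?S. x \<notin> P"
  proof (rule prime_avoidance[OF _ _ m])
    show "finite ?S"
    proof (rule finite_UN_I[OF fin])
      fix p assume "p \<in> F"
      thus "finite (case p of (A, B) \<Rightarrow> ann_primes A B)"
        using F finite_ann_primes[OF noeth] by (cases p) simp
    qed
    show "is_prime P" if "P \<in> ?S" for P
    proof -
      from that obtain A B where "(A, B) \<in> F" "P \<in> ann_primes A B" by auto
      thus ?thesis using ann_primes_prime[of A B P] F[of A B] by simp
    qed
    show "\<not> m \<subseteq> P" if "P \<in> ?S" for P
    proof
      assume mP: "m \<subseteq> P"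
      from that obtain A B a where AB: "(A, B) \<in> F" "a \<in> A" "a \<notin> B" "P = {r \<in> R. r * a \<in> B}"
        by (auto simp: ann_primes_def)
      have "a \<in> B" by (rule socle[OF AB(1,2)]) (use mP AB(4) in auto)
      thus False using AB(3) by simp
    qed
  qed
  then obtain x where x: "x \<in> m" "\<forall>P\<in>?S. x \<notin> P" by (rule bexE)
  have "regular_on x A B" if AB: "(A, B) \<in> F" for A B
    unfolding regular_on_def
  proof (intro ballI impI, rule ccontr)
    fix a assume a: "a \<in> A" "x * a \<in> B" "a \<notin> B"
    let ?P = "(\<lambda>a. {r \<in> R. r * a \<in> B}) ` (A - B)"
    have B: "is_ideal B" using F[OF AB] by simp
    have 1: "is_ideal I" if "I \<in> ?P" for I
    proof -
      from that obtain c where "I = {r \<in> R. r * c \<in> B}" by (rule imageE)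
      thus ?thesis using ideal_colon[OF B] by simp
    qed
    have 2: "{r \<in> R. r * a \<in> B} \<in> ?P" using a by (intro imageI) simp
    obtain P where P: "P \<in> ?P" "{r \<in> R. r * a \<in> B} \<subseteq> P" "\<And>Q. Q \<in> ?P \<Longrightarrow> P \<subseteq> Q \<Longrightarrow> Q = P"
      using exists_maximal_element[OF noeth 1 2] by blast
    have "P \<in> ann_primes A B"
    proof -
      from P(1) obtain a' where "a' \<in> A - B" "P = {r \<in> R. r * a' \<in> B}" by blast
      moreover have "\<forall>a\<in>A - B. P \<subseteq> {r \<in> R. r * a \<in> B} \<longrightarrow> {r \<in> R. r * a \<in> B} = P"
        using P(3) by blast
      ultimately show ?thesis unfolding ann_primes_def by blast
    qed
    moreover have "x \<in> P" using P(2) a(2) ideal_sub[OF m x(1)] by auto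
    ultimately show False using x(2) AB by auto
  qed
  thus ?thesis using x(1) by blast
qed

end

section \<open>Depth at a maximal ideal and short exact sequences\<close>

context comm_subring begin

lemma depth_ge_Suc_imp:
  "depth_ge m (Suc n) A B \<Longrightarrow> depth_ge m n A B"
  by (induction n arbitrary: B) (auto)

lemma depth_ge_mono: "depth_ge m n A B \<Longrightarrow> k \<le> n \<Longrightarrow> depth_ge m k A B"
proof (induction n)
  case (Suc n)
  thus ?case by (metis depth_ge_Suc_imp le_Suc_eq)
qed auto

text \<open>From x a = b + z a' and the regularity of \<open>z\<close> modulo \<open>x\<close> one
  gets a' = b' + x a'', and then \<open>x\<close> can be cancelled from x (a - z a''), which lies in
  \<open>B\<close>. This is the half of the interchange of \<open>x\<close> and \<open>z\<close>
  that holds in any commutative ring.\<close>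

lemma regular_on_exchange:
  assumes A: "is_ideal A" and B: "is_ideal B" "B \<subseteq> A" and xz: "x \<in> R" "z \<in> R"
    and x: "regular_on x A B" and z: "regular_on z A (plus_mult B x A)"
  shows "regular_on x A (plus_mult B z A)"
  unfolding regular_on_def
proof (intro ballI impI)
  fix a assume a: "a \<in> A" "x * a \<in> plus_mult B z A"
  then obtain b a' where 1: "b \<in> B" "a' \<in> A" "x * a = b + z * a'" by (auto elim: plus_multE)
  have "z * a' = - b + x * a" using 1 by simp
  then have "z * a' \<in> plus_mult B x A" using 1(1) a(1) ideal_uminus[OF B(1)] by (intro plus_multI[of "- b" _ a])
  then have "a' \<in> plus_mult B x A" using z 1 unfolding regular_on_def by blast
  then obtain b' a'' where 2: "b' \<in> B" "a'' \<in> A" "a' = b' + x * a''" by (auto elim: plus_multE)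
  have "x * (a - z * a'') = b + z * b'" using 1 2 by (simp add: algebra_simps)
  also have "\<dots> \<in> B" using 1 2 B xz by (simp add: ideal_add ideal_mult)
  finally have "x * (a - z * a'') \<in> B" .
  moreover have "a - z * a'' \<in> A" using a 2 A xz by (simp add: ideal_diff ideal_mult)
  ultimately have "a - z * a'' \<in> B" using x unfolding regular_on_def by blast
  thus "a \<in> plus_mult B z A" using 2 by (intro plus_multI[of "a - z * a''" _ a'']) auto
qed

end

locale noetherian_at = comm_subring R for R :: "'a::comm_ring_1 set" +
  fixes m :: "'a set"
  assumes noeth: is_noetherian and max: "is_maximal m"
begin

lemma m_ideal: "is_ideal m" using max by (rule maximal_ideal)
lemma m_prime: "is_prime m" using max by (rule maximal_prime)
lemma m_R: "x \<in> m \<Longrightarrow> x \<in> R" using ideal_sub[OF m_ideal] .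

definition submod :: "'a set \<Rightarrow> 'a set \<Rightarrow> bool" where
  "submod A B \<longleftrightarrow> is_ideal A \<and> is_ideal B \<and> B \<subseteq> A"

text \<open>The vanishing of Hom(R/m, A/B), which over a Noetherian ring means depth at least
  one.\<close>

definition socle_free :: "'a set \<Rightarrow> 'a set \<Rightarrow> bool" where
  "socle_free A B \<longleftrightarrow> (\<forall>a\<in>A. (\<forall>x\<in>m. x * a \<in> B) \<longrightarrow> a \<in> B)"

lemma socle_free_regular: "x \<in> m \<Longrightarrow> regular_on x A B \<Longrightarrow> socle_free A B"
  by (auto simp: socle_free_def regular_on_def)

lemma socle_free_depth: "depth_ge m (Suc n) A B \<Longrightarrow> socle_free A B"
  by (auto intro: socle_free_regular)

lemma submod_plus_mult: "submod A B \<Longrightarrow> x \<in> R \<Longrightarrow> submod A (plus_mult B x A)"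
  by (simp add: submod_def ideal_plus_mult plus_mult_subset)

lemma common_regular_finite:
  assumes "finite F" "\<And>A B. (A, B) \<in> F \<Longrightarrow> submod A B \<and> socle_free A B"
  shows "\<exists>x\<in>m. \<forall>(A, B)\<in>F. regular_on x A B"
proof (rule common_regular[OF noeth m_ideal assms(1)])
  show "is_ideal A \<and> is_ideal B \<and> B \<subseteq> A" if "(A, B) \<in> F" for A B
    using assms(2)[OF that] by (simp add: submod_def)
  show "a \<in> B" if "(A, B) \<in> F" "a \<in> A" "\<And>x. x \<in> m \<Longrightarrow> x * a \<in> B" for A B a
    using assms(2)[OF that(1)] that(2,3) unfolding socle_free_def by simp
qed

lemma common_regular1:
  assumes "submod A B" "socle_free A B"
  obtains x where "x \<in> m" "regular_on x A B"
  using common_regular_finite[of "{(A, B)}"] assms by auto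

lemma common_regular2:
  assumes "submod A B" "socle_free A B" "submod C D" "socle_free C D"
  obtains x where "x \<in> m" "regular_on x A B" "regular_on x C D"
  using common_regular_finite[of "{(A, B), (C, D)}"] assms by auto

lemma common_regular3:
  assumes "submod A B" "socle_free A B" "submod C D" "socle_free C D" "submod E F" "socle_free E F"
  obtains x where "x \<in> m" "regular_on x A B" "regular_on x C D" "regular_on x E F"
  using common_regular_finite[of "{(A, B), (C, D), (E, F)}"] assms by auto

text \<open>Modulo either regular element the socle computes Ext^1(R/m, A/B). Explicitly, a socle
  element \<open>a\<close> modulo \<open>y\<close> satisfies x a = b + y a', and \<open>a'\<close>
  is a socle element modulo \<open>x\<close>. So \<open>a'\<close> vanishes there, and cancelling
  \<open>x\<close> makes \<open>a\<close> vanish modulo \<open>y\<close>.\<close>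

lemma socle_free_quotient:
  assumes AB: "submod A B" and xy: "x \<in> R" "y \<in> R"
    and x: "regular_on x A B" "x \<in> m" and y: "regular_on y A B" and s: "socle_free A (plus_mult B x A)"
  shows "socle_free A (plus_mult B y A)"
  unfolding socle_free_def
proof (intro ballI impI)
  fix a assume a: "a \<in> A" "\<forall>z\<in>m. z * a \<in> plus_mult B y A"
  have A: "is_ideal A" and B: "is_ideal B" "B \<subseteq> A" using AB by (auto simp: submod_def)
  obtain b a' where 1: "b \<in> B" "a' \<in> A" "x * a = b + y * a'"
    using a(2) x(2) by (meson plus_multE)
  have "a' \<in> plus_mult B x A"
  proof -
    have "z * a' \<in> plus_mult B x A" if z: "z \<in> m" for z
    proof -
      obtain b' w where 2: "b' \<in> B" "w \<in> A" "z * a = b' + y * w"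
        using a(2) z by (meson plus_multE)
      have zR: "z \<in> R" using m_R z .
      have eqs: "y * a' = x * a - b" "y * w = z * a - b'" using 1 2 by simp_all
      have "y * (z * a' - x * w) = z * (y * a') - x * (y * w)" by (simp add: algebra_simps)
      also have "\<dots> = z * (x * a - b) - x * (z * a - b')" by (simp only: eqs)
      also have "\<dots> = x * b' - z * b" by (simp add: algebra_simps)
      also have "\<dots> \<in> B" using 1 2 B xy zR by (simp add: ideal_diff ideal_mult)
      finally have "y * (z * a' - x * w) \<in> B" .
      moreover have "z * a' - x * w \<in> A" using 1 2 A zR xy by (simp add: ideal_diff ideal_mult)
      ultimately have "z * a' - x * w \<in> B" using y unfolding regular_on_def by auto
      thus ?thesis using 2 by (intro plus_multI[of "z * a' - x * w" _ w]) auto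
    qed
    thus ?thesis using s 1 unfolding socle_free_def by auto
  qed
  then obtain b' a'' where 3: "b' \<in> B" "a'' \<in> A" "a' = b' + x * a''" by (auto elim: plus_multE)
  have "x * (a - y * a'') = b + y * b'" using 1 3 by (simp add: algebra_simps)
  also have "\<dots> \<in> B" using 1 3 B xy by (simp add: ideal_add ideal_mult)
  finally have "x * (a - y * a'') \<in> B" .
  moreover have "a - y * a'' \<in> A" using a 3 A xy by (simp add: ideal_diff ideal_mult)
  ultimately have "a - y * a'' \<in> B" using x unfolding regular_on_def by auto
  thus "a \<in> plus_mult B y A" using 3 by (intro plus_multI[of "a - y * a''" _ a'']) auto
qed

text \<open>An auxiliary \<open>z\<close>, regular on \<open>A / B\<close>, modulo \<open>x\<close>
  and modulo \<open>y\<close>, connects \<open>y\<close> with the first element \<open>x\<close> of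
  the given sequence: the induction hypothesis is applied modulo \<open>x\<close> to the element
  \<open>z\<close>, and then modulo \<open>z\<close> to the element \<open>y\<close>.\<close>

lemma depth_ge_quotient:
  assumes "submod A B" "y \<in> m" "regular_on y A B" "depth_ge m (Suc n) A B"
  shows "depth_ge m n A (plus_mult B y A)"
  using assms
proof (induction n arbitrary: B y)
  case (Suc n)
  have A: "is_ideal A" and B: "is_ideal B" "B \<subseteq> A" using Suc.prems(1) by (auto simp: submod_def)
  obtain x where x: "x \<in> m" "regular_on x A B" "depth_ge m (Suc n) A (plus_mult B x A)"
    using Suc.prems(4) by auto
  have xR: "x \<in> R" "y \<in> R" using x Suc.prems m_R by auto
  have sx: "socle_free A (plus_mult B x A)" using x(3) by (rule socle_free_depth)
  have sy: "socle_free A (plus_mult B y A)"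
    using socle_free_quotient[OF Suc.prems(1) xR x(2,1) Suc.prems(3) sx] .
  obtain z where z: "z \<in> m" "regular_on z A B" "regular_on z A (plus_mult B x A)" "regular_on z A (plus_mult B y A)"
    using common_regular3[OF Suc.prems(1) socle_free_regular[OF x(1,2)]
        submod_plus_mult[OF Suc.prems(1) xR(1)] sx submod_plus_mult[OF Suc.prems(1) xR(2)] sy] by metis
  have zR: "z \<in> R" using z m_R by auto
  have xz: "regular_on x A (plus_mult B z A)"
    by (rule regular_on_exchange[OF A B xR(1) zR x(2) z(3)])
  have yz: "regular_on y A (plus_mult B z A)"
    by (rule regular_on_exchange[OF A B xR(2) zR Suc.prems(3) z(4)])
  have "depth_ge m n A (plus_mult (plus_mult B x A) z A)"
    by (rule Suc.IH) (use submod_plus_mult Suc.prems(1) xR z x in auto)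
  then have "depth_ge m (Suc n) A (plus_mult B z A)"
    using x(1) xz plus_mult_commute[of B x A z] by auto
  then have "depth_ge m n A (plus_mult (plus_mult B z A) y A)"
    by (intro Suc.IH) (use submod_plus_mult Suc.prems zR yz in auto)
  thus ?case using z plus_mult_commute[of B z A y] by auto
qed auto

text \<open>Second isomorphism theorem: (A1 + B) / B and A1 / (A1 \<inter> B) are the same module,
  and they remain so after dividing by \<open>x\<close>.\<close>

lemma depth_ge_iso:
  assumes "is_ideal A1" "is_ideal B" "A = {a + b | a b. a \<in> A1 \<and> b \<in> B}"
  shows "depth_ge m n A B \<longleftrightarrow> depth_ge m n A1 (A1 \<inter> B)"
  using assms
proof (induction n arbitrary: B)
  case (Suc n)
  note A1 = Suc.prems(1) and B = Suc.prems(2) and A = Suc.prems(3)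
  have sub: "A1 \<subseteq> A" "B \<subseteq> A"
    unfolding A using ideal_zero[OF A1] ideal_zero[OF B] by force+
  have Aid: "is_ideal A" unfolding is_ideal_def
  proof (intro conjI ballI)
    show "A \<subseteq> R" unfolding A using ideal_sub[OF A1] ideal_sub[OF B] by (auto intro: add_mem)
    show "0 \<in> A" using sub ideal_zero[OF A1] by auto
    fix x assume "x \<in> A"
    then obtain a b where 1: "x = a + b" "a \<in> A1" "b \<in> B" unfolding A by auto
    {
      fix y assume "y \<in> A"
      then obtain c d where 2: "y = c + d" "c \<in> A1" "d \<in> B" unfolding A by auto
      have "x + y = (a + c) + (b + d)" using 1 2 by (simp add: algebra_simps)
      thus "x + y \<in> A" unfolding A using 1 2 ideal_add[OF A1] ideal_add[OF B] by blast
    }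
    fix r assume "r \<in> R"
    have "r * x = r * a + r * b" using 1 by (simp add: algebra_simps)
    thus "r * x \<in> A" unfolding A using 1 \<open>r \<in> R\<close> ideal_mult[OF A1] ideal_mult[OF B] by blast
  qed
  have reg: "regular_on x A B \<longleftrightarrow> regular_on x A1 (A1 \<inter> B)" if "x \<in> m" for x
  proof
    assume "regular_on x A B"
    thus "regular_on x A1 (A1 \<inter> B)" using sub unfolding regular_on_def by auto
  next
    assume r: "regular_on x A1 (A1 \<inter> B)"
    have xR: "x \<in> R" using that m_R by auto
    show "regular_on x A B" unfolding regular_on_def
    proof (intro ballI impI)
      fix c assume c: "c \<in> A" "x * c \<in> B"
      then obtain a b where 1: "c = a + b" "a \<in> A1" "b \<in> B" unfolding A by auto
      have "x * b + x * a \<in> B" using c 1 by (simp add: algebra_simps)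
      then have "x * a \<in> B" using ideal_mult[OF B xR 1(3)] by (rule ideal_add_cancel[OF B])
      then have "a \<in> B" using r 1 ideal_mult[OF A1 xR 1(2)] unfolding regular_on_def by auto
      thus "c \<in> B" using 1 B ideal_add by auto
    qed
  qed
  have nxt: "depth_ge m n A (plus_mult B x A) \<longleftrightarrow> depth_ge m n A1 (plus_mult (A1 \<inter> B) x A1)"
    if "x \<in> m" for x
  proof -
    have xR: "x \<in> R" using that m_R by auto
    have eq: "plus_mult B x A = plus_mult B x A1"
    proof
      show "plus_mult B x A1 \<subseteq> plus_mult B x A" using sub by (auto simp: plus_mult_def)
      show "plus_mult B x A \<subseteq> plus_mult B x A1"
      proof
        fix y assume "y \<in> plus_mult B x A"
        then obtain b c where 2: "b \<in> B" "c \<in> A" "y = b + x * c" by (rule plus_multE)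
        then obtain a b' where 1: "c = a + b'" "a \<in> A1" "b' \<in> B" unfolding A by auto
        show "y \<in> plus_mult B x A1"
          by (rule plus_multI[of "b + x * b'" _ a])
            (use 1 2 ideal_add[OF B] ideal_mult[OF B xR] in \<open>auto simp: distrib_left add_ac\<close>)
      qed
    qed
    have int: "A1 \<inter> plus_mult B x A1 = plus_mult (A1 \<inter> B) x A1"
    proof
      show "plus_mult (A1 \<inter> B) x A1 \<subseteq> A1 \<inter> plus_mult B x A1"
        using ideal_add[OF A1] ideal_mult[OF A1 xR] by (auto simp: plus_mult_def)
      show "A1 \<inter> plus_mult B x A1 \<subseteq> plus_mult (A1 \<inter> B) x A1"
      proof
        fix y assume y: "y \<in> A1 \<inter> plus_mult B x A1"
        then obtain b c where 2: "b \<in> B" "c \<in> A1" "y = b + x * c" by (auto elim: plus_multE)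
        then have "x * c + b \<in> A1" using y by (simp add: add.commute)
        then have "b \<in> A1" using ideal_mult[OF A1 xR 2(2)] by (rule ideal_add_cancel[OF A1])
        thus "y \<in> plus_mult (A1 \<inter> B) x A1" using 2 by (auto intro: plus_multI)
      qed
    qed
    have A': "A = {a + b | a b. a \<in> A1 \<and> b \<in> plus_mult B x A}"
    proof
      show "A \<subseteq> {a + b | a b. a \<in> A1 \<and> b \<in> plus_mult B x A}"
        using plus_mult_base[OF Aid, of B x] unfolding A by blast
      show "{a + b | a b. a \<in> A1 \<and> b \<in> plus_mult B x A} \<subseteq> A"
        using plus_mult_subset[OF Aid sub(2) xR] sub(1) ideal_add[OF Aid] by auto
    qed
    have "depth_ge m n A (plus_mult B x A) \<longleftrightarrow> depth_ge m n A1 (A1 \<inter> plus_mult B x A)"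
      by (rule Suc.IH[OF A1 ideal_plus_mult[OF Aid B xR] A'])
    thus ?thesis using eq int by simp
  qed
  show ?case using reg nxt by auto
qed auto

text \<open>As \<open>z\<close> is regular on \<open>A / A'\<close>, the intersection of
  \<open>A'\<close> with B + z A is B + z A'. So the exact sequence formed by A'/B, A/B and A/A'
  stays exact modulo \<open>z\<close>.\<close>

lemma mod_regular_iso:
  assumes A: "is_ideal A" and B: "is_ideal B" and A': "is_ideal A'" and sub: "B \<subseteq> A'" "A' \<subseteq> A"
    and z: "z \<in> m" "regular_on z A A'"
  shows "depth_ge m n (plus_mult A' z A) (plus_mult B z A) \<longleftrightarrow> depth_ge m n A' (plus_mult B z A')"
proof -
  have zR: "z \<in> R" using z m_R by auto
  have "A' \<inter> plus_mult B z A = plus_mult B z A'"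
  proof
    show "plus_mult B z A' \<subseteq> A' \<inter> plus_mult B z A"
      using sub ideal_add[OF A'] ideal_mult[OF A' zR] by (auto simp: plus_mult_def)
    show "A' \<inter> plus_mult B z A \<subseteq> plus_mult B z A'"
    proof
      fix y assume y: "y \<in> A' \<inter> plus_mult B z A"
      then obtain b c where 2: "b \<in> B" "c \<in> A" "y = b + z * c" by (auto elim: plus_multE)
      have "z * c \<in> A'" using ideal_add_cancel[OF A', of b "z * c"] y 2 sub by auto
      then have "c \<in> A'" using z 2 unfolding regular_on_def by auto
      thus "y \<in> plus_mult B z A'" using 2 by (auto intro: plus_multI)
    qed
  qed
  moreover have "plus_mult A' z A = {a + b | a b. a \<in> A' \<and> b \<in> plus_mult B z A}"
  proof
    show "plus_mult A' z A \<subseteq> {a + b | a b. a \<in> A' \<and> b \<in> plus_mult B z A}"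
      using plus_mult_mult[OF B] by (fastforce elim!: plus_multE)
    show "{a + b | a b. a \<in> A' \<and> b \<in> plus_mult B z A} \<subseteq> plus_mult A' z A"
    proof
      fix y assume "y \<in> {a + b | a b. a \<in> A' \<and> b \<in> plus_mult B z A}"
      then obtain a b c where "y = a + (b + z * c)" "a \<in> A'" "b \<in> B" "c \<in> A"
        by (auto elim!: plus_multE)
      thus "y \<in> plus_mult A' z A"
        using sub ideal_add[OF A'] by (intro plus_multI[of "a + b" _ c]) (auto simp: add.assoc)
    qed
  qed
  ultimately show ?thesis
    using depth_ge_iso[OF A' ideal_plus_mult[OF A B zR], of "plus_mult A' z A" n] by simp
qed

text \<open>An element regular on both ends of 0 -> A'/B -> A/B -> A/A' -> 0 is regular in the
  middle; dividing by it keeps the sequence exact and lowers the depth of both ends by one.\<close>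

lemma depth_ge_extension:
  assumes "submod A A'" "submod A' B" "depth_ge m n A' B" "depth_ge m n A A'"
  shows "depth_ge m n A B"
  using assms
proof (induction n arbitrary: A' B)
  case (Suc n)
  have id: "is_ideal A" "is_ideal B" "is_ideal A'" "B \<subseteq> A'" "A' \<subseteq> A"
    using Suc.prems(1,2) by (auto simp: submod_def)
  obtain z where z: "z \<in> m" "regular_on z A' B" "regular_on z A A'"
    using common_regular2[OF Suc.prems(2) socle_free_depth[OF Suc.prems(3)]
        Suc.prems(1) socle_free_depth[OF Suc.prems(4)]] by metis
  have zR: "z \<in> R" using z m_R by auto
  have "regular_on z A B" using z id by (auto simp: regular_on_def)
  moreover have "depth_ge m n A (plus_mult B z A)"
  proof (rule Suc.IH)
    show "submod A (plus_mult A' z A)" using submod_plus_mult Suc.prems(1) zR by auto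
    have "plus_mult B z A \<subseteq> plus_mult A' z A" using id by (auto simp: plus_mult_def)
    thus "submod (plus_mult A' z A) (plus_mult B z A)"
      using ideal_plus_mult id zR by (auto simp: submod_def)
    show "depth_ge m n A (plus_mult A' z A)" by (rule depth_ge_quotient) (use Suc.prems z in auto)
    have "depth_ge m n A' (plus_mult B z A')" by (rule depth_ge_quotient) (use Suc.prems z in auto)
    thus "depth_ge m n (plus_mult A' z A) (plus_mult B z A)"
      using mod_regular_iso[OF id(1,2,3,4,5) z(1,3)] by simp
  qed
  ultimately show ?case using z(1) by auto
qed auto

text \<open>The same induction with an element regular on \<open>A / B\<close> and
  \<open>A / A'\<close>, which restricts to the submodule. For depth one the restriction alone
  suffices; this is why the quotient may have depth one less.\<close>

lemma depth_ge_sub: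
  assumes "submod A A'" "submod A' B" "depth_ge m n A B" "depth_ge m (n - 1) A A'"
  shows "depth_ge m n A' B"
  using assms
proof (induction n arbitrary: A' B)
  case (Suc n)
  have id: "is_ideal A" "is_ideal B" "is_ideal A'" "B \<subseteq> A'" "A' \<subseteq> A"
    using Suc.prems(1,2) by (auto simp: submod_def)
  have AB: "submod A B" using id by (auto simp: submod_def)
  show ?case
  proof (cases n)
    case 0
    thus ?thesis using Suc.prems(3) id by (auto simp: regular_on_def)
  next
    case n: (Suc k)
    obtain z where z: "z \<in> m" "regular_on z A B" "regular_on z A A'"
      using common_regular2[OF AB socle_free_depth[OF Suc.prems(3)] Suc.prems(1) socle_free_depth[of k]]
        Suc.prems(4) n by (metis diff_Suc_1)
    have zR: "z \<in> R" using z m_R by auto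
    have "regular_on z A' B" using z id by (auto simp: regular_on_def)
    moreover have "depth_ge m n (plus_mult A' z A) (plus_mult B z A)"
    proof (rule Suc.IH)
      show "submod A (plus_mult A' z A)" using submod_plus_mult Suc.prems(1) zR by auto
      have "plus_mult B z A \<subseteq> plus_mult A' z A" using id by (auto simp: plus_mult_def)
      thus "submod (plus_mult A' z A) (plus_mult B z A)"
        using ideal_plus_mult id zR by (auto simp: submod_def)
      show "depth_ge m n A (plus_mult B z A)" by (rule depth_ge_quotient) (use Suc.prems AB z in auto)
      show "depth_ge m (n - 1) A (plus_mult A' z A)"
        by (rule depth_ge_quotient) (use Suc.prems n z in auto)
    qed
    ultimately show ?thesis
      using z(1) mod_regular_iso[OF id(1,2,3,4,5) z(1,3)] by auto
  qed
qed auto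

text \<open>A sequence of zeros is weakly regular on the zero module.\<close>

lemma depth_ge_trivial:
  assumes "is_ideal A" shows "depth_ge m n A A"
proof (induction n)
  case (Suc n)
  have "plus_mult A 0 A = A" using ideal_zero[OF assms] by (auto simp: plus_mult_def)
  moreover have "regular_on 0 A A" by (auto simp: regular_on_def)
  ultimately show ?case using Suc ideal_zero[OF m_ideal] by auto
qed auto

text \<open>The quotient vanishes at \<open>m\<close>. Writing 1 = u + r s with \<open>u\<close> in
  \<open>m\<close>, the element \<open>u\<close> acts on it as the identity, so it is regular and
  leaves the zero quotient.\<close>

lemma depth_ge_killed:
  assumes AB: "submod A B" and s: "s \<in> R" "s \<notin> m" "\<And>a. a \<in> A \<Longrightarrow> s * a \<in> B"
  shows "depth_ge m n A B"
proof (cases n)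
  case (Suc k)
  have id: "is_ideal A" "is_ideal B" "B \<subseteq> A" using AB by (auto simp: submod_def)
  obtain r u where ru: "r \<in> R" "u \<in> m" "1 = u + r * s" using maximalE[OF max s(1,2)] by metis
  have dec: "a = u * a + r * (s * a)" for a
  proof -
    have "a = (u + r * s) * a" using ru by simp
    thus ?thesis by (simp add: algebra_simps)
  qed
  have "regular_on u A B" unfolding regular_on_def
  proof (intro ballI impI)
    fix a assume "a \<in> A" "u * a \<in> B"
    thus "a \<in> B" using dec[of a] s ru id by (metis ideal_add ideal_mult)
  qed
  moreover have "plus_mult B u A = A"
  proof
    show "plus_mult B u A \<subseteq> A" using plus_mult_subset id ru m_R by auto
    show "A \<subseteq> plus_mult B u A"
    proof
      fix a assume "a \<in> A"
      thus "a \<in> plus_mult B u A"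
        using dec[of a] s ru id by (intro plus_multI[of "r * (s * a)" _ a]) (auto simp: ideal_mult add.commute)
    qed
  qed
  ultimately show ?thesis using ru depth_ge_trivial[OF id(1)] Suc by auto
qed auto

text \<open>If \<open>m\<close> annihilates \<open>a\<close> modulo \<open>B\<close> and so does
  some \<open>s\<close> outside of \<open>m\<close>, then 1 = u + r s annihilates \<open>a\<close>.
  Here the maximality of \<open>m\<close> turns regularity after localisation into a property of the
  module itself.\<close>

lemma loc_regular_socle_free:
  assumes B: "is_ideal B" and A: "is_ideal A" and x: "x \<in> m" "loc_regular_on (R - m) x A B"
  shows "socle_free A B"
  unfolding socle_free_def
proof (intro ballI impI)
  fix a assume a: "a \<in> A" "\<forall>x\<in>m. x * a \<in> B"
  then obtain s where s: "s \<in> R" "s \<notin> m" "s * a \<in> B" using x unfolding loc_regular_on_def by auto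
  obtain r u where ru: "r \<in> R" "u \<in> m" "1 = u + r * s" using maximalE[OF max s(1,2)] by metis
  have "a = (u + r * s) * a" using ru by simp
  also have "\<dots> = u * a + r * (s * a)" by (simp add: algebra_simps)
  also have "\<dots> \<in> B" using B a ru s by (simp add: ideal_add ideal_mult)
  finally show "a \<in> B" .
qed

text \<open>A truly regular element \<open>z\<close>, chosen to be regular also modulo
  \<open>x\<close>, is put in front. Then \<open>x\<close> remains locally regular modulo
  \<open>z\<close>, and the induction hypothesis applies there.\<close>

lemma loc_regular_depth_ge_Suc:
  assumes "submod A B" "x \<in> m" "loc_regular_on (R - m) x A B" "depth_ge m n A (plus_mult B x A)"
  shows "depth_ge m (Suc n) A B"
  using assms
proof (induction n arbitrary: B)
  case 0
  have "socle_free A B" using 0 loc_regular_socle_free[of B A x] by (auto simp: submod_def)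
  then obtain z where "z \<in> m" "regular_on z A B" using common_regular1[OF 0(1)] by metis
  thus ?case by auto
next
  case (Suc n)
  have id: "is_ideal A" "is_ideal B" "B \<subseteq> A" using Suc.prems(1) by (auto simp: submod_def)
  have xR: "x \<in> R" using Suc.prems m_R by auto
  have "socle_free A B" using Suc.prems(2,3) loc_regular_socle_free[of B A x] id by auto
  moreover have "socle_free A (plus_mult B x A)" using Suc.prems(4) by (rule socle_free_depth)
  ultimately obtain z where z: "z \<in> m" "regular_on z A B" "regular_on z A (plus_mult B x A)"
    using common_regular2[OF Suc.prems(1) _ submod_plus_mult[OF Suc.prems(1) xR]] by metis
  have zR: "z \<in> R" using z m_R by auto
  have "loc_regular_on (R - m) x A (plus_mult B z A)"
    unfolding loc_regular_on_def
  proof (intro ballI impI)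
    fix a assume a: "a \<in> A" "x * a \<in> plus_mult B z A"
    then obtain b a' where 1: "b \<in> B" "a' \<in> A" "x * a = b + z * a'" by (auto elim: plus_multE)
    have "z * a' = - b + x * a" using 1 by simp
    then have "z * a' \<in> plus_mult B x A" using 1(1) a(1) ideal_uminus[OF id(2)] by (intro plus_multI[of "- b" _ a])
    then have "a' \<in> plus_mult B x A" using z 1 unfolding regular_on_def by auto
    then obtain b' a'' where 2: "b' \<in> B" "a'' \<in> A" "a' = b' + x * a''" by (auto elim: plus_multE)
    have "x * (a - z * a'') = b + z * b'" using 1 2 by (simp add: algebra_simps)
    also have "\<dots> \<in> B" using 1 2 id zR by (simp add: ideal_add ideal_mult)
    finally have "x * (a - z * a'') \<in> B" .
    moreover have "a - z * a'' \<in> A" using a 2 id zR by (simp add: ideal_diff ideal_mult)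
    ultimately obtain s where s: "s \<in> R - m" "s * (a - z * a'') \<in> B"
      using Suc.prems(3) unfolding loc_regular_on_def by auto
    have "s * a \<in> plus_mult B z A"
      by (rule plus_multI[of "s * (a - z * a'')" _ "s * a''"])
        (use s 2 ideal_mult[OF id(1)] in \<open>auto simp: right_diff_distrib mult.left_commute\<close>)
    thus "\<exists>s\<in>R - m. s * a \<in> plus_mult B z A" using s by auto
  qed
  moreover have "depth_ge m n A (plus_mult (plus_mult B z A) x A)"
    using depth_ge_quotient[OF submod_plus_mult[OF Suc.prems(1) xR] z(1,3) Suc.prems(4)]
      plus_mult_commute[of B x A z] by simp
  ultimately have "depth_ge m (Suc n) A (plus_mult B z A)"
    using Suc.IH submod_plus_mult[OF Suc.prems(1) zR] Suc.prems(2) by auto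
  thus ?case using z by auto
qed

lemma loc_depth_imp_depth:
  "submod A B \<Longrightarrow> loc_depth_ge (R - m) m n A B \<Longrightarrow> depth_ge m n A B"
proof (induction n arbitrary: B)
  case (Suc n)
  then obtain x where x: "x \<in> m" "loc_regular_on (R - m) x A B" "loc_depth_ge (R - m) m n A (plus_mult B x A)"
    by auto
  thus ?case
    using loc_regular_depth_ge_Suc[OF Suc.prems(1) x(1,2)] Suc.IH submod_plus_mult[OF Suc.prems(1) m_R[OF x(1)]]
    by auto
qed auto

end

section \<open>Prime chains and regular sequences\<close>

primrec list_monom :: "'a::comm_ring_1 list \<Rightarrow> nat list \<Rightarrow> 'a" where
  "list_monom [] \<alpha> = 1"
| "list_monom (y # ys) \<alpha> = y ^ hd \<alpha> * list_monom ys (tl \<alpha>)"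

text \<open>Independence, over the field embedded by \<open>kc\<close>, of the residues modulo
  \<open>P\<close>. Lists are used so that a repeated element counts as a dependence.\<close>

definition alg_indep :: "('k::field \<Rightarrow> 'a::comm_ring_1) \<Rightarrow> 'a set \<Rightarrow> 'a list \<Rightarrow> bool" where
  "alg_indep kc P ys \<longleftrightarrow> (\<forall>E c. finite E \<longrightarrow> (\<forall>\<alpha>\<in>E. length \<alpha> = length ys) \<longrightarrow>
     (\<Sum>\<alpha>\<in>E. kc (c \<alpha>) * list_monom ys \<alpha>) \<in> P \<longrightarrow> (\<forall>\<alpha>\<in>E. c \<alpha> = 0))"

context comm_subring begin

lemma list_monom_mem: "set ys \<subseteq> R \<Longrightarrow> list_monom ys \<alpha> \<in> R"
  by (induction ys arbitrary: \<alpha>) (auto intro: one_mem mult_mem power_mem)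

definition prime_chain :: "nat \<Rightarrow> (nat \<Rightarrow> 'a set) \<Rightarrow> bool" where
  "prime_chain n q \<longleftrightarrow> (\<forall>i\<le>n. is_prime (q i)) \<and> (\<forall>i<n. q i \<subset> q (Suc i))"

lemma prime_chain_mono: "prime_chain n q \<Longrightarrow> i \<le> n \<Longrightarrow> q i \<subseteq> q n"
proof (induction n)
  case (Suc n)
  have "prime_chain n q" using Suc.prems by (auto simp: prime_chain_def)
  moreover have "q n \<subseteq> q (Suc n)" using Suc.prems by (auto simp: prime_chain_def)
  ultimately show ?case using Suc by (cases "i = Suc n") auto
qed auto

lemma prime_chain_extend:
  assumes "prime_chain n q" "is_prime Q" "Q \<subset> q 0"
  shows "prime_chain (Suc n) (case_nat Q q)"
  unfolding prime_chain_def
proof (intro conjI allI impI)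
  fix i
  show "i \<le> Suc n \<Longrightarrow> is_prime (case i of 0 \<Rightarrow> Q | Suc x \<Rightarrow> q x)"
    using assms by (cases i) (auto simp: prime_chain_def)
  show "i < Suc n \<Longrightarrow> (case i of 0 \<Rightarrow> Q | Suc x \<Rightarrow> q x) \<subset> (case Suc i of 0 \<Rightarrow> Q | Suc x \<Rightarrow> q x)"
    using assms by (cases i) (auto simp: prime_chain_def)
qed

text \<open>An ideal \<open>P\<close> that is maximal among those disjoint from a multiplicative set
  is prime: if x and y are outside of \<open>P\<close>, both enlarged ideals meet the set, and the
  product of the two common elements lies in P + (x y).\<close>

lemma exists_prime_disjoint:
  assumes is_noetherian and I: "is_ideal I" and S: "S \<subseteq> R" "1 \<in> S" "\<And>s t. s \<in> S \<Longrightarrow> t \<in> S \<Longrightarrow> s * t \<in> S"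
    and dis: "I \<inter> S = {}"
  obtains P where "is_prime P" "I \<subseteq> P" "P \<inter> S = {}"
proof -
  let ?P = "{J. is_ideal J \<and> I \<subseteq> J \<and> J \<inter> S = {}}"
  have 1: "\<And>J. J \<in> ?P \<Longrightarrow> is_ideal J" by simp
  have 2: "I \<in> ?P" using I dis by simp
  obtain P where P: "P \<in> ?P" "I \<subseteq> P" "\<And>Q. Q \<in> ?P \<Longrightarrow> P \<subseteq> Q \<Longrightarrow> Q = P"
    using exists_maximal_element[OF assms(1) 1 2] by blast
  have id: "is_ideal P" using P by simp
  have meet: "\<exists>p\<in>P. \<exists>r\<in>R. p + x * r \<in> S" if x: "x \<in> R" "x \<notin> P" for x
  proof (rule ccontr)
    assume neg: "\<not> ?thesis"
    have "plus_mult P x R \<in> ?P"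
    proof -
      have "is_ideal (plus_mult P x R)" using ideal_plus_mult[OF ideal_R id x(1)] .
      moreover have "P \<subseteq> plus_mult P x R" using plus_mult_base[OF ideal_R] .
      moreover have "plus_mult P x R \<inter> S = {}" using neg by (auto simp: plus_mult_def)
      ultimately show ?thesis using P(2) by auto
    qed
    then have "plus_mult P x R = P" using P(3) plus_mult_base[OF ideal_R] by simp
    moreover have "x * 1 \<in> plus_mult P x R" using plus_mult_mult[OF id one_mem] .
    ultimately show False using x by simp
  qed
  have "is_prime P" unfolding is_prime_def
  proof (intro conjI ballI impI)
    show "is_ideal P" by (rule id)
    show "1 \<notin> P" using P(1) S(2) by auto
    fix x y assume xy: "x \<in> R" "y \<in> R" "x * y \<in> P"
    show "x \<in> P \<or> y \<in> P"
    proof (rule ccontr)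
      assume "\<not> ?thesis"
      then obtain p r p' r' where 1: "p \<in> P" "r \<in> R" "p + x * r \<in> S" "p' \<in> P" "r' \<in> R" "p' + y * r' \<in> S"
        using meet xy by metis
      have "(p + x * r) * (p' + y * r') = p' * p + (y * r') * p + (x * r) * p' + (r * r') * (x * y)"
        by (simp add: algebra_simps)
      also have "\<dots> \<in> P"

      proof -
        have "p' * p \<in> P" "(y * r') * p \<in> P" "(x * r) * p' \<in> P"
          using 1 xy ideal_sub[OF id] mult_mem by (auto intro!: ideal_mult[OF id])
        moreover have "(r * r') * (x * y) \<in> P" using ideal_mult[OF id mult_mem xy(3)] 1 by simp
        ultimately show ?thesis by (intro ideal_add[OF id])
      qed
      finally show False using S(3)[OF 1(3,6)] P(1) by auto
    qed
  qed
  thus ?thesis using that P by simp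
qed

text \<open>The elements x^n s with \<open>s\<close> outside of \<open>Q\<close> form a
  multiplicative set that misses \<open>I\<close> by \<open>reg\<close>. A prime that misses this
  set lies in \<open>Q\<close> and omits \<open>x\<close>.\<close>

lemma prime_below:
  assumes noeth: is_noetherian and I: "is_ideal I" and Q: "is_prime Q" "I \<subseteq> Q" and x: "x \<in> Q"
    and reg: "\<And>n s. s \<in> R \<Longrightarrow> x ^ n * s \<in> I \<Longrightarrow> s \<in> Q"
  obtains Q' where "is_prime Q'" "I \<subseteq> Q'" "Q' \<subset> Q" "x \<notin> Q'"
proof -
  have xR: "x \<in> R" using ideal_sub[OF prime_ideal[OF Q(1)] x] .
  define S where "S = {x ^ n * s | n s. s \<in> R - Q}"
  have 1: "S \<subseteq> R" unfolding S_def using xR by (auto intro: mult_mem power_mem)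
  have Q1: "1 \<in> R - Q" using Q(1) one_mem by (auto simp: is_prime_def)
  then have 2: "1 \<in> S" unfolding S_def by (intro CollectI exI[of _ 0] exI[of _ 1]) auto
  have 3: "s * t \<in> S" if st: "s \<in> S" "t \<in> S" for s t
  proof -
    obtain n s' k t' where 4: "s = x ^ n * s'" "t = x ^ k * t'" "s' \<in> R - Q" "t' \<in> R - Q"
      using st unfolding S_def by auto
    have "s * t = x ^ (n + k) * (s' * t')" using 4 by (simp add: power_add algebra_simps)
    moreover have "s' * t' \<in> R - Q" using 4 Q(1) mult_mem unfolding is_prime_def by auto
    ultimately show ?thesis unfolding S_def by auto
  qed
  have 4: "I \<inter> S = {}" unfolding S_def using reg by auto
  obtain P where P: "is_prime P" "I \<subseteq> P" "P \<inter> S = {}"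
    using exists_prime_disjoint[OF noeth I 1 2 3 4] by metis
  have "P \<subseteq> Q"
  proof
    fix r assume r: "r \<in> P"
    have "r \<in> R" using ideal_sub[OF prime_ideal[OF P(1)] r] .
    show "r \<in> Q"
    proof (rule ccontr)
      assume "r \<notin> Q"
      then have "x ^ 0 * r \<in> S" unfolding S_def using \<open>r \<in> R\<close> by blast
      thus False using P(3) r by auto
    qed
  qed
  moreover have "x ^ 1 * 1 \<in> S" unfolding S_def using Q1 by blast
  then have "x \<notin> P" using P(3) by auto
  ultimately show ?thesis using that[of P] P x by auto
qed

text \<open>The inequality between depth and height. The chain for I + x R begins with a prime
  \<open>q 0\<close> containing \<open>x\<close>; as \<open>x\<close> is regular modulo
  \<open>I\<close> locally at \<open>Q\<close>, \<open>prime_below\<close> gives a prime under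
  \<open>q 0\<close> that contains \<open>I\<close> and omits \<open>x\<close>.\<close>

lemma chain_of_loc_depth:
  assumes noeth: is_noetherian and Q: "is_prime Q"
  shows "is_ideal I \<Longrightarrow> I \<subseteq> Q \<Longrightarrow> loc_depth_ge (R - Q) Q n R I \<Longrightarrow>
    \<exists>q. prime_chain n q \<and> I \<subseteq> q 0 \<and> q n = Q"
proof (induction n arbitrary: I)
  case 0
  thus ?case using Q by (intro exI[of _ "\<lambda>_. Q"]) (auto simp: prime_chain_def)
next
  case (Suc n)
  have Qid: "is_ideal Q" using prime_ideal[OF Q] .
  obtain x where x: "x \<in> Q" "loc_regular_on (R - Q) x R I" "loc_depth_ge (R - Q) Q n R (plus_mult I x R)"
    using Suc.prems by auto
  have xR: "x \<in> R" using ideal_sub[OF Qid x(1)] .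
  have "plus_mult I x R \<subseteq> Q"
  proof
    fix y assume "y \<in> plus_mult I x R"
    then obtain b a where "b \<in> I" "a \<in> R" "y = b + a * x" by (auto simp: plus_mult_def mult.commute)
    thus "y \<in> Q" using Suc.prems(2) Qid x(1) by (auto intro: ideal_add ideal_mult)
  qed
  then obtain q where q: "prime_chain n q" "plus_mult I x R \<subseteq> q 0" "q n = Q"
    using Suc.IH[OF ideal_plus_mult[OF ideal_R Suc.prems(1) xR]] x(3) by auto
  have q0: "is_prime (q 0)" "q 0 \<subseteq> Q" using q prime_chain_mono[OF q(1), of 0] by (auto simp: prime_chain_def)
  have Iq: "I \<subseteq> q 0" using q(2) plus_mult_base[OF ideal_R, of I x] by auto
  have xq: "x \<in> q 0" using q(2) plus_mult_mult[OF Suc.prems(1) one_mem, of x] by auto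
  have reg: "s \<in> q 0" if "s \<in> R" "x ^ k * s \<in> I" for k s
    using that
  proof (induction k arbitrary: s)
    case 0 thus ?case using Iq by auto
  next
    case (Suc k)
    have "x * (x ^ k * s) \<in> I" "x ^ k * s \<in> R" using Suc.prems xR by (auto simp: mult.assoc intro: mult_mem power_mem)
    then obtain s' where s': "s' \<in> R" "s' \<notin> Q" "s' * (x ^ k * s) \<in> I"
      using x(2) unfolding loc_regular_on_def by auto
    have "s' * s \<in> q 0" by (rule Suc.IH) (use s' Suc.prems mult_mem in \<open>auto simp: mult.left_commute\<close>)
    thus ?case using q0 s' Suc.prems(1) unfolding is_prime_def by auto
  qed
  obtain Q' where Q': "is_prime Q'" "I \<subseteq> Q'" "Q' \<subset> q 0"
    using prime_below[OF noeth Suc.prems(1) q0(1) Iq xq] reg by metis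
  show ?case
    using prime_chain_extend[OF q(1) Q'(1,3)] Q' q(3) by (intro exI[of _ "case_nat Q' q"]) auto
qed

lemma depth_imp_loc_depth:
  assumes "is_prime Q" shows "depth_ge Q n A B \<Longrightarrow> loc_depth_ge (R - Q) Q n A B"
proof (induction n arbitrary: B)
  case (Suc n)
  then obtain x where x: "x \<in> Q" "regular_on x A B" "loc_depth_ge (R - Q) Q n A (plus_mult B x A)" by auto
  have "1 \<in> R - Q" using assms one_mem by (auto simp: is_prime_def)
  then have "loc_regular_on (R - Q) x A B" using x(2) unfolding loc_regular_on_def regular_on_def
    by (metis mult_1)
  thus ?case using x by auto
qed auto

text \<open>From a nontrivial relation modulo \<open>P\<close> cancel the smallest power of
  \<open>x\<close> that occurs, which \<open>x \<notin> P\<close> permits, and reduce modulo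
  \<open>P'\<close>. The terms still divisible by \<open>x\<close> vanish, and the rest is a
  nontrivial relation between \<open>ys\<close>.\<close>

lemma alg_indep_Cons:
  assumes kc: "\<And>c. kc c \<in> R" "kc 0 = 0"
    and P: "is_prime P" "is_ideal P'" "P \<subseteq> P'" and x: "x \<in> P'" "x \<notin> P" and ys: "set ys \<subseteq> R"
    and ind: "alg_indep kc P' ys"
  shows "alg_indep kc P (x # ys)"
  unfolding alg_indep_def
proof (intro allI impI)
  fix E c
  assume E: "finite E" "\<forall>\<alpha>\<in>E. length \<alpha> = length (x # ys)"
    and sm: "(\<Sum>\<alpha>\<in>E. kc (c \<alpha>) * list_monom (x # ys) \<alpha>) \<in> P"
  have xR: "x \<in> R" using x(1) ideal_sub[OF P(2)] by auto
  show "\<forall>\<alpha>\<in>E. c \<alpha> = 0"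
  proof (rule ccontr)
    assume neg: "\<not> ?thesis"
    define F where "F = {\<alpha> \<in> E. c \<alpha> \<noteq> 0}"
    have F: "finite F" "F \<noteq> {}" using E neg by (auto simp: F_def)
    define \<mu> where "\<mu> = Min (hd ` F)"
    have mu: "\<mu> \<le> hd \<alpha>" if "\<alpha> \<in> F" for \<alpha> using F that by (auto simp: \<mu>_def)
    have mu_in: "\<mu> \<in> hd ` F" unfolding \<mu>_def using F by (intro Min_in) auto
    define T where "T = (\<lambda>\<alpha>. kc (c \<alpha>) * (x ^ (hd \<alpha> - \<mu>) * list_monom ys (tl \<alpha>)))"
    have "(\<Sum>\<alpha>\<in>E. kc (c \<alpha>) * list_monom (x # ys) \<alpha>) = (\<Sum>\<alpha>\<in>F. kc (c \<alpha>) * list_monom (x # ys) \<alpha>)"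
      by (rule sum.mono_neutral_right) (use E kc in \<open>auto simp: F_def\<close>)
    also have "\<dots> = (\<Sum>\<alpha>\<in>F. x ^ \<mu> * T \<alpha>)"
    proof (rule sum.cong[OF refl])
      fix \<alpha> assume "\<alpha> \<in> F"
      then have "x ^ hd \<alpha> = x ^ \<mu> * x ^ (hd \<alpha> - \<mu>)" using mu by (simp flip: power_add)
      thus "kc (c \<alpha>) * list_monom (x # ys) \<alpha> = x ^ \<mu> * T \<alpha>" by (simp add: T_def algebra_simps)
    qed
    also have "\<dots> = x ^ \<mu> * sum T F" by (simp add: sum_distrib_left)
    finally have 1: "x ^ \<mu> * sum T F \<in> P" using sm by simp
    have TR: "T \<alpha> \<in> R" for \<alpha> unfolding T_def by (intro mult_mem power_mem kc xR list_monom_mem ys)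
    have "x ^ \<mu> \<notin> P" using prime_power[OF P(1) xR] x(2) by auto
    then have "sum T F \<in> P" using 1 P(1) power_mem[OF xR] sum_mem[of F T] TR unfolding is_prime_def by auto
    then have 2: "sum T F \<in> P'" using P(3) by auto
    define G where "G = {\<alpha> \<in> F. hd \<alpha> = \<mu>}"
    have split: "sum T F = sum T (F - G) + sum T G"
      using F by (intro sum.subset_diff) (auto simp: G_def)
    have "sum T (F - G) \<in> P'"
    proof (rule ideal_sum[OF P(2)])
      fix \<alpha> assume a: "\<alpha> \<in> F - G"
      then have "hd \<alpha> - \<mu> = Suc (hd \<alpha> - \<mu> - 1)" using mu[of \<alpha>] by (auto simp: G_def)
      then obtain k where "hd \<alpha> - \<mu> = Suc k" by blast
      then have "T \<alpha> = (kc (c \<alpha>) * (x ^ k * list_monom ys (tl \<alpha>))) * x" by (simp add: T_def algebra_simps)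
      thus "T \<alpha> \<in> P'" using P(2) x(1)
        by (auto intro!: ideal_mult mult_mem power_mem kc xR list_monom_mem ys)
    qed
    then have 3: "sum T G \<in> P'" using 2 split ideal_add_cancel[OF P(2)] by simp
    have inj: "inj_on tl G"
    proof (rule inj_onI)
      fix \<alpha> \<beta> assume "\<alpha> \<in> G" "\<beta> \<in> G" "tl \<alpha> = tl \<beta>"
      moreover have "\<alpha> \<noteq> []" "\<beta> \<noteq> []" using calculation E by (auto simp: G_def F_def)
      ultimately show "\<alpha> = \<beta>" by (auto simp: G_def intro: list.expand)
    qed
    have "sum T G = (\<Sum>\<beta>\<in>tl ` G. kc (c (\<mu> # \<beta>)) * list_monom ys \<beta>)"
      unfolding sum.reindex[OF inj] comp_def
    proof (rule sum.cong[OF refl])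
      fix \<alpha> assume a: "\<alpha> \<in> G"
      then have "\<alpha> \<noteq> []" using E by (auto simp: G_def F_def)
      then have "\<mu> # tl \<alpha> = \<alpha>" using a by (cases \<alpha>) (auto simp: G_def)
      thus "T \<alpha> = kc (c (\<mu> # tl \<alpha>)) * list_monom ys (tl \<alpha>)" using a by (simp add: T_def G_def)
    qed
    then have "(\<Sum>\<beta>\<in>tl ` G. kc (c (\<mu> # \<beta>)) * list_monom ys \<beta>) \<in> P'" using 3 by simp
    moreover have "finite (tl ` G)" using F by (auto simp: G_def)
    moreover have "\<forall>\<beta>\<in>tl ` G. length \<beta> = length ys" using E by (auto simp: G_def F_def)
    ultimately have "\<forall>\<beta>\<in>tl ` G. c (\<mu> # \<beta>) = 0"
      using ind[unfolded alg_indep_def, rule_format, of "tl ` G" "\<lambda>\<beta>. c (\<mu> # \<beta>)"] by blast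
    moreover obtain \<alpha> where "\<alpha> \<in> G" using mu_in by (auto simp: G_def)
    moreover have "\<mu> # tl \<alpha> = \<alpha>"
    proof -
      have "\<alpha> \<noteq> []" using E \<open>\<alpha> \<in> G\<close> by (auto simp: G_def F_def)
      thus ?thesis using \<open>\<alpha> \<in> G\<close> by (cases \<alpha>) (auto simp: G_def)
    qed
    ultimately show False by (auto simp: G_def F_def)
  qed
qed

text \<open>Each strict inclusion of the chain contributes one independent element, an element of
  the larger prime outside the smaller one.\<close>

lemma alg_indep_chain:
  assumes kc: "\<And>c. kc c \<in> R" "kc 0 = 0" and ys: "set ys \<subseteq> R"
  shows "prime_chain n q \<Longrightarrow> alg_indep kc (q n) ys \<Longrightarrow>
    \<exists>xs. length xs = n \<and> set xs \<subseteq> R \<and> alg_indep kc (q 0) (xs @ ys)"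
proof (induction n arbitrary: q)
  case (Suc n)
  have "prime_chain n (\<lambda>i. q (Suc i))" using Suc.prems by (auto simp: prime_chain_def)
  then obtain xs where xs: "length xs = n" "set xs \<subseteq> R" "alg_indep kc (q 1) (xs @ ys)"
    using Suc.IH[of "\<lambda>i. q (Suc i)"] Suc.prems by auto
  have pr: "is_prime (q 0)" "is_prime (q 1)" "q 0 \<subset> q 1" using Suc.prems(1) by (auto simp: prime_chain_def)
  then obtain x where x: "x \<in> q 1" "x \<notin> q 0" by auto
  have "alg_indep kc (q 0) (x # xs @ ys)"
    by (rule alg_indep_Cons[OF kc pr(1) prime_ideal[OF pr(2)] _ x _ xs(3)]) (use pr xs ys in auto)
  moreover have "x \<in> R" using x(1) ideal_sub[OF prime_ideal[OF pr(2)]] by auto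
  ultimately show ?case using xs by (intro exI[of _ "x # xs"]) auto
qed auto

definition ideal_gen :: "'a set \<Rightarrow> 'a set" where
  "ideal_gen G = \<Inter>{I. is_ideal I \<and> G \<subseteq> I}"

lemma ideal_gen_ideal: "G \<subseteq> R \<Longrightarrow> is_ideal (ideal_gen G)"
  unfolding ideal_gen_def using ideal_R by (intro ideal_Inter) auto

lemma ideal_gen_base: "G \<subseteq> ideal_gen G"
  by (auto simp: ideal_gen_def)

lemma ideal_gen_least: "is_ideal I \<Longrightarrow> G \<subseteq> I \<Longrightarrow> ideal_gen G \<subseteq> I"
  by (auto simp: ideal_gen_def)

lemma ideal_gen_insert:
  assumes "G \<subseteq> R" "x \<in> R"
  shows "ideal_gen (insert x G) = plus_mult (ideal_gen G) x R"
proof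
  note id = ideal_gen_ideal[OF assms(1)]
  show "ideal_gen (insert x G) \<subseteq> plus_mult (ideal_gen G) x R"
  proof (rule ideal_gen_least)
    show "is_ideal (plus_mult (ideal_gen G) x R)" using ideal_plus_mult[OF ideal_R id assms(2)] .
    show "insert x G \<subseteq> plus_mult (ideal_gen G) x R"
      using plus_mult_base[OF ideal_R, of "ideal_gen G" x] ideal_gen_base[of G]
        plus_mult_mult[OF id one_mem, of x] by auto
  qed
  have id2: "is_ideal (ideal_gen (insert x G))" using ideal_gen_ideal assms by auto
  show "plus_mult (ideal_gen G) x R \<subseteq> ideal_gen (insert x G)"
  proof
    fix y assume "y \<in> plus_mult (ideal_gen G) x R"
    then obtain b a where 1: "b \<in> ideal_gen G" "a \<in> R" "y = b + a * x"
      by (auto simp: plus_mult_def mult.commute)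
    have "ideal_gen G \<subseteq> ideal_gen (insert x G)"
      using ideal_gen_base[of "insert x G"] by (intro ideal_gen_least id2) auto
    moreover have "x \<in> ideal_gen (insert x G)" using ideal_gen_base[of "insert x G"] by auto
    ultimately show "y \<in> ideal_gen (insert x G)" using 1 by (auto intro: ideal_add[OF id2] ideal_mult[OF id2])
  qed
qed

text \<open>The recursion of \<open>depth_ge\<close> divides by one element at a time; collecting
  these elements in \<open>G\<close> turns it into the list form used by
  \<open>regular_sequence\<close>.\<close>

lemma depth_ge_imp_regular_list:
  assumes "m \<subseteq> R"
  shows "G \<subseteq> R \<Longrightarrow> depth_ge m n R (ideal_gen G) \<Longrightarrow>
    \<exists>xs. length xs = n \<and> set xs \<subseteq> m \<and> (\<forall>i<n. regular_on (xs ! i) R (ideal_gen (set (take i xs) \<union> G)))"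
proof (induction n arbitrary: G)
  case (Suc n)
  then obtain x where x: "x \<in> m" "regular_on x R (ideal_gen G)" "depth_ge m n R (plus_mult (ideal_gen G) x R)"
    by auto
  have xR: "x \<in> R" using x(1) assms by (rule subsetD[rotated])
  have "\<exists>xs. length xs = n \<and> set xs \<subseteq> m \<and> (\<forall>i<n. regular_on (xs ! i) R (ideal_gen (set (take i xs) \<union> insert x G)))"
    by (rule Suc.IH) (use Suc.prems(1) x(3) ideal_gen_insert[OF Suc.prems(1) xR] xR in simp_all)
  then obtain xs where xs: "length xs = n" "set xs \<subseteq> m"
    "\<forall>i<n. regular_on (xs ! i) R (ideal_gen (set (take i xs) \<union> insert x G))" by (elim exE conjE)
  have "regular_on ((x # xs) ! i) R (ideal_gen (set (take i (x # xs)) \<union> G))" if "i < Suc n" for i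
    using that xs(3) x(2) by (cases i) auto
  thus ?case using x xs by (intro exI[of _ "x # xs"]) auto
qed auto

lemma regular_list_imp_depth_ge:
  assumes "m \<subseteq> R"
  shows "G \<subseteq> R \<Longrightarrow> set xs \<subseteq> m \<Longrightarrow> (\<And>i. i < length xs \<Longrightarrow>
    regular_on (xs ! i) R (ideal_gen (set (take i xs) \<union> G))) \<Longrightarrow> depth_ge m (length xs) R (ideal_gen G)"
proof (induction xs arbitrary: G)
  case (Cons x xs)
  have xR: "x \<in> R" using Cons.prems assms by auto
  have "regular_on x R (ideal_gen G)" using Cons.prems(3)[of 0] by simp
  moreover have "depth_ge m (length xs) R (ideal_gen (insert x G))"
  proof (rule Cons.IH)
    fix i assume "i < length xs"
    thus "regular_on (xs ! i) R (ideal_gen (set (take i xs) \<union> insert x G))" using Cons.prems(3)[of "Suc i"] by simp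
  qed (use Cons.prems xR in auto)
  ultimately show ?case using Cons.prems ideal_gen_insert[OF Cons.prems(1) xR] by auto
qed auto

lemma ideal_gen_empty: "ideal_gen {} = {0}"
  using ideal_gen_least[OF ideal_zero_set, of "{}"] ideal_zero[OF ideal_gen_ideal[of "{}"]] by auto

end

section \<open>Hilbert's basis theorem for the adjunction of one element\<close>

primrec poly_values :: "'a::comm_ring_1 set \<Rightarrow> 'a \<Rightarrow> nat \<Rightarrow> 'a set" where
  "poly_values R u 0 = {0}"
| "poly_values R u (Suc n) = {p + c * u ^ n | p c. p \<in> poly_values R u n \<and> c \<in> R}"

definition adjoin :: "'a::comm_ring_1 set \<Rightarrow> 'a \<Rightarrow> 'a set" where
  "adjoin R u = (\<Union>n. poly_values R u n)"

context comm_subring begin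

lemma poly_values_zero: "0 \<in> poly_values R u n"
proof (induction n)
  case (Suc n)
  thus ?case using zero_mem by (auto intro!: exI[of _ 0])
qed auto

lemma poly_values_Suc: "poly_values R u n \<subseteq> poly_values R u (Suc n)"
proof
  fix p assume "p \<in> poly_values R u n"
  moreover have "p = p + 0 * u ^ n" by simp
  ultimately show "p \<in> poly_values R u (Suc n)" using zero_mem unfolding poly_values.simps(2) by blast
qed

lemma poly_values_mono: "n \<le> k \<Longrightarrow> poly_values R u n \<subseteq> poly_values R u k"
  using lift_Suc_mono_le[of "poly_values R u"] poly_values_Suc by auto

lemma poly_values_add: "p \<in> poly_values R u n \<Longrightarrow> q \<in> poly_values R u n \<Longrightarrow> p + q \<in> poly_values R u n"
proof (induction n arbitrary: p q)
  case (Suc n)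
  then obtain p' c q' d where 1: "p = p' + c * u ^ n" "p' \<in> poly_values R u n" "c \<in> R"
    "q = q' + d * u ^ n" "q' \<in> poly_values R u n" "d \<in> R" by auto
  have "p + q = (p' + q') + (c + d) * u ^ n" using 1 by (simp add: algebra_simps)
  thus ?case using Suc.IH[OF 1(2,5)] add_mem[OF 1(3,6)] by auto
qed auto

lemma poly_values_smult: "r \<in> R \<Longrightarrow> p \<in> poly_values R u n \<Longrightarrow> r * p \<in> poly_values R u n"
proof (induction n arbitrary: p)
  case (Suc n)
  then obtain p' c where 1: "p = p' + c * u ^ n" "p' \<in> poly_values R u n" "c \<in> R" by auto
  have "r * p = r * p' + (r * c) * u ^ n" using 1 by (simp add: algebra_simps)
  thus ?case using Suc.IH[OF Suc.prems(1) 1(2)] mult_mem[OF Suc.prems(1) 1(3)] by auto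
qed auto

lemma poly_values_shift: "p \<in> poly_values R u n \<Longrightarrow> u * p \<in> poly_values R u (Suc n)"
proof (induction n arbitrary: p)
  case 0
  thus ?case using poly_values_zero[of u "Suc 0"] by simp
next
  case (Suc n)
  then obtain p' c where 1: "p = p' + c * u ^ n" "p' \<in> poly_values R u n" "c \<in> R" by auto
  have "u * p = u * p' + c * u ^ Suc n" using 1 by (simp add: algebra_simps)
  moreover have "u * p' \<in> poly_values R u (Suc n)" using Suc.IH[OF 1(2)] .
  ultimately show ?case using 1(3) unfolding poly_values.simps(2)[of R u "Suc n"] by blast
qed

lemma adjoin_subring: "comm_subring (adjoin R u)"
proof
  have e: "\<exists>n. x \<in> poly_values R u n \<and> y \<in> poly_values R u n" if xy: "x \<in> adjoin R u" "y \<in> adjoin R u" for x y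
  proof -
    obtain n k where "x \<in> poly_values R u n" "y \<in> poly_values R u k" using xy by (auto simp: adjoin_def)
    thus ?thesis using poly_values_mono[of n "max n k" u] poly_values_mono[of k "max n k" u]
      by (intro exI[of _ "max n k"]) auto
  qed
  have R: "r \<in> adjoin R u" if "r \<in> R" for r
  proof -
    have "r \<in> poly_values R u (Suc 0)" using that by auto
    thus ?thesis unfolding adjoin_def by blast
  qed
  show "1 \<in> adjoin R u" using R one_mem .
  show add: "x + y \<in> adjoin R u" if "x \<in> adjoin R u" "y \<in> adjoin R u" for x y
    using e[OF that] poly_values_add unfolding adjoin_def by blast
  have sm: "r * x \<in> adjoin R u" if "r \<in> R" "x \<in> adjoin R u" for r x
    using that poly_values_smult unfolding adjoin_def by blast
  have ush: "u ^ n * x \<in> adjoin R u" if "x \<in> adjoin R u" for x n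
  proof (induction n)
    case (Suc n)
    then obtain k where "u ^ n * x \<in> poly_values R u k" by (auto simp: adjoin_def)
    then have "u * (u ^ n * x) \<in> adjoin R u" unfolding adjoin_def using poly_values_shift by blast
    thus ?case by (simp add: mult.assoc)
  qed (use that in auto)
  show "- x \<in> adjoin R u" if "x \<in> adjoin R u" for x
    using sm[OF uminus_mem[OF one_mem] that] by simp
  have "x * y \<in> adjoin R u" if y: "y \<in> adjoin R u" and "x \<in> poly_values R u n" for x y n
    using that(2)
  proof (induction n arbitrary: x)
    case 0
    have "0 \<in> adjoin R u" using R zero_mem .
    thus ?case using 0 by simp
  next
    case (Suc n)
    then obtain p' c where 1: "x = p' + c * u ^ n" "p' \<in> poly_values R u n" "c \<in> R" by auto
    have "x * y = p' * y + c * (u ^ n * y)" using 1 by (simp add: algebra_simps)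
    thus ?case using add[OF Suc.IH[OF 1(2)] sm[OF 1(3) ush[OF y]]] by simp
  qed
  then show "x * y \<in> adjoin R u" if "x \<in> adjoin R u" "y \<in> adjoin R u" for x y
  proof -
    from that(1) obtain n where "x \<in> poly_values R u n" by (auto simp: adjoin_def)
    thus ?thesis using \<open>\<And>y x n. y \<in> adjoin R u \<Longrightarrow> x \<in> poly_values R u n \<Longrightarrow> x * y \<in> adjoin R u\<close>[OF that(2)] by simp
  qed
qed

lemma adjoin_base: "R \<subseteq> adjoin R u"
proof
  fix r assume "r \<in> R"
  then have "r \<in> poly_values R u (Suc 0)" by auto
  thus "r \<in> adjoin R u" unfolding adjoin_def by blast
qed

lemma adjoin_elem: "u \<in> adjoin R u"
proof -
  have "1 \<in> poly_values R u (Suc 0)" using one_mem by auto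
  from poly_values_shift[OF this] show ?thesis unfolding adjoin_def by (auto simp del: poly_values.simps)
qed

text \<open>\<open>poly_values R u n\<close> holds the values at \<open>u\<close> of polynomials of
  degree below \<open>n\<close>. As \<open>u\<close> may satisfy relations, a leading coefficient
  belongs to a representation and not to the element.\<close>

definition lead_coeffs :: "'a \<Rightarrow> 'a set \<Rightarrow> nat \<Rightarrow> 'a set" where
  "lead_coeffs u I n = {c \<in> R. \<exists>p\<in>poly_values R u n. c * u ^ n + p \<in> I}"

context
  fixes u :: 'a
begin

interpretation S: comm_subring "adjoin R u" by (rule adjoin_subring)

lemma lead_coeffs_ideal:
  assumes I: "S.is_ideal I" shows "is_ideal (lead_coeffs u I n)"
  unfolding is_ideal_def
proof (intro conjI ballI)
  show "lead_coeffs u I n \<subseteq> R" by (auto simp: lead_coeffs_def)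
  show "0 \<in> lead_coeffs u I n"
    using zero_mem poly_values_zero S.ideal_zero[OF I] by (auto simp: lead_coeffs_def intro!: bexI[of _ 0])
  fix x assume "x \<in> lead_coeffs u I n"
  then obtain p where x: "x \<in> R" "p \<in> poly_values R u n" "x * u ^ n + p \<in> I" by (auto simp: lead_coeffs_def)
  {
    fix y assume "y \<in> lead_coeffs u I n"
    then obtain q where y: "y \<in> R" "q \<in> poly_values R u n" "y * u ^ n + q \<in> I" by (auto simp: lead_coeffs_def)
    have "(x + y) * u ^ n + (p + q) = (x * u ^ n + p) + (y * u ^ n + q)" by (simp add: algebra_simps)
    thus "x + y \<in> lead_coeffs u I n"
      using S.ideal_add[OF I x(3) y(3)] poly_values_add[OF x(2) y(2)] add_mem[OF x(1) y(1)]
      unfolding lead_coeffs_def by (metis (no_types, lifting) mem_Collect_eq)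
  }
  fix r assume r: "r \<in> R"
  have "(r * x) * u ^ n + r * p = r * (x * u ^ n + p)" by (simp add: algebra_simps)
  moreover have "r \<in> adjoin R u" using r adjoin_base by auto
  ultimately have "(r * x) * u ^ n + r * p \<in> I" using S.ideal_mult[OF I _ x(3)] by simp
  thus "r * x \<in> lead_coeffs u I n"
    using poly_values_smult[OF r x(2)] mult_mem[OF r x(1)] unfolding lead_coeffs_def by auto
qed

lemma lead_coeffs_Suc:
  assumes I: "S.is_ideal I" shows "lead_coeffs u I n \<subseteq> lead_coeffs u I (Suc n)"
proof
  fix x assume "x \<in> lead_coeffs u I n"
  then obtain p where x: "x \<in> R" "p \<in> poly_values R u n" "x * u ^ n + p \<in> I" by (auto simp: lead_coeffs_def)
  have "u * (x * u ^ n + p) = x * u ^ Suc n + u * p" by (simp add: algebra_simps)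
  then have "x * u ^ Suc n + u * p \<in> I" using S.ideal_mult[OF I adjoin_elem x(3)] by simp
  thus "x \<in> lead_coeffs u I (Suc n)" using x(1) poly_values_shift[OF x(2)] unfolding lead_coeffs_def by blast
qed

text \<open>By induction on the degree bound: an element of \<open>I\<close> and an element of
  \<open>J\<close> with the same leading coefficient differ by an element of \<open>I\<close> of
  lower degree.\<close>

lemma lead_coeffs_subset_imp:
  assumes I: "S.is_ideal I" and J: "S.is_ideal J" "J \<subseteq> I"
    and L: "\<And>n. lead_coeffs u I n \<subseteq> lead_coeffs u J n"
  shows "I \<subseteq> J"
proof -
  have "x \<in> J" if "x \<in> I" "x \<in> poly_values R u n" for x n
    using that
  proof (induction n arbitrary: x)
    case 0
    thus ?case using S.ideal_zero[OF J(1)] by simp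
  next
    case (Suc n)
    then obtain p c where 1: "x = p + c * u ^ n" "p \<in> poly_values R u n" "c \<in> R" by auto
    then have "c \<in> lead_coeffs u I n" using Suc.prems(1) by (auto simp: lead_coeffs_def add.commute)
    then obtain q where q: "q \<in> poly_values R u n" "c * u ^ n + q \<in> J" using L by (force simp: lead_coeffs_def)
    have e: "x - (c * u ^ n + q) = p + (- 1) * q" using 1 by simp
    have "x - (c * u ^ n + q) \<in> I" using S.ideal_diff[OF I Suc.prems(1)] q(2) J(2) by auto
    moreover have "p + (- 1) * q \<in> poly_values R u n"
      using poly_values_add[OF 1(2) poly_values_smult[OF uminus_mem[OF one_mem] q(1)]] .
    ultimately have "x - (c * u ^ n + q) \<in> J" using Suc.IH e by metis
    then have "(c * u ^ n + q) + (x - (c * u ^ n + q)) \<in> J" by (rule S.ideal_add[OF J(1) q(2)])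
    thus ?case by simp
  qed
  moreover have "\<exists>n. x \<in> poly_values R u n" if "x \<in> I" for x
    using S.ideal_sub[OF I that] by (auto simp: adjoin_def)
  ultimately show ?thesis by blast
qed

text \<open>Hilbert's argument. The ideals of leading coefficients increase with the degree and are
  constant from some \<open>N\<close> on; elements of \<open>I\<close> that realise finite
  generating sets of those up to \<open>N\<close> generate \<open>I\<close>.\<close>

theorem adjoin_noetherian:
  assumes noeth: is_noetherian
  shows "comm_subring.is_noetherian (adjoin R u)"
  unfolding S.is_noetherian_def
proof (intro allI impI)
  fix I assume I: "S.is_ideal I"
  let ?L = "lead_coeffs u I"
  have Lid: "is_ideal (?L n)" for n using lead_coeffs_ideal[OF I] .
  have Lmono: "?L n \<subseteq> ?L k" if "n \<le> k" for n k
    using lift_Suc_mono_le[of ?L n k] lead_coeffs_Suc[OF I] that by simp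
  have dir: "\<exists>K\<in>range ?L. X \<subseteq> K \<and> Y \<subseteq> K" if "X \<in> range ?L" "Y \<in> range ?L" for X Y
  proof -
    from that obtain n k where nk: "X = ?L n" "Y = ?L k" by auto
    thus ?thesis using Lmono[of n "max n k"] Lmono[of k "max n k"] by (intro bexI[of _ "?L (max n k)"]) auto
  qed
  define U where "U = \<Union>(range ?L)"
  have Uid: "is_ideal U" unfolding U_def by (rule ideal_directed_Union) (use Lid dir in auto)
  obtain G where G: "finite G" "G \<subseteq> U" "\<And>J. is_ideal J \<Longrightarrow> G \<subseteq> J \<Longrightarrow> U \<subseteq> J"
    using noetherianE[OF noeth Uid] by metis
  have "\<exists>X\<in>range ?L. G \<subseteq> X"
    by (rule finite_subset_directed_Union[OF G(1) _ _ dir]) (use G(2) U_def in auto)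
  then obtain N where N: "G \<subseteq> ?L N" by auto
  have UN: "U \<subseteq> ?L N" by (rule G(3)[OF Lid N])
  have "\<exists>Gn. finite Gn \<and> Gn \<subseteq> ?L n \<and> (\<forall>J. is_ideal J \<longrightarrow> Gn \<subseteq> J \<longrightarrow> ?L n \<subseteq> J)" for n
    using noeth Lid[of n] unfolding is_noetherian_def by simp
  then have "\<forall>n. \<exists>Gn. finite Gn \<and> Gn \<subseteq> ?L n \<and> (\<forall>J. is_ideal J \<longrightarrow> Gn \<subseteq> J \<longrightarrow> ?L n \<subseteq> J)" by simp
  then obtain H where "\<forall>n. finite (H n) \<and> H n \<subseteq> ?L n \<and> (\<forall>J. is_ideal J \<longrightarrow> H n \<subseteq> J \<longrightarrow> ?L n \<subseteq> J)"
    by (rule choice[THEN exE])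
  then have H: "\<And>n. finite (H n)" "\<And>n. H n \<subseteq> ?L n" "\<And>n J. is_ideal J \<Longrightarrow> H n \<subseteq> J \<Longrightarrow> ?L n \<subseteq> J"
    by simp_all
  have ex: "\<exists>w. w \<in> I \<and> (\<exists>p\<in>poly_values R u n. w = g * u ^ n + p)" if "g \<in> H n" for g n
  proof -
    have "g \<in> ?L n" using that H(2) by (rule subsetD[rotated])
    thus ?thesis unfolding lead_coeffs_def by auto
  qed
  define w where "w n g = (SOME w. w \<in> I \<and> (\<exists>p\<in>poly_values R u n. w = g * u ^ n + p))" for n g
  have w: "w n g \<in> I \<and> (\<exists>p\<in>poly_values R u n. w n g = g * u ^ n + p)" if "g \<in> H n" for n g
    unfolding w_def by (rule someI_ex[OF ex[OF that]])
  define W where "W = (\<Union>n\<le>N. w n ` H n)"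
  have "finite W" unfolding W_def using H(1) by auto
  moreover have "W \<subseteq> I" unfolding W_def using w by auto
  moreover have "I \<subseteq> J" if J: "S.is_ideal J" "W \<subseteq> J" for J
  proof -
    \<comment> \<open>The comparison of leading coefficients is made for an ideal inside
      \<open>I\<close>, hence the intersection.\<close>
    have IJ: "S.is_ideal (I \<inter> J)" using S.ideal_Int[OF I J(1)] .
    have low: "?L n \<subseteq> lead_coeffs u (I \<inter> J) n" if "n \<le> N" for n
    proof (rule H(3)[OF lead_coeffs_ideal[OF IJ]])
      show "H n \<subseteq> lead_coeffs u (I \<inter> J) n"
      proof
        fix g assume g: "g \<in> H n"
        then have "w n g \<in> I \<inter> J" using J(2) \<open>W \<subseteq> I\<close> that unfolding W_def by blast
        thus "g \<in> lead_coeffs u (I \<inter> J) n" using w[OF g] H(2)[of n] g unfolding lead_coeffs_def by auto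
      qed
    qed
    have "?L n \<subseteq> lead_coeffs u (I \<inter> J) n" for n
    proof (cases "n \<le> N")
      case False
      then have "?L n \<subseteq> ?L N" using UN unfolding U_def by auto
      also have "\<dots> \<subseteq> lead_coeffs u (I \<inter> J) N" using low by simp
      also have "\<dots> \<subseteq> lead_coeffs u (I \<inter> J) n"
        using lift_Suc_mono_le[of "lead_coeffs u (I \<inter> J)" N n] lead_coeffs_Suc[OF IJ] False by simp
      finally show ?thesis .
    qed (rule low)
    then have "I \<subseteq> I \<inter> J" by (intro lead_coeffs_subset_imp[OF I IJ]) auto
    thus ?thesis by auto
  qed
  ultimately show "\<exists>G. finite G \<and> G \<subseteq> I \<and> (\<forall>J. S.is_ideal J \<longrightarrow> G \<subseteq> J \<longrightarrow> I \<subseteq> J)" by blast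
qed

end

end

lemma noetherian_adjoin_finite:
  fixes R0 :: "'a::comm_ring_1 set"
  assumes "comm_subring R0" "comm_subring.is_noetherian R0" "finite G" "comm_subring R" "R0 \<subseteq> R" "G \<subseteq> R"
  shows "\<exists>S. comm_subring S \<and> comm_subring.is_noetherian S \<and> R0 \<subseteq> S \<and> G \<subseteq> S \<and> S \<subseteq> R"
  using assms(3,6)
proof (induction G rule: finite_induct)
  case empty
  thus ?case using assms by auto
next
  case (insert u G)
  then obtain S where S: "comm_subring S" "comm_subring.is_noetherian S" "R0 \<subseteq> S" "G \<subseteq> S" "S \<subseteq> R" by auto
  interpret S: comm_subring S by (rule S)
  interpret R: comm_subring R by (rule assms)
  have "poly_values S u n \<subseteq> R" for n
    using insert.prems S(5) by (induction n) (auto intro!: R.zero_mem R.add_mem R.mult_mem R.power_mem)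
  then have "adjoin S u \<subseteq> R" by (auto simp: adjoin_def)
  thus ?case using S.adjoin_subring S.adjoin_noetherian[OF S(2)] S.adjoin_base[of u] S.adjoin_elem[of u] S
    by (intro exI[of _ "adjoin S u"]) auto
qed

lemma comm_subring_field_noetherian:
  fixes kc :: "'k::field \<Rightarrow> 'a::comm_ring_1"
  assumes "kc 0 = 0" "kc 1 = 1" "\<And>a b. kc (a + b) = kc a + kc b" "\<And>a b. kc (a * b) = kc a * kc b"
  shows "comm_subring (range kc)" "comm_subring.is_noetherian (range kc)"
proof -
  have um: "- kc a = kc (- a)" for a
    using assms(1) assms(3)[of a "- a"] by (metis add.inverse_unique add.right_inverse)
  show 1: "comm_subring (range kc)"
  proof
    show "1 \<in> range kc" using assms(2) by (metis rangeI)
  qed (use um assms(3,4) in \<open>auto simp flip: assms(3,4)\<close>)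
  interpret comm_subring "range kc" by (rule 1)
  show "comm_subring.is_noetherian (range kc)"
    unfolding is_noetherian_def
  proof (intro allI impI)
    fix I assume I: "is_ideal I"
    show "\<exists>G. finite G \<and> G \<subseteq> I \<and> (\<forall>J. is_ideal J \<longrightarrow> G \<subseteq> J \<longrightarrow> I \<subseteq> J)"
    proof (cases "I \<subseteq> {0}")
      case True
      thus ?thesis by (intro exI[of _ "{}"]) (auto simp: is_ideal_def)
    next
      case False
      then obtain a where a: "kc a \<in> I" "kc a \<noteq> 0" using ideal_sub[OF I] by blast
      then have "a \<noteq> 0" using assms(1) by auto
      then have e: "kc b = kc (b / a) * kc a" for b by (simp flip: assms(4))
      have "I \<subseteq> J" if J: "is_ideal J" "{kc a} \<subseteq> J" for J
      proof
        fix x assume "x \<in> I"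
        then obtain b where "x = kc b" using ideal_sub[OF I] by blast
        thus "x \<in> J" using ideal_mult[OF J(1), of "kc (b / a)" "kc a"] J(2) e[of b] by auto
      qed
      thus ?thesis using a by (intro exI[of _ "{kc a}"]) auto
    qed
  qed
qed

section \<open>Rings with a monomial basis\<close>

text \<open>Multiplication in \<open>int ^ 'n\<close> is componentwise and \<open>of_nat n\<close>
  is a constant vector, so \<open>of_nat n * g\<close> is the n-fold multiple of \<open>g\<close>.
  The clause about \<open>S\<close> is the induction principle of the generated monoid.\<close>

lemma affine_monoidE:
  assumes "affine_monoid M"
  obtains G where "finite G" "G \<subseteq> M" "0 \<in> M" "\<And>a b. a \<in> M \<Longrightarrow> b \<in> M \<Longrightarrow> a + b \<in> M"
    "\<And>S. 0 \<in> S \<Longrightarrow> (\<And>a b. a \<in> S \<Longrightarrow> b \<in> G \<Longrightarrow> a + b \<in> S) \<Longrightarrow> M \<subseteq> S"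
    "\<And>a. a \<in> M \<Longrightarrow> \<exists>c :: _ \<Rightarrow> nat. a = (\<Sum>g\<in>G. of_nat (c g) * g)"
    "\<And>c :: _ \<Rightarrow> nat. (\<Sum>g\<in>G. of_nat (c g) * g) \<in> M"
proof -
  obtain G where G: "finite G" "M = {x. \<exists>m :: _ \<Rightarrow> nat. x = (\<Sum>g\<in>G. of_nat (m g) * g)}"
    using assms unfolding affine_monoid_def by auto
  have 1: "g \<in> M" if "g \<in> G" for g
  proof -
    have "(\<Sum>h\<in>G. of_nat (if h = g then 1 else 0) * h) = (\<Sum>h\<in>G. if h = g then h else 0)"
      by (intro sum.cong) auto
    also have "\<dots> = g" using that G(1) by simp
    finally show ?thesis unfolding G(2) by (auto intro!: exI[of _ "\<lambda>h. if h = g then 1 else 0"])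
  qed
  have 2: "0 \<in> M" unfolding G(2) by (auto intro!: exI[of _ "\<lambda>_. 0"])
  have 3: "a + b \<in> M" if ab: "a \<in> M" "b \<in> M" for a b
  proof -
    obtain m k :: "_ \<Rightarrow> nat" where "a = (\<Sum>g\<in>G. of_nat (m g) * g)" "b = (\<Sum>g\<in>G. of_nat (k g) * g)"
      using ab unfolding G(2) by auto
    then have "a + b = (\<Sum>g\<in>G. of_nat (m g + k g) * g)" by (simp add: distrib_right sum.distrib)
    thus ?thesis unfolding G(2) by (intro CollectI exI[of _ "\<lambda>g. m g + k g"])
  qed
  have 4: "M \<subseteq> S" if S: "0 \<in> S" "\<And>a b. a \<in> S \<Longrightarrow> b \<in> G \<Longrightarrow> a + b \<in> S" for S
  proof
    fix x assume "x \<in> M"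
    then obtain m :: "_ \<Rightarrow> nat" where m: "x = (\<Sum>g\<in>G. of_nat (m g) * g)" unfolding G(2) by auto
    have n: "a + of_nat n * g \<in> S" if "a \<in> S" "g \<in> G" for a g and n :: nat
    proof (induction n)
      case (Suc n)
      have "a + of_nat (Suc n) * g = (a + of_nat n * g) + g" by (simp add: algebra_simps)
      thus ?case using S(2)[OF Suc \<open>g \<in> G\<close>] by (simp only:)
    qed (use that in auto)
    have "(\<Sum>g\<in>F. of_nat (m g) * g) \<in> S" if "finite F" "F \<subseteq> G" for F
      using that
    proof (induction F rule: finite_induct)
      case (insert x F)
      then have "(\<Sum>g\<in>F. of_nat (m g) * g) + of_nat (m x) * x \<in> S" by (intro n) auto
      moreover have "(\<Sum>g\<in>insert x F. of_nat (m g) * g) = (\<Sum>g\<in>F. of_nat (m g) * g) + of_nat (m x) * x"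
        using insert.hyps by (simp add: add.commute)
      ultimately show ?case by (simp only:)
    qed (simp add: S(1))
    thus "x \<in> S" using m G(1) by simp
  qed
  show ?thesis by (rule that[OF G(1) _ 2 3 4]) (use 1 G(2) in auto)
qed

text \<open>A ring with basis \<open>e a\<close> and coefficient functions \<open>cf\<close>, kept
  abstract so that the toric face ring and the ring of each single face are instances.
  \<open>fam_face\<close> says that the members of the family meet each other in faces.\<close>

locale monomial_ring = comm_subring R for R :: "'a::comm_ring_1 set" +
  fixes kc :: "'k::field \<Rightarrow> 'a" and e :: "int ^ ('n::finite) \<Rightarrow> 'a" and cf :: "'a \<Rightarrow> int ^ 'n \<Rightarrow> 'k"
    and \<M> :: "(int ^ 'n) set set"
  assumes fam_finite: "finite \<M>" and fam_nonempty: "\<M> \<noteq> {}"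
    and fam_affine: "N \<in> \<M> \<Longrightarrow> affine_monoid N"
    and fam_face: "N \<in> \<M> \<Longrightarrow> N' \<in> \<M> \<Longrightarrow> a \<in> N \<Longrightarrow> b \<in> N \<Longrightarrow> a + b \<in> N' \<Longrightarrow> a \<in> N'"
    and kc_zero: "kc 0 = 0" and kc_one: "kc 1 = 1" and kc_add: "kc (c + d) = kc c + kc d"
    and kc_mult: "kc (c * d) = kc c * kc d" and kc_mem: "kc c \<in> R"
    and e_mem: "a \<in> \<Union>\<M> \<Longrightarrow> e a \<in> R" and e_zero: "e 0 = 1"
    and e_mult: "a \<in> \<Union>\<M> \<Longrightarrow> b \<in> \<Union>\<M> \<Longrightarrow>
      e a * e b = (if \<exists>N\<in>\<M>. a \<in> N \<and> b \<in> N then e (a + b) else 0)"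
    and cf_finite: "x \<in> R \<Longrightarrow> finite {a. cf x a \<noteq> 0}"
    and cf_support: "x \<in> R \<Longrightarrow> cf x a \<noteq> 0 \<Longrightarrow> a \<in> \<Union>\<M>"
    and cf_lincomb: "finite A \<Longrightarrow> A \<subseteq> \<Union>\<M> \<Longrightarrow> cf (\<Sum>a\<in>A. kc (f a) * e a) = (\<lambda>a. if a \<in> A then f a else 0)"
    and cf_expand: "x \<in> R \<Longrightarrow> x = (\<Sum>a\<in>{a. cf x a \<noteq> 0}. kc (cf x a) * e a)"
begin

abbreviation U where "U \<equiv> \<Union>\<M>"
definition compat where "compat a b \<longleftrightarrow> (\<exists>N\<in>\<M>. a \<in> N \<and> b \<in> N)"
definition supp where "supp x = {a. cf x a \<noteq> 0}"

lemma fam_zero: "N \<in> \<M> \<Longrightarrow> 0 \<in> N"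
  using affine_monoidE[OF fam_affine] by metis
lemma fam_add: "N \<in> \<M> \<Longrightarrow> a \<in> N \<Longrightarrow> b \<in> N \<Longrightarrow> a + b \<in> N"
  using affine_monoidE[OF fam_affine, of N] by metis
lemma zero_U: "0 \<in> U" using fam_zero fam_nonempty by auto
lemma compat_add: "compat a b \<Longrightarrow> a + b \<in> U" unfolding compat_def using fam_add by blast
lemma compat_sym: "compat a b \<longleftrightarrow> compat b a" by (auto simp: compat_def)
lemma compat_zero: "a \<in> U \<Longrightarrow> compat 0 a" using fam_zero by (auto simp: compat_def)
lemma compat_U: "compat a b \<Longrightarrow> a \<in> U \<and> b \<in> U" by (auto simp: compat_def)
lemma e_mult': "a \<in> U \<Longrightarrow> b \<in> U \<Longrightarrow> e a * e b = (if compat a b then e (a + b) else 0)"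
  using e_mult by (simp add: compat_def)

text \<open>By the face property \<open>N'\<close> contains both summands of \<open>a + y\<close>;
  all three exponents therefore lie in one member of the family.\<close>

lemma compat_assoc:
  assumes "compat a y" "compat b (a + y)" shows "compat (a + b) y" "compat a b" "compat b y"
proof -
  obtain N N' where N: "N \<in> \<M>" "N' \<in> \<M>" "a \<in> N" "y \<in> N" "b \<in> N'" "a + y \<in> N'"
    using assms by (auto simp: compat_def)
  have "a \<in> N'" using fam_face[OF N(1,2,3,4,6)] .
  moreover have "y \<in> N'" using fam_face[OF N(1,2,4,3)] N(6) by (simp add: add.commute)
  ultimately show "compat (a + b) y" "compat a b" "compat b y" using N fam_add by (auto simp: compat_def)
qed

lemma supp_finite: "x \<in> R \<Longrightarrow> finite (supp x)" using cf_finite by (simp add: supp_def)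
lemma supp_U: "x \<in> R \<Longrightarrow> supp x \<subseteq> U" using cf_support by (auto simp: supp_def)

lemma expand_superset:
  assumes "x \<in> R" "finite A" "supp x \<subseteq> A"
  shows "x = (\<Sum>a\<in>A. kc (cf x a) * e a)"
proof -
  have "(\<Sum>a\<in>A. kc (cf x a) * e a) = (\<Sum>a\<in>supp x. kc (cf x a) * e a)"
    by (rule sum.mono_neutral_right) (use assms in \<open>auto simp: supp_def kc_zero\<close>)
  thus ?thesis using cf_expand[OF assms(1)] by (simp add: supp_def)
qed

lemma lincomb_mem: "A \<subseteq> U \<Longrightarrow> (\<Sum>a\<in>A. kc (c a) * e a) \<in> R"
  by (intro sum_mem mult_mem kc_mem e_mem) auto

lemma cf_add:
  assumes "x \<in> R" "y \<in> R" shows "cf (x + y) a = cf x a + cf y a"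
proof -
  let ?A = "supp x \<union> supp y"
  have A: "finite ?A" "?A \<subseteq> U" using supp_finite supp_U assms by auto
  have "x + y = (\<Sum>a\<in>?A. kc (cf x a) * e a) + (\<Sum>a\<in>?A. kc (cf y a) * e a)"
    using expand_superset[OF assms(1) A(1)] expand_superset[OF assms(2) A(1)] by simp
  also have "\<dots> = (\<Sum>a\<in>?A. kc (cf x a + cf y a) * e a)"
    by (simp add: kc_add distrib_right sum.distrib)
  finally have "cf (x + y) a = (if a \<in> ?A then cf x a + cf y a else 0)"
    by (simp only: cf_lincomb[OF A])
  thus ?thesis by (auto simp: supp_def)
qed

lemma cf_zero: "cf 0 a = 0" using cf_lincomb[of "{}"] by simp

lemma cf_scale:
  assumes "x \<in> R" shows "cf (kc c * x) a = c * cf x a"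
proof -
  have A: "finite (supp x)" "supp x \<subseteq> U" using supp_finite supp_U assms by auto
  have "kc c * x = kc c * (\<Sum>a\<in>supp x. kc (cf x a) * e a)" using expand_superset[OF assms A(1)] by simp
  also have "\<dots> = (\<Sum>a\<in>supp x. kc (c * cf x a) * e a)" by (simp add: kc_mult sum_distrib_left mult.assoc)
  finally have "cf (kc c * x) a = (if a \<in> supp x then c * cf x a else 0)" by (simp only: cf_lincomb[OF A])
  thus ?thesis by (auto simp: supp_def)
qed

lemma kc_uminus: "kc (- c) = - kc c"
  using kc_add[of c "- c"] kc_zero by (simp add: eq_neg_iff_add_eq_0 add.commute)

lemma cf_uminus: "x \<in> R \<Longrightarrow> cf (- x) a = - cf x a"
  using cf_scale[of x "- 1" a] by (simp add: kc_uminus kc_one)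

lemma cf_sum: "(\<And>i. i \<in> I \<Longrightarrow> f i \<in> R) \<Longrightarrow> cf (sum f I) a = (\<Sum>i\<in>I. cf (f i) a)"
  by (induction I rule: infinite_finite_induct) (auto simp: cf_zero cf_add sum_mem)

lemma cf_e: "a \<in> U \<Longrightarrow> cf (e a) b = (if b = a then 1 else 0)"
  using cf_lincomb[of "{a}" "\<lambda>_. 1"] by (simp add: kc_one)

lemma cf_inject: "x \<in> R \<Longrightarrow> y \<in> R \<Longrightarrow> (\<And>a. cf x a = cf y a) \<Longrightarrow> x = y"
  using cf_expand[of x] cf_expand[of y] by simp

lemma supp_zero: "supp 0 = {}" by (simp add: supp_def cf_zero)
lemma supp_empty: "x \<in> R \<Longrightarrow> supp x = {} \<Longrightarrow> x = 0"
  using expand_superset[of x "{}"] by simp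
lemma supp_add: "x \<in> R \<Longrightarrow> y \<in> R \<Longrightarrow> supp (x + y) \<subseteq> supp x \<union> supp y"
  by (auto simp: supp_def cf_add)
lemma supp_e: "a \<in> U \<Longrightarrow> supp (e a) = {a}" by (auto simp: supp_def cf_e)

lemma cf_mult:
  assumes "x \<in> R" "y \<in> R"
  shows "cf (x * y) c = (\<Sum>a\<in>supp x. \<Sum>b\<in>supp y. if compat a b \<and> a + b = c then cf x a * cf y b else 0)"
proof -
  have "x * y = (\<Sum>a\<in>supp x. kc (cf x a) * e a) * (\<Sum>b\<in>supp y. kc (cf y b) * e b)"
    using expand_superset[OF assms(1) supp_finite[OF assms(1)]]
      expand_superset[OF assms(2) supp_finite[OF assms(2)]] by simp
  also have "\<dots> = (\<Sum>a\<in>supp x. \<Sum>b\<in>supp y. kc (cf x a * cf y b) * (e a * e b))"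
    by (simp add: sum_product kc_mult mult_ac)
  finally have xy: "x * y = \<dots>" .
  have U: "a \<in> U" if "a \<in> supp x \<or> a \<in> supp y" for a using that supp_U assms by auto
  have mem: "kc k * (e a * e b) \<in> R" if "a \<in> supp x" "b \<in> supp y" for k a b
    using that U by (intro mult_mem kc_mem e_mem) auto
  have "cf (x * y) c = (\<Sum>a\<in>supp x. \<Sum>b\<in>supp y. cf (kc (cf x a * cf y b) * (e a * e b)) c)"
    unfolding xy using mem by (subst cf_sum, intro sum_mem, simp)
      (intro sum.cong refl, subst cf_sum, simp_all)
  also have "\<dots> = (\<Sum>a\<in>supp x. \<Sum>b\<in>supp y. if compat a b \<and> a + b = c then cf x a * cf y b else 0)"
  proof (intro sum.cong refl)
    fix a b assume ab: "a \<in> supp x" "b \<in> supp y"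
    have 1: "e a * e b \<in> R" using ab U by (intro mult_mem e_mem) auto
    show "cf (kc (cf x a * cf y b) * (e a * e b)) c = (if compat a b \<and> a + b = c then cf x a * cf y b else 0)"
      unfolding cf_scale[OF 1] using ab U by (auto simp: e_mult' cf_e[OF compat_add] cf_zero)
  qed
  finally show ?thesis .
qed

lemma supp_mult:
  assumes "x \<in> R" "y \<in> R"
  shows "supp (x * y) \<subseteq> {a + b | a b. a \<in> supp x \<and> b \<in> supp y \<and> compat a b}"
proof
  fix c assume c: "c \<in> supp (x * y)"
  show "c \<in> {a + b | a b. a \<in> supp x \<and> b \<in> supp y \<and> compat a b}"
  proof (rule ccontr)
    assume neg: "\<not> ?thesis"
    have "cf (x * y) c = 0" unfolding cf_mult[OF assms] using neg by (intro sum.neutral ballI) auto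
    thus False using c by (simp add: supp_def)
  qed
qed

definition up_closed where
  "up_closed Y \<longleftrightarrow> Y \<subseteq> U \<and> (\<forall>y\<in>Y. \<forall>a. compat a y \<longrightarrow> a + y \<in> Y)"

definition span_of where "span_of Y = {x \<in> R. supp x \<subseteq> Y}"

lemma span_of_mono: "Y \<subseteq> Y' \<Longrightarrow> span_of Y \<subseteq> span_of Y'" by (auto simp: span_of_def)
lemma span_of_R: "span_of Y \<subseteq> R" by (auto simp: span_of_def)
lemma span_of_U: "span_of U = R" using supp_U by (auto simp: span_of_def)
lemma span_of_empty: "span_of {} = {0}" using supp_empty supp_zero zero_mem by (auto simp: span_of_def)
lemma e_span_of: "a \<in> U \<Longrightarrow> a \<in> Y \<Longrightarrow> e a \<in> span_of Y" by (simp add: span_of_def e_mem supp_e)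

lemma span_of_Int: "span_of (Y \<inter> Y') = span_of Y \<inter> span_of Y'" by (auto simp: span_of_def)

lemma span_of_ideal: "up_closed Y \<Longrightarrow> is_ideal (span_of Y)"
  unfolding is_ideal_def
proof (intro conjI ballI)
  assume up: "up_closed Y"
  show "span_of Y \<subseteq> R" by (rule span_of_R)
  show "0 \<in> span_of Y" by (simp add: span_of_def zero_mem supp_zero)
  show "x + y \<in> span_of Y" if "x \<in> span_of Y" "y \<in> span_of Y" for x y
    using that supp_add[of x y] by (auto simp: span_of_def add_mem)
  show "r * x \<in> span_of Y" if "r \<in> R" "x \<in> span_of Y" for r x
    using that supp_mult[of r x] up by (fastforce simp: span_of_def mult_mem up_closed_def)
qed

definition proj where "proj P x = (\<Sum>a\<in>supp x \<inter> P. kc (cf x a) * e a)"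

lemma proj_mem: "x \<in> R \<Longrightarrow> proj P x \<in> R"
  unfolding proj_def using supp_U by (intro lincomb_mem) auto

lemma cf_proj: "x \<in> R \<Longrightarrow> cf (proj P x) a = (if a \<in> P then cf x a else 0)"
  unfolding proj_def by (subst cf_lincomb) (use supp_U supp_finite in \<open>auto simp: supp_def\<close>)

lemma supp_proj: "x \<in> R \<Longrightarrow> supp (proj P x) = supp x \<inter> P"
  by (auto simp: supp_def cf_proj)

lemma proj_add: "x \<in> R \<Longrightarrow> y \<in> R \<Longrightarrow> proj P (x + y) = proj P x + proj P y"
  by (rule cf_inject) (auto simp: proj_mem add_mem cf_proj cf_add)

lemma proj_id: "x \<in> R \<Longrightarrow> supp x \<subseteq> P \<Longrightarrow> proj P x = x"
  by (rule cf_inject) (auto simp: proj_mem cf_proj supp_def)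

lemma proj_disjoint: "x \<in> R \<Longrightarrow> supp x \<inter> P = {} \<Longrightarrow> proj P x = 0"
  by (rule cf_inject) (auto simp: proj_mem cf_proj supp_def zero_mem cf_zero)

lemma proj_compl: "x \<in> R \<Longrightarrow> x = proj P x + proj (- P) x"
  by (rule cf_inject) (auto simp: proj_mem add_mem cf_proj cf_add)

text \<open>The monomials of the finitely many generators of the monoids are adjoined to the field
  one at a time; they generate the whole ring.\<close>

theorem noetherian: is_noetherian
proof -
  have R0: "comm_subring (range kc)" "comm_subring.is_noetherian (range kc)"
    using comm_subring_field_noetherian[of kc] kc_zero kc_one kc_add kc_mult by auto
  have "\<forall>N\<in>\<M>. \<exists>G. finite G \<and> G \<subseteq> N \<and> (\<forall>S. 0 \<in> S \<longrightarrow> (\<forall>a b. a \<in> S \<longrightarrow> b \<in> G \<longrightarrow> a + b \<in> S) \<longrightarrow> N \<subseteq> S)"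
  proof
    fix N assume "N \<in> \<M>"
    from fam_affine[OF this] show "\<exists>G. finite G \<and> G \<subseteq> N \<and> (\<forall>S. 0 \<in> S \<longrightarrow> (\<forall>a b. a \<in> S \<longrightarrow> b \<in> G \<longrightarrow> a + b \<in> S) \<longrightarrow> N \<subseteq> S)"
      by (rule affine_monoidE) metis
  qed
  then obtain G where G: "\<forall>N\<in>\<M>. finite (G N) \<and> G N \<subseteq> N \<and>
      (\<forall>S. 0 \<in> S \<longrightarrow> (\<forall>a b. a \<in> S \<longrightarrow> b \<in> G N \<longrightarrow> a + b \<in> S) \<longrightarrow> N \<subseteq> S)"
    by (rule bchoice[THEN exE])
  have GU: "G N \<subseteq> U" if "N \<in> \<M>" for N using G that by auto
  obtain S where S: "comm_subring S" "comm_subring.is_noetherian S" "range kc \<subseteq> S" "(\<Union>N\<in>\<M>. e ` G N) \<subseteq> S" "S \<subseteq> R"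
  proof -
    have fin: "finite (\<Union>N\<in>\<M>. e ` G N)" using G fam_finite by auto
    have "range kc \<subseteq> R" "(\<Union>N\<in>\<M>. e ` G N) \<subseteq> R"
      using kc_mem e_mem GU by (auto intro!: e_mem dest!: GU)
    from noetherian_adjoin_finite[OF R0 fin comm_subring_axioms this] show ?thesis using that by auto
  qed
  interpret S: comm_subring S by (rule S)
  have "e a \<in> S" if "a \<in> N" "N \<in> \<M>" for a N
  proof -
    have "N \<subseteq> {a \<in> N. e a \<in> S}"
    proof -
      have "0 \<in> {a \<in> N. e a \<in> S}" using fam_zero that e_zero S.one_mem by auto
      moreover have "a + b \<in> {a \<in> N. e a \<in> S}" if a: "a \<in> {a \<in> N. e a \<in> S}" and b: "b \<in> G N" for a b
      proof -
        have bN: "b \<in> N" using b G \<open>N \<in> \<M>\<close> by auto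
        have "compat a b" using a bN \<open>N \<in> \<M>\<close> by (auto simp: compat_def)
        then have "e a * e b = e (a + b)" using e_mult'[of a b] compat_U by simp
        moreover have "e a * e b \<in> S" using a b S(4) \<open>N \<in> \<M>\<close> by (intro S.mult_mem) auto
        ultimately show ?thesis using a bN fam_add \<open>N \<in> \<M>\<close> by auto
      qed
      ultimately show ?thesis using G \<open>N \<in> \<M>\<close> by blast
    qed
    thus ?thesis using that by auto
  qed
  then have "e a \<in> S" if "a \<in> U" for a using that by auto
  then have "(\<Sum>a\<in>{a. cf x a \<noteq> 0}. kc (cf x a) * e a) \<in> S" if "x \<in> R" for x
    using cf_support[OF that] S(3) by (intro S.sum_mem S.mult_mem) auto
  then have "x \<in> S" if "x \<in> R" for x
    by (subst cf_expand[OF that]) (use that in simp)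
  then have "S = R" using S(5) by auto
  thus ?thesis using S(2) by simp
qed

end

section \<open>Gradings by additive functions and locally regular elements\<close>

context monomial_ring begin

definition graded_ideal :: "(int ^ 'n \<Rightarrow> real) \<Rightarrow> 'a set \<Rightarrow> bool" where
  "graded_ideal l I \<longleftrightarrow> is_ideal I \<and> (\<forall>x\<in>I. \<forall>t. proj {a. l a = t} x \<in> I)"

lemma graded_span_of: "up_closed Y \<Longrightarrow> graded_ideal l (span_of Y)"
  unfolding graded_ideal_def using span_of_ideal by (auto simp: span_of_def proj_mem supp_proj)

lemma proj_mult_homogeneous:
  fixes l :: "int ^ 'n \<Rightarrow> real"
  assumes l: "\<And>a b. l (a + b) = l a + l b" and q: "q \<in> R" "supp q \<subseteq> {a. l a = d}" and x: "x \<in> R"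
  shows "proj {a. l a = d + t} (q * x) = q * proj {a. l a = t} x"
proof -
  let ?P = "{a. l a = t}"
  have m: "proj ?P x \<in> R" "proj (- ?P) x \<in> R" using proj_mem x by auto
  have xe: "proj ?P x + proj (- ?P) x = x" by (rule proj_compl[OF x, symmetric])
  have "q * proj ?P x + q * proj (- ?P) x = q * (proj ?P x + proj (- ?P) x)" by (rule distrib_left[symmetric])
  also have "\<dots> = q * x" by (simp only: xe)
  finally have "q * x = q * proj ?P x + q * proj (- ?P) x" by (rule sym)
  moreover have "proj {a. l a = d + t} (q * proj ?P x) = q * proj ?P x"
  proof (intro proj_id mult_mem q m subsetI)
    fix a assume "a \<in> supp (q * proj ?P x)"
    then obtain b c where "a = b + c" "b \<in> supp q" "c \<in> supp (proj ?P x)" using supp_mult[OF q(1) m(1)] by auto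
    thus "a \<in> {a. l a = d + t}" using supp_proj[OF x, of ?P] q(2) l[of b c] by auto
  qed
  moreover have "proj {a. l a = d + t} (q * proj (- ?P) x) = 0"
  proof (intro proj_disjoint mult_mem q m)
    have "a \<notin> {a. l a = d + t}" if "a \<in> supp (q * proj (- ?P) x)" for a
    proof -
      from that obtain b c where "a = b + c" "b \<in> supp q" "c \<in> supp (proj (- ?P) x)"
        using supp_mult[OF q(1) m(2)] by auto
      thus ?thesis using supp_proj[OF x, of "- ?P"] q(2) l[of b c] by auto
    qed
    thus "supp (q * proj (- ?P) x) \<inter> {a. l a = d + t} = {}" by auto
  qed
  ultimately show ?thesis using m q by (simp add: proj_add mult_mem)
qed

lemma graded_plus_mult:
  fixes l :: "int ^ 'n \<Rightarrow> real"
  assumes l: "\<And>a b. l (a + b) = l a + l b" and q: "q \<in> R" "supp q \<subseteq> {a. l a = 0}"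
    and A: "graded_ideal l A" and B: "graded_ideal l B"
  shows "graded_ideal l (plus_mult B q A)"
  unfolding graded_ideal_def
proof (intro conjI ballI allI)
  have id: "is_ideal A" "is_ideal B" using A B by (auto simp: graded_ideal_def)
  show "is_ideal (plus_mult B q A)" using ideal_plus_mult[OF id q(1)] .
  fix x t assume "x \<in> plus_mult B q A"
  then obtain b a where x: "b \<in> B" "a \<in> A" "x = b + q * a" by (rule plus_multE)
  have R: "a \<in> R" "b \<in> R" using x ideal_sub[OF id(1)] ideal_sub[OF id(2)] by auto
  have "proj {a. l a = t} x = proj {a. l a = t} b + q * proj {a. l a = t} a"
    using proj_mult_homogeneous[OF l q R(1), of t] R q x by (simp add: proj_add mult_mem)
  thus "proj {a. l a = t} x \<in> plus_mult B q A"
    using A B x unfolding graded_ideal_def by (intro plus_multI) auto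
qed

text \<open>The component of highest possible degree of q g is the product q1 g1 of the top
  components, so q1 g1 lies in the graded ideal \<open>I\<close>. Then \<open>q\<close> also
  multiplies q1 (g - g1) into \<open>I\<close>, an element with fewer degrees than \<open>g\<close>.
  By induction some \<open>s\<close> outside of \<open>m\<close> kills it modulo \<open>I\<close>,
  and s q1 kills \<open>g\<close>.\<close>

lemma top_component_loc_regular:
  fixes l :: "int ^ 'n \<Rightarrow> real"
  assumes l: "\<And>a b. l (a + b) = l a + l b" and m: "is_prime m"
    and q: "q \<in> R" "supp q \<subseteq> {a. l a \<le> d}" "proj {a. l a = d} q \<notin> m"
    and A: "is_ideal A" and I: "graded_ideal l I" and gr: "graded_ideal l A"
  shows "loc_regular_on (R - m) q A I"
  unfolding loc_regular_on_def
proof (intro ballI impI)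
  fix g assume "g \<in> A" "q * g \<in> I"
  thus "\<exists>s\<in>R - m. s * g \<in> I"
  proof (induction "card (l ` supp g)" arbitrary: g rule: less_induct)
    case less
    have Iid: "is_ideal I" using I by (simp add: graded_ideal_def)
    have gR: "g \<in> R" using less.prems(1) ideal_sub[OF A] by auto
    show ?case
    proof (cases "supp g = {}")
      case True
      have "1 \<in> R - m" using m one_mem by (auto simp: is_prime_def)
      moreover have "g = 0" using supp_empty[OF gR True] .
      ultimately show ?thesis using ideal_zero[OF Iid] by auto
    next
      case False
      define t where "t = Max (l ` supp g)"
      have fin: "finite (l ` supp g)" using supp_finite[OF gR] by simp
      have t: "t \<in> l ` supp g" unfolding t_def using fin False by (intro Max_in) auto
      have tmax: "l a \<le> t" if "a \<in> supp g" for a unfolding t_def using fin that by simp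
      define q1 where "q1 = proj {a. l a = d} q"
      define q2 where "q2 = proj (- {a. l a = d}) q"
      define g1 where "g1 = proj {a. l a = t} g"
      define g2 where "g2 = proj (- {a. l a = t}) g"
      have R: "q1 \<in> R" "q2 \<in> R" "g1 \<in> R" "g2 \<in> R"
        unfolding q1_def q2_def g1_def g2_def using proj_mem gR q(1) by auto
      have qs: "q = q1 + q2" "g = g1 + g2"
        unfolding q1_def q2_def g1_def g2_def using proj_compl gR q(1) by auto
      have s1: "supp q1 \<subseteq> {a. l a = d}" "supp g1 \<subseteq> {a. l a = t}"
        unfolding q1_def g1_def using supp_proj gR q(1) by auto
      have s2: "supp q2 \<subseteq> {a. l a < d}"
        unfolding q2_def supp_proj[OF q(1)] using q(2) by fastforce
      have s3: "supp g2 \<subseteq> {a. l a < t}"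
        unfolding g2_def supp_proj[OF gR] using tmax by fastforce
      have "proj {a. l a = d + t} (q * g) = q1 * g1"
      proof -
        have "q * g = q1 * g1 + (q1 * g2 + q2 * g)" using qs by (simp add: algebra_simps)
        moreover have "proj {a. l a = d + t} (q1 * g1) = q1 * g1"
        proof (intro proj_id mult_mem R subsetI)
          fix a assume "a \<in> supp (q1 * g1)"
          then obtain b c where "a = b + c" "b \<in> supp q1" "c \<in> supp g1" using supp_mult[OF R(1,3)] by auto
          thus "a \<in> {a. l a = d + t}" using s1 l[of b c] by auto
        qed
        moreover have "proj {a. l a = d + t} (q1 * g2) = 0"
        proof (intro proj_disjoint mult_mem R)
          have "a \<notin> {a. l a = d + t}" if "a \<in> supp (q1 * g2)" for a
          proof -
            from that obtain b c where "a = b + c" "b \<in> supp q1" "c \<in> supp g2" using supp_mult[OF R(1,4)] by auto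
            moreover from this have "l b = d" "l c < t" using s1 s3 by auto
            ultimately show ?thesis using l[of b c] by simp
          qed
          thus "supp (q1 * g2) \<inter> {a. l a = d + t} = {}" by auto
        qed
        moreover have "proj {a. l a = d + t} (q2 * g) = 0"
        proof (intro proj_disjoint mult_mem R gR)
          have "l a < d + t" if "a \<in> supp (q2 * g)" for a
          proof -
            from that supp_mult[OF R(2) gR] obtain b c where "a = b + c" "b \<in> supp q2" "c \<in> supp g" by auto
            moreover from this have "l b < d" "l c \<le> t" using s2 tmax[of c] by auto
            ultimately show ?thesis using l by simp
          qed
          thus "supp (q2 * g) \<inter> {a. l a = d + t} = {}" by force
        qed
        ultimately show ?thesis using R gR by (simp add: proj_add mult_mem add_mem)
      qed
      then have q1g1: "q1 * g1 \<in> I" using I less.prems(2) unfolding graded_ideal_def by metis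
      have g1A: "g1 \<in> A" using gr less.prems(1) unfolding g1_def graded_ideal_def by auto
      have g2A: "g2 \<in> A" using ideal_diff[OF A less.prems(1) g1A] qs(2) by simp
      define h where "h = q1 * g2"
      have hA: "h \<in> A" unfolding h_def using ideal_mult[OF A R(1) g2A] .
      have "q * h = q1 * (q * g) - q * (q1 * g1)" unfolding h_def using qs(2) by (simp add: algebra_simps)
      then have qh: "q * h \<in> I"
        using ideal_diff[OF Iid ideal_mult[OF Iid R(1) less.prems(2)] ideal_mult[OF Iid q(1) q1g1]] by simp
      have "l ` supp h \<subseteq> (\<lambda>s. d + s) ` (l ` supp g - {t})"
      proof
        fix s assume "s \<in> l ` supp h"
        then obtain a where "a \<in> supp h" "s = l a" by auto
        then obtain b c where bc: "a = b + c" "b \<in> supp q1" "c \<in> supp g2"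
          using supp_mult[OF R(1,4)] unfolding h_def by auto
        have "l b = d" using bc(2) s1 by auto
        moreover have "c \<in> supp g" "l c \<noteq> t" using bc(3) unfolding g2_def supp_proj[OF gR] by auto
        ultimately show "s \<in> (\<lambda>s. d + s) ` (l ` supp g - {t})" using \<open>s = l a\<close> bc(1) l by auto
      qed
      then have "card (l ` supp h) \<le> card (l ` supp g - {t})"
        using fin by (meson card_image_le card_mono finite_Diff finite_imageI order_trans)
      also have "\<dots> < card (l ` supp g)" using fin t by (meson card_Diff1_less)
      finally obtain s where s: "s \<in> R - m" "s * h \<in> I" using less.hyps[OF _ hA qh] by auto
      have "(s * q1) * g = s * h + s * (q1 * g1)" unfolding h_def using qs(2) by (simp add: algebra_simps)
      then have "(s * q1) * g \<in> I"
        using ideal_add[OF Iid s(2) ideal_mult[OF Iid _ q1g1, of s]] s(1) by simp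
      moreover have "s * q1 \<in> R - m"
        using s(1) R(1) q(3) m mult_mem unfolding is_prime_def q1_def by auto
      ultimately show ?thesis by blast
    qed
  qed
qed

end

section \<open>Monomials outside the maximal ideal\<close>

locale monomial_at = monomial_ring R kc e cf \<M>
  for R :: "'a::comm_ring_1 set" and kc :: "'k::field \<Rightarrow> 'a" and e :: "int ^ ('n::finite) \<Rightarrow> 'a"
    and cf \<M> +
  fixes m :: "'a set"
  assumes m_max: "is_maximal m"
begin

sublocale noetherian_at R m
  using noetherian m_max by unfold_locales

text \<open>The exponents whose monomials become units in the localisation at
  \<open>m\<close>.\<close>

definition units_at where "units_at = {a \<in> U. e a \<notin> m}"

lemma one_notin_m: "1 \<notin> m" using m_prime by (simp add: is_prime_def)

lemma units_at_zero: "0 \<in> units_at"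
  using zero_U e_zero one_notin_m by (simp add: units_at_def)

text \<open>The product of two monomials outside the prime \<open>m\<close> is again outside of
  \<open>m\<close>. In particular it is nonzero, which forces the exponents to be
  compatible.\<close>

lemma units_at_prod:
  assumes "a \<in> units_at" "b \<in> units_at"
  shows "compat a b" "a + b \<in> units_at"
proof -
  have "e a * e b \<notin> m" using assms m_prime e_mem by (auto simp: units_at_def is_prime_def)
  then show 1: "compat a b" using assms ideal_zero[OF m_ideal] by (auto simp: units_at_def e_mult' split: if_splits)
  show "a + b \<in> units_at"
    using \<open>e a * e b \<notin> m\<close> 1 assms compat_add[OF 1] by (simp add: units_at_def e_mult')
qed

lemma units_at_mult: "a \<in> units_at \<Longrightarrow> b \<in> units_at \<Longrightarrow> e a * e b = e (a + b)"
  using units_at_prod(1)[of a b] by (simp add: units_at_def e_mult')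

lemma units_at_summand:
  assumes "compat a b" "a + b \<in> units_at" shows "a \<in> units_at"
proof -
  have U: "a \<in> U" "b \<in> U" using assms compat_U by auto
  have "e b * e a \<notin> m" using assms U compat_sym[of a b] by (simp add: e_mult' units_at_def add.commute)
  then have "e a \<notin> m" using ideal_mult[OF m_ideal e_mem[OF U(2)]] by auto
  thus ?thesis using U by (simp add: units_at_def)
qed

lemma units_at_multiple: "a \<in> units_at \<Longrightarrow> of_nat n * a \<in> units_at \<and> e (of_nat n * a) = e a ^ n"
proof (induction n)
  case (Suc n)
  have "of_nat (Suc n) * a = a + of_nat n * a" by (simp add: algebra_simps)
  thus ?case using Suc units_at_prod[of a "of_nat n * a"] units_at_mult[of a "of_nat n * a"] by simp
qed (simp add: units_at_zero e_zero)

definition nspan :: "(int ^ 'n) set \<Rightarrow> (int ^ 'n) set" where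
  "nspan J = {\<Sum>b\<in>J. of_nat (n b) * b | n :: _ \<Rightarrow> nat. True}"

lemma nspan_units: "finite J \<Longrightarrow> J \<subseteq> units_at \<Longrightarrow> nspan J \<subseteq> units_at"
proof -
  assume J: "finite J" "J \<subseteq> units_at"
  have "(\<Sum>b\<in>J. of_nat (n b) * b) \<in> units_at" for n :: "_ \<Rightarrow> nat"
    using J by (induction J rule: finite_induct) (auto simp: units_at_zero units_at_multiple intro: units_at_prod)
  thus ?thesis by (auto simp: nspan_def)
qed

lemma nspan_insert:
  assumes "finite J" "b \<notin> J" "a \<in> nspan (insert b J)"
  obtains v n where "v \<in> nspan J" "a = v + of_nat n * b"
proof -
  from assms(3) obtain n :: "_ \<Rightarrow> nat" where "a = (\<Sum>c\<in>insert b J. of_nat (n c) * c)" by (auto simp: nspan_def)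
  then have "a = (\<Sum>c\<in>J. of_nat (n c) * c) + of_nat (n b) * b" using assms by (simp add: add.commute)
  thus ?thesis using that unfolding nspan_def by blast
qed

text \<open>For linearly independent \<open>J\<close> inside \<open>units_at\<close> the monomials
  of \<open>nspan J\<close> span a polynomial ring in the \<open>e b\<close>, and the condition says
  that it embeds into the residue field.\<close>

definition alg_free :: "(int ^ 'n) set \<Rightarrow> bool" where
  "alg_free J \<longleftrightarrow> span_of (nspan J) \<inter> m = {0}"

lemma alg_free_empty: "alg_free {}"
proof -
  have triv: "x = 0" if x: "x \<in> R" "supp x \<subseteq> {0}" "x \<in> m" for x
  proof (rule ccontr)
    assume "x \<noteq> 0"
    have xe: "x = kc (cf x 0)" using expand_superset[OF x(1) _ x(2)] e_zero by simp
    then have "cf x 0 \<noteq> 0" using \<open>x \<noteq> 0\<close> kc_zero by auto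
    then have "kc (inverse (cf x 0)) * x = 1" using xe kc_mult[of "inverse (cf x 0)" "cf x 0"] kc_one by simp
    thus False using ideal_mult[OF m_ideal kc_mem x(3), of "inverse (cf x 0)"] one_notin_m by simp
  qed
  have "span_of (nspan {}) \<inter> m \<subseteq> {0}"
  proof
    fix x assume "x \<in> span_of (nspan {}) \<inter> m"
    then have "x \<in> R" "supp x \<subseteq> {0}" "x \<in> m" by (auto simp: nspan_def span_of_def)
    from triv[OF this] show "x \<in> {0}" by simp
  qed
  thus ?thesis using zero_mem supp_zero ideal_zero[OF m_ideal] unfolding alg_free_def span_of_def by auto
qed

lemma exists_max_alg_free:
  assumes "finite B"
  obtains J where "J \<subseteq> B" "alg_free J" "\<And>b. b \<in> B - J \<Longrightarrow> \<not> alg_free (insert b J)"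
proof -
  let ?P = "\<lambda>J. J \<subseteq> B \<and> alg_free J"
  obtain J where J: "?P J" "\<And>J'. ?P J' \<Longrightarrow> card J' \<le> card J"
  proof -
    have "\<forall>J. ?P J \<longrightarrow> card J < Suc (card B)" using card_mono[OF assms] by (auto simp: less_Suc_eq_le)
    moreover have "?P {}" using alg_free_empty by simp
    ultimately have "\<exists>J. ?P J \<and> (\<forall>J'. ?P J' \<longrightarrow> card J' \<le> card J)" by (rule ex_has_greatest_nat[rotated])
    thus ?thesis using that by blast
  qed
  show ?thesis
  proof (rule that[of J])
    fix b assume b: "b \<in> B - J"
    show "\<not> alg_free (insert b J)"
    proof
      assume "alg_free (insert b J)"
      then have "card (insert b J) \<le> card J" using J b by auto
      thus False using b assms J(1) finite_subset[of J B] by auto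
    qed
  qed (use J in auto)
qed

text \<open>The relation witnessing that \<open>b\<close> is algebraic modulo \<open>m\<close> over the monomials of \<open>J\<close> has
  leading coefficient outside of \<open>m\<close>, which makes it a nonzerodivisor locally at \<open>m\<close>.\<close>

lemma algebraic_relation:
  fixes l :: "int ^ 'n \<Rightarrow> real"
  assumes J: "finite J" "insert b J \<subseteq> units_at" "b \<notin> J" "alg_free J" "\<not> alg_free (insert b J)"
    and l: "\<And>a c. l (a + c) = l a + l c" "l b = 1" "\<And>c. c \<in> J \<Longrightarrow> l c = 0"
  obtains q d where "q \<in> m" "supp q \<subseteq> nspan (insert b J)" "supp q \<subseteq> {a. l a \<le> d}" "proj {a. l a = d} q \<notin> m"
proof -
  have l0: "l 0 = 0" using l(1)[of 0 0] by simp
  have lmult: "l (of_nat n * a) = real n * l a" for n a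
    by (induction n) (auto simp: l0 l(1) algebra_simps)
  have lJ: "l v = 0" if v: "v \<in> nspan J" for v
  proof -
    obtain n :: "_ \<Rightarrow> nat" where "v = (\<Sum>c\<in>J. of_nat (n c) * c)" using v by (auto simp: nspan_def)
    moreover have "l (\<Sum>c\<in>F. of_nat (n c) * c) = 0" if "finite F" "F \<subseteq> J" for F
      using that by (induction F rule: finite_induct) (auto simp: l0 l(1) lmult l(3))
    ultimately show ?thesis using J(1) by simp
  qed
  have "0 \<in> span_of (nspan (insert b J)) \<inter> m" using zero_mem supp_zero ideal_zero[OF m_ideal] by (auto simp: span_of_def)
  then obtain q where q: "q \<in> R" "supp q \<subseteq> nspan (insert b J)" "q \<in> m" "q \<noteq> 0"
    using J(5) unfolding alg_free_def span_of_def by blast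
  define d where "d = Max (l ` supp q)"
  have ne: "supp q \<noteq> {}" using supp_empty q by auto
  have fin: "finite (l ` supp q)" using supp_finite[OF q(1)] by simp
  have din: "d \<in> l ` supp q" unfolding d_def using fin ne by (intro Max_in) auto
  then obtain a0 where a0: "a0 \<in> supp q" "d = l a0" by auto
  then obtain v0 n where "v0 \<in> nspan J" "a0 = v0 + of_nat n * b" using nspan_insert[OF J(1,3)] q(2) by blast
  then have dn: "d = real n" using a0 l lmult lJ by simp
  let ?q1 = "proj {a. l a = d} q"
  have dec: "a - of_nat n * b \<in> nspan J" if a: "a \<in> supp ?q1" for a
  proof -
    have "a \<in> supp q" "l a = d" using a supp_proj[OF q(1)] by auto
    moreover obtain v k where "v \<in> nspan J" "a = v + of_nat k * b"
      using nspan_insert[OF J(1,3)] q(2) calculation(1) by blast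
    moreover have "k = n" using calculation l lmult lJ dn by simp
    ultimately show ?thesis by simp
  qed
  have Jun: "nspan J \<subseteq> units_at" using nspan_units J by auto
  have nb: "of_nat n * b \<in> units_at" "e (of_nat n * b) = e b ^ n" using units_at_multiple[of b n] J(2) by auto
  \<comment> \<open>The top component is the monomial of \<open>of_nat n * b\<close> times
    \<open>c\<close>, a nonzero combination of monomials of \<open>nspan J\<close>. Freeness of
    \<open>J\<close> keeps \<open>c\<close> out of \<open>m\<close>, and the monomial is a unit at
    \<open>m\<close>.\<close>
  define c where "c = (\<Sum>v\<in>(\<lambda>a. a - of_nat n * b) ` supp ?q1. kc (cf q (v + of_nat n * b)) * e v)"
  have finq1: "finite (supp ?q1)" using supp_finite proj_mem q(1) by auto
  have q1e: "?q1 = e (of_nat n * b) * c"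
  proof -
    have "?q1 = (\<Sum>a\<in>supp ?q1. kc (cf ?q1 a) * e a)"
      using expand_superset[OF proj_mem[OF q(1)] finq1 subset_refl] .
    also have "\<dots> = (\<Sum>a\<in>supp ?q1. e (of_nat n * b) * (kc (cf q a) * e (a - of_nat n * b)))"
    proof (rule sum.cong[OF refl])
      fix a assume a: "a \<in> supp ?q1"
      have "e (a - of_nat n * b) * e (of_nat n * b) = e a"
        using units_at_mult[of "a - of_nat n * b" "of_nat n * b"] dec[OF a] Jun nb by auto
      moreover have "cf ?q1 a = cf q a" using a cf_proj[OF q(1)] by (auto simp: supp_def)
      ultimately show "kc (cf ?q1 a) * e a = e (of_nat n * b) * (kc (cf q a) * e (a - of_nat n * b))"
        by (metis mult.commute mult.left_commute)
    qed
    also have "\<dots> = e (of_nat n * b) * c"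
      unfolding c_def by (subst sum.reindex) (auto simp: inj_on_def sum_distrib_left)
    finally show ?thesis .
  qed
  have Vsub: "(\<lambda>a. a - of_nat n * b) ` supp ?q1 \<subseteq> nspan J" using dec by auto
  have VU: "(\<lambda>a. a - of_nat n * b) ` supp ?q1 \<subseteq> U" using Vsub Jun by (auto simp: units_at_def)
  have cfc: "cf c v = (if v \<in> (\<lambda>a. a - of_nat n * b) ` supp ?q1 then cf q (v + of_nat n * b) else 0)" for v
    unfolding c_def by (subst cf_lincomb[OF _ VU]) (use finq1 in auto)
  have cR: "c \<in> R" unfolding c_def using VU by (rule lincomb_mem)
  have "c \<noteq> 0"
  proof
    assume "c = 0"
    have "a0 \<in> supp ?q1" using a0 supp_proj[OF q(1)] by auto
    then have "cf c (a0 - of_nat n * b) = cf q a0" unfolding cfc by auto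
    thus False using a0 \<open>c = 0\<close> cf_zero by (simp add: supp_def)
  qed
  moreover have "c \<in> span_of (nspan J)" unfolding span_of_def supp_def using cR cfc Vsub by (auto split: if_splits)
  ultimately have "c \<notin> m" using J(4) unfolding alg_free_def by blast
  moreover have "e (of_nat n * b) \<in> R" "e (of_nat n * b) \<notin> m" using nb(1) e_mem by (auto simp: units_at_def)
  ultimately have "?q1 \<notin> m" using q1e cR m_prime unfolding is_prime_def by auto
  moreover have "supp q \<subseteq> {a. l a \<le> d}" unfolding d_def using fin by auto
  ultimately show ?thesis using that q by blast
qed

text \<open>Each \<open>b\<close> in \<open>T\<close> contributes its algebraic relation
  \<open>q\<close>, whose exponents are combinations of \<open>b\<close> and \<open>J\<close>. It
  therefore has degree 0 for the coordinate \<open>l b'\<close> of every other \<open>b'\<close> in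
  \<open>T\<close>, so dividing by \<open>q\<close> preserves the gradings on which the remaining
  relations rely.\<close>

lemma loc_depth_base:
  fixes l :: "int ^ 'n \<Rightarrow> int ^ 'n \<Rightarrow> real"
  assumes B: "finite B" "B \<subseteq> units_at" and J: "J \<subseteq> B" "alg_free J" "\<And>b. b \<in> B - J \<Longrightarrow> \<not> alg_free (insert b J)"
    and l: "\<And>b a c. b \<in> B \<Longrightarrow> l b (a + c) = l b a + l b c" "\<And>b. b \<in> B \<Longrightarrow> l b b = 1"
      "\<And>b c. b \<in> B \<Longrightarrow> c \<in> B \<Longrightarrow> c \<noteq> b \<Longrightarrow> l b c = 0"
  shows "finite T \<Longrightarrow> T \<subseteq> B - J \<Longrightarrow> (\<And>b. b \<in> T \<Longrightarrow> graded_ideal (l b) A \<and> graded_ideal (l b) I) \<Longrightarrow>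
    is_ideal A \<Longrightarrow> is_ideal I \<Longrightarrow> loc_depth_ge (R - m) m (card T) A I"
proof (induction T arbitrary: I rule: finite_induct)
  case (insert b T)
  have b: "b \<in> B" "b \<notin> J" using insert.prems by auto
  have fJ: "finite J" using B J finite_subset by auto
  have lc: "\<And>c. c \<in> J \<Longrightarrow> l b c = 0" using l(3)[OF b(1)] J(1) b(2) by blast
  then obtain q d where q: "q \<in> m" "supp q \<subseteq> nspan (insert b J)" "supp q \<subseteq> {a. l b a \<le> d}" "proj {a. l b a = d} q \<notin> m"
  proof -
    have "insert b J \<subseteq> units_at" "b \<in> B - J" using b B J by auto
    from algebraic_relation[of J b "l b", OF fJ this(1) b(2) J(2) J(3)[OF this(2)] l(1,2)[OF b(1)] lc]
    show ?thesis using that by blast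
  qed
  have qR: "q \<in> R" using m_R q(1) .
  have "loc_regular_on (R - m) q A I"
    by (rule top_component_loc_regular[of "l b", OF l(1)[OF b(1)] m_prime qR q(3,4)]) (use insert.prems in auto)
  moreover have "loc_depth_ge (R - m) m (card T) A (plus_mult I q A)"
  proof (rule insert.IH)
    fix b' assume b': "b' \<in> T"
    have b'B: "b' \<in> B" "b' \<notin> J" "b' \<noteq> b" using b' insert by auto
    have l0: "l b' 0 = 0" using l(1)[OF b'B(1), of 0 0] by simp
    have lmult: "l b' (of_nat n * a) = real n * l b' a" for n a
      by (induction n) (auto simp: l0 l(1)[OF b'B(1)] algebra_simps)
    have "l b' (\<Sum>c\<in>F. of_nat (n c) * c) = 0" if "finite F" "F \<subseteq> insert b J" for F and n :: "_ \<Rightarrow> nat"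
      using that
    proof (induction F rule: finite_induct)
      case (insert x F)
      have "l b' x = 0" using l(3)[OF b'B(1), of x] insert.prems b J b'B by auto
      thus ?case using insert by (simp add: l(1)[OF b'B(1)] lmult)
    qed (simp add: l0)
    then have "l b' a = 0" if "a \<in> nspan (insert b J)" for a using that fJ unfolding nspan_def by auto
    then have q0: "supp q \<subseteq> {a. l b' a = 0}" using q(2) by auto
    have gr: "graded_ideal (l b') A" "graded_ideal (l b') I" using insert.prems(2)[of b'] b' by simp_all
    show "graded_ideal (l b') A \<and> graded_ideal (l b') (plus_mult I q A)"
      using graded_plus_mult[of "l b'", OF l(1)[OF b'B(1)] qR q0 gr] gr(1) by (rule conjI[rotated])
  next
    show "is_ideal (plus_mult I q A)" using ideal_plus_mult[OF insert.prems(3,4) qR] .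
    show "is_ideal A" "T \<subseteq> B - J" using insert.prems(1,3) by simp_all
  qed
  ultimately show ?case using insert.hyps q(1) by auto
qed simp

end

section \<open>Subquotients spanned by monomials\<close>

context monomial_ring begin

lemma up_closed_Int: "up_closed Y \<Longrightarrow> up_closed Y' \<Longrightarrow> up_closed (Y \<inter> Y')"
  by (auto simp: up_closed_def)
lemma up_closed_empty: "up_closed {}" by (simp add: up_closed_def)
lemma up_closed_U: "up_closed U" using compat_add by (auto simp: up_closed_def)

lemma span_of_Un: "span_of (Y \<union> Y') = {a + b | a b. a \<in> span_of Y \<and> b \<in> span_of Y'}"
proof
  show "span_of (Y \<union> Y') \<subseteq> {a + b | a b. a \<in> span_of Y \<and> b \<in> span_of Y'}"
  proof
    fix x assume x: "x \<in> span_of (Y \<union> Y')"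
    then have xR: "x \<in> R" "supp x \<subseteq> Y \<union> Y'" by (auto simp: span_of_def)
    have "proj Y x \<in> span_of Y" "proj (- Y) x \<in> span_of Y'"
      using xR by (auto simp: span_of_def proj_mem supp_proj)
    thus "x \<in> {a + b | a b. a \<in> span_of Y \<and> b \<in> span_of Y'}" using proj_compl[OF xR(1), of Y] by auto
  qed
  show "{a + b | a b. a \<in> span_of Y \<and> b \<in> span_of Y'} \<subseteq> span_of (Y \<union> Y')"
  proof
    fix x assume "x \<in> {a + b | a b. a \<in> span_of Y \<and> b \<in> span_of Y'}"
    then obtain a b where "x = a + b" "a \<in> span_of Y" "b \<in> span_of Y'" by auto
    thus "x \<in> span_of (Y \<union> Y')" using supp_add[of a b] by (auto simp: span_of_def add_mem)
  qed
qed

lemma cf_e_mult: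
  assumes "a \<in> U" "x \<in> R" shows "cf (e a * x) (a + y) = (if compat a y then cf x y else 0)"
proof -
  have "cf (e a * x) (a + y) = (\<Sum>b\<in>supp x. if compat a b \<and> a + b = a + y then cf (e a) a * cf x b else 0)"
    unfolding cf_mult[OF e_mem[OF assms(1)] assms(2)] supp_e[OF assms(1)] by simp
  also have "\<dots> = (\<Sum>b\<in>supp x. if b = y then (if compat a y then cf x y else 0) else 0)"
    using cf_e[OF assms(1)] by (intro sum.cong) auto
  also have "\<dots> = (if compat a y then cf x y else 0)"
    using supp_finite[OF assms(2)] by (auto simp: supp_def)
  finally show ?thesis .
qed

text \<open>Convexity for the order given by compatible addition. These are exactly the differences
  of two up-closed sets, so their monomials form a basis of a quotient of monomial ideals;
  \<open>up_in\<close> then describes its monomial submodules.\<close>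

definition convex_in where
  "convex_in Y \<longleftrightarrow> Y \<subseteq> U \<and>
     (\<forall>y a b. y \<in> Y \<longrightarrow> compat a y \<longrightarrow> compat b (a + y) \<longrightarrow> b + (a + y) \<in> Y \<longrightarrow> a + y \<in> Y)"

definition up_in where
  "up_in Y' Y \<longleftrightarrow> Y' \<subseteq> Y \<and> (\<forall>y\<in>Y'. \<forall>a. compat a y \<longrightarrow> a + y \<in> Y \<longrightarrow> a + y \<in> Y')"

text \<open>\<open>Y1\<close> is the upward closure of \<open>Y\<close>, and convexity makes
  \<open>Y1 - Y\<close> up-closed.\<close>

lemma convex_in_rep:
  assumes "convex_in Y"
  obtains Y1 Y2 where "up_closed Y1" "up_closed Y2" "Y2 \<subseteq> Y1" "Y = Y1 - Y2"
proof -
  define Y1 where "Y1 = {a + y | a y. compat a y \<and> y \<in> Y}"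
  have sub: "Y \<subseteq> Y1"
  proof
    fix y assume "y \<in> Y"
    then have "y \<in> U" using assms unfolding convex_in_def by blast
    then have "compat 0 y" by (rule compat_zero)
    thus "y \<in> Y1" unfolding Y1_def using \<open>y \<in> Y\<close> by (intro CollectI exI[of _ 0] exI[of _ y]) simp
  qed
  have Y1U: "Y1 \<subseteq> U" unfolding Y1_def using compat_add by auto
  have step: "b + (a + y) \<in> Y1" if "compat a y" "y \<in> Y" "compat b (a + y)" for a b y
  proof -
    have "compat (a + b) y" using compat_assoc[OF that(1,3)] by simp
    moreover have "b + (a + y) = (a + b) + y" by (simp add: algebra_simps)
    ultimately show ?thesis unfolding Y1_def using that(2) by blast
  qed
  have up1: "up_closed Y1" unfolding up_closed_def
  proof (intro conjI ballI allI impI Y1U)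
    fix z b assume "z \<in> Y1" "compat b z"
    then obtain a y where "z = a + y" "compat a y" "y \<in> Y" unfolding Y1_def by auto
    thus "b + z \<in> Y1" using step \<open>compat b z\<close> by simp
  qed
  have up2: "up_closed (Y1 - Y)" unfolding up_closed_def
  proof (intro conjI ballI allI impI)
    show "Y1 - Y \<subseteq> U" using Y1U by auto
    fix z b assume z: "z \<in> Y1 - Y" "compat b z"
    then obtain a y where 1: "z = a + y" "compat a y" "y \<in> Y" unfolding Y1_def by auto
    have "b + (a + y) \<in> Y1" using step[OF 1(2,3)] z(2) 1(1) by simp
    moreover have "b + (a + y) \<notin> Y"
    proof
      assume "b + (a + y) \<in> Y"
      then have "a + y \<in> Y" using assms 1 z(2) unfolding convex_in_def by blast
      thus False using z 1 by simp
    qed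
    ultimately show "b + z \<in> Y1 - Y" using 1 by simp
  qed
  show ?thesis by (rule that[OF up1 up2]) (use sub in auto)
qed

lemma convex_in_diff: "up_closed Y1 \<Longrightarrow> up_closed Y2 \<Longrightarrow> convex_in (Y1 - Y2)"
  unfolding convex_in_def up_closed_def by blast

lemma convex_in_up_in:
  assumes "convex_in Y" "up_in Y' Y" shows "convex_in Y'" "convex_in (Y - Y')"
proof -
  have s: "Y' \<subseteq> Y" "Y \<subseteq> U" using assms by (auto simp: up_in_def convex_in_def)
  have c: "a + y \<in> Y" if "y \<in> Y" "compat a y" "compat b (a + y)" "b + (a + y) \<in> Y" for a b y
    using assms(1) that unfolding convex_in_def by blast
  show "convex_in Y'" unfolding convex_in_def
  proof (intro conjI allI impI)
    show "Y' \<subseteq> U" using s by auto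
    fix y a b assume y: "y \<in> Y'" "compat a y" "compat b (a + y)" "b + (a + y) \<in> Y'"
    have "a + y \<in> Y" by (rule c[of y a b]) (use y s in auto)
    thus "a + y \<in> Y'" using assms(2) y unfolding up_in_def by blast
  qed
  show "convex_in (Y - Y')" unfolding convex_in_def
  proof (intro conjI allI impI)
    show "Y - Y' \<subseteq> U" using s by auto
    fix y a b assume y: "y \<in> Y - Y'" "compat a y" "compat b (a + y)" "b + (a + y) \<in> Y - Y'"
    have "a + y \<in> Y" by (rule c[of y a b]) (use y in auto)
    moreover have "a + y \<notin> Y'" using assms(2) y unfolding up_in_def by blast
    ultimately show "a + y \<in> Y - Y'" by simp
  qed
qed

text \<open>Modulo \<open>span_of (U - H)\<close>, that is, in the face ring of \<open>H\<close>,
  the monomial of \<open>a\<close> is a nonzerodivisor, while \<open>q 0\<close> contains it because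
  \<open>a \<notin> G\<close>. So one more prime fits under \<open>q 0\<close>.\<close>

lemma face_chain_extend:
  assumes noeth: is_noetherian
    and H: "up_closed (U - H)" "H \<subseteq> U" and G: "G \<subseteq> H"
    and a: "a \<in> H" "a \<notin> G" "\<And>h. h \<in> H \<Longrightarrow> compat a h \<and> a + h \<in> H"
    and q: "prime_chain n q" "span_of (U - G) \<subseteq> q 0"
  obtains q' where "prime_chain (Suc n) q'" "span_of (U - H) \<subseteq> q' 0" "q' (Suc n) = q n"
proof -
  have aU: "a \<in> U" using a(1) H(2) by auto
  have q0: "is_prime (q 0)" using q by (auto simp: prime_chain_def)
  have I: "is_ideal (span_of (U - H))" using span_of_ideal[OF H(1)] .
  have Iq: "span_of (U - H) \<subseteq> q 0" using q(2) span_of_mono[of "U - H" "U - G"] G by auto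
  have ea: "e a \<in> q 0" using q(2) e_span_of[OF aU, of "U - G"] a(2) aU by auto
  have step: "s \<in> span_of (U - H)" if s: "s \<in> R" "e a * s \<in> span_of (U - H)" for s
  proof -
    have "h \<notin> H" if h: "h \<in> supp s" for h
    proof
      assume "h \<in> H"
      then have "cf (e a * s) (a + h) = cf s h" "a + h \<in> H" using a(3) cf_e_mult[OF aU s(1)] by auto
      then have "a + h \<in> supp (e a * s)" using h by (simp add: supp_def)
      thus False using s(2) \<open>a + h \<in> H\<close> by (auto simp: span_of_def)
    qed
    thus ?thesis using s(1) supp_U[OF s(1)] by (auto simp: span_of_def)
  qed
  have reg: "s \<in> span_of (U - H)" if "s \<in> R" "e a ^ k * s \<in> span_of (U - H)" for k s
    using that
  proof (induction k)
    case (Suc k)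
    have "e a ^ k * s \<in> R" using Suc.prems(1) e_mem[OF aU] by (intro mult_mem power_mem)
    moreover have "e a * (e a ^ k * s) \<in> span_of (U - H)" using Suc.prems(2) by (simp add: mult.assoc)
    ultimately show ?case using Suc.IH[OF Suc.prems(1) step] by blast
  qed simp
  have reg': "s \<in> q 0" if "s \<in> R" "e a ^ k * s \<in> span_of (U - H)" for k s
    using reg[OF that] Iq by auto
  obtain Q where Q: "is_prime Q" "span_of (U - H) \<subseteq> Q" "Q \<subset> q 0"
    using prime_below[OF noeth I q0 Iq ea] reg' by metis
  show ?thesis
    by (rule that[of "case_nat Q q"]) (use prime_chain_extend[OF q(1) Q(1,3)] Q(2) in auto)
qed

end

context monomial_at begin

text \<open>The quotient \<open>span_of Y1 / span_of Y2\<close> with \<open>Y = Y1 - Y2\<close> has the basis \<open>x\<^sup>a\<close>, \<open>a \<in> Y\<close>, and does not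
  depend on the choice of \<open>Y1\<close> and \<open>Y2\<close>.\<close>

definition set_depth :: "nat \<Rightarrow> (int ^ 'n) set \<Rightarrow> bool" where
  "set_depth n Y \<longleftrightarrow> (\<forall>Y1 Y2. up_closed Y1 \<longrightarrow> up_closed Y2 \<longrightarrow> Y2 \<subseteq> Y1 \<longrightarrow> Y = Y1 - Y2 \<longrightarrow>
     depth_ge m n (span_of Y1) (span_of Y2))"

lemma submod_span_of: "up_closed Y1 \<Longrightarrow> up_closed Y2 \<Longrightarrow> Y2 \<subseteq> Y1 \<Longrightarrow> submod (span_of Y1) (span_of Y2)"
  by (simp add: submod_def span_of_ideal span_of_mono)

lemma depth_ge_span_restrict:
  assumes "up_closed Y1" "up_closed Y2" "Y2 \<subseteq> Y1" "up_closed Z" "Y1 - Y2 \<subseteq> Z"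
  shows "depth_ge m n (span_of Y1) (span_of Y2) \<longleftrightarrow>
    depth_ge m n (span_of (Y1 \<inter> Z)) (span_of (Y1 \<inter> Z \<inter> Y2))"
proof -
  have "(Y1 \<inter> Z) \<union> Y2 = Y1" using assms by auto
  then have "span_of Y1 = {a + b | a b. a \<in> span_of (Y1 \<inter> Z) \<and> b \<in> span_of Y2}"
    using span_of_Un[of "Y1 \<inter> Z" Y2] by simp
  from depth_ge_iso[OF span_of_ideal[OF up_closed_Int[OF assms(1,4)]] span_of_ideal[OF assms(2)] this]
  show ?thesis by (simp add: span_of_Int)
qed

text \<open>Two representations \<open>Y1 - Y2\<close> and \<open>Z1 - Z2\<close> of the same set
  are both compared with the one inside \<open>Y1 \<inter> Z1\<close>; hence a single representation
  decides.\<close>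

lemma set_depth_iff:
  assumes "up_closed Y1" "up_closed Y2" "Y2 \<subseteq> Y1"
  shows "set_depth n (Y1 - Y2) \<longleftrightarrow> depth_ge m n (span_of Y1) (span_of Y2)"
proof
  assume "set_depth n (Y1 - Y2)"
  thus "depth_ge m n (span_of Y1) (span_of Y2)" using assms unfolding set_depth_def by simp
next
  assume d: "depth_ge m n (span_of Y1) (span_of Y2)"
  show "set_depth n (Y1 - Y2)" unfolding set_depth_def
  proof (intro allI impI)
    fix Z1 Z2 assume Z: "up_closed Z1" "up_closed Z2" "Z2 \<subseteq> Z1" "Y1 - Y2 = Z1 - Z2"
    have "Y1 \<inter> Z1 \<inter> Y2 = Z1 \<inter> Y1 \<inter> Z2" "Y1 \<inter> Z1 = Z1 \<inter> Y1" using Z(3,4) assms(3) by auto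
    moreover have "depth_ge m n (span_of (Y1 \<inter> Z1)) (span_of (Y1 \<inter> Z1 \<inter> Y2))"
      using d depth_ge_span_restrict[OF assms Z(1)] Z(4) by auto
    ultimately show "depth_ge m n (span_of Z1) (span_of Z2)"
      using depth_ge_span_restrict[OF Z(1,2,3) assms(1)] Z(4) by auto
  qed
qed

lemma set_depth_extension:
  assumes "convex_in Y" "up_in Y' Y" "set_depth n Y'" "set_depth n (Y - Y')"
  shows "set_depth n Y"
proof -
  obtain Y1 Y2 where Y: "up_closed Y1" "up_closed Y2" "Y2 \<subseteq> Y1" "Y = Y1 - Y2"
    using convex_in_rep[OF assms(1)] by metis
  have up: "up_closed (Y2 \<union> Y')" using Y assms(2) unfolding up_closed_def up_in_def by blast
  have s: "Y2 \<subseteq> Y2 \<union> Y'" "Y2 \<union> Y' \<subseteq> Y1" "Y2 \<union> Y' - Y2 = Y'" "Y1 - (Y2 \<union> Y') = Y - Y'"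
    using Y assms(2) unfolding up_in_def by auto
  have "depth_ge m n (span_of (Y2 \<union> Y')) (span_of Y2)" using set_depth_iff[OF up Y(2) s(1), of n] assms(3) s by simp
  moreover have "depth_ge m n (span_of Y1) (span_of (Y2 \<union> Y'))" using set_depth_iff[OF Y(1) up s(2), of n] assms(4) s by simp
  ultimately have "depth_ge m n (span_of Y1) (span_of Y2)"
    by (intro depth_ge_extension[OF submod_span_of[OF Y(1) up s(2)] submod_span_of[OF up Y(2) s(1)]])
  thus ?thesis using set_depth_iff[OF Y(1,2,3)] Y(4) by simp
qed

lemma set_depth_sub:
  assumes "convex_in Y" "up_in Y' Y" "set_depth n Y" "set_depth (n - 1) (Y - Y')"
  shows "set_depth n Y'"
proof -
  obtain Y1 Y2 where Y: "up_closed Y1" "up_closed Y2" "Y2 \<subseteq> Y1" "Y = Y1 - Y2"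
    using convex_in_rep[OF assms(1)] by metis
  have up: "up_closed (Y2 \<union> Y')" using Y assms(2) unfolding up_closed_def up_in_def by blast
  have s: "Y2 \<subseteq> Y2 \<union> Y'" "Y2 \<union> Y' \<subseteq> Y1" "Y2 \<union> Y' - Y2 = Y'" "Y1 - (Y2 \<union> Y') = Y - Y'"
    using Y assms(2) unfolding up_in_def by auto
  have "depth_ge m n (span_of Y1) (span_of Y2)" using set_depth_iff[OF Y(1,2,3), of n] assms(3) Y(4) by simp
  moreover have "depth_ge m (n - 1) (span_of Y1) (span_of (Y2 \<union> Y'))"
    using set_depth_iff[OF Y(1) up s(2), of "n - 1"] assms(4) s by simp
  ultimately have "depth_ge m n (span_of (Y2 \<union> Y')) (span_of Y2)"
    by (intro depth_ge_sub[OF submod_span_of[OF Y(1) up s(2)] submod_span_of[OF up Y(2) s(1)]])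
  thus ?thesis using set_depth_iff[OF up Y(2) s(1), of n] s by simp
qed

lemma set_depth_zero: "set_depth 0 Y"
  by (simp add: set_depth_def)

lemma set_depth_empty: "set_depth n {}"
  using set_depth_iff[OF up_closed_empty up_closed_empty, of n] depth_ge_trivial[OF span_of_ideal[OF up_closed_empty]]
  by simp

lemma set_depth_mono: "set_depth n Y \<Longrightarrow> k \<le> n \<Longrightarrow> set_depth k Y"
  unfolding set_depth_def using depth_ge_mono by blast

text \<open>Multiplication by the unit \<open>e s\<close> kills every monomial of \<open>Y\<close>
  or moves it out of \<open>Y\<close>, so the quotient vanishes at \<open>m\<close>.\<close>

lemma set_depth_killed:
  assumes "convex_in Y" "s \<in> units_at" "\<And>y. y \<in> Y \<Longrightarrow> compat s y \<Longrightarrow> s + y \<notin> Y"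
  shows "set_depth n Y"
proof -
  obtain Y1 Y2 where Y: "up_closed Y1" "up_closed Y2" "Y2 \<subseteq> Y1" "Y = Y1 - Y2"
    using convex_in_rep[OF assms(1)] by metis
  have s: "s \<in> U" "e s \<in> R" "e s \<notin> m" using assms(2) e_mem by (auto simp: units_at_def)
  have "e s * x \<in> span_of Y2" if x: "x \<in> span_of Y1" for x
  proof -
    have xR: "x \<in> R" "supp x \<subseteq> Y1" using x by (auto simp: span_of_def)
    have "supp (e s * x) \<subseteq> Y2"
    proof
      fix c assume "c \<in> supp (e s * x)"
      then obtain y where y: "c = s + y" "y \<in> supp x" "compat s y"
        using supp_mult[OF s(2) xR(1)] supp_e[OF s(1)] by auto
      have "s + y \<in> Y1" using Y(1) y xR(2) unfolding up_closed_def by auto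
      show "c \<in> Y2"
      proof (cases "y \<in> Y2")
        case True
        thus ?thesis using Y(2) y unfolding up_closed_def by auto
      next
        case False
        then have "y \<in> Y" using y(2) xR(2) Y(4) by auto
        thus ?thesis using assms(3)[OF _ y(3)] y(1) Y(4) \<open>s + y \<in> Y1\<close> by auto
      qed
    qed
    thus ?thesis using xR s by (simp add: span_of_def mult_mem)
  qed
  from depth_ge_killed[OF submod_span_of[OF Y(1,2,3)] s(2,3) this]
  show ?thesis using set_depth_iff[OF Y(1,2,3)] Y(4) by simp
qed

text \<open>Multiplication by the monomial of \<open>a\<close> shifts the basis \<open>Y\<close>
  injectively into itself. It is therefore regular, and the cokernel has the complement of the
  shifted set as its basis.\<close>

lemma set_depth_shift:
  assumes Y: "convex_in Y" and a: "a \<in> U" "e a \<in> m" "\<And>y. y \<in> Y \<Longrightarrow> compat a y"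
    and up: "up_in ((+) a ` Y) Y" and d: "set_depth n (Y - (+) a ` Y)"
  shows "set_depth (Suc n) Y"
proof -
  obtain Y1 Y2 where Y: "up_closed Y1" "up_closed Y2" "Y2 \<subseteq> Y1" "Y = Y1 - Y2"
    using convex_in_rep[OF Y] by metis
  let ?aY = "(+) a ` Y"
  have sub: "?aY \<subseteq> Y" using up by (simp add: up_in_def)
  have upa: "up_closed (Y2 \<union> ?aY)" using Y up unfolding up_closed_def up_in_def by blast
  have eq: "plus_mult (span_of Y2) (e a) (span_of Y1) = span_of (Y2 \<union> ?aY)"
  proof
    show "plus_mult (span_of Y2) (e a) (span_of Y1) \<subseteq> span_of (Y2 \<union> ?aY)"
    proof
      fix z assume "z \<in> plus_mult (span_of Y2) (e a) (span_of Y1)"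
      then obtain b x where z: "b \<in> span_of Y2" "x \<in> span_of Y1" "z = b + e a * x" by (rule plus_multE)
      have R: "x \<in> R" "e a * x \<in> R" "b \<in> R" using z a e_mem by (auto simp: span_of_def intro: mult_mem)
      have "supp (e a * x) \<subseteq> Y2 \<union> ?aY"
      proof
        fix c assume "c \<in> supp (e a * x)"
        then obtain y where y: "c = a + y" "y \<in> supp x" "compat a y"
          using supp_mult[OF e_mem[OF a(1)] R(1)] supp_e[OF a(1)] by auto
        show "c \<in> Y2 \<union> ?aY"
        proof (cases "y \<in> Y2")
          case True
          thus ?thesis using Y(2) y unfolding up_closed_def by auto
        next
          case False
          thus ?thesis using y z(2) Y(4) by (auto simp: span_of_def)
        qed
      qed
      thus "z \<in> span_of (Y2 \<union> ?aY)" using z supp_add[OF R(3,2)] R by (auto simp: span_of_def add_mem)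
    qed
    show "span_of (Y2 \<union> ?aY) \<subseteq> plus_mult (span_of Y2) (e a) (span_of Y1)"
      unfolding span_of_Un
    proof
      fix z assume "z \<in> {b + c | b c. b \<in> span_of Y2 \<and> c \<in> span_of ?aY}"
      then obtain b c where z: "z = b + c" "b \<in> span_of Y2" "c \<in> span_of ?aY" by auto
      have c: "c \<in> R" "supp c \<subseteq> ?aY" using z by (auto simp: span_of_def)
      define V where "V = {y \<in> Y. a + y \<in> supp c}"
      have cV: "supp c = (+) a ` V" unfolding V_def using c(2) by auto
      have fV: "finite V" using supp_finite[OF c(1)] finite_imageD[of "(+) a" V] unfolding cV by auto
      have VU: "V \<subseteq> U" using Y(1,4) by (auto simp: V_def up_closed_def)
      define x where "x = (\<Sum>y\<in>V. kc (cf c (a + y)) * e y)"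
      have "x \<in> R" unfolding x_def using lincomb_mem[OF VU] .
      moreover have "supp x \<subseteq> V" unfolding supp_def x_def by (subst cf_lincomb[OF fV VU]) auto
      ultimately have xs: "x \<in> span_of Y1" using Y(4) by (auto simp: span_of_def V_def)
      have "c = (\<Sum>y\<in>V. kc (cf c (a + y)) * e (a + y))"
        using expand_superset[OF c(1) supp_finite[OF c(1)] subset_refl] unfolding cV
        by (subst (asm) sum.reindex) (auto simp: comp_def)
      also have "\<dots> = e a * x" unfolding x_def sum_distrib_left
      proof (rule sum.cong[OF refl])
        fix y assume y: "y \<in> V"
        then have "e a * e y = e (a + y)" using a(3)[of y] compat_U by (auto simp: V_def e_mult')
        thus "kc (cf c (a + y)) * e (a + y) = e a * (kc (cf c (a + y)) * e y)" by (metis mult.left_commute)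
      qed
      finally show "z \<in> plus_mult (span_of Y2) (e a) (span_of Y1)" using z xs by (auto intro: plus_multI)
    qed
  qed
  have reg: "regular_on (e a) (span_of Y1) (span_of Y2)" unfolding regular_on_def
  proof (intro ballI impI)
    fix x assume x: "x \<in> span_of Y1" "e a * x \<in> span_of Y2"
    have xR: "x \<in> R" "supp x \<subseteq> Y1" using x by (auto simp: span_of_def)
    have "y \<in> Y2" if y: "y \<in> supp x" for y
    proof (rule ccontr)
      assume "y \<notin> Y2"
      then have yY: "y \<in> Y" using y xR Y(4) by auto
      then have "cf (e a * x) (a + y) = cf x y" using cf_e_mult[OF a(1) xR(1), of y] a(3) by simp
      then have "a + y \<in> supp (e a * x)" using y by (simp add: supp_def)
      then have "a + y \<in> Y2" using x(2) by (auto simp: span_of_def)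
      moreover have "a + y \<in> Y" using sub yY by auto
      ultimately show False using Y(4) by simp
    qed
    thus "x \<in> span_of Y2" using xR by (auto simp: span_of_def)
  qed
  have s: "Y2 \<union> ?aY \<subseteq> Y1" "Y1 - (Y2 \<union> ?aY) = Y - ?aY" using sub Y(3,4) by auto
  have "depth_ge m n (span_of Y1) (span_of (Y2 \<union> ?aY))" using set_depth_iff[OF Y(1) upa s(1), of n] d s(2) by simp
  then have "depth_ge m (Suc n) (span_of Y1) (span_of Y2)" using a(2) reg eq by auto
  thus ?thesis using set_depth_iff[OF Y(1,2,3)] Y(4) by simp
qed

text \<open>Multiplication inside \<open>Y\<close> never lowers \<open>lev\<close>, so the exponents
  above the lowest level span a submodule whose quotient is that level. The induction is on the
  number of levels.\<close>

lemma set_depth_levels: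
  fixes lev :: "int ^ 'n \<Rightarrow> real"
  assumes "convex_in Y" "finite (lev ` Y)"
    and "\<And>y a. y \<in> Y \<Longrightarrow> compat a y \<Longrightarrow> a + y \<in> Y \<Longrightarrow> lev y \<le> lev (a + y)"
    and "\<And>s. s \<in> lev ` Y \<Longrightarrow> set_depth n {y \<in> Y. lev y = s}"
  shows "set_depth n Y"
  using assms
proof (induction "card (lev ` Y)" arbitrary: Y rule: less_induct)
  case less
  show ?case
  proof (cases "Y = {}")
    case True
    thus ?thesis using set_depth_empty by simp
  next
    case False
    define s where "s = Min (lev ` Y)"
    have s: "s \<in> lev ` Y" unfolding s_def using False less.prems(2) by (intro Min_in) auto
    have smin: "s \<le> lev y" if "y \<in> Y" for y unfolding s_def using less.prems(2) that by simp
    define Y' where "Y' = {y \<in> Y. lev y \<noteq> s}"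
    have up: "up_in Y' Y" unfolding up_in_def
    proof (intro conjI ballI allI impI)
      show "Y' \<subseteq> Y" by (auto simp: Y'_def)
      fix y a assume y: "y \<in> Y'" "compat a y" "a + y \<in> Y"
      then have "lev y \<le> lev (a + y)" "s < lev y" using less.prems(3)[of y a] smin[of y] by (auto simp: Y'_def)
      thus "a + y \<in> Y'" using y by (auto simp: Y'_def)
    qed
    have im: "lev ` Y' \<subseteq> lev ` Y - {s}" by (auto simp: Y'_def)
    have "set_depth n Y'"
    proof (rule less.hyps)
      have "card (lev ` Y') \<le> card (lev ` Y - {s})" using im less.prems(2) by (intro card_mono) auto
      also have "\<dots> < card (lev ` Y)" using s less.prems(2) by (meson card_Diff1_less)
      finally show "card (lev ` Y') < card (lev ` Y)" .
      show "convex_in Y'" using convex_in_up_in[OF less.prems(1) up] by simp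
      show "finite (lev ` Y')" using im less.prems(2) by (meson finite_Diff finite_subset)
      show "lev y \<le> lev (a + y)" if "y \<in> Y'" "compat a y" "a + y \<in> Y'" for y a
        using less.prems(3)[of y a] that by (simp add: Y'_def)
      show "set_depth n {y \<in> Y'. lev y = t}" if t: "t \<in> lev ` Y'" for t
      proof -
        have "t \<noteq> s" "t \<in> lev ` Y" using t by (auto simp: Y'_def)
        then have "{y \<in> Y'. lev y = t} = {y \<in> Y. lev y = t}" by (auto simp: Y'_def)
        thus ?thesis using less.prems(4)[OF \<open>t \<in> lev ` Y\<close>] by simp
      qed
    qed
    moreover have "Y - Y' = {y \<in> Y. lev y = s}" by (auto simp: Y'_def)
    ultimately show ?thesis using set_depth_extension[OF less.prems(1) up] less.prems(4)[OF s] by simp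
  qed
qed

lemma set_depth_base:
  fixes l :: "int ^ 'n \<Rightarrow> int ^ 'n \<Rightarrow> real"
  assumes B: "finite B" "B \<subseteq> units_at" and J: "J \<subseteq> B" "alg_free J" "\<And>b. b \<in> B - J \<Longrightarrow> \<not> alg_free (insert b J)"
    and l: "\<And>b a c. b \<in> B \<Longrightarrow> l b (a + c) = l b a + l b c" "\<And>b. b \<in> B \<Longrightarrow> l b b = 1"
      "\<And>b c. b \<in> B \<Longrightarrow> c \<in> B \<Longrightarrow> c \<noteq> b \<Longrightarrow> l b c = 0"
    and Y: "convex_in Y"
  shows "set_depth (card (B - J)) Y"
proof -
  obtain Y1 Y2 where Y: "up_closed Y1" "up_closed Y2" "Y2 \<subseteq> Y1" "Y = Y1 - Y2"
    using convex_in_rep[OF Y] by metis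
  have "loc_depth_ge (R - m) m (card (B - J)) (span_of Y1) (span_of Y2)"
    by (rule loc_depth_base[of B J l, OF B J l])
      (use B Y graded_span_of span_of_ideal in auto)
  then have "depth_ge m (card (B - J)) (span_of Y1) (span_of Y2)"
    by (intro loc_depth_imp_depth submod_span_of Y)
  thus ?thesis using set_depth_iff[OF Y(1,2,3)] Y(4) by simp
qed

end

section \<open>Linear systems and the counting of lattice points\<close>

lemma homogeneous_system:
  fixes A :: "'e \<Rightarrow> 'z \<Rightarrow> 'k::field"
  assumes "finite Z" "finite E" "card Z < card E"
  shows "\<exists>c. (\<exists>\<alpha>\<in>E. c \<alpha> \<noteq> 0) \<and> (\<forall>z\<in>Z. (\<Sum>\<alpha>\<in>E. c \<alpha> * A \<alpha> z) = 0)"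
  using assms
proof (induction Z arbitrary: E A rule: finite_induct)
  case empty
  then obtain \<alpha> where "\<alpha> \<in> E" by fastforce
  thus ?case by (intro exI[of _ "\<lambda>_. 1"]) auto
next
  case (insert z Z)
  show ?case
  proof (cases "\<forall>\<alpha>\<in>E. A \<alpha> z = 0")
    case True
    have "card Z < card E" using insert by simp
    then obtain c where "\<exists>\<alpha>\<in>E. c \<alpha> \<noteq> 0" "\<forall>z\<in>Z. (\<Sum>\<alpha>\<in>E. c \<alpha> * A \<alpha> z) = 0"
      using insert.IH[OF insert.prems(1)] by blast
    thus ?thesis using True by (intro exI[of _ c]) auto
  next
    case False
    then obtain \<beta> where \<beta>: "\<beta> \<in> E" "A \<beta> z \<noteq> 0" by blast
    define A' where "A' \<alpha> w = A \<alpha> w - A \<alpha> z / A \<beta> z * A \<beta> w" for \<alpha> w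
    have "card Z < card (E - {\<beta>})" using insert \<beta> by simp
    then obtain c where c: "\<exists>\<alpha>\<in>E - {\<beta>}. c \<alpha> \<noteq> 0" "\<forall>w\<in>Z. (\<Sum>\<alpha>\<in>E - {\<beta>}. c \<alpha> * A' \<alpha> w) = 0"
      using insert.IH[of "E - {\<beta>}" A'] insert.prems(1) by auto
    define d where "d = c(\<beta> := - (\<Sum>\<alpha>\<in>E - {\<beta>}. c \<alpha> * A \<alpha> z) / A \<beta> z)"
    have split: "(\<Sum>\<alpha>\<in>E. d \<alpha> * A \<alpha> w) = d \<beta> * A \<beta> w + (\<Sum>\<alpha>\<in>E - {\<beta>}. c \<alpha> * A \<alpha> w)" for w
    proof -
      have "(\<Sum>\<alpha>\<in>E - {\<beta>}. d \<alpha> * A \<alpha> w) = (\<Sum>\<alpha>\<in>E - {\<beta>}. c \<alpha> * A \<alpha> w)"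
        by (intro sum.cong) (auto simp: d_def)
      thus ?thesis using sum.remove[OF insert.prems(1) \<beta>(1), of "\<lambda>\<alpha>. d \<alpha> * A \<alpha> w"] by simp
    qed
    have "(\<Sum>\<alpha>\<in>E. d \<alpha> * A \<alpha> z) = 0" unfolding split using \<beta>(2) by (simp add: d_def)
    moreover have "(\<Sum>\<alpha>\<in>E. d \<alpha> * A \<alpha> w) = 0" if "w \<in> Z" for w
    proof -
      have "0 = (\<Sum>\<alpha>\<in>E - {\<beta>}. c \<alpha> * A' \<alpha> w)" using c(2) that by simp
      also have "\<dots> = (\<Sum>\<alpha>\<in>E - {\<beta>}. c \<alpha> * A \<alpha> w - c \<alpha> * A \<alpha> z * (A \<beta> w / A \<beta> z))"
        by (intro sum.cong) (auto simp: A'_def algebra_simps)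
      also have "\<dots> = (\<Sum>\<alpha>\<in>E - {\<beta>}. c \<alpha> * A \<alpha> w) - (\<Sum>\<alpha>\<in>E - {\<beta>}. c \<alpha> * A \<alpha> z) * (A \<beta> w / A \<beta> z)"
        by (simp only: sum_subtractf sum_distrib_right)
      finally show ?thesis unfolding split by (simp add: d_def)
    qed
    moreover have "\<exists>\<alpha>\<in>E. d \<alpha> \<noteq> 0" using c(1) by (auto simp: d_def)
    ultimately show ?thesis by (intro exI[of _ d]) auto
  qed
qed

lemma rvec_add: "rvec (a + b) = rvec a + rvec b" by (simp add: rvec_def vec_eq_iff)
lemma rvec_diff: "rvec (a - b) = rvec a - rvec b" by (simp add: rvec_def vec_eq_iff)
lemma rvec_zero: "rvec 0 = 0" by (simp add: rvec_def vec_eq_iff)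
lemma rvec_inject: "rvec a = rvec b \<longleftrightarrow> a = b" by (simp add: rvec_def vec_eq_iff)
lemma of_nat_vec_nth: "(of_nat n :: int ^ 'n::finite) $ i = int n"
  by (induction n) auto
lemma rvec_of_nat: "rvec (of_nat n * a) = real n *\<^sub>R rvec a"
  by (simp add: rvec_def vec_eq_iff of_nat_vec_nth)
lemma rvec_sum: "rvec (sum f A) = (\<Sum>a\<in>A. rvec (f a))"
  by (induction A rule: infinite_finite_induct) (auto simp: rvec_add rvec_zero)

text \<open>Slice by a coordinate \<open>i\<close> that does not vanish identically on
  \<open>S\<close>. It takes at most 2 r + 1 values on \<open>X\<close>, and the differences inside
  one slice lie in a subspace of smaller dimension.\<close>

lemma lattice_box_card:
  fixes X :: "(int ^ 'n::finite) set" and r :: nat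
  assumes "\<And>a i. a \<in> X \<Longrightarrow> \<bar>a $ i\<bar> \<le> int r" "subspace S" "dim S \<le> k"
    and "\<And>a b. a \<in> X \<Longrightarrow> b \<in> X \<Longrightarrow> rvec a - rvec b \<in> S"
  shows "finite X \<and> card X \<le> (2 * r + 1) ^ k"
  using assms
proof (induction k arbitrary: S X)
  have triv: "finite X \<and> card X \<le> 1" if "\<And>a b. a \<in> X \<Longrightarrow> b \<in> X \<Longrightarrow> rvec a - rvec b \<in> S" "S \<subseteq> {0}"
    for S and X :: "(int ^ 'n) set"
  proof (cases "X = {}")
    case False
    then obtain a where "a \<in> X" by blast
    have "b = a" if "b \<in> X" for b
    proof -
      have "rvec b - rvec a = 0" using \<open>\<And>a b. a \<in> X \<Longrightarrow> b \<in> X \<Longrightarrow> rvec a - rvec b \<in> S\<close>[OF that \<open>a \<in> X\<close>] \<open>S \<subseteq> {0}\<close> by auto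
      thus ?thesis by (simp add: rvec_inject)
    qed
    then have "X \<subseteq> {a}" by auto
    moreover from this have "card X \<le> card {a}" by (intro card_mono) auto
    ultimately show ?thesis using finite_subset[of X "{a}"] by simp
  qed simp
  {
    case 0
    then have "S \<subseteq> {0}" by simp
    thus ?case using triv[of X S] 0(4) by simp
  next
    case (Suc k)
    show ?case
    proof (cases "S \<subseteq> {0}")
      case True
      have "1 \<le> (2 * r + 1) ^ Suc k" by (rule one_le_power) simp
      thus ?thesis using triv[of X S] Suc.prems(4) True by fastforce
    next
      case False
      then obtain x where "x \<in> S" "x \<noteq> 0" by auto
      then obtain i where x: "x \<in> S" "x $ i \<noteq> 0" by (auto simp: vec_eq_iff)
      define S' where "S' = S \<inter> {x. x $ i = 0}"
      have S': "subspace S'" unfolding S'_def using Suc.prems(2) by (auto simp: subspace_def)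
      have "S' \<subset> S" using x unfolding S'_def by auto
      then have "dim S' < dim S" using S' Suc.prems(2) by (intro dim_psubset) (simp add: span_eq_iff[THEN iffD2])
      then have d: "dim S' \<le> k" using Suc.prems(3) by simp
      define Xc where "Xc c = {a \<in> X. a $ i = c}" for c
      have Xc: "finite (Xc c) \<and> card (Xc c) \<le> (2 * r + 1) ^ k" for c
      proof (rule Suc.IH[OF _ S' d])
        show "rvec a - rvec b \<in> S'" if "a \<in> Xc c" "b \<in> Xc c" for a b
          using that Suc.prems(4)[of a b] by (auto simp: Xc_def S'_def rvec_def)
      qed (use Suc.prems(1) in \<open>auto simp: Xc_def\<close>)
      have "- int r \<le> a $ i \<and> a $ i \<le> int r" if "a \<in> X" for a using Suc.prems(1)[OF that, of i] by linarith
      then have X: "X = (\<Union>c\<in>{- int r..int r}. Xc c)" unfolding Xc_def by auto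
      have "card X \<le> (\<Sum>c\<in>{- int r..int r}. card (Xc c))" by (subst X, rule card_UN_le) simp
      also have "\<dots> \<le> (\<Sum>c\<in>{- int r..int r}. (2 * r + 1) ^ k)" using Xc by (intro sum_mono) auto
      also have "\<dots> = (2 * r + 1) ^ Suc k" by (simp add: nat_add_distrib)
      finally have "card X \<le> (2 * r + 1) ^ Suc k" .
      moreover have "finite X" by (subst X) (use Xc in auto)
      ultimately show ?thesis by simp
    qed
  }
qed

section \<open>Face projections and the bound on independent elements\<close>

context monomial_ring begin

lemma up_closed_compl: "N \<in> \<M> \<Longrightarrow> up_closed (U - N)"
  unfolding up_closed_def
proof (intro conjI ballI allI impI)
  assume N: "N \<in> \<M>"
  fix y a assume y: "y \<in> U - N" "compat a y"
  then obtain N' where N': "N' \<in> \<M>" "a \<in> N'" "y \<in> N'" by (auto simp: compat_def)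
  have "a + y \<notin> N"
  proof
    assume "a + y \<in> N"
    then have "y \<in> N" using fam_face[OF N'(1) N N'(3,2)] by (simp add: add.commute)
    thus False using y by simp
  qed
  thus "a + y \<in> U - N" using compat_add[OF y(2)] by simp
qed simp

text \<open>\<open>proj N\<close> is the face projection onto the ring of \<open>N\<close>. The
  monomials outside the face \<open>N\<close> span an ideal; both sides agree modulo this ideal and
  are supported in \<open>N\<close>.\<close>

lemma proj_mult:
  assumes N: "N \<in> \<M>" and x: "x \<in> R" "y \<in> R"
  shows "proj N (x * y) = proj N x * proj N y"
proof -
  have I: "is_ideal (span_of (U - N))" using span_of_ideal[OF up_closed_compl[OF N]] .
  have R: "proj N x \<in> R" "proj N y \<in> R" "proj (- N) x \<in> R" "proj (- N) y \<in> R" using proj_mem x by auto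
  have P: "proj (- N) z \<in> span_of (U - N)" if "z \<in> R" for z
    using that supp_U[OF that] by (auto simp: span_of_def proj_mem supp_proj)
  have dx: "proj N x + proj (- N) x = x" "proj N y + proj (- N) y = y"
    using proj_compl[OF x(1), of N] proj_compl[OF x(2), of N] by simp_all
  have "x * y = (proj N x + proj (- N) x) * (proj N y + proj (- N) y)" unfolding dx ..
  also have "\<dots> = proj N x * proj N y + ((proj N y + proj (- N) y) * proj (- N) x + proj N x * proj (- N) y)"
    by (simp add: algebra_simps)
  also have "\<dots> = proj N x * proj N y + (y * proj (- N) x + proj N x * proj (- N) y)" unfolding dx ..
  finally have xy: "x * y = proj N x * proj N y + (y * proj (- N) x + proj N x * proj (- N) y)" .
  define z where "z = y * proj (- N) x + proj N x * proj (- N) y"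
  have z: "z \<in> span_of (U - N)" unfolding z_def
    using ideal_add[OF I ideal_mult[OF I x(2) P[OF x(1)]] ideal_mult[OF I R(1) P[OF x(2)]]] .
  have "supp (proj N x * proj N y) \<subseteq> N"
  proof
    fix c assume "c \<in> supp (proj N x * proj N y)"
    then obtain a b where "c = a + b" "a \<in> supp (proj N x)" "b \<in> supp (proj N y)" using supp_mult[OF R(1,2)] by auto
    thus "c \<in> N" using supp_proj[OF x(1)] supp_proj[OF x(2)] fam_add[OF N] by auto
  qed
  then have 1: "proj N (proj N x * proj N y) = proj N x * proj N y" using R by (intro proj_id mult_mem)
  have 2: "proj N z = 0" using z by (intro proj_disjoint) (auto simp: span_of_def)
  have zR: "z \<in> R" using z by (simp add: span_of_def)
  show ?thesis unfolding xy z_def[symmetric]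
    using proj_add[OF mult_mem[OF R(1,2)] zR, of N] 1 2 by simp
qed

lemma sub_monomial_ring:
  assumes N: "N \<in> \<M>" shows "monomial_ring (span_of N) kc e cf {N}"
proof -
  have NU: "N \<subseteq> U" using N by auto
  show ?thesis
  proof (unfold_locales, goal_cases)
    case 1 thus ?case using e_span_of[OF zero_U fam_zero[OF N]] e_zero by simp
  next
    case (2 x y) thus ?case using supp_add[of x y] by (auto simp: span_of_def add_mem)
  next
    case (3 x) thus ?case by (auto simp: span_of_def supp_def cf_uminus uminus_mem)
  next
    case (4 x y)
    then have R: "x \<in> R" "y \<in> R" "supp x \<subseteq> N" "supp y \<subseteq> N" by (auto simp: span_of_def)
    have "supp (x * y) \<subseteq> N"
    proof
      fix c assume "c \<in> supp (x * y)"
      then obtain a b where "c = a + b" "a \<in> supp x" "b \<in> supp y" using supp_mult[OF R(1,2)] by auto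
      thus "c \<in> N" using R(3,4) fam_add[OF N] by auto
    qed
    thus ?case using mult_mem[OF R(1,2)] by (simp add: span_of_def)
  next
    case (7 N') thus ?case using fam_affine[OF N] by simp
  next
    case (13 c)
    have "kc c * e 0 \<in> R" using kc_mem e_mem[OF zero_U] by (rule mult_mem)
    moreover have "supp (kc c * e 0) \<subseteq> {0}"
      using cf_scale[OF e_mem[OF zero_U]] cf_e[OF zero_U] by (auto simp: supp_def)
    ultimately show ?case using fam_zero[OF N] e_zero by (auto simp: span_of_def)
  next
    case (14 a) thus ?case using e_span_of[of a N] NU by auto
  next
    case (16 a b)
    then have "compat a b" using N by (auto simp: compat_def)
    thus ?case using 16 e_mult'[of a b] compat_U by auto
  next
    case (17 x) thus ?case using cf_finite by (simp add: span_of_def)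
  next
    case (18 x a) thus ?case by (auto simp: span_of_def supp_def)
  next
    case (19 A f) thus ?case using cf_lincomb[of A f] NU by auto
  next
    case (20 x) thus ?case using cf_expand by (simp add: span_of_def)
  qed (simp_all add: kc_zero kc_one kc_add kc_mult e_zero)
qed

text \<open>The face projection fixes \<open>span_of N\<close> and, having its kernel inside
  \<open>m\<close>, maps \<open>m\<close> into itself. It therefore sends an identity 1 = u + r x to
  one inside the subring.\<close>

lemma maximal_restrict:
  assumes N: "N \<in> \<M>" and m: "is_maximal m" "span_of (U - N) \<subseteq> m"
  shows "comm_subring.is_maximal (span_of N) (m \<inter> span_of N)"
proof -
  interpret S: monomial_ring "span_of N" kc e cf "{N}" by (rule sub_monomial_ring[OF N])
  have mid: "is_ideal m" using maximal_ideal[OF m(1)] .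
  have Nid: "x \<in> R \<Longrightarrow> proj N x \<in> span_of N" for x by (auto simp: span_of_def proj_mem supp_proj)
  have pm: "proj N u \<in> m" if "u \<in> m" for u
  proof -
    have uR: "u \<in> R" using ideal_sub[OF mid that] .
    have "proj (- N) u \<in> span_of (U - N)" using uR supp_U[OF uR] by (auto simp: span_of_def proj_mem supp_proj)
    then have "proj (- N) u \<in> m" using m(2) by auto
    moreover have "proj N u = u - proj (- N) u" using proj_compl[OF uR, of N] by (simp add: eq_diff_eq)
    ultimately show ?thesis using ideal_diff[OF mid that] by simp
  qed
  show ?thesis unfolding S.is_maximal_def
  proof (intro conjI ballI)
    show "S.is_ideal (m \<inter> span_of N)" unfolding S.is_ideal_def
      using ideal_zero[OF mid] ideal_add[OF mid] ideal_mult[OF mid subsetD[OF span_of_R]]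
        S.zero_mem S.add_mem S.mult_mem by auto
    show "1 \<notin> m \<inter> span_of N" using m(1) by (simp add: is_maximal_def)
    fix x assume x: "x \<in> span_of N - m \<inter> span_of N"
    then have xR: "x \<in> R" "x \<notin> m" "supp x \<subseteq> N" by (auto simp: span_of_def)
    obtain r u where ru: "r \<in> R" "u \<in> m" "1 = u + r * x" using maximalE[OF m(1) xR(1,2)] by metis
    have uR: "u \<in> R" using ideal_sub[OF mid ru(2)] .
    have "proj N 1 = proj N u + proj N r * proj N x"
      using ru proj_add[OF uR mult_mem[OF ru(1) xR(1)], of N] proj_mult[OF N ru(1) xR(1)] by simp
    moreover have "proj N 1 = 1" using S.one_mem by (intro proj_id) (auto simp: span_of_def)
    moreover have "proj N x = x" using xR by (intro proj_id)
    ultimately have "1 = proj N u + proj N r * x" by simp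
    thus "\<exists>r\<in>span_of N. \<exists>u\<in>m \<inter> span_of N. 1 = u + r * x" using Nid ru(1) uR pm[OF ru(2)] by blast
  qed
qed

text \<open>The face projection makes the ring of \<open>N\<close> a quotient of \<open>R\<close>,
  and the ideal on the right is the preimage of \<open>I\<close>. An element of the subring acts in
  the same way on both quotients.\<close>

lemma depth_restrict:
  assumes N: "N \<in> \<M>"
  shows "depth_ge (m \<inter> span_of N) n (span_of N) I \<Longrightarrow> depth_ge m n R {x \<in> R. proj N x \<in> I}"
proof (induction n arbitrary: I)
  case (Suc n)
  then obtain x where x: "x \<in> m" "x \<in> span_of N" "regular_on x (span_of N) I"
    "depth_ge (m \<inter> span_of N) n (span_of N) (plus_mult I x (span_of N))" by auto
  have xR: "x \<in> R" "proj N x = x" using x(2) by (auto simp: span_of_def intro: proj_id)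
  have pN: "a \<in> R \<Longrightarrow> proj N a \<in> span_of N" for a by (auto simp: span_of_def proj_mem supp_proj)
  have px: "proj N (x * a) = x * proj N a" if "a \<in> R" for a using proj_mult[OF N xR(1) that] xR(2) by simp
  have "regular_on x R {x \<in> R. proj N x \<in> I}"
    using x(3) px pN unfolding regular_on_def by auto
  moreover have "plus_mult {x \<in> R. proj N x \<in> I} x R = {y \<in> R. proj N y \<in> plus_mult I x (span_of N)}"
  proof
    show "plus_mult {x \<in> R. proj N x \<in> I} x R \<subseteq> {y \<in> R. proj N y \<in> plus_mult I x (span_of N)}"
    proof
      fix y assume "y \<in> plus_mult {x \<in> R. proj N x \<in> I} x R"
      then obtain b a where 1: "b \<in> R" "proj N b \<in> I" "a \<in> R" "y = b + x * a" by (auto elim: plus_multE)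
      then have "proj N y = proj N b + x * proj N a" using proj_add[OF 1(1) mult_mem[OF xR(1) 1(3)], of N] px by simp
      then have "proj N y \<in> plus_mult I x (span_of N)" by (rule plus_multI[OF 1(2) pN[OF 1(3)]])
      moreover have "y \<in> R" unfolding 1(4) by (intro add_mem mult_mem 1 xR)
      ultimately show "y \<in> {y \<in> R. proj N y \<in> plus_mult I x (span_of N)}" by simp
    qed
    show "{y \<in> R. proj N y \<in> plus_mult I x (span_of N)} \<subseteq> plus_mult {x \<in> R. proj N x \<in> I} x R"
    proof
      fix y assume "y \<in> {y \<in> R. proj N y \<in> plus_mult I x (span_of N)}"
      then obtain i a where 1: "y \<in> R" "i \<in> I" "a \<in> span_of N" "proj N y = i + x * a" by (auto elim: plus_multE)
      have aR: "a \<in> R" "proj N a = a" using 1(3) by (auto simp: span_of_def intro: proj_id)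
      have d: "y - x * a \<in> R" using 1(1) xR aR by (intro diff_mem mult_mem)
      have "proj N (y - x * a) + x * a = proj N y"
        using proj_add[OF d mult_mem[OF xR(1) aR(1)], of N] px[OF aR(1)] aR(2) by simp
      then have "proj N (y - x * a) = i" using 1(4) by simp
      thus "y \<in> plus_mult {x \<in> R. proj N x \<in> I} x R"
        using d aR 1(2) by (intro plus_multI[of "y - x * a" _ a]) auto
    qed
  qed
  ultimately show ?case using Suc.IH[OF x(4)] x(1) by auto
qed simp

lemma supp_list_monom:
  fixes B :: nat
  assumes "set zs \<subseteq> R" "\<And>z a i. z \<in> set zs \<Longrightarrow> a \<in> supp z \<Longrightarrow> \<bar>a $ i\<bar> \<le> int B"
    "length \<alpha> = length zs" "set \<alpha> \<subseteq> {..<r}" "a \<in> supp (list_monom zs \<alpha>)"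
  shows "\<bar>a $ i\<bar> \<le> int (length zs * (r * B))"
  using assms
proof (induction zs arbitrary: \<alpha> a)
  case Nil
  then have "a \<in> supp (e 0)" by (simp add: e_zero)
  thus ?case using supp_e[OF zero_U] by auto
next
  case (Cons z zs)
  then obtain k \<beta> where \<alpha>: "\<alpha> = k # \<beta>" by (cases \<alpha>) auto
  have z: "z \<in> R" "\<And>a i. a \<in> supp z \<Longrightarrow> \<bar>a $ i\<bar> \<le> int B" using Cons.prems by auto
  have pw: "\<bar>a $ i\<bar> \<le> int (j * B)" if "a \<in> supp (z ^ j)" for a i j
    using that
  proof (induction j arbitrary: a)
    case 0
    then have "a \<in> supp (e 0)" by (simp add: e_zero)
    thus ?case using supp_e[OF zero_U] by auto
  next
    case (Suc j)
    then obtain b c where "a = b + c" "b \<in> supp z" "c \<in> supp (z ^ j)"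
      using supp_mult[OF z(1) power_mem[OF z(1), of j]] by auto
    thus ?case using z(2)[of b i] Suc.IH[of c] by (simp add: algebra_simps)
  qed
  have R: "z ^ k \<in> R" "list_monom zs \<beta> \<in> R" using z(1) Cons.prems(1) by (auto intro: power_mem list_monom_mem)
  obtain b c where bc: "a = b + c" "b \<in> supp (z ^ k)" "c \<in> supp (list_monom zs \<beta>)"
    using supp_mult[OF R] Cons.prems(5) \<alpha> by auto
  have "\<bar>c $ i\<bar> \<le> int (length zs * (r * B))"
    by (rule Cons.IH[of \<beta>]) (use Cons.prems \<alpha> bc in auto)
  moreover have "\<bar>b $ i\<bar> \<le> int (k * B)" using pw[OF bc(2)] .
  moreover have "k * B \<le> r * B" using Cons.prems(4) \<alpha> by simp
  then have "int (k * B) \<le> int (r * B)" by (rule of_nat_mono)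
  ultimately have "\<bar>a $ i\<bar> \<le> int (r * B) + int (length zs * (r * B))" using bc(1) by simp
  thus ?case by simp
qed

text \<open>With more than \<open>k\<close> elements there are at least r^(k+1) monomials with
  exponents below \<open>r\<close>. Their supports lie in boxes of size proportional to
  \<open>r\<close> in finitely many monoids of dimension at most \<open>k\<close>, which leaves on
  the order of r^k positions. For large \<open>r\<close> this forces a linear relation in the ring
  itself.\<close>

lemma alg_indep_length:
  assumes dimN: "\<And>N. N \<in> \<M> \<Longrightarrow> dim (rvec ` N) \<le> k" and zs: "set zs \<subseteq> R"
    and ind: "alg_indep kc P zs" "0 \<in> P"
  shows "length zs \<le> k"
proof (rule ccontr)
  assume "\<not> ?thesis"
  then have n: "Suc k \<le> length zs" by simp
  let ?n = "length zs"
  have "finite (\<Union>z\<in>set zs. supp z)" using zs supp_finite by auto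
  then have "finite ((\<lambda>(a, i). nat \<bar>a $ i\<bar>) ` ((\<Union>z\<in>set zs. supp z) \<times> UNIV))" by simp
  then obtain B where B: "\<forall>b\<in>(\<lambda>(a, i). nat \<bar>a $ i\<bar>) ` ((\<Union>z\<in>set zs. supp z) \<times> UNIV). b \<le> B"
    by (meson finite_nat_set_iff_bounded_le)
  have Bb: "\<bar>a $ i\<bar> \<le> int B" if "z \<in> set zs" "a \<in> supp z" for z a i
  proof -
    have "nat \<bar>a $ i\<bar> \<le> B" using B that by force
    thus ?thesis by linarith
  qed
  define s where "s = card \<M>"
  \<comment> \<open>This value exceeds s (2 n B + 1)^k with n the length of \<open>zs\<close>; so
    the number of positions, at most s (2 n B + 1)^k r^k, stays below r^(k+1).\<close>
  define r where "r = s * (2 * ?n * B + 1) ^ k + 1"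
  define Z where "Z = {a \<in> U. \<forall>i. \<bar>a $ i\<bar> \<le> int (?n * (r * B))}"
  define E where "E = {\<alpha>. set \<alpha> \<subseteq> {..<r} \<and> length \<alpha> = ?n}"
  have ZN: "finite {a \<in> N. \<forall>i. \<bar>a $ i\<bar> \<le> int (?n * (r * B))} \<and>
      card {a \<in> N. \<forall>i. \<bar>a $ i\<bar> \<le> int (?n * (r * B))} \<le> (2 * (?n * (r * B)) + 1) ^ k" if N: "N \<in> \<M>" for N
  proof (rule lattice_box_card[of _ _ "span (rvec ` N)"])
    show "dim (span (rvec ` N)) \<le> k" using dimN[OF N] by simp
  qed (auto intro: span_diff span_base)
  have ZU: "Z = (\<Union>N\<in>\<M>. {a \<in> N. \<forall>i. \<bar>a $ i\<bar> \<le> int (?n * (r * B))})" unfolding Z_def by auto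
  have finZ: "finite Z" unfolding ZU using fam_finite ZN by auto
  have "card Z \<le> (\<Sum>N\<in>\<M>. card {a \<in> N. \<forall>i. \<bar>a $ i\<bar> \<le> int (?n * (r * B))})"
    unfolding ZU by (rule card_UN_le[OF fam_finite])
  also have "\<dots> \<le> (\<Sum>N\<in>\<M>. (2 * (?n * (r * B)) + 1) ^ k)" using ZN by (intro sum_mono) auto
  also have "\<dots> = s * (2 * (?n * (r * B)) + 1) ^ k" by (simp add: s_def)
  also have "\<dots> \<le> s * ((2 * ?n * B + 1) * r) ^ k"
    by (intro mult_left_mono power_mono) (auto simp: r_def algebra_simps)
  also have "\<dots> = (s * (2 * ?n * B + 1) ^ k) * r ^ k" by (simp only: power_mult_distrib mult.assoc)
  also have "\<dots> < r * r ^ k" by (intro mult_strict_right_mono) (auto simp: r_def)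
  also have "\<dots> = r ^ Suc k" by simp
  also have "\<dots> \<le> r ^ ?n" using n by (intro power_increasing) (auto simp: r_def)
  also have "\<dots> = card E" unfolding E_def using card_lists_length_eq[of "{..<r}" ?n] by simp
  finally have card: "card Z < card E" .
  have finE: "finite E" unfolding E_def using finite_lists_length_eq[of "{..<r}" ?n] by simp
  obtain c where c: "\<exists>\<alpha>\<in>E. c \<alpha> \<noteq> 0" "\<forall>z\<in>Z. (\<Sum>\<alpha>\<in>E. c \<alpha> * cf (list_monom zs \<alpha>) z) = 0"
    using homogeneous_system[OF finZ finE card, of "\<lambda>\<alpha>. cf (list_monom zs \<alpha>)"] by blast
  define x where "x = (\<Sum>\<alpha>\<in>E. kc (c \<alpha>) * list_monom zs \<alpha>)"
  have mR: "list_monom zs \<alpha> \<in> R" for \<alpha> using list_monom_mem[OF zs] .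
  have xR: "x \<in> R" unfolding x_def by (intro sum_mem mult_mem kc_mem mR)
  have cfx: "cf x a = (\<Sum>\<alpha>\<in>E. c \<alpha> * cf (list_monom zs \<alpha>) a)" for a
    unfolding x_def by (subst cf_sum) (auto intro: mult_mem kc_mem mR simp: cf_scale[OF mR])
  have "cf x a = 0" for a
  proof (cases "a \<in> Z")
    case True
    thus ?thesis using c(2) cfx by simp
  next
    case False
    have "cf (list_monom zs \<alpha>) a = 0" if "\<alpha> \<in> E" for \<alpha>
    proof (rule ccontr)
      assume nz: "cf (list_monom zs \<alpha>) a \<noteq> 0"
      then have "a \<in> supp (list_monom zs \<alpha>)" by (simp add: supp_def)
      then have "\<bar>a $ i\<bar> \<le> int (?n * (r * B))" for i
        by (intro supp_list_monom[OF zs Bb]) (use that in \<open>auto simp: E_def\<close>)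
      moreover have "a \<in> U" using cf_support[OF mR nz] .
      ultimately show False using False by (simp add: Z_def)
    qed
    thus ?thesis using cfx by simp
  qed
  then have "x = 0" using cf_inject[OF xR zero_mem] by (simp add: cf_zero)
  then have "x \<in> P" using ind(2) by simp
  then have "\<forall>\<alpha>\<in>E. c \<alpha> = 0"
    using ind(1)[unfolded alg_indep_def, rule_format, of E c] finE unfolding x_def E_def by blast
  thus False using c(1) by blast
qed

end

primrec list_comb :: "(int ^ ('n::finite)) list \<Rightarrow> nat list \<Rightarrow> int ^ 'n" where
  "list_comb [] \<alpha> = 0"
| "list_comb (j # js) \<alpha> = of_nat (hd \<alpha>) * j + list_comb js (tl \<alpha>)"

context monomial_at begin

lemma span_compl_units:
  assumes "units_at \<subseteq> N" shows "span_of (U - N) \<subseteq> m"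
proof
  fix x assume x: "x \<in> span_of (U - N)"
  then have xR: "x \<in> R" "supp x \<subseteq> U - N" by (auto simp: span_of_def)
  have "(\<Sum>a\<in>supp x. kc (cf x a) * e a) \<in> m"
  proof (rule ideal_sum[OF m_ideal])
    fix a assume "a \<in> supp x"
    then have "e a \<in> m" using xR(2) assms by (auto simp: units_at_def)
    thus "kc (cf x a) * e a \<in> m" by (rule ideal_mult[OF m_ideal kc_mem])
  qed
  thus "x \<in> m" using expand_superset[OF xR(1) supp_finite[OF xR(1)] subset_refl] by simp
qed

lemma set_depth_face_ring:
  assumes N: "N \<in> \<M>" and d: "depth_ge (m \<inter> span_of N) n (span_of N) {0}"
  shows "set_depth n N"
proof -
  have "{x \<in> R. proj N x \<in> {0}} = span_of (U - N)"
  proof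
    show "{x \<in> R. proj N x \<in> {0}} \<subseteq> span_of (U - N)"
    proof
      fix x assume "x \<in> {x \<in> R. proj N x \<in> {0}}"
      then have x: "x \<in> R" "proj N x = 0" by auto
      then have "supp x \<inter> N = {}" using supp_proj[OF x(1), of N] supp_zero by simp
      thus "x \<in> span_of (U - N)" using x supp_U[OF x(1)] by (auto simp: span_of_def)
    qed
    show "span_of (U - N) \<subseteq> {x \<in> R. proj N x \<in> {0}}"
      by (auto simp: span_of_def intro!: proj_disjoint)
  qed
  then have "depth_ge m n (span_of U) (span_of (U - N))" using depth_restrict[OF N d] span_of_U by simp
  then have "set_depth n (U - (U - N))" using set_depth_iff[OF up_closed_U up_closed_compl[OF N]] by simp
  moreover have "U - (U - N) = N" using N by auto
  ultimately show ?thesis by simp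
qed

lemma list_comb_units:
  "set js \<subseteq> units_at \<Longrightarrow> list_comb js \<alpha> \<in> units_at \<and> list_monom (map e js) \<alpha> = e (list_comb js \<alpha>)"
proof (induction js arbitrary: \<alpha>)
  case (Cons j js)
  have 1: "of_nat (hd \<alpha>) * j \<in> units_at" "e (of_nat (hd \<alpha>) * j) = e j ^ hd \<alpha>" using units_at_multiple Cons.prems by auto
  have 2: "list_comb js (tl \<alpha>) \<in> units_at" "list_monom (map e js) (tl \<alpha>) = e (list_comb js (tl \<alpha>))"
    using Cons by auto
  show ?case using 1 2 units_at_prod(2)[OF 1(1) 2(1)] units_at_mult[OF 1(1) 2(1)] by simp
qed (simp add: units_at_zero e_zero)

lemma list_comb_nspan: "distinct js \<Longrightarrow> list_comb js \<alpha> \<in> nspan (set js)"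
proof (induction js arbitrary: \<alpha>)
  case (Cons j js)
  then obtain n :: "_ \<Rightarrow> nat" where n: "list_comb js (tl \<alpha>) = (\<Sum>b\<in>set js. of_nat (n b) * b)"
    unfolding nspan_def by fastforce
  have "(\<Sum>b\<in>set js. of_nat ((n(j := hd \<alpha>)) b) * b) = (\<Sum>b\<in>set js. of_nat (n b) * b)"
    using Cons.prems by (intro sum.cong) auto
  then have "list_comb (j # js) \<alpha> = (\<Sum>b\<in>set (j # js). of_nat ((n(j := hd \<alpha>)) b) * b)"
    using Cons.prems n by simp
  thus ?case unfolding nspan_def by blast
qed (simp add: nspan_def)

text \<open>The coordinates \<open>l b\<close> recover the exponents from the combination, so
  different exponent lists give different monomials, and a polynomial relation modulo
  \<open>m\<close> becomes an element of \<open>span_of (nspan J)\<close> in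
  \<open>m\<close>.\<close>

lemma alg_indep_of_alg_free:
  fixes l :: "int ^ 'n \<Rightarrow> int ^ 'n \<Rightarrow> real"
  assumes J: "finite J" "J \<subseteq> units_at" "alg_free J"
    and l: "\<And>b a c. b \<in> J \<Longrightarrow> l b (a + c) = l b a + l b c" "\<And>b. b \<in> J \<Longrightarrow> l b b = 1"
      "\<And>b c. b \<in> J \<Longrightarrow> c \<in> J \<Longrightarrow> c \<noteq> b \<Longrightarrow> l b c = 0"
  obtains ys where "length ys = card J" "set ys \<subseteq> R" "alg_indep kc m ys"
proof -
  obtain js where js: "set js = J" "distinct js" using finite_distinct_list[OF J(1)] by blast
  have l0: "l b 0 = 0" if "b \<in> J" for b using l(1)[OF that, of 0 0] by simp
  have lmult: "l b (of_nat n * a) = real n * l b a" if "b \<in> J" for b a n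
    by (induction n) (auto simp: l0[OF that] l(1)[OF that] algebra_simps)
  have lz: "l b (list_comb ks \<alpha>) = 0" if "b \<in> J" "set ks \<subseteq> J - {b}" for b ks \<alpha>
    using that(2) by (induction ks arbitrary: \<alpha>) (auto simp: l0 l(1) lmult l(3) that(1))
  have inj: "\<alpha> = \<beta>" if "set ks \<subseteq> J" "distinct ks" "length \<alpha> = length ks" "length \<beta> = length ks"
      "list_comb ks \<alpha> = list_comb ks \<beta>" for ks \<alpha> \<beta>
    using that
  proof (induction ks arbitrary: \<alpha> \<beta>)
    case (Cons k ks)
    obtain a \<alpha>' b \<beta>' where ab: "\<alpha> = a # \<alpha>'" "\<beta> = b # \<beta>'" using Cons.prems by (cases \<alpha>; cases \<beta>) auto
    have kJ: "k \<in> J" "set ks \<subseteq> J - {k}" using Cons.prems by auto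
    have "l k (list_comb (k # ks) \<alpha>) = l k (list_comb (k # ks) \<beta>)" using Cons.prems by simp
    then have "a = b" using ab lz[OF kJ] by (simp add: l(1)[OF kJ(1)] lmult[OF kJ(1)] l(2)[OF kJ(1)])
    moreover have "\<alpha>' = \<beta>'" by (rule Cons.IH) (use Cons.prems ab calculation in auto)
    ultimately show ?case using ab by simp
  qed simp
  show ?thesis
  proof (rule that[of "map e js"])
    show "length (map e js) = card J" using js distinct_card by fastforce
    show "set (map e js) \<subseteq> R" using js J(2) e_mem by (auto simp: units_at_def)
    show "alg_indep kc m (map e js)" unfolding alg_indep_def
    proof (intro allI impI ballI)
      fix E c \<alpha>
      assume E: "finite E" "\<forall>\<alpha>\<in>E. length \<alpha> = length (map e js)"
        and sm: "(\<Sum>\<alpha>\<in>E. kc (c \<alpha>) * list_monom (map e js) \<alpha>) \<in> m" and \<alpha>: "\<alpha> \<in> E"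
      let ?g = "list_comb js"
      have injE: "inj_on ?g E"
      proof (rule inj_onI)
        fix \<alpha> \<beta> assume "\<alpha> \<in> E" "\<beta> \<in> E" "?g \<alpha> = ?g \<beta>"
        thus "\<alpha> = \<beta>" using inj[of js \<alpha> \<beta>] js E(2) by simp
      qed
      have gU: "?g ` E \<subseteq> U" using list_comb_units[of js] js J(2) by (auto simp: units_at_def)
      define x where "x = (\<Sum>v\<in>?g ` E. kc (c (inv_into E ?g v)) * e v)"
      have "(\<Sum>\<alpha>\<in>E. kc (c \<alpha>) * list_monom (map e js) \<alpha>) = x"
        unfolding x_def sum.reindex[OF injE] comp_def
        using list_comb_units[of js] js J(2) injE by (intro sum.cong) (auto simp: inv_into_f_f)
      then have xm: "x \<in> m" using sm by simp
      have cfx: "cf x v = (if v \<in> ?g ` E then c (inv_into E ?g v) else 0)" for v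
        unfolding x_def by (subst cf_lincomb[OF _ gU]) (use E in auto)
      have "x \<in> R" unfolding x_def using gU by (rule lincomb_mem)
      then have "x \<in> span_of (nspan J)"
        using list_comb_nspan[OF js(2)] js(1) unfolding span_of_def supp_def by (auto simp: cfx split: if_splits)
      then have "x = 0" using J(3) xm unfolding alg_free_def by blast
      then have "cf x (?g \<alpha>) = 0" by (simp add: cf_zero)
      thus "c \<alpha> = 0" using \<alpha> injE by (simp add: cfx inv_into_f_f)
    qed
  qed
qed

end

section \<open>Rational cones\<close>

lemma cone_gen_finite:
  assumes "finite G"
  shows "cone_gen G = {\<Sum>v\<in>G. c v *\<^sub>R v | c. \<forall>v\<in>G. 0 \<le> c v}"
proof
  show "cone_gen G \<subseteq> {\<Sum>v\<in>G. c v *\<^sub>R v | c. \<forall>v\<in>G. 0 \<le> c v}"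
  proof
    fix x assume "x \<in> cone_gen G"
    then obtain T c where T: "finite T" "T \<subseteq> G" "\<forall>v\<in>T. 0 \<le> c v" "x = (\<Sum>v\<in>T. c v *\<^sub>R v)"
      unfolding cone_gen_def by auto
    have "x = (\<Sum>v\<in>G. (if v \<in> T then c v else 0) *\<^sub>R v)"
      unfolding T(4) by (rule sum.mono_neutral_cong_left) (use T assms in auto)
    thus "x \<in> {\<Sum>v\<in>G. c v *\<^sub>R v | c. \<forall>v\<in>G. 0 \<le> c v}" using T(3) by force
  qed
  show "{\<Sum>v\<in>G. c v *\<^sub>R v | c. \<forall>v\<in>G. 0 \<le> c v} \<subseteq> cone_gen G"
    using assms unfolding cone_gen_def by blast
qed

lemma cone_gen_eq_hull: "cone_gen S = convex_cone hull S"
proof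
  show "cone_gen S \<subseteq> convex_cone hull S"
  proof
    fix x assume "x \<in> cone_gen S"
    then obtain T c where T: "finite T" "T \<subseteq> S" "\<forall>v\<in>T. 0 \<le> c v" "x = (\<Sum>v\<in>T. c v *\<^sub>R v)"
      unfolding cone_gen_def by auto
    have "(\<Sum>v\<in>T. c v *\<^sub>R v) \<in> convex_cone hull S" using T(1-3)
    proof (induction T rule: finite_induct)
      case (insert v T)
      then have "c v *\<^sub>R v \<in> convex_cone hull S" by (intro convex_cone_hull_mul hull_inc) auto
      thus ?case using insert by (simp add: convex_cone_hull_add)
    qed (simp add: convex_cone_hull_contains_0)
    thus "x \<in> convex_cone hull S" using T(4) by simp
  qed
  show "convex_cone hull S \<subseteq> cone_gen S"
  proof (rule hull_minimal)
    show "S \<subseteq> cone_gen S"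
    proof
      fix x assume "x \<in> S"
      thus "x \<in> cone_gen S" unfolding cone_gen_def
        by (intro CollectI exI[of _ "{x}"] exI[of _ "\<lambda>_. 1"]) auto
    qed
    show "convex_cone (cone_gen S)" unfolding convex_cone_iff
    proof (intro conjI ballI allI impI)
      show "0 \<in> cone_gen S" unfolding cone_gen_def by (auto intro!: exI[of _ "{}"])
      fix x y assume "x \<in> cone_gen S" "y \<in> cone_gen S"
      then obtain T c T' c' where T: "finite T" "T \<subseteq> S" "\<forall>v\<in>T. 0 \<le> c v" "x = (\<Sum>v\<in>T. c v *\<^sub>R v)"
        "finite T'" "T' \<subseteq> S" "\<forall>v\<in>T'. 0 \<le> c' v" "y = (\<Sum>v\<in>T'. c' v *\<^sub>R v)"
        unfolding cone_gen_def by blast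
      have "x = (\<Sum>v\<in>T \<union> T'. (if v \<in> T then c v else 0) *\<^sub>R v)"
        unfolding T(4) by (rule sum.mono_neutral_cong_left) (use T in auto)
      moreover have "y = (\<Sum>v\<in>T \<union> T'. (if v \<in> T' then c' v else 0) *\<^sub>R v)"
        unfolding T(8) by (rule sum.mono_neutral_cong_left) (use T in auto)
      ultimately have "x + y = (\<Sum>v\<in>T \<union> T'. ((if v \<in> T then c v else 0) + (if v \<in> T' then c' v else 0)) *\<^sub>R v)"
        by (simp add: sum.distrib scaleR_add_left)
      thus "x + y \<in> cone_gen S" unfolding cone_gen_def
        using T by (intro CollectI exI[of _ "T \<union> T'"]
            exI[of _ "\<lambda>v. (if v \<in> T then c v else 0) + (if v \<in> T' then c' v else 0)"]) auto
    next
      fix x and t :: real assume "x \<in> cone_gen S" "0 \<le> t"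
      then obtain T c where T: "finite T" "T \<subseteq> S" "\<forall>v\<in>T. 0 \<le> c v" "x = (\<Sum>v\<in>T. c v *\<^sub>R v)"
        unfolding cone_gen_def by auto
      then have "t *\<^sub>R x = (\<Sum>v\<in>T. (t * c v) *\<^sub>R v)" by (simp add: scaleR_sum_right)
      thus "t *\<^sub>R x \<in> cone_gen S" unfolding cone_gen_def
        using T \<open>0 \<le> t\<close> by (intro CollectI exI[of _ T] exI[of _ "\<lambda>v. t * c v"]) auto
    qed
  qed
qed

lemma rational_cone_convex_cone: "rational_cone C \<Longrightarrow> convex_cone C"
  unfolding rational_cone_def cone_gen_eq_hull using convex_cone_convex_cone_hull by auto

lemma rational_cone_polyhedron: "rational_cone C \<Longrightarrow> polyhedron C"
  unfolding rational_cone_def cone_gen_eq_hull using polyhedron_convex_cone_hull by (metis finite_imageI)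

text \<open>For the scaling, \<open>z\<close> lies between 0 and s z when s > 1. For the summands,
  \<open>x + y\<close> is the midpoint of 2 x and 2 y, so these endpoints lie in the face.\<close>

lemma convex_cone_face:
  assumes C: "convex_cone C" and F: "F face_of C" "F \<noteq> {}"
  shows "convex_cone F" "x \<in> C \<Longrightarrow> y \<in> C \<Longrightarrow> x + y \<in> F \<Longrightarrow> x \<in> F"
proof -
  have sub: "F \<subseteq> C" using F(1) by (rule face_of_imp_subset)
  have seg: "a \<in> F \<and> b \<in> F" if "a \<in> C" "b \<in> C" "x \<in> F" "x \<in> open_segment a b" for a b x
    using F(1) that unfolding face_of_def by blast
  have scale: "t *\<^sub>R z \<in> F" if z: "z \<in> F" and t: "0 \<le> t" for z and t :: real
  proof (cases "z = 0 \<or> t = 1")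
    case False
    have zC: "z \<in> C" using z sub by auto
    have two: "0 \<in> F \<and> s *\<^sub>R z \<in> F" if s: "1 < s" for s :: real
    proof (rule seg[OF _ _ z])
      show "0 \<in> C" using convex_cone_contains_0[OF C] .
      show "s *\<^sub>R z \<in> C" using convex_cone_scaleR[OF C _ zC] s by simp
      have "z = (1 / s) *\<^sub>R (s *\<^sub>R z)" using s by simp
      thus "z \<in> open_segment 0 (s *\<^sub>R z)" unfolding in_segment using s False
        by (intro conjI exI[of _ "1 / s"]) auto
    qed
    show ?thesis
    proof (cases "1 < t")
      case True thus ?thesis using two by simp
    next
      case False
      have "0 \<in> F" using two[of 2] by simp
      moreover have "convex F" using F(1) by (simp add: face_of_def)
      ultimately have "(1 - t) *\<^sub>R 0 + t *\<^sub>R z \<in> F" using z t False by (intro convexD) auto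
      thus ?thesis by simp
    qed
  qed (use z in auto)
  have conv: "convex F" using F(1) by (simp add: face_of_def)
  show 1: "convex_cone F" unfolding convex_cone_def conic_def
    using F(2) conv scale by auto
  show "x \<in> F" if xy: "x \<in> C" "y \<in> C" "x + y \<in> F"
  proof (cases "x = y")
    case True
    then have "x = (1/2) *\<^sub>R (x + y)" by (simp add: scaleR_2[symmetric])
    thus ?thesis using convex_cone_scaleR[OF 1 _ xy(3), of "1/2"] by simp
  next
    case False
    have "(1/2) *\<^sub>R (2 *\<^sub>R x) + (1/2) *\<^sub>R (2 *\<^sub>R y) = x + y" by simp
    then have "x + y \<in> open_segment (2 *\<^sub>R x) (2 *\<^sub>R y)" unfolding in_segment using False
      by (intro conjI exI[of _ "1/2"]) auto
    then have "2 *\<^sub>R x \<in> F" using seg[of "2 *\<^sub>R x" "2 *\<^sub>R y" "x + y"] xy convex_cone_scaleR[OF C, of 2] by auto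
    thus ?thesis using convex_cone_scaleR[OF 1, of "1/2" "2 *\<^sub>R x"] by simp
  qed
qed

lemma aff_dim_convex_cone: "convex_cone C \<Longrightarrow> aff_dim C = int (dim C)"
  using convex_cone_contains_0 by (intro aff_dim_zero hull_inc)

lemma rel_interior_cone_diff:
  fixes C :: "'a::euclidean_space set"
  assumes C: "convex_cone C" and z: "z \<in> rel_interior C" and a: "a \<in> C"
  shows "\<exists>t>0. z - t *\<^sub>R a \<in> C"
proof -
  obtain r where r: "r > 0" "ball z r \<inter> affine hull C \<subseteq> C" and zC: "z \<in> C"
    using z unfolding mem_rel_interior_ball by auto
  define t where "t = r / (2 * (norm a + 1))"
  have t: "t > 0" unfolding t_def using r(1) by (simp add: add_nonneg_pos)
  have "t * norm a < r"
  proof -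
    obtain n where n: "n = norm a" "0 \<le> n" by simp
    have "n < 2 * (n + 1)" using n(2) by simp
    then have "n / (2 * (n + 1)) < 1" using n(2) by (simp add: divide_less_eq)
    then have "r * (n / (2 * (n + 1))) < r * 1" using r(1) by (intro mult_strict_left_mono)
    thus ?thesis by (simp add: t_def n(1))
  qed
  then have 1: "z - t *\<^sub>R a \<in> ball z r" using t by (simp add: dist_norm)
  have "affine hull C = span C" using convex_cone_contains_0[OF C] by (intro affine_hull_span_0 hull_inc)
  then have 2: "z - t *\<^sub>R a \<in> affine hull C" using zC a by (auto intro: span_diff span_scale span_base)
  have "z - t *\<^sub>R a \<in> C" using r(2) IntI[OF 1 2] by (rule subsetD)
  thus ?thesis using t by blast
qed

text \<open>From a point of the relative interior one could move a little in the direction of -a. So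
  \<open>z\<close> is in the relative boundary, which for a polyhedron is the union of its
  facets.\<close>

lemma cone_boundary_facet:
  assumes C: "rational_cone C" and z: "z \<in> C" "a \<in> C" "\<And>t. t > 0 \<Longrightarrow> z - t *\<^sub>R a \<notin> C"
  shows "\<exists>F. F facet_of C \<and> z \<in> F"
proof -
  have poly: "polyhedron C" using rational_cone_polyhedron[OF C] .
  have "z \<notin> rel_interior C" using rel_interior_cone_diff[OF rational_cone_convex_cone[OF C] _ z(2)] z(3) by blast
  then have "z \<in> rel_frontier C" using z(1) polyhedron_imp_closed[OF poly] by (simp add: rel_frontier_def)
  thus ?thesis using rel_frontier_of_polyhedron[OF poly] by auto
qed

text \<open>The real coefficients are approximated simultaneously by fractions with common
  denominator \<open>q\<close>. The error vector is integral, and the quality of the approximation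
  forces its entries below 1 in absolute value, so it vanishes.\<close>

lemma int_combination_of_real:
  fixes \<Gamma> :: "(int ^ 'n::finite) set"
  assumes fin: "finite \<Gamma>" and c: "\<And>g. g \<in> \<Gamma> \<Longrightarrow> 0 \<le> c g" and w: "rvec w = (\<Sum>g\<in>\<Gamma>. c g *\<^sub>R rvec g)"
  shows "\<exists>(q::nat) (p :: _ \<Rightarrow> nat). 0 < q \<and> of_nat q * w = (\<Sum>g\<in>\<Gamma>. of_nat (p g) * g)"
proof -
  obtain f and n :: nat where f: "bij_betw f {..<n} \<Gamma>"
    using ex_bij_betw_nat_finite[OF fin] by (auto simp: atLeast0LessThan)
  \<comment> \<open>One more than the sum of the absolute values of all entries: errors below 1 / N
    in the coefficients then add up to at most (N - 1) / N in each entry.\<close>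
  define N where "N = nat (\<Sum>g\<in>\<Gamma>. \<Sum>k\<in>UNIV. \<bar>g $ k\<bar>) + 1"
  have Npos: "N > 0" by (simp add: N_def)
  have N: "real N = (\<Sum>g\<in>\<Gamma>. \<Sum>k\<in>UNIV. \<bar>real_of_int (g $ k)\<bar>) + 1"
  proof -
    have "0 \<le> (\<Sum>g\<in>\<Gamma>. \<Sum>k\<in>UNIV. \<bar>g $ k\<bar>)" by (intro sum_nonneg) auto
    thus ?thesis unfolding N_def by (simp add: of_nat_nat)
  qed
  obtain q p where q: "0 < q" "\<And>i. i < n \<Longrightarrow> \<bar>of_int q * c (f i) - of_int (p i)\<bar> < 1 / N"
    using Dirichlet_approx_simult[OF Npos, of n "\<lambda>i. c (f i)"] by metis
  define P where "P g = p (the_inv_into {..<n} f g)" for g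
  have P: "\<bar>of_int q * c g - of_int (P g)\<bar> < 1 / N" if g: "g \<in> \<Gamma>" for g
  proof -
    obtain i where i: "i < n" "g = f i" using f g unfolding bij_betw_def by auto
    then have "P g = p i" using f unfolding P_def bij_betw_def by (simp add: the_inv_into_f_f)
    thus ?thesis using q(2)[OF i(1)] i(2) by simp
  qed
  have N1: "1 / real N \<le> 1" using Npos by simp
  have P0: "0 \<le> P g" if g: "g \<in> \<Gamma>" for g
  proof -
    have "0 \<le> of_int q * c g" using q(1) c[OF g] by simp
    then have "- 1 < real_of_int (P g)" using P[OF g] N1 by linarith
    thus ?thesis by linarith
  qed
  define err where "err = of_nat (nat q) * w - (\<Sum>g\<in>\<Gamma>. of_nat (nat (P g)) * g)"
  have "rvec err = (\<Sum>g\<in>\<Gamma>. (of_int q * c g - of_int (P g)) *\<^sub>R rvec g)"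
  proof -
    have "rvec err = real (nat q) *\<^sub>R rvec w - (\<Sum>g\<in>\<Gamma>. real (nat (P g)) *\<^sub>R rvec g)"
      unfolding err_def by (simp add: rvec_diff rvec_of_nat rvec_sum)
    also have "\<dots> = (\<Sum>g\<in>\<Gamma>. (of_int q * c g) *\<^sub>R rvec g) - (\<Sum>g\<in>\<Gamma>. of_int (P g) *\<^sub>R rvec g)"
      unfolding w using q(1) P0 by (simp add: scaleR_sum_right of_nat_nat)
    finally show ?thesis by (simp add: sum_subtractf scaleR_diff_left)
  qed
  note errv = this
  have "err $ k = 0" for k
  proof -
    have "real_of_int (err $ k) = (\<Sum>g\<in>\<Gamma>. (of_int q * c g - of_int (P g)) * real_of_int (g $ k))"
      using arg_cong[OF errv, of "\<lambda>v. v $ k"] by (simp add: rvec_def)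
    then have "\<bar>real_of_int (err $ k)\<bar> \<le> (\<Sum>g\<in>\<Gamma>. \<bar>(of_int q * c g - of_int (P g)) * real_of_int (g $ k)\<bar>)"
      using sum_abs by metis
    also have "\<dots> \<le> (\<Sum>g\<in>\<Gamma>. 1 / N * (\<Sum>k\<in>UNIV. \<bar>real_of_int (g $ k)\<bar>))"
    proof (rule sum_mono)
      fix g assume g: "g \<in> \<Gamma>"
      have "\<bar>real_of_int (g $ k)\<bar> \<le> (\<Sum>k\<in>UNIV. \<bar>real_of_int (g $ k)\<bar>)" by (intro member_le_sum) auto
      thus "\<bar>(of_int q * c g - of_int (P g)) * real_of_int (g $ k)\<bar> \<le> 1 / N * (\<Sum>k\<in>UNIV. \<bar>real_of_int (g $ k)\<bar>)"
        unfolding abs_mult using P[OF g] by (intro mult_mono) auto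
    qed
    also have "\<dots> = 1 / N * (\<Sum>g\<in>\<Gamma>. \<Sum>k\<in>UNIV. \<bar>real_of_int (g $ k)\<bar>)" by (simp only: sum_distrib_left)
    also have "\<dots> = 1 / N * (real N - 1)" using N by (simp only: add_diff_cancel_right')
    also have "\<dots> = (real N - 1) / N" by simp
    also have "\<dots> < 1" using Npos by simp
    finally show ?thesis by linarith
  qed
  then have "err = 0" by (simp add: vec_eq_iff)
  then have "of_nat (nat q) * w = (\<Sum>g\<in>\<Gamma>. of_nat (nat (P g)) * g)"
    unfolding err_def by (simp only: right_minus_eq)
  thus ?thesis using q(1) by (intro exI[of _ "nat q"] exI[of _ "\<lambda>g. nat (P g)"]) auto
qed

text \<open>\<open>l\<close> is a dual basis for \<open>B\<close>: each \<open>l b\<close> comes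
  from a linear function that is prescribed on the basis and reads off the coordinate of
  \<open>b\<close>.\<close>

lemma max_independent_lattice:
  fixes S :: "(int ^ 'n::finite) set"
  obtains B l where "finite B" "B \<subseteq> S" "rvec ` S \<subseteq> span (rvec ` B)" "card B = dim (rvec ` S)"
    "\<And>b a c. b \<in> B \<Longrightarrow> l b (a + c) = (l b a + l b c :: real)" "\<And>b. b \<in> B \<Longrightarrow> l b b = 1"
    "\<And>b c. b \<in> B \<Longrightarrow> c \<in> B \<Longrightarrow> c \<noteq> b \<Longrightarrow> l b c = 0"
proof -
  obtain V where V: "V \<subseteq> rvec ` S" "independent V" "rvec ` S \<subseteq> span V" "card V = dim (rvec ` S)"
    using basis_exists[of "rvec ` S"] by metis
  have finV: "finite V" using V(2) by (rule independent_imp_finite)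
  define B where "B = {a \<in> S. rvec a \<in> V}"
  have im: "rvec ` B = V" unfolding B_def using V(1) by auto
  have inj: "inj_on rvec B" by (simp add: inj_on_def rvec_inject)
  have fB: "finite B" using finV im inj finite_imageD by blast
  have "\<exists>g. linear g \<and> (\<forall>x\<in>V. g x = (if x = rvec b then 1 else 0 :: real))" for b
    using linear_independent_extend[OF V(2), of "\<lambda>x. if x = rvec b then 1 else 0"] by blast
  then have "\<forall>b. \<exists>g. linear g \<and> (\<forall>x\<in>V. g x = (if x = rvec b then 1 else 0 :: real))" by (rule allI)
  then obtain g where "\<forall>b. linear (g b) \<and> (\<forall>x\<in>V. g b x = (if x = rvec b then 1 else 0 :: real))"
    by (rule choice[THEN exE])
  then have g: "linear (g b)" "x \<in> V \<Longrightarrow> g b x = (if x = rvec b then 1 else 0 :: real)" for b x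
    by simp_all
  show ?thesis
  proof (rule that[of B "\<lambda>b a. g b (rvec a)"])
    show "card B = dim (rvec ` S)" using card_image[OF inj] im V(4) by simp
    show "g b (rvec (a + c)) = g b (rvec a) + g b (rvec c)" for a b c
      using g(1)[of b] by (simp add: rvec_add linear_add)
    show "g b (rvec b) = 1" if "b \<in> B" for b using g(2)[of "rvec b" b] that by (auto simp: B_def)
    show "g b (rvec c) = 0" if "b \<in> B" "c \<in> B" "c \<noteq> b" for b c
      using g(2)[of "rvec c" b] that by (auto simp: B_def rvec_inject)
    show "rvec ` S \<subseteq> span (rvec ` B)" using V(3) im by simp
  qed (use fB in \<open>auto simp: B_def\<close>)
qed

section \<open>Lattice points of rational cones\<close>

lemma finite_lattice_box: "finite {a :: int ^ 'n::finite. \<forall>i. \<bar>real_of_int (a $ i)\<bar> \<le> r i}"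
proof -
  define s where "s = nat \<lceil>Max (range r)\<rceil>"
  have s: "r i \<le> real s" for i
  proof -
    have "r i \<le> Max (range r)" by simp
    thus ?thesis unfolding s_def using real_nat_ceiling_ge[of "Max (range r)"] by linarith
  qed
  have "finite {a :: int ^ 'n. \<forall>i. \<bar>a $ i\<bar> \<le> int s}"
    using lattice_box_card[of "{a :: int ^ 'n. \<forall>i. \<bar>a $ i\<bar> \<le> int s}" s UNIV] by auto
  moreover have "{a :: int ^ 'n. \<forall>i. \<bar>real_of_int (a $ i)\<bar> \<le> r i} \<subseteq> {a. \<forall>i. \<bar>a $ i\<bar> \<le> int s}"
  proof safe
    fix a :: "int ^ 'n" and i assume "\<forall>i. \<bar>real_of_int (a $ i)\<bar> \<le> r i"
    then have "\<bar>real_of_int (a $ i)\<bar> \<le> real s" using s[of i] by (meson order_trans)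
    thus "\<bar>a $ i\<bar> \<le> int s" by linarith
  qed
  ultimately show ?thesis by (rule finite_subset[rotated])
qed

lemma cone_combination_round:
  fixes G :: "(int ^ 'n::finite) set"
  assumes "finite G" "\<forall>g\<in>G. 0 \<le> c g"
  shows "\<exists>(k :: int ^ 'n \<Rightarrow> nat) (d :: int ^ 'n \<Rightarrow> real). (\<forall>g\<in>G. 0 \<le> d g \<and> d g \<le> 1) \<and>
    (\<Sum>g\<in>G. c g *\<^sub>R rvec g) = rvec (\<Sum>g\<in>G. of_nat (k g) * g) + (\<Sum>g\<in>G. d g *\<^sub>R rvec g)"
proof -
  define k where "k g = nat \<lfloor>c g\<rfloor>" for g
  define d where "d g = c g - real (k g)" for g
  have kc: "real (k g) \<le> c g" "c g \<le> real (k g) + 1" if "g \<in> G" for g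
    using bspec[OF assms(2) that] unfolding k_def by linarith+
  show ?thesis
  proof (intro exI[of _ k] exI[of _ d] conjI ballI)
    show "0 \<le> d g" "d g \<le> 1" if "g \<in> G" for g using kc[OF that] by (simp_all add: d_def)
    have "rvec (\<Sum>g\<in>G. of_nat (k g) * g) + (\<Sum>g\<in>G. d g *\<^sub>R rvec g) = (\<Sum>g\<in>G. real (k g) *\<^sub>R rvec g + d g *\<^sub>R rvec g)"
      by (simp add: rvec_sum rvec_of_nat sum.distrib)
    also have "\<dots> = (\<Sum>g\<in>G. c g *\<^sub>R rvec g)" by (simp add: d_def flip: scaleR_add_left)
    finally show "(\<Sum>g\<in>G. c g *\<^sub>R rvec g) = rvec (\<Sum>g\<in>G. of_nat (k g) * g) + (\<Sum>g\<in>G. d g *\<^sub>R rvec g)" by simp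
  qed
qed

lemma box_combination_bound:
  fixes G :: "(int ^ 'n::finite) set"
  assumes "\<forall>g\<in>G. 0 \<le> d g \<and> d g \<le> 1"
  shows "\<bar>(\<Sum>g\<in>G. d g *\<^sub>R rvec g) $ i\<bar> \<le> (\<Sum>g\<in>G. \<bar>real_of_int (g $ i)\<bar>)"
proof -
  have "\<bar>(\<Sum>g\<in>G. d g *\<^sub>R rvec g) $ i\<bar> = \<bar>\<Sum>g\<in>G. d g * real_of_int (g $ i)\<bar>" by (simp add: rvec_def)
  also have "\<dots> \<le> (\<Sum>g\<in>G. \<bar>d g * real_of_int (g $ i)\<bar>)" by (rule sum_abs)
  also have "\<dots> \<le> (\<Sum>g\<in>G. \<bar>real_of_int (g $ i)\<bar>)"
  proof (rule sum_mono)
    fix g assume "g \<in> G"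
    then show "\<bar>d g * real_of_int (g $ i)\<bar> \<le> \<bar>real_of_int (g $ i)\<bar>"
      using bspec[OF assms, of g] by (simp add: abs_mult mult_left_le_one_le)
  qed
  finally show ?thesis .
qed

lemma rational_coneE:
  assumes "rational_cone C"
  obtains G where "finite G" "C = {\<Sum>g\<in>G. c g *\<^sub>R rvec g | c. \<forall>g\<in>G. 0 \<le> c g}"
proof -
  obtain G where G: "finite G" "C = cone_gen (rvec ` G)" using assms unfolding rational_cone_def by auto
  have inj: "inj_on rvec G" by (simp add: inj_on_def rvec_inject)
  have "C = {\<Sum>v\<in>rvec ` G. c v *\<^sub>R v | c. \<forall>v\<in>rvec ` G. 0 \<le> c v}"
    using cone_gen_finite[of "rvec ` G"] G by simp
  also have "\<dots> = {\<Sum>g\<in>G. c g *\<^sub>R rvec g | c. \<forall>g\<in>G. 0 \<le> c g}"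
  proof safe
    fix c assume "\<forall>v\<in>rvec ` G. 0 \<le> (c v :: real)"
    thus "\<exists>c'. (\<Sum>v\<in>rvec ` G. c v *\<^sub>R v) = (\<Sum>g\<in>G. c' g *\<^sub>R rvec g) \<and> (\<forall>g\<in>G. 0 \<le> c' g)"
      by (intro exI[of _ "\<lambda>g. c (rvec g)"]) (simp add: sum.reindex[OF inj])
  next
    fix c assume c: "\<forall>g\<in>G. 0 \<le> (c g :: real)"
    have "(\<Sum>g\<in>G. c g *\<^sub>R rvec g) = (\<Sum>v\<in>rvec ` G. c (inv_into G rvec v) *\<^sub>R v)"
      unfolding sum.reindex[OF inj] comp_def by (intro sum.cong) (auto simp: inv_into_f_f[OF inj])
    thus "\<exists>c'. (\<Sum>g\<in>G. c g *\<^sub>R rvec g) = (\<Sum>v\<in>rvec ` G. c' v *\<^sub>R v) \<and> (\<forall>v\<in>rvec ` G. 0 \<le> c' v)"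
      using c by (intro exI[of _ "\<lambda>v. c (inv_into G rvec v)"]) (auto simp: inv_into_f_f[OF inj])
  qed
  finally show ?thesis using that G(1) by blast
qed

text \<open>Gordan's lemma: subtracting the integral parts of the coefficients leaves a lattice
  point of the cone with coefficients in [0, 1], and there are only finitely many of these.\<close>

lemma affine_monoid_lattice_points:
  fixes C :: "(real ^ 'n::finite) set"
  assumes "rational_cone C" shows "affine_monoid (lattice_points C)"
proof -
  obtain G where G: "finite G" "C = {\<Sum>g\<in>G. c g *\<^sub>R rvec g | c. \<forall>g\<in>G. 0 \<le> c g}"
    using rational_coneE[OF assms] by blast
  have cc: "convex_cone C" using rational_cone_convex_cone[OF assms] .
  have GC: "rvec g \<in> C" if g: "g \<in> G" for g
  proof -
    have "rvec g = (\<Sum>h\<in>G. (if h = g then 1 else 0) *\<^sub>R rvec h)"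
      using g G(1) by (simp add: if_distrib[of "\<lambda>t. t *\<^sub>R _"] cong: if_cong)
    thus ?thesis unfolding G(2) by (intro CollectI exI[of _ "\<lambda>h. if h = g then 1 else 0"]) auto
  qed
  define K where "K = {a. \<forall>i. \<bar>real_of_int (a $ i)\<bar> \<le> (\<Sum>g\<in>G. \<bar>real_of_int (g $ i)\<bar>)} \<inter> lattice_points C"
  have finK: "finite K" unfolding K_def by (rule finite_Int[OF disjI1[OF finite_lattice_box]])
  have GK: "G \<subseteq> K"
  proof
    fix g assume g: "g \<in> G"
    then have "\<bar>real_of_int (g $ i)\<bar> \<le> (\<Sum>g\<in>G. \<bar>real_of_int (g $ i)\<bar>)" for i
      using G(1) by (intro member_le_sum[of g G "\<lambda>g. \<bar>real_of_int (g $ i)\<bar>"]) auto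
    thus "g \<in> K" using GC[OF g] by (simp add: K_def lattice_points_def)
  qed
  have "lattice_points C = {x. \<exists>m :: int ^ 'n \<Rightarrow> nat. x = (\<Sum>g\<in>K. of_nat (m g) * g)}"
  proof
    show "lattice_points C \<subseteq> {x. \<exists>m :: int ^ 'n \<Rightarrow> nat. x = (\<Sum>g\<in>K. of_nat (m g) * g)}"
    proof
      fix a assume "a \<in> lattice_points C"
      then obtain c where c: "rvec a = (\<Sum>g\<in>G. c g *\<^sub>R rvec g)" "\<forall>g\<in>G. 0 \<le> c g"
        unfolding lattice_points_def G(2) by auto
      from cone_combination_round[OF G(1) c(2)]
      obtain k :: "int ^ 'n \<Rightarrow> nat" and d where kd': "\<forall>g\<in>G. 0 \<le> d g \<and> d g \<le> 1"
        "(\<Sum>g\<in>G. c g *\<^sub>R rvec g) = rvec (\<Sum>g\<in>G. of_nat (k g) * g) + (\<Sum>g\<in>G. d g *\<^sub>R rvec g)"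
        by (elim exE conjE)
      have kd: "\<And>g. g \<in> G \<Longrightarrow> 0 \<le> d g \<and> d g \<le> 1"
        "rvec a = rvec (\<Sum>g\<in>G. of_nat (k g) * g) + (\<Sum>g\<in>G. d g *\<^sub>R rvec g)"
        using kd'(1) trans[OF c(1) kd'(2)] by simp_all
      define b where "b = a - (\<Sum>g\<in>G. of_nat (k g) * g)"
      have rb: "rvec b = (\<Sum>g\<in>G. d g *\<^sub>R rvec g)" unfolding b_def rvec_diff kd(2) by simp
      have "rvec b \<in> C" unfolding rb G(2) using kd(1) by blast
      moreover have "\<bar>real_of_int (b $ i)\<bar> \<le> (\<Sum>g\<in>G. \<bar>real_of_int (g $ i)\<bar>)" for i
        using box_combination_bound[OF kd'(1), of i] unfolding rb[symmetric] by (simp add: rvec_def)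
      ultimately have bK: "b \<in> K" by (simp add: K_def lattice_points_def)
      \<comment> \<open>The generators \<open>G\<close> belong to \<open>K\<close> themselves, so
        the integral part and the remainder \<open>b\<close> combine into one coefficient function
        on \<open>K\<close>.\<close>
      define p where "p g = (if g \<in> G then k g else 0) + (if g = b then 1 else 0)" for g
      have "(\<Sum>g\<in>K. of_nat (p g) * g) = (\<Sum>g\<in>K. (if g \<in> G then of_nat (k g) * g else 0) + (if g = b then g else 0))"
        by (intro sum.cong) (auto simp: p_def algebra_simps)
      also have "\<dots> = (\<Sum>g\<in>G. of_nat (k g) * g) + b"
        using finK GK bK by (simp add: sum.distrib sum.inter_restrict[symmetric] Int_absorb1)
      finally have "a = (\<Sum>g\<in>K. of_nat (p g) * g)" by (simp add: b_def)
      thus "a \<in> {x. \<exists>m :: int ^ 'n \<Rightarrow> nat. x = (\<Sum>g\<in>K. of_nat (m g) * g)}" by blast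
    qed
    show "{x. \<exists>m :: int ^ 'n \<Rightarrow> nat. x = (\<Sum>g\<in>K. of_nat (m g) * g)} \<subseteq> lattice_points C"
    proof
      fix x assume "x \<in> {x. \<exists>m :: int ^ 'n \<Rightarrow> nat. x = (\<Sum>g\<in>K. of_nat (m g) * g)}"
      then obtain p :: "int ^ 'n \<Rightarrow> nat" where p: "x = (\<Sum>g\<in>K. of_nat (p g) * g)" by blast
      have "(\<Sum>g\<in>F. real (p g) *\<^sub>R rvec g) \<in> C" if "finite F" "F \<subseteq> K" for F
        using that
      proof (induction F rule: finite_induct)
        case (insert g F)
        then have "rvec g \<in> C" by (auto simp: K_def lattice_points_def)
        thus ?case using insert convex_cone_add[OF cc convex_cone_scaleR[OF cc, of "real (p g)" "rvec g"]] by simp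
      qed (simp add: convex_cone_contains_0[OF cc])
      thus "x \<in> lattice_points C" unfolding p lattice_points_def using finK by (simp add: rvec_sum rvec_of_nat)
    qed
  qed
  thus ?thesis unfolding affine_monoid_def using finK by blast
qed

lemma cone_gen_lattice_points:
  assumes "rational_cone C" shows "cone_gen (rvec ` lattice_points C) = C"
proof
  have cc: "convex_cone C" using rational_cone_convex_cone[OF assms] .
  show "cone_gen (rvec ` lattice_points C) \<subseteq> C" unfolding cone_gen_eq_hull
    by (rule hull_minimal) (use cc in \<open>auto simp: lattice_points_def\<close>)
  obtain G where G: "finite G" "C = cone_gen (rvec ` G)" using assms unfolding rational_cone_def by auto
  have "rvec ` G \<subseteq> C" unfolding G(2) cone_gen_eq_hull by (rule hull_subset)
  then have "G \<subseteq> lattice_points C" by (auto simp: lattice_points_def)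
  then show "C \<subseteq> cone_gen (rvec ` lattice_points C)"
    by (subst G(2)) (simp only: cone_gen_eq_hull, intro hull_mono image_mono)
qed

text \<open>Subtracting generators of \<open>D\<close> moves a witness \<open>y\<close> into a fixed
  box without changing \<open>s\<close>. One lattice point serves at most one \<open>s\<close>: if
  it served s < t, then (t - s) a would be a summand of a point of the face \<open>D\<close>,
  contrary to \<open>a \<notin> D\<close>.\<close>

lemma finite_lattice_levels:
  fixes D :: "(real ^ 'n::finite) set"
  assumes C: "convex_cone C" and D: "rational_cone D" "D face_of C" and a: "a \<in> C" "a \<notin> D"
  shows "finite {s. 0 \<le> s \<and> s \<le> 1 \<and> (\<exists>y. rvec y - v - s *\<^sub>R a \<in> D)}" (is "finite ?L")
proof -
  obtain G where G: "finite G" "D = {\<Sum>g\<in>G. c g *\<^sub>R rvec g | c. \<forall>g\<in>G. 0 \<le> c g}"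
    using rational_coneE[OF D(1)] by blast
  have Dne: "D \<noteq> {}" using convex_cone_nonempty[OF rational_cone_convex_cone[OF D(1)]] .
  have Dcc: "convex_cone D" using rational_cone_convex_cone[OF D(1)] .
  define K :: "(int ^ 'n) set" where
    "K = {y. \<forall>i. \<bar>real_of_int (y $ i)\<bar> \<le> \<bar>v $ i\<bar> + \<bar>a $ i\<bar> + (\<Sum>g\<in>G. \<bar>real_of_int (g $ i)\<bar>)}"
  have finK: "finite K" unfolding K_def by (rule finite_lattice_box)
  have "\<exists>y\<in>K. rvec y - v - s *\<^sub>R a \<in> D" if sL: "s \<in> ?L" for s
  proof -
    obtain y where y: "rvec y - v - s *\<^sub>R a \<in> D" and s: "0 \<le> s" "s \<le> 1" using sL by blast
    then obtain c where c: "rvec y - v - s *\<^sub>R a = (\<Sum>g\<in>G. c g *\<^sub>R rvec g)" "\<forall>g\<in>G. 0 \<le> c g"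
      unfolding G(2) by auto
    from cone_combination_round[OF G(1) c(2)]
    obtain k :: "int ^ 'n \<Rightarrow> nat" and d where kd': "\<forall>g\<in>G. 0 \<le> d g \<and> d g \<le> 1"
      "(\<Sum>g\<in>G. c g *\<^sub>R rvec g) = rvec (\<Sum>g\<in>G. of_nat (k g) * g) + (\<Sum>g\<in>G. d g *\<^sub>R rvec g)"
      by (elim exE conjE)
    have kd: "\<And>g. g \<in> G \<Longrightarrow> 0 \<le> d g \<and> d g \<le> 1"
      "rvec y - v - s *\<^sub>R a = rvec (\<Sum>g\<in>G. of_nat (k g) * g) + (\<Sum>g\<in>G. d g *\<^sub>R rvec g)"
      using kd'(1) trans[OF c(1) kd'(2)] by simp_all
    define y' where "y' = y - (\<Sum>g\<in>G. of_nat (k g) * g)"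
    have e: "rvec y' - v - s *\<^sub>R a = (\<Sum>g\<in>G. d g *\<^sub>R rvec g)"
      unfolding y'_def rvec_diff using kd(2) by (simp add: algebra_simps)
    then have "rvec y' - v - s *\<^sub>R a \<in> D" unfolding G(2) using kd(1) by blast
    moreover have "y' \<in> K" unfolding K_def
    proof (intro CollectI allI)
      fix i
      have "rvec y' = v + s *\<^sub>R a + (\<Sum>g\<in>G. d g *\<^sub>R rvec g)" using e by (simp add: algebra_simps)
      then have "real_of_int (y' $ i) = v $ i + s * a $ i + (\<Sum>g\<in>G. d g *\<^sub>R rvec g) $ i"
        by (simp add: rvec_def vec_eq_iff)
      moreover have "\<bar>s * a $ i\<bar> \<le> \<bar>a $ i\<bar>" using s by (simp add: abs_mult mult_left_le_one_le)
      ultimately show "\<bar>real_of_int (y' $ i)\<bar> \<le> \<bar>v $ i\<bar> + \<bar>a $ i\<bar> + (\<Sum>g\<in>G. \<bar>real_of_int (g $ i)\<bar>)"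
        using box_combination_bound[OF kd'(1), of i] by linarith
    qed
    ultimately show ?thesis by blast
  qed
  note ex = this
  define f where "f s = (SOME y. y \<in> K \<and> rvec y - v - s *\<^sub>R a \<in> D)" for s
  have f: "f s \<in> K \<and> rvec (f s) - v - s *\<^sub>R a \<in> D" if "s \<in> ?L" for s
    unfolding f_def by (rule someI_ex) (use ex[OF that] in blast)
  have lt: False if "s < t" "rvec y - v - s *\<^sub>R a \<in> D" "rvec y - v - t *\<^sub>R a \<in> D" for s t y
  proof -
    have "(t - s) *\<^sub>R a + (rvec y - v - t *\<^sub>R a) \<in> D" using that(2) by (simp add: algebra_simps)
    moreover have "(t - s) *\<^sub>R a \<in> C" using convex_cone_scaleR[OF C _ a(1)] that(1) by simp
    moreover have "rvec y - v - t *\<^sub>R a \<in> C" using that(3) face_of_imp_subset[OF D(2)] by auto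
    ultimately have "(t - s) *\<^sub>R a \<in> D" using convex_cone_face(2)[OF C D(2) Dne] by blast
    then have "(1 / (t - s)) *\<^sub>R ((t - s) *\<^sub>R a) \<in> D"
      using that(1) by (intro convex_cone_scaleR[OF Dcc, of "1 / (t - s)" "(t - s) *\<^sub>R a"]) auto
    thus False using a(2) that(1) by simp
  qed
  have "inj_on f ?L"
  proof (rule inj_onI)
    fix s t assume st: "s \<in> ?L" "t \<in> ?L" "f s = f t"
    show "s = t" using lt[of s t "f s"] lt[of t s "f s"] f[OF st(1)] f[OF st(2)] st(3) by (cases s t rule: linorder_cases) simp_all
  qed
  moreover have "f ` ?L \<subseteq> K" using f by blast
  ultimately show ?thesis using finK inj_on_finite by blast
qed

section \<open>Shellings\<close>

locale fan_ring = monomial_at R kc e cf "M ` \<Sigma>" m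
  for R :: "'a::comm_ring_1 set" and kc :: "'k::field \<Rightarrow> 'a" and e :: "int ^ ('n::finite) \<Rightarrow> 'a"
    and cf and M :: "(real ^ 'n) set \<Rightarrow> (int ^ 'n) set" and \<Sigma> and m +
  fixes B J :: "(int ^ 'n) set" and l :: "int ^ 'n \<Rightarrow> int ^ 'n \<Rightarrow> real"
  assumes fan: "rational_pointed_fan \<Sigma>" and mc: "monoidal_complex \<Sigma> M"
    and B: "finite B" "B \<subseteq> units_at" "rvec ` units_at \<subseteq> span (rvec ` B)" "card B = dim (rvec ` units_at)"
    and J: "J \<subseteq> B" "alg_free J" "b \<in> B - J \<Longrightarrow> \<not> alg_free (insert b J)"
    and l: "b \<in> B \<Longrightarrow> l b (a + c) = l b a + l b c" "b \<in> B \<Longrightarrow> l b b = 1"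
      "b \<in> B \<Longrightarrow> c \<in> B \<Longrightarrow> c \<noteq> b \<Longrightarrow> l b c = 0"
begin

lemma cone_rational: "C \<in> \<Sigma> \<Longrightarrow> rational_cone C"
  using fan by (simp add: rational_pointed_fan_def rational_pointed_cone_def)
lemma cone_cc: "C \<in> \<Sigma> \<Longrightarrow> convex_cone C"
  using cone_rational rational_cone_convex_cone by blast
lemma fan_finite: "finite \<Sigma>" using fan by (simp add: rational_pointed_fan_def)
lemma face_in_fan: "C \<in> \<Sigma> \<Longrightarrow> F \<in> Defs.cone_faces C \<Longrightarrow> F \<in> \<Sigma>"
  using fan by (auto simp: rational_pointed_fan_def)
lemma fan_inter: "C \<in> \<Sigma> \<Longrightarrow> D \<in> \<Sigma> \<Longrightarrow> C \<inter> D \<in> cone_faces C \<and> C \<inter> D \<in> cone_faces D"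
  using fan by (auto simp: rational_pointed_fan_def)
lemma face_mem: "C \<in> \<Sigma> \<Longrightarrow> F \<in> cone_faces C \<Longrightarrow> x \<in> C \<Longrightarrow> y \<in> C \<Longrightarrow> x + y \<in> F \<Longrightarrow> x \<in> F"
  using convex_cone_face(2)[OF cone_cc] by (auto simp: cone_faces_def)
lemma face_sub: "F \<in> cone_faces C \<Longrightarrow> F \<subseteq> C"
  by (auto simp: cone_faces_def dest: face_of_imp_subset)
lemma monoid_affine: "C \<in> \<Sigma> \<Longrightarrow> affine_monoid (M C)" using mc unfolding monoidal_complex_def by blast
lemma monoid_gen: "C \<in> \<Sigma> \<Longrightarrow> cone_gen (rvec ` M C) = C" using mc unfolding monoidal_complex_def by blast
lemma monoid_cone: "C \<in> \<Sigma> \<Longrightarrow> a \<in> M C \<Longrightarrow> rvec a \<in> C"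
proof -
  assume C: "C \<in> \<Sigma>" and a: "a \<in> M C"
  have "rvec a \<in> convex_cone hull (rvec ` M C)" using a by (intro hull_inc imageI)
  thus ?thesis by (simp only: cone_gen_eq_hull[symmetric] monoid_gen[OF C])
qed
lemma monoid_restrict: "C \<in> \<Sigma> \<Longrightarrow> D \<in> \<Sigma> \<Longrightarrow> D \<subseteq> C \<Longrightarrow> M D = {a \<in> M C. rvec a \<in> D}"
  using mc unfolding monoidal_complex_def by blast
lemma monoid_face: "C \<in> \<Sigma> \<Longrightarrow> F \<in> cone_faces C \<Longrightarrow> M F = {a \<in> M C. rvec a \<in> F}"
  by (rule monoid_restrict[OF _ face_in_fan face_sub])
lemma monoid_add: "C \<in> \<Sigma> \<Longrightarrow> a \<in> M C \<Longrightarrow> b \<in> M C \<Longrightarrow> a + b \<in> M C"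
  using fam_add[of "M C"] by auto
lemma monoid_zero: "C \<in> \<Sigma> \<Longrightarrow> 0 \<in> M C" using fam_zero[of "M C"] by auto
lemma monoid_multiple: "C \<in> \<Sigma> \<Longrightarrow> a \<in> M C \<Longrightarrow> of_nat n * a \<in> M C"
  by (induction n) (auto simp: monoid_zero monoid_add distrib_right)
lemma monoid_Int: "C \<in> \<Sigma> \<Longrightarrow> D \<in> \<Sigma> \<Longrightarrow> M C \<inter> M D = M (C \<inter> D)"
proof -
  assume CD: "C \<in> \<Sigma>" "D \<in> \<Sigma>"
  have E: "C \<inter> D \<in> \<Sigma>" using fan_inter[OF CD] face_in_fan[OF CD(1)] by auto
  have "M (C \<inter> D) = {a \<in> M C. rvec a \<in> C \<inter> D}" "M (C \<inter> D) = {a \<in> M D. rvec a \<in> C \<inter> D}"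
    using monoid_restrict[OF CD(1) E] monoid_restrict[OF CD(2) E] by simp_all
  moreover have "a \<in> M C \<Longrightarrow> rvec a \<in> C" "a \<in> M D \<Longrightarrow> rvec a \<in> D" for a
    using monoid_cone[OF CD(1)] monoid_cone[OF CD(2)] by simp_all
  ultimately show ?thesis by blast
qed
lemma monoid_mono: "C \<in> \<Sigma> \<Longrightarrow> D \<in> \<Sigma> \<Longrightarrow> C \<subseteq> D \<Longrightarrow> M C \<subseteq> M D"
proof -
  assume CD: "C \<in> \<Sigma>" "D \<in> \<Sigma>" "C \<subseteq> D"
  show ?thesis unfolding monoid_restrict[OF CD(2,1,3)] by blast
qed
lemma monoid_subset_cone: "C \<in> \<Sigma> \<Longrightarrow> D \<in> \<Sigma> \<Longrightarrow> M C \<subseteq> M D \<Longrightarrow> C \<subseteq> D"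
proof -
  assume CD: "C \<in> \<Sigma>" "D \<in> \<Sigma>" "M C \<subseteq> M D"
  have "convex_cone hull (rvec ` M C) \<subseteq> convex_cone hull (rvec ` M D)" using CD(3) by (intro hull_mono image_mono)
  thus ?thesis by (simp only: cone_gen_eq_hull[symmetric] monoid_gen[OF CD(1)] monoid_gen[OF CD(2)])
qed
lemma monoid_face_closed: "C \<in> \<Sigma> \<Longrightarrow> compat a b \<Longrightarrow> a + b \<in> M C \<Longrightarrow> a \<in> M C \<and> b \<in> M C"
proof -
  assume C: "C \<in> \<Sigma>" and ab: "compat a b" "a + b \<in> M C"
  obtain N where N: "N \<in> M ` \<Sigma>" "a \<in> N" "b \<in> N" using ab(1) by (auto simp: compat_def)
  show ?thesis using fam_face[OF N(1) _ N(2,3), of "M C"] fam_face[OF N(1) _ N(3,2), of "M C"] C ab(2)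
    by (auto simp: add.commute)
qed
lemma compat_monoid: "C \<in> \<Sigma> \<Longrightarrow> a \<in> M C \<Longrightarrow> b \<in> M C \<Longrightarrow> compat a b"
  by (auto simp: compat_def)
lemma dim_monoid: "C \<in> \<Sigma> \<Longrightarrow> dim (rvec ` M C) = dim C"
proof -
  assume C: "C \<in> \<Sigma>"
  have "convex_cone hull (rvec ` M C) \<subseteq> span (rvec ` M C)"
    by (rule hull_minimal) (auto simp: span_base convex_cone_span)
  then have "C \<subseteq> span (rvec ` M C)" by (simp only: cone_gen_eq_hull[symmetric] monoid_gen[OF C])
  then have "dim C \<le> dim (span (rvec ` M C))" by (rule dim_subset)
  then have "dim C \<le> dim (rvec ` M C)" by simp
  moreover have "rvec ` M C \<subseteq> C" using monoid_cone[OF C] by auto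
  then have "dim (rvec ` M C) \<le> dim C" by (rule dim_subset)
  ultimately show ?thesis by simp
qed

text \<open>The sum of the generators, as the algebraic form of an interior point: it lies in no
  proper face, and if its monomial is a unit at \<open>m\<close>, so are all monomials of
  \<open>M C\<close>.\<close>

lemma dominating_element:
  assumes C: "C \<in> \<Sigma>"
  obtains a where "a \<in> M C" "\<forall>c\<in>M C. \<exists>n. \<exists>d\<in>M C. of_nat n * a = c + d"
proof -
  obtain G where G: "finite G" and MG: "M C = {x. \<exists>p :: int ^ 'n \<Rightarrow> nat. x = (\<Sum>g\<in>G. of_nat (p g) * g)}"
    using monoid_affine[OF C] unfolding affine_monoid_def by blast
  have gen: "\<exists>p :: int ^ 'n \<Rightarrow> nat. a = (\<Sum>g\<in>G. of_nat (p g) * g)" if "a \<in> M C" for a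
    using that unfolding MG by blast
  have mem: "(\<Sum>g\<in>G. of_nat (p g) * g) \<in> M C" for p :: "int ^ 'n \<Rightarrow> nat" unfolding MG by blast
  show ?thesis
  proof (rule that[of "\<Sum>g\<in>G. of_nat 1 * g"])
    show "(\<Sum>g\<in>G. of_nat 1 * g) \<in> M C" using mem[of "\<lambda>_. 1"] .
    show "\<forall>c\<in>M C. \<exists>n. \<exists>d\<in>M C. of_nat n * (\<Sum>g\<in>G. of_nat 1 * g) = c + d"
    proof
    fix c assume "c \<in> M C"
    then obtain p :: "int ^ 'n \<Rightarrow> nat" where p: "c = (\<Sum>g\<in>G. of_nat (p g) * g)" using gen[of c] by blast
    define n where "n = (\<Sum>g\<in>G. p g)"
    have pn: "p g \<le> n" if "g \<in> G" for g unfolding n_def using G that by (intro member_le_sum) auto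
    have "of_nat n * (\<Sum>g\<in>G. of_nat 1 * g) = (\<Sum>g\<in>G. of_nat n * g)" by (simp only: sum_distrib_left of_nat_1 mult_1)
    also have "\<dots> = (\<Sum>g\<in>G. of_nat (p g) * g + of_nat (n - p g) * g)"
    proof (rule sum.cong[OF refl])
      fix g assume "g \<in> G"
      then have "n = p g + (n - p g)" using pn by simp
      then have "(of_nat n :: int ^ 'n) = of_nat (p g) + of_nat (n - p g)" by (metis of_nat_add)
      thus "of_nat n * g = of_nat (p g) * g + of_nat (n - p g) * g" by (simp add: distrib_right)
    qed
    finally have "of_nat n * (\<Sum>g\<in>G. of_nat 1 * g) = c + (\<Sum>g\<in>G. of_nat (n - p g) * g)"
      by (simp only: sum.distrib p)
    thus "\<exists>n. \<exists>d\<in>M C. of_nat n * (\<Sum>g\<in>G. of_nat 1 * g) = c + d" using mem[of "\<lambda>g. n - p g"] by blast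
    qed
  qed
qed

lemma dominating_unit:
  assumes C: "C \<in> \<Sigma>" and a: "a \<in> M C" "\<forall>c\<in>M C. \<exists>n. \<exists>d\<in>M C. of_nat n * a = c + d" and u: "a \<in> units_at"
  shows "M C \<subseteq> units_at"
proof
  fix c assume c: "c \<in> M C"
  then obtain n d where nd: "d \<in> M C" "of_nat n * a = c + d" using a(2) by blast
  have "of_nat n * a \<in> units_at" using units_at_multiple[OF u] by simp
  thus "c \<in> units_at" using units_at_summand[OF compat_monoid[OF C c nd(1)]] nd(2) by simp
qed

lemma dominating_not_in_face:
  assumes C: "C \<in> \<Sigma>" and a: "a \<in> M C" "\<forall>c\<in>M C. \<exists>n. \<exists>d\<in>M C. of_nat n * a = c + d"
    and F: "F \<in> cone_faces C" "rvec a \<in> F"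
  shows "F = C"
proof -
  have Fcc: "convex_cone F" using cone_cc[OF face_in_fan[OF C F(1)]] .
  have "rvec c \<in> F" if c: "c \<in> M C" for c
  proof -
    obtain n d where nd: "d \<in> M C" "of_nat n * a = c + d" using a(2) c by blast
    have "rvec c + rvec d = real n *\<^sub>R rvec a" using nd(2) by (simp flip: rvec_add rvec_of_nat)
    also have "\<dots> \<in> F" using convex_cone_scaleR[OF Fcc _ F(2)] by simp
    finally show ?thesis using face_mem[OF C F(1) monoid_cone[OF C c] monoid_cone[OF C nd(1)]] by simp
  qed
  then have "M C \<subseteq> M F" unfolding monoid_face[OF C F(1)] by blast
  then have "C \<subseteq> F" by (rule monoid_subset_cone[OF C face_in_fan[OF C F(1)]])
  thus ?thesis using face_sub[OF F(1)] by auto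
qed

lemma card_base: "card (B - J) = card B - card J" "card J \<le> card B"
  using B(1) J(1) by (auto simp: card_Diff_subset finite_subset card_mono)

lemma set_depth_units_dim: "convex_in Y \<Longrightarrow> set_depth (card B - card J) Y"
  using set_depth_base[of B J l Y, OF B(1,2) J l] card_base by simp

lemma units_dim_le: "C \<in> \<Sigma> \<Longrightarrow> units_at \<subseteq> M C \<Longrightarrow> card B \<le> dim C"
  using dim_subset[of "rvec ` units_at" C] monoid_cone[of C] B(4) by auto

text \<open>What a shelling guarantees about every facet, be it the first or a later one; in this
  form it can be assumed of a single cone.\<close>

definition shelled_boundary :: "nat \<Rightarrow> (real ^ 'n) set \<Rightarrow> bool" where
  "shelled_boundary k C \<longleftrightarrow> k = 0 \<or> (\<exists>Ds. is_shelling (k - 1) (bd_fan C) Ds)"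

text \<open>The properties of the monoids \<open>M C\<close> on which the gluing rests, isolated
  because it is applied to translated cones as well. The fourth condition makes the exponents of
  each cone span a quotient of the module spanned by all of them.\<close>

definition admissible :: "(real ^ 'n) set set \<Rightarrow> ((real ^ 'n) set \<Rightarrow> (int ^ 'n) set) \<Rightarrow> bool" where
  "admissible \<Sigma>' Y \<longleftrightarrow> \<Sigma>' \<subseteq> \<Sigma> \<and> (\<forall>C\<in>\<Sigma>'. cone_faces C \<subseteq> \<Sigma>') \<and> (\<forall>C\<in>\<Sigma>'. convex_in (Y C)) \<and>
     (\<forall>C\<in>\<Sigma>'. \<forall>D\<in>\<Sigma>'. \<forall>y\<in>Y D. \<forall>a. compat a y \<longrightarrow> a + y \<in> Y C \<longrightarrow> y \<in> Y C) \<and>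
     (\<forall>C\<in>\<Sigma>'. \<forall>D\<in>\<Sigma>'. Y C \<inter> Y D = Y (C \<inter> D))"

lemma shelling_set_depth:
  assumes adm: "admissible \<Sigma>' Y"
  shows "(\<And>k' C. k' \<le> k \<Longrightarrow> C \<in> \<Sigma>' \<Longrightarrow> aff_dim C = int k' \<Longrightarrow> shelled_boundary k' C \<Longrightarrow> set_depth (k' - j) (Y C)) \<Longrightarrow>
    is_shelling k \<Sigma>s Cs \<Longrightarrow> \<Sigma>s \<subseteq> \<Sigma>' \<Longrightarrow> r \<le> length Cs \<Longrightarrow> set_depth (k - j) (\<Union>i<r. Y (Cs ! i))"
proof (induction k arbitrary: \<Sigma>s Cs r)
  case 0
  thus ?case by (simp add: set_depth_zero)
next
  case (Suc k)
  have adm1: "\<Sigma>' \<subseteq> \<Sigma>" "\<And>C. C \<in> \<Sigma>' \<Longrightarrow> cone_faces C \<subseteq> \<Sigma>'" "\<And>C. C \<in> \<Sigma>' \<Longrightarrow> convex_in (Y C)"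
    "\<And>C D y a. C \<in> \<Sigma>' \<Longrightarrow> D \<in> \<Sigma>' \<Longrightarrow> y \<in> Y D \<Longrightarrow> compat a y \<Longrightarrow> a + y \<in> Y C \<Longrightarrow> y \<in> Y C"
    "\<And>C D. C \<in> \<Sigma>' \<Longrightarrow> D \<in> \<Sigma>' \<Longrightarrow> Y C \<inter> Y D = Y (C \<inter> D)"
    using adm unfolding admissible_def by blast+
  have mono: "Y C \<subseteq> Y D" if "C \<in> \<Sigma>'" "D \<in> \<Sigma>'" "C \<subseteq> D" for C D
    using adm1(5)[OF that(1,2)] that(3) by (auto simp: Int_absorb2)
  have sh: "pure_fan (Suc k) \<Sigma>s" "set Cs = facets \<Sigma>s"
    and sh0: "Cs \<noteq> [] \<Longrightarrow> \<exists>Ds. is_shelling k (bd_fan (Cs ! 0)) Ds"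
    and shj: "\<And>j. 0 < j \<Longrightarrow> j < length Cs \<Longrightarrow> \<exists>Ds r. is_shelling k (bd_fan (Cs ! j)) Ds \<and> 1 \<le> r \<and> r \<le> length Ds \<and>
             (\<Union>i<j. cone_faces (Cs ! i) \<inter> cone_faces (Cs ! j)) = (\<Union>l<r. cone_faces (Ds ! l))"
    using Suc.prems(2) unfolding is_shelling.simps(2) by blast+
  note H = Suc.prems(1) and IHk = Suc.IH
  have CsS: "Cs ! i \<in> \<Sigma>'" "aff_dim (Cs ! i) = int (Suc k)" if "i < length Cs" for i
  proof -
    have "Cs ! i \<in> facets \<Sigma>s" using sh(2) that by (metis nth_mem)
    thus "Cs ! i \<in> \<Sigma>'" "aff_dim (Cs ! i) = int (Suc k)"
      using Suc.prems(3) sh(1) unfolding pure_fan_def facets_def by auto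
  qed
  show ?case using Suc.prems(4)
  proof (induction r)
    case 0
    thus ?case by (simp add: set_depth_empty)
  next
    case (Suc r)
    have r: "r < length Cs" using Suc.prems by simp
    let ?C = "Cs ! r"
    have shb: "shelled_boundary (Suc k) ?C"
    proof (cases "r = 0")
      case True
      thus ?thesis using sh0 r unfolding shelled_boundary_def by auto
    next
      case False
      thus ?thesis using shj[of r] r unfolding shelled_boundary_def by auto
    qed
    have dC: "set_depth (Suc k - j) (Y ?C)" by (rule H[OF order_refl CsS[OF r] shb])
    define V where "V = (\<Union>i<r. Y (Cs ! i))"
    have W: "(\<Union>i<Suc r. Y (Cs ! i)) = V \<union> Y ?C" unfolding V_def by (auto simp: less_Suc_eq)
    have IHV: "set_depth (Suc k - j) V" using Suc.IH r unfolding V_def by simp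
    have VD: "\<exists>D\<in>\<Sigma>'. y \<in> Y D \<and> Y D \<subseteq> V" if y: "y \<in> V" for y
    proof -
      obtain i where "i < r" "y \<in> Y (Cs ! i)" using y unfolding V_def by auto
      thus ?thesis using CsS(1)[of i] r unfolding V_def by (intro bexI[of _ "Cs ! i"]) auto
    qed
    have CS: "?C \<in> \<Sigma>'" using CsS(1)[OF r] .
    have memD: "\<exists>D\<in>\<Sigma>'. y \<in> Y D \<and> Y D \<subseteq> V \<union> Y ?C" if y: "y \<in> V \<union> Y ?C" for y
      using y VD[of y] CS by blast
    have convW: "convex_in (V \<union> Y ?C)" unfolding convex_in_def
    proof (intro conjI allI impI)
      show "V \<union> Y ?C \<subseteq> U"
      proof
        fix y assume "y \<in> V \<union> Y ?C"
        then obtain D where "D \<in> \<Sigma>'" "y \<in> Y D" using memD by blast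
        thus "y \<in> U" using adm1(3)[of D] unfolding convex_in_def by blast
      qed
      fix y a b assume y: "y \<in> V \<union> Y ?C" "compat a y" "compat b (a + y)" "b + (a + y) \<in> V \<union> Y ?C"
      obtain D where D: "D \<in> \<Sigma>'" "y \<in> Y D" using memD[OF y(1)] by blast
      obtain E where E: "E \<in> \<Sigma>'" "b + (a + y) \<in> Y E" "Y E \<subseteq> V \<union> Y ?C" using memD[OF y(4)] by blast
      have "compat (a + b) y" using compat_assoc(1)[OF y(2,3)] .
      moreover have "(a + b) + y \<in> Y E" using E(2) by (simp add: algebra_simps)
      ultimately have "y \<in> Y E" using adm1(4)[OF E(1) D(1,2)] by blast
      then have "a + y \<in> Y E" using adm1(3)[OF E(1)] y(2,3) E(2) unfolding convex_in_def by blast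
      thus "a + y \<in> V \<union> Y ?C" using E(3) by blast
    qed
    have up: "up_in (Y ?C - V) (V \<union> Y ?C)" "up_in (Y ?C - V) (Y ?C)"
    proof -
      have *: "a + y \<notin> V" if y: "y \<in> Y ?C - V" "compat a y" for a y
      proof
        assume "a + y \<in> V"
        then obtain D where D: "D \<in> \<Sigma>'" "a + y \<in> Y D" "Y D \<subseteq> V" using VD by blast
        have "y \<in> Y D" using adm1(4)[OF D(1) CS _ y(2) D(2)] y(1) by blast
        thus False using D(3) y(1) by blast
      qed
      show "up_in (Y ?C - V) (V \<union> Y ?C)" "up_in (Y ?C - V) (Y ?C)" unfolding up_in_def using * by blast+
    qed
    have "set_depth (Suc k - j) (Y ?C - V)"
    proof (rule set_depth_sub[OF adm1(3)[OF CS] up(2) dC])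
      have e: "Y ?C - (Y ?C - V) = V \<inter> Y ?C" by blast
      have d: "Suc k - j - 1 = k - j" by simp
      show "set_depth (Suc k - j - 1) (Y ?C - (Y ?C - V))"
      proof (cases "r = 0")
        case True
        thus ?thesis unfolding e V_def by (simp add: set_depth_empty)
      next
        case False
        obtain Ds t where Ds: "is_shelling k (bd_fan ?C) Ds" "t \<le> length Ds"
          "(\<Union>i<r. cone_faces (Cs ! i) \<inter> cone_faces ?C) = (\<Union>l<t. cone_faces (Ds ! l))"
          using shj[of r] False r by blast
        have bd: "bd_fan ?C \<subseteq> \<Sigma>'" using adm1(2)[OF CS] by (auto simp: bd_fan_def)
        have "set_depth (k - j) (\<Union>i<t. Y (Ds ! i))"
          by (rule IHk[OF _ Ds(1) bd Ds(2)])
            (use H in simp)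
        \<comment> \<open>The first \<open>t\<close> members of \<open>Ds\<close>, with their faces,
          are exactly the faces shared with earlier cones; the common exponents with
          \<open>Cs ! i\<close> belong to the shared face
          \<open>Cs ! i \<inter> Cs ! r\<close>.\<close>
        moreover have "(\<Union>i<t. Y (Ds ! i)) = V \<inter> Y ?C"
        proof
          show "(\<Union>i<t. Y (Ds ! i)) \<subseteq> V \<inter> Y ?C"
          proof
            fix y assume "y \<in> (\<Union>i<t. Y (Ds ! i))"
            then obtain q where q: "q < t" "y \<in> Y (Ds ! q)" by auto
            have "is_shelling k (bd_fan ?C) Ds" by (rule Ds(1))
            then have "set Ds = facets (bd_fan ?C)" by (cases k) auto
            then have "Ds ! q \<in> bd_fan ?C" using q(1) Ds(2) unfolding facets_def by (metis (no_types, lifting) mem_Collect_eq nth_mem order_less_le_trans)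
            then have DqS: "Ds ! q \<in> \<Sigma>'" "Ds ! q \<in> cone_faces ?C" using bd by (auto simp: bd_fan_def)
            have "Ds ! q \<in> cone_faces (Ds ! q)" using DqS(2) by (auto simp: cone_faces_def face_of_refl_eq dest: face_of_imp_convex)
            then obtain i where i: "i < r" "Ds ! q \<in> cone_faces (Cs ! i)" using Ds(3) q(1) by blast
            have iS: "Cs ! i \<in> \<Sigma>'" using CsS(1)[of i] i(1) r by simp
            have "y \<in> Y (Cs ! i)" using mono[OF DqS(1) iS face_sub[OF i(2)]] q(2) by blast
            moreover have "y \<in> Y ?C" using mono[OF DqS(1) CS face_sub[OF DqS(2)]] q(2) by blast
            ultimately show "y \<in> V \<inter> Y ?C" unfolding V_def using i(1) by blast
          qed
          show "V \<inter> Y ?C \<subseteq> (\<Union>i<t. Y (Ds ! i))"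
          proof
            fix y assume y: "y \<in> V \<inter> Y ?C"
            then obtain i where i: "i < r" "y \<in> Y (Cs ! i)" unfolding V_def by auto
            have iS: "Cs ! i \<in> \<Sigma>'" using CsS(1)[of i] i(1) r by simp
            let ?E = "Cs ! i \<inter> ?C"
            have yE: "y \<in> Y ?E" using adm1(5)[OF iS CS] i(2) y by blast
            have "?E \<in> cone_faces (Cs ! i) \<inter> cone_faces ?C" using fan_inter[of "Cs ! i" ?C] iS CS adm1(1) by blast
            then obtain q where q: "q < t" "?E \<in> cone_faces (Ds ! q)" using Ds(3) i(1) by blast
            have "set Ds = facets (bd_fan ?C)" using Ds(1) by (cases k) auto
            then have "Ds ! q \<in> bd_fan ?C" using q(1) Ds(2) unfolding facets_def by (metis (no_types, lifting) mem_Collect_eq nth_mem order_less_le_trans)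
            then have "Ds ! q \<in> \<Sigma>'" using bd by blast
            moreover have "?E \<in> \<Sigma>'" using fan_inter[of "Cs ! i" ?C] iS CS adm1(1,2) by blast
            ultimately have "y \<in> Y (Ds ! q)" using mono[OF _ _ face_sub[OF q(2)]] yE by blast
            thus "y \<in> (\<Union>i<t. Y (Ds ! i))" using q(1) by blast
          qed
        qed
        ultimately show ?thesis unfolding e d by simp
      qed
    qed
    moreover have "V \<union> Y ?C - (Y ?C - V) = V" by blast
    ultimately show ?case unfolding W using set_depth_extension[OF convW up(1)] IHV by simp
  qed
qed

end

section \<open>Depth of the face rings\<close>

context fan_ring begin

text \<open>Let \<open>b0\<close> be the sum of the generators that are units. If b0 - t a stayed in
  \<open>G\<close> for the dominating \<open>a\<close> and some t > 0, a positive multiple of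
  \<open>b0\<close> would be \<open>a\<close> plus an element of \<open>M G\<close>, so
  \<open>a\<close> would be a unit and the units would span dimension \<open>dim G\<close>. Hence
  \<open>b0\<close> lies in a facet, and with it all generators that are units, thus all
  units.\<close>

lemma units_in_facet:
  assumes G: "G \<in> \<Sigma>" and u: "units_at \<subseteq> M G" and d: "card B < dim G"
  shows "\<exists>F. F facet_of G \<and> F \<in> cone_faces G \<and> units_at \<subseteq> M F"
proof -
  obtain a where a: "a \<in> M G" "\<forall>c\<in>M G. \<exists>n. \<exists>d\<in>M G. of_nat n * a = c + d"
    using dominating_element[OF G] by blast
  have a_notin: "a \<notin> units_at"
  proof
    assume "a \<in> units_at"
    then have "M G \<subseteq> units_at" by (rule dominating_unit[OF G a])
    then have "rvec ` M G \<subseteq> rvec ` units_at" by (rule image_mono)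
    then have "dim (rvec ` M G) \<le> card B" unfolding B(4) by (rule dim_subset)
    thus False using d dim_monoid[OF G] by simp
  qed
  obtain \<Gamma> where \<Gamma>: "finite \<Gamma>" "\<Gamma> \<subseteq> M G"
    "\<And>S. 0 \<in> S \<Longrightarrow> (\<And>a b. a \<in> S \<Longrightarrow> b \<in> \<Gamma> \<Longrightarrow> a + b \<in> S) \<Longrightarrow> M G \<subseteq> S"
    by (rule affine_monoidE[OF monoid_affine[OF G]]) blast
  define b0 where "b0 = (\<Sum>g\<in>\<Gamma> \<inter> units_at. of_nat 1 * g)"
  have "b0 \<in> nspan (\<Gamma> \<inter> units_at)" unfolding nspan_def b0_def by (intro CollectI exI[of _ "\<lambda>_. 1"]) simp
  then have b0u: "b0 \<in> units_at" using nspan_units[of "\<Gamma> \<inter> units_at"] \<Gamma>(1) by blast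
  have GG: "convex_cone G" using cone_cc[OF G] .
  have b0G: "rvec b0 \<in> G" using monoid_cone[OF G] b0u u by blast
  have aG: "rvec a \<in> G" using monoid_cone[OF G a(1)] .
  have bd: "rvec b0 - t *\<^sub>R rvec a \<notin> G" if t: "t > 0" for t
  proof
    assume inG: "rvec b0 - t *\<^sub>R rvec a \<in> G"
    obtain n :: nat where n: "1 / t \<le> real n" using real_arch_simple by blast
    then have nt: "1 \<le> real n * t" using t by (simp add: divide_le_eq)
    have "rvec (of_nat n * b0 - a) = real n *\<^sub>R (rvec b0 - t *\<^sub>R rvec a) + (real n * t - 1) *\<^sub>R rvec a"
      by (simp only: rvec_diff rvec_of_nat) (simp add: algebra_simps)
    also have "\<dots> \<in> G" using nt by (intro convex_cone_add[OF GG] convex_cone_scaleR[OF GG] inG aG) auto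
    finally have "rvec (of_nat n * b0 - a) \<in> cone_gen (rvec ` M G)" unfolding monoid_gen[OF G] .
    then obtain T c where T: "finite T" "T \<subseteq> rvec ` M G" "\<forall>v\<in>T. 0 \<le> c v" "rvec (of_nat n * b0 - a) = (\<Sum>v\<in>T. c v *\<^sub>R v)"
      unfolding cone_gen_def by blast
    define T' where "T' = {g \<in> M G. rvec g \<in> T}"
    have im: "rvec ` T' = T" using T(2) unfolding T'_def by blast
    have inj: "inj_on rvec T'" by (simp add: inj_on_def rvec_inject)
    have fT: "finite T'" using T(1) im inj finite_imageD by blast
    have "rvec (of_nat n * b0 - a) = (\<Sum>g\<in>T'. c (rvec g) *\<^sub>R rvec g)"
      unfolding T(4) im[symmetric] by (simp add: sum.reindex[OF inj])
    moreover have "0 \<le> c (rvec g)" if "g \<in> T'" for g using T(3) that unfolding T'_def by blast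
    \<comment> \<open>Membership in the cone yields only real coefficients; a positive multiple has
      natural ones and therefore lies in the monoid.\<close>
    ultimately obtain q :: nat and p :: "_ \<Rightarrow> nat" where q: "0 < q" "of_nat q * (of_nat n * b0 - a) = (\<Sum>g\<in>T'. of_nat (p g) * g)"
      using int_combination_of_real[OF fT, of "\<lambda>g. c (rvec g)" "of_nat n * b0 - a"] by blast
    define w where "w = (\<Sum>g\<in>T'. of_nat (p g) * g)"
    have wM: "w \<in> M G"
    proof -
      have "(\<Sum>g\<in>F. of_nat (p g) * g) \<in> M G" if "finite F" "F \<subseteq> T'" for F
        using that
      proof (induction F rule: finite_induct)
        case (insert x F)
        have "x \<in> M G" using insert.prems unfolding T'_def by blast
        then have "of_nat (p x) * x + (\<Sum>g\<in>F. of_nat (p g) * g) \<in> M G"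
          using insert by (intro monoid_add[OF G] monoid_multiple[OF G]) auto
        thus ?case using insert.hyps by simp
      qed (simp add: monoid_zero[OF G])
      thus ?thesis unfolding w_def using fT by blast
    qed
    obtain q' where q': "q = Suc q'" using q(1) gr0_implies_Suc by blast
    have "of_nat q * (of_nat n * b0) = of_nat q * (of_nat n * b0 - a) + of_nat q * a" by (simp add: algebra_simps)
    also have "\<dots> = a + (of_nat q' * a + w)" unfolding q(2) w_def[symmetric] by (simp add: q' algebra_simps)
    finally have "of_nat q * (of_nat n * b0) = a + (of_nat q' * a + w)" .
    moreover have "of_nat q * (of_nat n * b0) \<in> units_at" using units_at_multiple b0u by blast
    moreover have "of_nat q' * a + w \<in> M G" by (intro monoid_add[OF G] monoid_multiple[OF G] a(1) wM)
    ultimately have "a \<in> units_at" using units_at_summand[OF compat_monoid[OF G a(1)]] by simp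
    thus False using a_notin by simp
  qed
  obtain F where F: "F facet_of G" "rvec b0 \<in> F"
    using cone_boundary_facet[OF cone_rational[OF G] b0G aG bd] by blast
  have Ff: "F \<in> cone_faces G" using F by (auto simp: cone_faces_def facet_of_def)
  have Fcc: "convex_cone F" using cone_cc[OF face_in_fan[OF G Ff]] .
  have gF: "rvec g \<in> F" if g: "g \<in> \<Gamma> \<inter> units_at" for g
  proof -
    have fin: "finite (\<Gamma> \<inter> units_at)" using \<Gamma>(1) by simp
    have "b0 = g + (\<Sum>h\<in>\<Gamma> \<inter> units_at - {g}. of_nat 1 * h)"
      unfolding b0_def using sum.remove[OF fin g, of "\<lambda>h. of_nat 1 * h"] by simp
    moreover have "(\<Sum>h\<in>\<Gamma> \<inter> units_at - {g}. of_nat 1 * h) \<in> nspan (\<Gamma> \<inter> units_at - {g})"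
      unfolding nspan_def by (intro CollectI exI[of _ "\<lambda>_. 1"]) simp
    then have "(\<Sum>h\<in>\<Gamma> \<inter> units_at - {g}. of_nat 1 * h) \<in> units_at"
      using nspan_units[of "\<Gamma> \<inter> units_at - {g}"] fin by blast
    then have "rvec (\<Sum>h\<in>\<Gamma> \<inter> units_at - {g}. of_nat 1 * h) \<in> G" using monoid_cone[OF G] u by blast
    moreover have "rvec g \<in> G" using monoid_cone[OF G] g u by blast
    ultimately show ?thesis using face_mem[OF G Ff] F(2) by (metis rvec_add)
  qed
  have "M G \<subseteq> {x \<in> M G. x \<in> units_at \<longrightarrow> rvec x \<in> F}"
  proof (rule \<Gamma>(3))
    show "0 \<in> {x \<in> M G. x \<in> units_at \<longrightarrow> rvec x \<in> F}"
      using monoid_zero[OF G] convex_cone_contains_0[OF Fcc] by (simp add: rvec_zero)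
    fix x b assume x: "x \<in> {x \<in> M G. x \<in> units_at \<longrightarrow> rvec x \<in> F}" and b: "b \<in> \<Gamma>"
    have xb: "x \<in> M G" "b \<in> M G" using x b \<Gamma>(2) by auto
    have "rvec (x + b) \<in> F" if un: "x + b \<in> units_at"
    proof -
      have "x \<in> units_at" using units_at_summand[OF compat_monoid[OF G xb] un] .
      moreover have "b \<in> units_at" using units_at_summand[OF compat_monoid[OF G xb(2,1)]] un by (simp add: add.commute)
      ultimately show ?thesis using x gF b convex_cone_add[OF Fcc] by (simp add: rvec_add)
    qed
    thus "x + b \<in> {x \<in> M G. x \<in> units_at \<longrightarrow> rvec x \<in> F}" using monoid_add[OF G xb] by blast
  qed
  then have "units_at \<subseteq> M F" unfolding monoid_face[OF G Ff] using u by blast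
  thus ?thesis using F(1) Ff by blast
qed

lemma killed_face_ring:
  assumes C: "C \<in> \<Sigma>" and u: "\<not> units_at \<subseteq> M C"
  shows "set_depth n (M C)"
proof -
  obtain s where s: "s \<in> units_at" "s \<notin> M C" using u by blast
  have "U - (U - M C) = M C" using C by blast
  then have conv: "convex_in (M C)" using convex_in_diff[OF up_closed_U up_closed_compl[OF imageI[OF C]]] by (simp only:)
  show ?thesis
  proof (rule set_depth_killed[OF conv s(1)])
    show "s + y \<notin> M C" if "y \<in> M C" "compat s y" for y
      using monoid_face_closed[OF C that(2)] s(2) by blast
  qed
qed

text \<open>\<open>cm\<close> is the Cohen-Macaulay property in the form in which it is used: a
  chain of primes ending in the contracted ideal yields depth equal to its length. It remains to
  exhibit a chain of length \<open>k - card J\<close>.\<close>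

lemma face_ring_set_depth:
  assumes C: "C \<in> \<Sigma>" "aff_dim C = int k"
    and cm: "\<And>h q. comm_subring.is_maximal (span_of (M C)) (m \<inter> span_of (M C)) \<Longrightarrow>
      comm_subring.prime_chain (span_of (M C)) h q \<Longrightarrow> q h = m \<inter> span_of (M C) \<Longrightarrow>
      depth_ge (m \<inter> span_of (M C)) h (span_of (M C)) {0}"
  shows "set_depth (k - card J) (M C)"
proof (cases "units_at \<subseteq> M C")
  case False
  thus ?thesis by (rule killed_face_ring[OF C(1)])
next
  case u: True
  let ?N = "M C" and ?S = "span_of (M C)"
  have N: "?N \<in> M ` \<Sigma>" using C(1) by blast
  have mmax: "comm_subring.is_maximal ?S (m \<inter> ?S)" by (rule maximal_restrict[OF N m_max span_compl_units[OF u]])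
  interpret S: monomial_at ?S kc e cf "{?N}" "m \<inter> ?S"
    using sub_monomial_ring[OF N] mmax by (simp add: monomial_at_def monomial_at_axioms_def)
  have Sunits: "S.units_at = units_at"
  proof
    show "S.units_at \<subseteq> units_at" unfolding S.units_at_def units_at_def using N e_span_of[of _ ?N] by auto
    show "units_at \<subseteq> S.units_at" using u unfolding S.units_at_def units_at_def by auto
  qed
  have spanS: "S.span_of Y = span_of Y" if "Y \<subseteq> ?N" for Y
    using that unfolding S.span_of_def by (auto simp: span_of_def)
  have nsp: "nspan X \<subseteq> ?N" if X: "X \<subseteq> B" for X
  proof -
    have "finite X" "X \<subseteq> units_at" using X B(1,2) finite_subset by blast+
    from nspan_units[OF this] show ?thesis using u by blast
  qed
  have Sfree: "S.alg_free X \<longleftrightarrow> alg_free X" if X: "X \<subseteq> B" for X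
  proof -
    have "S.span_of (nspan X) \<inter> (m \<inter> ?S) = span_of (nspan X) \<inter> m"
      unfolding spanS[OF nsp[OF X]] using span_of_mono[OF nsp[OF X]] by blast
    thus ?thesis unfolding S.alg_free_def alg_free_def by simp
  qed
  have Scompat: "S.compat x y \<longleftrightarrow> x \<in> ?N \<and> y \<in> ?N" for x y by (auto simp: S.compat_def)
  have Sup: "S.up_closed (\<Union>{?N} - M G)" if G: "G \<in> cone_faces C" for G
    unfolding S.up_closed_def
  proof (intro conjI ballI allI impI)
    fix y x assume y: "y \<in> \<Union>{?N} - M G" "S.compat x y"
    have yN: "x \<in> ?N" "y \<in> ?N" using y by (auto simp: Scompat)
    have "x + y \<notin> M G" using monoid_face_closed[OF face_in_fan[OF C(1) G] compat_monoid[OF C(1) yN]] y(1) by blast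
    thus "x + y \<in> \<Union>{?N} - M G" using monoid_add[OF C(1) yN] by simp
  qed simp
  have base: "\<exists>q. S.prime_chain (card B - card J) q \<and> S.span_of (\<Union>{?N} - M G) \<subseteq> q 0 \<and> q (card B - card J) = m \<inter> ?S"
    if G: "G \<in> cone_faces C" "units_at \<subseteq> M G" for G
  proof -
    have "loc_depth_ge (?S - (m \<inter> ?S)) (m \<inter> ?S) (card (B - J)) (S.span_of (\<Union>{?N})) (S.span_of (\<Union>{?N} - M G))"
    proof (rule S.loc_depth_base[of B J l])
      show "finite B" "B \<subseteq> S.units_at" "J \<subseteq> B" "S.alg_free J" using B J Sunits Sfree[OF J(1)] by auto
      show "\<not> S.alg_free (insert b J)" if "b \<in> B - J" for b using J(3)[OF that] Sfree[of "insert b J"] that J(1) by blast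
      show "finite (B - J)" "B - J \<subseteq> B - J" using B(1) by auto
      show "S.graded_ideal (l b) (S.span_of (\<Union>{?N})) \<and> S.graded_ideal (l b) (S.span_of (\<Union>{?N} - M G))" for b
        using S.graded_span_of[OF S.up_closed_U] S.graded_span_of[OF Sup[OF G(1)]] by blast
      show "S.is_ideal (S.span_of (\<Union>{?N}))" "S.is_ideal (S.span_of (\<Union>{?N} - M G))"
        using S.span_of_ideal[OF S.up_closed_U] S.span_of_ideal[OF Sup[OF G(1)]] by blast+
    qed (use l in blast)+
    then have "loc_depth_ge (?S - (m \<inter> ?S)) (m \<inter> ?S) (card B - card J) ?S (S.span_of (\<Union>{?N} - M G))"
      using S.span_of_U card_base by simp
    moreover have "S.span_of (\<Union>{?N} - M G) \<subseteq> m \<inter> ?S"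
      using S.span_compl_units[of "M G"] G(2) Sunits by simp
    ultimately show ?thesis
      using S.chain_of_loc_depth[OF S.noetherian S.m_prime S.span_of_ideal[OF Sup[OF G(1)]]] by blast
  qed
  \<comment> \<open>\<open>t\<close> is the excess of \<open>dim G\<close> over
    \<open>card B\<close>. Each step passes to a facet that still contains the units and adds one
    prime at the lower end of its chain.\<close>
  have chain: "\<exists>q. S.prime_chain (card B - card J + t) q \<and> S.span_of (\<Union>{?N} - M G) \<subseteq> q 0 \<and> q (card B - card J + t) = m \<inter> ?S"
    if "G \<in> cone_faces C" "units_at \<subseteq> M G" "dim G = card B + t" for G t
    using that
  proof (induction t arbitrary: G)
    case 0
    thus ?case using base by simp
  next
    case (Suc t)
    have GS: "G \<in> \<Sigma>" using face_in_fan[OF C(1) Suc.prems(1)] .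
    have "card B < dim G" using Suc.prems(3) by simp
    then obtain F where F: "F facet_of G" "F \<in> cone_faces G" "units_at \<subseteq> M F" using units_in_facet[OF GS Suc.prems(2)] by blast
    have FS: "F \<in> \<Sigma>" using face_in_fan[OF GS F(2)] .
    have FC: "F \<in> cone_faces C" using F(2) Suc.prems(1) face_of_trans unfolding cone_faces_def by blast
    have "aff_dim F = aff_dim G - 1" using F(1) by (simp add: facet_of_def)
    then have dF: "dim F = card B + t"
      using Suc.prems(3) aff_dim_convex_cone[OF cone_cc[OF FS]] aff_dim_convex_cone[OF cone_cc[OF GS]] by simp
    obtain q where q: "S.prime_chain (card B - card J + t) q" "S.span_of (\<Union>{?N} - M F) \<subseteq> q 0" "q (card B - card J + t) = m \<inter> ?S"
      using Suc.IH[OF FC F(3) dF] by blast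
    have MFG: "M F \<subseteq> M G" unfolding monoid_face[OF GS F(2)] by blast
    have "\<not> M G \<subseteq> M F"
    proof
      assume "M G \<subseteq> M F"
      then have "G \<subseteq> F" by (rule monoid_subset_cone[OF GS FS])
      then have "dim G \<le> dim F" by (rule dim_subset)
      thus False using dF Suc.prems(3) by simp
    qed
    then obtain a where a: "a \<in> M G" "a \<notin> M F" by blast
    have GN: "M G \<subseteq> ?N" unfolding monoid_face[OF C(1) Suc.prems(1)] by blast
    have ah: "S.compat a h \<and> a + h \<in> M G" if "h \<in> M G" for h
      using a(1) that GN monoid_add[OF GS] unfolding Scompat by blast
    have GN': "M G \<subseteq> \<Union>{?N}" using GN by simp
    obtain q' where "S.prime_chain (Suc (card B - card J + t)) q'" "S.span_of (\<Union>{?N} - M G) \<subseteq> q' 0"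
      "q' (Suc (card B - card J + t)) = q (card B - card J + t)"
      using S.face_chain_extend[OF S.noetherian Sup[OF Suc.prems(1)] GN' MFG a ah q(1,2)] by blast
    thus ?case using q(3) by (intro exI[of _ q']) simp
  qed
  have dC: "dim C = k" using C aff_dim_convex_cone[OF cone_cc[OF C(1)]] by simp
  have CC: "C \<in> cone_faces C" using cone_cc[OF C(1)] by (auto simp: cone_faces_def convex_cone_def face_of_refl)
  have le: "card B \<le> k" using units_dim_le[OF C(1) u] dC by simp
  then have "dim C = card B + (k - card B)" using dC by simp
  from chain[OF CC u this] obtain q where q: "S.prime_chain (card B - card J + (k - card B)) q"
    "q (card B - card J + (k - card B)) = m \<inter> ?S" by blast
  have e: "card B - card J + (k - card B) = k - card J" using le card_base(2) by simp
  have "depth_ge (m \<inter> ?S) (k - card J) ?S {0}" using cm[OF mmax q] unfolding e .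
  thus ?thesis by (rule set_depth_face_ring[OF N])
qed

text \<open>The \<open>h\<close> steps of the chain together with the monomials of \<open>J\<close>
  give \<open>h + card J\<close> elements that are independent modulo \<open>q 0\<close>, so
  \<open>h\<close> is at most \<open>k - card J\<close>, the depth supplied by the gluing.\<close>

lemma prime_chain_depth:
  assumes sh: "is_shelling k \<Sigma> Cs"
    and H: "\<And>k' C. C \<in> \<Sigma> \<Longrightarrow> aff_dim C = int k' \<Longrightarrow> shelled_boundary k' C \<Longrightarrow> set_depth (k' - card J) (M C)"
    and q: "prime_chain h q" "q h = m"
  shows "depth_ge m h R {0}"
proof -
  have convM: "convex_in (M C)" if C: "C \<in> \<Sigma>" for C
  proof -
    have "U - (U - M C) = M C" using C by blast
    thus ?thesis using convex_in_diff[OF up_closed_U up_closed_compl[OF imageI[OF C]]] by (simp only:)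
  qed
  have adm: "admissible \<Sigma> M" unfolding admissible_def
  proof (intro conjI ballI allI impI)
    show "cone_faces C \<subseteq> \<Sigma>" if "C \<in> \<Sigma>" for C using face_in_fan[OF that] by blast
    show "y \<in> M C" if "C \<in> \<Sigma>" "compat a y" "a + y \<in> M C" for C y a
      using monoid_face_closed[OF that] by blast
  qed (use convM monoid_Int in auto)
  have fac: "set Cs = facets \<Sigma>" "pure_fan k \<Sigma>" using sh by (cases k; simp)+
  have max: "\<exists>D\<in>facets \<Sigma>. C \<subseteq> D" if C: "C \<in> \<Sigma>" for C
  proof -
    have "finite {D \<in> \<Sigma>. C \<subseteq> D}" "C \<in> {D \<in> \<Sigma>. C \<subseteq> D}" using fan_finite C by auto
    from finite_has_maximal2[OF this]
    obtain D where D: "D \<in> {D \<in> \<Sigma>. C \<subseteq> D}" "C \<subseteq> D" "\<forall>E\<in>{D \<in> \<Sigma>. C \<subseteq> D}. D \<subseteq> E \<longrightarrow> D = E"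
      by (elim bexE conjE)
    have "D \<in> facets \<Sigma>" unfolding facets_def using D by auto
    thus ?thesis using D(2) by (rule bexI[rotated])
  qed
  have dimf: "dim D = k" if "D \<in> facets \<Sigma>" for D
    using that fac(2) aff_dim_convex_cone[OF cone_cc[of D]] by (simp add: pure_fan_def facets_def)
  have UC: "(\<Union>i<length Cs. M (Cs ! i)) = U"
  proof
    have "Cs ! i \<in> \<Sigma>" if "i < length Cs" for i using nth_mem[OF that] fac(1) by (simp add: facets_def)
    thus "(\<Union>i<length Cs. M (Cs ! i)) \<subseteq> U" by auto
    show "U \<subseteq> (\<Union>i<length Cs. M (Cs ! i))"
    proof
      fix a assume "a \<in> U"
      then obtain C where C: "C \<in> \<Sigma>" "a \<in> M C" by blast
      obtain D where D: "D \<in> facets \<Sigma>" "C \<subseteq> D" using max[OF C(1)] by (rule bexE)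
      have "D \<in> \<Sigma>" using D(1) by (simp add: facets_def)
      then have "a \<in> M D" using monoid_mono[OF C(1) _ D(2)] C(2) by blast
      moreover obtain i where "i < length Cs" "D = Cs ! i" using D(1) unfolding fac(1)[symmetric] in_set_conv_nth by auto
      ultimately show "a \<in> (\<Union>i<length Cs. M (Cs ! i))" by blast
    qed
  qed
  have "set_depth (k - card J) (\<Union>i<length Cs. M (Cs ! i))"
    by (rule shelling_set_depth[OF adm _ sh subset_refl order_refl]) (rule H)
  then have "set_depth (k - card J) (U - {})" unfolding UC by simp
  then have dR: "depth_ge m (k - card J) R {0}"
    using set_depth_iff[OF up_closed_U up_closed_empty] span_of_U span_of_empty by simp
  have fJ: "finite J" "J \<subseteq> units_at" using finite_subset[OF J(1) B(1)] subset_trans[OF J(1) B(2)] .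
  obtain ys where ys: "length ys = card J" "set ys \<subseteq> R" "alg_indep kc m ys"
  proof (rule alg_indep_of_alg_free[of J l, OF fJ J(2)])
    show "l b (a + c) = l b a + l b c" if "b \<in> J" for b a c using l(1) that J(1) by blast
    show "l b b = 1" if "b \<in> J" for b using l(2) that J(1) by blast
    show "l b c = 0" if "b \<in> J" "c \<in> J" "c \<noteq> b" for b c using l(3) that J(1) by blast
  qed
  obtain xs where xs: "length xs = h" "set xs \<subseteq> R" "alg_indep kc (q 0) (xs @ ys)"
  proof -
    have "alg_indep kc (q h) ys" using ys(3) q(2) by simp
    from alg_indep_chain[OF kc_mem kc_zero ys(2) q(1) this] that show ?thesis by blast
  qed
  have "0 \<in> q 0" using q(1) ideal_zero[OF prime_ideal] by (simp add: prime_chain_def)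
  have "length (xs @ ys) \<le> k"
  proof (rule alg_indep_length[OF _ _ xs(3) \<open>0 \<in> q 0\<close>])
    fix N assume "N \<in> M ` \<Sigma>"
    then obtain C where C: "C \<in> \<Sigma>" "N = M C" by auto
    obtain D where D: "D \<in> facets \<Sigma>" "C \<subseteq> D" using max[OF C(1)] by (rule bexE)
    have "dim (rvec ` N) = dim C" using dim_monoid[OF C(1)] C(2) by simp
    also have "\<dots> \<le> dim D" using D(2) by (rule dim_subset)
    finally show "dim (rvec ` N) \<le> k" using dimf[OF D(1)] by simp
  qed (use xs ys in auto)
  then have "h \<le> k - card J" using xs ys by simp
  thus ?thesis by (rule depth_ge_mono[OF dR])
qed

section \<open>Translates of cones in the full lattice\<close>

definition shifted_points :: "real ^ 'n \<Rightarrow> (real ^ 'n) set \<Rightarrow> (int ^ 'n) set" where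
  "shifted_points v C = {y. rvec y - v \<in> C}"

context
  assumes lattice: "M = lattice_points"
begin

lemma lattice_mem: "a \<in> M C \<longleftrightarrow> rvec a \<in> C"
  unfolding lattice lattice_points_def by simp

lemma shifted_points_cone:
  assumes "C0 \<in> \<Sigma>" "v \<in> C0" "C \<in> cone_faces C0" "y \<in> shifted_points v C"
  shows "y \<in> M C0"
proof -
  have "rvec y - v \<in> C0" using assms(3,4) face_sub[of C C0] by (auto simp: shifted_points_def)
  then have "(rvec y - v) + v \<in> C0" by (rule convex_cone_add[OF cone_cc[OF assms(1)] _ assms(2)])
  thus ?thesis by (simp add: lattice_mem)
qed

text \<open>Both faces are taken inside one cone \<open>C0\<close> that contains \<open>v\<close>,
  since \<open>v\<close> itself may lie outside of them. The translated faces then stay inside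
  \<open>C0\<close>, and the face property of \<open>C\<close> splits the sum of
  \<open>rvec y - v\<close> and \<open>rvec a\<close>.\<close>

lemma shifted_points_down:
  assumes C0: "C0 \<in> \<Sigma>" "v \<in> C0" and C: "C \<in> cone_faces C0" and D: "D \<in> cone_faces C0"
    and y: "y \<in> shifted_points v D" "compat a y" "a + y \<in> shifted_points v C"
  shows "y \<in> shifted_points v C" "rvec a \<in> C"
proof -
  have "a + y \<in> M C0" by (rule shifted_points_cone[OF C0 C y(3)])
  then have a: "rvec a \<in> C0" using monoid_face_closed[OF C0(1) y(2)] lattice_mem by blast
  have yv: "rvec y - v \<in> C0" using y(1) face_sub[OF D] by (auto simp: shifted_points_def)
  have s: "(rvec y - v) + rvec a \<in> C" using y(3) by (simp add: shifted_points_def rvec_add algebra_simps)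
  show "y \<in> shifted_points v C" using face_mem[OF C0(1) C yv a s] by (simp add: shifted_points_def)
  show "rvec a \<in> C" using face_mem[OF C0(1) C a yv] s by (simp add: add.commute)
qed

lemma shifted_points_convex:
  assumes C0: "C0 \<in> \<Sigma>" "v \<in> C0" and C: "C \<in> cone_faces C0"
  shows "convex_in (shifted_points v C)"
  unfolding convex_in_def
proof (intro conjI allI impI)
  show "shifted_points v C \<subseteq> U"
  proof
    fix y assume "y \<in> shifted_points v C"
    then have "y \<in> M C0" by (rule shifted_points_cone[OF C0 C])
    thus "y \<in> U" using C0(1) by blast
  qed
  fix y a b assume y: "y \<in> shifted_points v C" "compat a y" "compat b (a + y)" "b + (a + y) \<in> shifted_points v C"
  have cab: "compat (a + b) y" "compat a b" using compat_assoc[OF y(2,3)] by blast+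
  have "(a + b) + y \<in> shifted_points v C" using y(4) by (simp add: algebra_simps)
  then have ab: "rvec (a + b) \<in> C" by (rule shifted_points_down(2)[OF C0 C C y(1) cab(1)])
  have "C \<in> \<Sigma>" using face_in_fan[OF C0(1) C] .
  then have "a \<in> M C" using monoid_face_closed[OF _ cab(2)] ab lattice_mem by blast
  then have "rvec a + (rvec y - v) \<in> C"
    using y(1) convex_cone_add[OF cone_cc[OF \<open>C \<in> \<Sigma>\<close>]] by (simp add: lattice_mem shifted_points_def)
  thus "a + y \<in> shifted_points v C" by (simp add: shifted_points_def rvec_add algebra_simps)
qed

lemma shifted_points_admissible:
  assumes C0: "C0 \<in> \<Sigma>" "v \<in> C0"
  shows "admissible (cone_faces C0) (shifted_points v)"
  unfolding admissible_def
proof (intro conjI ballI allI impI)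
  show "cone_faces C0 \<subseteq> \<Sigma>" using face_in_fan[OF C0(1)] by blast
  show "cone_faces C \<subseteq> cone_faces C0" if "C \<in> cone_faces C0" for C
    using that face_of_trans unfolding cone_faces_def by blast
  show "convex_in (shifted_points v C)" if "C \<in> cone_faces C0" for C
    by (rule shifted_points_convex[OF C0 that])
  show "y \<in> shifted_points v C" if "C \<in> cone_faces C0" "D \<in> cone_faces C0" "y \<in> shifted_points v D"
    "compat a y" "a + y \<in> shifted_points v C" for C D y a
    by (rule shifted_points_down(1)[OF C0 that])
  show "shifted_points v C \<inter> shifted_points v D = shifted_points v (C \<inter> D)" for C D
    by (auto simp: shifted_points_def)
qed

text \<open>The translates \<open>v + s a + C\<close> for \<open>0 \<le> s \<le> 1\<close> lose lattice points at finitely many values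
  of \<open>s\<close> only, and what is lost at \<open>s\<close> are the lattice points of \<open>v + s a + \<partial>C\<close>.\<close>

lemma shifted_points_set_depth:
  "C0 \<in> \<Sigma> \<Longrightarrow> v \<in> C0 \<Longrightarrow> C \<in> cone_faces C0 \<Longrightarrow> aff_dim C = int k \<Longrightarrow> shelled_boundary k C \<Longrightarrow>
    set_depth (k - card J) (shifted_points v C)"
proof (induction k arbitrary: C0 v C rule: less_induct)
  case (less k)
  note C0 = less.prems(1,2) and C = less.prems(3)
  have CS: "C \<in> \<Sigma>" using face_in_fan[OF C0(1) C] .
  have Ccc: "convex_cone C" using cone_cc[OF CS] .
  have dC: "dim C = k" using less.prems(4) aff_dim_convex_cone[OF Ccc] by simp
  have conv: "convex_in (shifted_points v C)" by (rule shifted_points_convex[OF C0 C])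
  \<comment> \<open>In the first case a unit outside of \<open>C\<close> annihilates the module at
    \<open>m\<close>. In the third case the units do not span the dimension of \<open>C\<close>,
    which forces the dominating monomial into \<open>m\<close>.\<close>
  consider (killed) "\<not> units_at \<subseteq> M C" | (base) "k \<le> card B" | (step) "units_at \<subseteq> M C" "card B < k" by linarith
  thus ?case
  proof cases
    case killed
    then obtain s where s: "s \<in> units_at" "s \<notin> M C" by blast
    show ?thesis
    proof (rule set_depth_killed[OF conv s(1)])
      show "s + y \<notin> shifted_points v C" if "y \<in> shifted_points v C" "compat s y" for y
        using shifted_points_down(2)[OF C0 C C that] s(2) lattice_mem by blast
    qed
  next
    case base
    then show ?thesis using set_depth_mono[OF set_depth_units_dim[OF conv]] by simp
  next
    case step
    obtain k' where k': "k = Suc k'" using step(2) by (cases k) auto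
    obtain Ds where Ds: "is_shelling k' (bd_fan C) Ds"
      using less.prems(5) k' unfolding shelled_boundary_def by auto
    obtain a where a: "a \<in> M C" "\<forall>c\<in>M C. \<exists>n. \<exists>d\<in>M C. of_nat n * a = c + d"
      using dominating_element[OF CS] by blast
    have a_nu: "a \<notin> units_at"
    proof
      assume "a \<in> units_at"
      then have "M C \<subseteq> units_at" by (rule dominating_unit[OF CS a])
      then have "rvec ` M C \<subseteq> rvec ` units_at" by (rule image_mono)
      then have "dim (rvec ` M C) \<le> card B" unfolding B(4) by (rule dim_subset)
      thus False using step(2) dim_monoid[OF CS] dC by simp
    qed
    have aU: "a \<in> U" using a(1) CS by blast
    have am: "e a \<in> m" using a_nu aU unfolding units_at_def by blast
    have aC: "rvec a \<in> C" using monoid_cone[OF CS a(1)] .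
    have MC0: "M C \<subseteq> M C0" using monoid_mono[OF CS C0(1) face_sub[OF C]] .
    let ?Y = "shifted_points v C"
    have aY: "a + y \<in> ?Y" if "y \<in> ?Y" for y
    proof -
      have "rvec a + (rvec y - v) \<in> C" using that convex_cone_add[OF Ccc aC] by (simp add: shifted_points_def)
      thus ?thesis by (simp add: shifted_points_def rvec_add algebra_simps)
    qed
    have up: "up_in ((+) a ` ?Y) ?Y" unfolding up_in_def
    proof (intro conjI ballI allI impI)
      show "(+) a ` ?Y \<subseteq> ?Y" using aY by blast
      fix y b assume y: "y \<in> (+) a ` ?Y" "compat b y" "b + y \<in> ?Y"
      then obtain y0 where y0: "y0 \<in> ?Y" "y = a + y0" by blast
      have "y \<in> ?Y" using aY y0 by blast
      then have "rvec b \<in> C" using shifted_points_down(2)[OF C0 C C _ y(2,3)] by blast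
      then have "rvec b + (rvec y0 - v) \<in> C" using y0(1) convex_cone_add[OF Ccc] by (simp add: shifted_points_def)
      then have "b + y0 \<in> ?Y" by (simp add: shifted_points_def rvec_add algebra_simps)
      moreover have "b + y = a + (b + y0)" using y0(2) by (simp add: algebra_simps)
      ultimately show "b + y \<in> (+) a ` ?Y" by blast
    qed
    define Z where "Z = ?Y - (+) a ` ?Y"
    have Z: "rvec y - v \<in> C" "rvec y - v - 1 *\<^sub>R rvec a \<notin> C" if "y \<in> Z" for y
    proof -
      show "rvec y - v \<in> C" using that by (simp add: Z_def shifted_points_def)
      show "rvec y - v - 1 *\<^sub>R rvec a \<notin> C"
      proof
        assume "rvec y - v - 1 *\<^sub>R rvec a \<in> C"
        then have "y - a \<in> ?Y" by (simp add: shifted_points_def rvec_diff algebra_simps)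
        then have "a + (y - a) \<in> (+) a ` ?Y" by (rule imageI)
        thus False using that by (simp add: Z_def)
      qed
    qed
    have ZI: "y \<in> Z" if "rvec y - v \<in> C" "rvec y - v - 1 *\<^sub>R rvec a \<notin> C" for y
      using that unfolding Z_def by (auto simp: shifted_points_def rvec_add algebra_simps)
    have convZ: "convex_in Z" unfolding Z_def using convex_in_up_in(2)[OF conv up] .
    define T where "T y = {s \<in> {0..1}. rvec y - v - s *\<^sub>R rvec a \<in> C}" for y
    \<comment> \<open>The largest s in [0, 1] for which \<open>y\<close> still belongs to v + s a +
      C. It is attained because the cone is closed, and for \<open>y\<close> in \<open>Z\<close> it
      is less than 1.\<close>
    define lev where "lev y = Sup (T y)" for y
    have down: "rvec y - v - s *\<^sub>R rvec a \<in> C" if "rvec y - v - t *\<^sub>R rvec a \<in> C" "s \<le> t" for y s t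
    proof -
      have "(rvec y - v - t *\<^sub>R rvec a) + (t - s) *\<^sub>R rvec a \<in> C"
        using that by (intro convex_cone_add[OF Ccc] convex_cone_scaleR[OF Ccc] aC) auto
      thus ?thesis by (simp add: algebra_simps)
    qed
    have Tcl: "closed (T y)" for y
    proof -
      have "closed C" using polyhedron_imp_closed[OF rational_cone_polyhedron[OF cone_rational[OF CS]]] .
      then have "closed ((\<lambda>s. rvec y - v - s *\<^sub>R rvec a) -` C)"
        by (intro closed_vimage continuous_intros)
      moreover have "T y = {0..1} \<inter> (\<lambda>s. rvec y - v - s *\<^sub>R rvec a) -` C" unfolding T_def by auto
      ultimately show ?thesis by (simp add: closed_Int)
    qed
    have Tbdd: "bdd_above (T y)" for y unfolding T_def by (rule bdd_aboveI[of _ 1]) simp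
    have T0: "0 \<in> T y" if "y \<in> Z" for y using Z(1)[OF that] by (simp add: T_def)
    have levT: "lev y \<in> T y" if "y \<in> Z" for y
      unfolding lev_def using T0[OF that] by (intro closed_contains_Sup Tcl Tbdd) auto
    have lev1: "0 \<le> lev y" "lev y < 1" "rvec y - v - lev y *\<^sub>R rvec a \<in> C" if y: "y \<in> Z" for y
    proof -
      have "0 \<le> lev y \<and> lev y \<le> 1 \<and> rvec y - v - lev y *\<^sub>R rvec a \<in> C" using levT[OF y] by (simp add: T_def)
      moreover have "lev y \<noteq> 1" using Z(2)[OF y] calculation by auto
      ultimately show "0 \<le> lev y" "lev y < 1" "rvec y - v - lev y *\<^sub>R rvec a \<in> C" by auto
    qed
    have levmax: "rvec y - v - lev y *\<^sub>R rvec a - t *\<^sub>R rvec a \<notin> C" if y: "y \<in> Z" and t: "t > 0" for y t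
    proof
      assume "rvec y - v - lev y *\<^sub>R rvec a - t *\<^sub>R rvec a \<in> C"
      then have 1: "rvec y - v - (lev y + t) *\<^sub>R rvec a \<in> C" by (simp add: algebra_simps)
      \<comment> \<open>Cut off at 1 to stay in the range of \<open>T y\<close>; since
        \<open>lev y\<close> is less than 1, the value still exceeds \<open>lev y\<close>.\<close>
      define s where "s = min (lev y + t) 1"
      have "rvec y - v - s *\<^sub>R rvec a \<in> C" using down[OF 1, of s] by (simp add: s_def)
      then have "s \<in> T y" unfolding T_def using lev1[OF y] t by (auto simp: s_def)
      then have "s \<le> lev y" unfolding lev_def by (rule cSup_upper[OF _ Tbdd])
      thus False using lev1[OF y] t by (auto simp: s_def min_def split: if_splits)
    qed
    have facet: "\<exists>F. F \<in> bd_fan C \<and> rvec y - v - lev y *\<^sub>R rvec a \<in> F" if y: "y \<in> Z" for y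
    proof -
      obtain F where F: "F facet_of C" "rvec y - v - lev y *\<^sub>R rvec a \<in> F"
        using cone_boundary_facet[OF cone_rational[OF CS] lev1(3)[OF y] aC levmax[OF y]] by blast
      have "F \<noteq> C" using F(1) by (auto simp: facet_of_def)
      then have "F \<in> bd_fan C" using F by (auto simp: bd_fan_def cone_faces_def facet_of_def)
      thus ?thesis using F(2) by blast
    qed
    have a_bd: "rvec a \<notin> F" if "F \<in> bd_fan C" for F
      using dominating_not_in_face[OF CS a] that by (auto simp: bd_fan_def)
    have finlev: "finite (lev ` Z)"
    proof (rule finite_subset)
      show "lev ` Z \<subseteq> (\<Union>F\<in>bd_fan C. {s. 0 \<le> s \<and> s \<le> 1 \<and> (\<exists>y. rvec y - v - s *\<^sub>R rvec a \<in> F)})"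
      proof
        fix s assume "s \<in> lev ` Z"
        then obtain y where y: "y \<in> Z" "s = lev y" by blast
        obtain F where "F \<in> bd_fan C" "rvec y - v - lev y *\<^sub>R rvec a \<in> F" using facet[OF y(1)] by blast
        moreover have "0 \<le> s" "s \<le> 1" using lev1[OF y(1)] y(2) by simp_all
        ultimately show "s \<in> (\<Union>F\<in>bd_fan C. {s. 0 \<le> s \<and> s \<le> 1 \<and> (\<exists>y. rvec y - v - s *\<^sub>R rvec a \<in> F)})"
          using y(2) by blast
      qed
      have bdS: "bd_fan C \<subseteq> \<Sigma>" using face_in_fan[OF CS] by (auto simp: bd_fan_def)
      show "finite (\<Union>F\<in>bd_fan C. {s. 0 \<le> s \<and> s \<le> 1 \<and> (\<exists>y. rvec y - v - s *\<^sub>R rvec a \<in> F)})"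
      proof (rule finite_UN_I)
        show "finite (bd_fan C)" using bdS fan_finite by (rule finite_subset)
        fix F assume F: "F \<in> bd_fan C"
        have "F face_of C" using F by (simp add: bd_fan_def cone_faces_def)
        moreover have "rational_cone F" using cone_rational bdS F by blast
        ultimately show "finite {s. 0 \<le> s \<and> s \<le> 1 \<and> (\<exists>y. rvec y - v - s *\<^sub>R rvec a \<in> F)}"
          using finite_lattice_levels[OF Ccc _ _ aC a_bd[OF F]] by blast
      qed
    qed
    have levmono: "lev y \<le> lev (b + y)" if y: "y \<in> Z" "compat b y" "b + y \<in> Z" for y b
    proof -
      have ys: "y \<in> ?Y" "b + y \<in> ?Y" using y(1,3) by (auto simp: Z_def)
      have bC: "rvec b \<in> C" using shifted_points_down(2)[OF C0 C C ys(1) y(2) ys(2)] .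
      have "(rvec y - v - lev y *\<^sub>R rvec a) + rvec b \<in> C" by (rule convex_cone_add[OF Ccc lev1(3)[OF y(1)] bC])
      then have "rvec (b + y) - v - lev y *\<^sub>R rvec a \<in> C" by (simp add: rvec_add algebra_simps)
      then have "lev y \<in> T (b + y)" unfolding T_def using lev1[OF y(1)] by simp
      thus ?thesis unfolding lev_def[of "b + y"] by (rule cSup_upper[OF _ Tbdd])
    qed
    have Dsf: "set Ds = facets (bd_fan C)" using Ds by (cases k') auto
    \<comment> \<open>A point of level \<open>s\<close> leaves the cone at once when moved further
      along -a, so y - v - s a lies in a proper face. Conversely \<open>a\<close> belongs to no
      proper face, so a point of v + s a + D, with D a facet of the boundary, cannot reach a level
      above \<open>s\<close>.\<close>
    have level: "{y \<in> Z. lev y = s} = (\<Union>i<length Ds. shifted_points (v + s *\<^sub>R rvec a) (Ds ! i))" if s: "s \<in> lev ` Z" for s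
    proof
      have s01: "0 \<le> s" "s < 1" using s lev1 by auto
      show "{y \<in> Z. lev y = s} \<subseteq> (\<Union>i<length Ds. shifted_points (v + s *\<^sub>R rvec a) (Ds ! i))"
      proof
        fix y assume "y \<in> {y \<in> Z. lev y = s}"
        then have y: "y \<in> Z" "lev y = s" by auto
        obtain F where F: "F \<in> bd_fan C" "rvec y - v - s *\<^sub>R rvec a \<in> F" using facet[OF y(1)] y(2) by blast
        have "finite (bd_fan C)" using finite_subset[OF _ fan_finite, of "bd_fan C"] face_in_fan[OF CS] by (auto simp: bd_fan_def)
        then have "finite {D \<in> bd_fan C. F \<subseteq> D}" "F \<in> {D \<in> bd_fan C. F \<subseteq> D}" using F by auto
        from finite_has_maximal2[OF this]
        obtain D where D: "D \<in> {D \<in> bd_fan C. F \<subseteq> D}" "F \<subseteq> D" "\<forall>E\<in>{D \<in> bd_fan C. F \<subseteq> D}. D \<subseteq> E \<longrightarrow> D = E"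
          by (elim bexE conjE)
        have "D \<in> facets (bd_fan C)" unfolding facets_def using D by auto
        then obtain i where i: "i < length Ds" "D = Ds ! i" unfolding Dsf[symmetric] in_set_conv_nth by auto
        have "y \<in> shifted_points (v + s *\<^sub>R rvec a) D" using F(2) D(2) by (auto simp: shifted_points_def algebra_simps)
        thus "y \<in> (\<Union>i<length Ds. shifted_points (v + s *\<^sub>R rvec a) (Ds ! i))" using i by blast
      qed
      show "(\<Union>i<length Ds. shifted_points (v + s *\<^sub>R rvec a) (Ds ! i)) \<subseteq> {y \<in> Z. lev y = s}"
      proof
        fix y assume "y \<in> (\<Union>i<length Ds. shifted_points (v + s *\<^sub>R rvec a) (Ds ! i))"
        then obtain i where i: "i < length Ds" "y \<in> shifted_points (v + s *\<^sub>R rvec a) (Ds ! i)" by blast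
        have "Ds ! i \<in> facets (bd_fan C)" using nth_mem[OF i(1)] Dsf by simp
        then have Db: "Ds ! i \<in> bd_fan C" by (simp add: facets_def)
        then have Df: "Ds ! i \<in> cone_faces C" by (simp add: bd_fan_def)
        have z: "rvec y - v - s *\<^sub>R rvec a \<in> Ds ! i" using i(2) by (simp add: shifted_points_def algebra_simps)
        then have zC: "rvec y - v - s *\<^sub>R rvec a \<in> C" using face_sub[OF Df] by blast
        have nz: "t \<le> s" if tC: "rvec y - v - t *\<^sub>R rvec a \<in> C" for t
        proof (rule ccontr)
          assume "\<not> t \<le> s"
          then have ts: "0 < t - s" by simp
          have "(t - s) *\<^sub>R rvec a + (rvec y - v - t *\<^sub>R rvec a) \<in> Ds ! i" using z by (simp add: algebra_simps)
          moreover have "(t - s) *\<^sub>R rvec a \<in> C" using ts by (intro convex_cone_scaleR[OF Ccc _ aC]) simp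
          ultimately have "(t - s) *\<^sub>R rvec a \<in> Ds ! i" using face_mem[OF CS Df _ tC] by blast
          then have "(1 / (t - s)) *\<^sub>R ((t - s) *\<^sub>R rvec a) \<in> Ds ! i"
            using ts by (intro convex_cone_scaleR[OF cone_cc[OF face_in_fan[OF CS Df]], of "1 / (t - s)" "(t - s) *\<^sub>R rvec a"]) auto
          thus False using a_bd[OF Db] ts by simp
        qed
        have yZ: "y \<in> Z"
        proof (rule ZI)
          show "rvec y - v \<in> C" using down[OF zC, of 0] s01 by simp
          show "rvec y - v - 1 *\<^sub>R rvec a \<notin> C" using nz[of 1] s01 by auto
        qed
        have "s \<in> T y" unfolding T_def using s01 zC by simp
        then have "s \<le> lev y" unfolding lev_def by (rule cSup_upper[OF _ Tbdd])
        moreover have "lev y \<le> s" by (rule nz[OF lev1(3)[OF yZ]])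
        ultimately show "y \<in> {y \<in> Z. lev y = s}" using yZ by simp
      qed
    qed
    have "set_depth (k' - card J) Z"
    proof (rule set_depth_levels[OF convZ finlev levmono])
      fix s assume s: "s \<in> lev ` Z"
      have s0: "0 \<le> s" using s lev1(1) by auto
      let ?v = "v + s *\<^sub>R rvec a"
      have aC0: "rvec a \<in> C0" using aC face_sub[OF C] by blast
      have v': "?v \<in> C0"
        by (intro convex_cone_add[OF cone_cc[OF C0(1)]] convex_cone_scaleR[OF cone_cc[OF C0(1)]] C0(2) s0 aC0)
      have bdsub: "bd_fan C \<subseteq> cone_faces C0"
        using C face_of_trans unfolding bd_fan_def cone_faces_def by blast
      have "set_depth (k' - card J) (\<Union>i<length Ds. shifted_points ?v (Ds ! i))"
      proof (rule shelling_set_depth[OF shifted_points_admissible[OF C0(1) v'] _ Ds bdsub order_refl])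
        fix k'' D assume "k'' \<le> k'" "D \<in> cone_faces C0" "aff_dim D = int k''" "shelled_boundary k'' D"
        thus "set_depth (k'' - card J) (shifted_points ?v D)"
          using less.IH[of k'' C0 ?v D] k' C0(1) v' by simp
      qed
      thus "set_depth (k' - card J) {y \<in> Z. lev y = s}" unfolding level[OF s] .
    qed
    then have "set_depth (Suc (k' - card J)) ?Y" unfolding Z_def
    proof (rule set_depth_shift[OF conv aU am _ up, rotated])
      show "compat a y" if "y \<in> ?Y" for y
        using compat_monoid[OF C0(1)] a(1) MC0 shifted_points_cone[OF C0 C that] by blast
    qed
    \<comment> \<open>Subtraction is truncated, and this inequality makes
      \<open>Suc (k' - card J)\<close> equal to \<open>k - card J\<close>.\<close>
    moreover have "card J \<le> k'" using card_base(2) step(2) k' by simp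
    ultimately show ?thesis using k' by (simp add: Suc_diff_le)
  qed
qed

lemma lattice_set_depth:
  assumes "C \<in> \<Sigma>" "aff_dim C = int k" "shelled_boundary k C"
  shows "set_depth (k - card J) (M C)"
proof -
  have "C \<in> cone_faces C" using cone_cc[OF assms(1)] by (auto simp: cone_faces_def convex_cone_def face_of_refl)
  then have "set_depth (k - card J) (shifted_points 0 C)"
    using shifted_points_set_depth[of C 0 C k] assms convex_cone_contains_0[OF cone_cc[OF assms(1)]] by simp
  moreover have "shifted_points 0 C = M C" by (auto simp: shifted_points_def lattice_mem)
  ultimately show ?thesis by simp
qed

end

end

section \<open>Passage to the toric face ring\<close>

lemma le_height:
  assumes "\<forall>i\<le>n. primeideal (Q i) R" "\<forall>i<n. Q i \<subset> Q (Suc i)" "Q n = I"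
  shows "enat n \<le> height R I"
  unfolding height_def
  by (rule Sup_upper, rule CollectI, rule exI[of _ n], rule conjI[OF refl], rule exI[of _ Q], intro conjI)
    (fact assms)+

text \<open>The connection between subrings of a type and the record based rings of the statement:
  the isomorphism \<open>\<psi>\<close> transports ideals, primes, maximal ideals and regular
  sequences between them.\<close>

locale ring_copy = comm_subring R for R :: "'a::comm_ring_1 set" +
  fixes P :: "('b, 'c) ring_scheme" and \<psi> :: "'a \<Rightarrow> 'b"
  assumes bij: "bij_betw \<psi> R (carrier P)"
    and psi_add: "x \<in> R \<Longrightarrow> y \<in> R \<Longrightarrow> \<psi> (x + y) = \<psi> x \<oplus>\<^bsub>P\<^esub> \<psi> y"
    and psi_mult: "x \<in> R \<Longrightarrow> y \<in> R \<Longrightarrow> \<psi> (x * y) = \<psi> x \<otimes>\<^bsub>P\<^esub> \<psi> y"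
    and psi_zero: "\<psi> 0 = \<zero>\<^bsub>P\<^esub>" and psi_one: "\<psi> 1 = \<one>\<^bsub>P\<^esub>"
begin

lemma psi_inj: "x \<in> R \<Longrightarrow> y \<in> R \<Longrightarrow> \<psi> x = \<psi> y \<longleftrightarrow> x = y"
  using bij by (auto simp: bij_betw_def inj_on_def)
lemma carrierE: assumes "y \<in> carrier P" obtains x where "x \<in> R" "y = \<psi> x"
  using assms bij by (auto simp: bij_betw_def)
lemma psi_carrier: "x \<in> R \<Longrightarrow> \<psi> x \<in> carrier P"
  using bij by (auto simp: bij_betw_def)

lemma P_cring: "cring P"
proof (rule cringI)
  show "abelian_group P"
  proof (rule abelian_groupI)
    fix x y z assume "x \<in> carrier P" "y \<in> carrier P" "z \<in> carrier P"
    then obtain x' y' z' where "x' \<in> R" "x = \<psi> x'" "y' \<in> R" "y = \<psi> y'" "z' \<in> R" "z = \<psi> z'"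
      by (metis carrierE)
    thus "x \<oplus>\<^bsub>P\<^esub> y \<oplus>\<^bsub>P\<^esub> z = x \<oplus>\<^bsub>P\<^esub> (y \<oplus>\<^bsub>P\<^esub> z)"
      by (simp add: psi_add[symmetric] add_mem add.assoc)
  next
    fix x y assume "x \<in> carrier P" "y \<in> carrier P"
    then obtain x' y' where xy: "x' \<in> R" "x = \<psi> x'" "y' \<in> R" "y = \<psi> y'" by (metis carrierE)
    show "x \<oplus>\<^bsub>P\<^esub> y = y \<oplus>\<^bsub>P\<^esub> x" using xy by (simp add: psi_add[symmetric] add.commute)
    show "x \<oplus>\<^bsub>P\<^esub> y \<in> carrier P" using xy by (simp add: psi_add[symmetric] add_mem psi_carrier)
  next
    fix x assume "x \<in> carrier P"
    then obtain x' where x: "x' \<in> R" "x = \<psi> x'" by (metis carrierE)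
    show "\<zero>\<^bsub>P\<^esub> \<oplus>\<^bsub>P\<^esub> x = x" using x zero_mem psi_add[of 0 x'] psi_zero by simp
    show "\<exists>y\<in>carrier P. y \<oplus>\<^bsub>P\<^esub> x = \<zero>\<^bsub>P\<^esub>"
      using x psi_add[of "- x'" x'] psi_zero uminus_mem psi_carrier by (intro bexI[of _ "\<psi> (- x')"]) auto
  qed (use psi_carrier[OF zero_mem] psi_zero in simp)
  show "comm_monoid P"
  proof (rule comm_monoidI)
    fix x y z assume "x \<in> carrier P" "y \<in> carrier P" "z \<in> carrier P"
    then obtain x' y' z' where "x' \<in> R" "x = \<psi> x'" "y' \<in> R" "y = \<psi> y'" "z' \<in> R" "z = \<psi> z'"
      by (metis carrierE)
    thus "x \<otimes>\<^bsub>P\<^esub> y \<otimes>\<^bsub>P\<^esub> z = x \<otimes>\<^bsub>P\<^esub> (y \<otimes>\<^bsub>P\<^esub> z)"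
      by (simp add: psi_mult[symmetric] mult_mem mult.assoc)
  next
    fix x y assume "x \<in> carrier P" "y \<in> carrier P"
    then obtain x' y' where xy: "x' \<in> R" "x = \<psi> x'" "y' \<in> R" "y = \<psi> y'" by (metis carrierE)
    show "x \<otimes>\<^bsub>P\<^esub> y = y \<otimes>\<^bsub>P\<^esub> x" using xy by (simp add: psi_mult[symmetric] mult.commute)
    show "x \<otimes>\<^bsub>P\<^esub> y \<in> carrier P" using xy by (simp add: psi_mult[symmetric] mult_mem psi_carrier)
  next
    fix x assume "x \<in> carrier P"
    then obtain x' where x: "x' \<in> R" "x = \<psi> x'" by (metis carrierE)
    show "\<one>\<^bsub>P\<^esub> \<otimes>\<^bsub>P\<^esub> x = x" using x one_mem psi_mult[of 1 x'] psi_one by simp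
  qed (use psi_carrier[OF one_mem] psi_one in simp)
  fix x y z assume "x \<in> carrier P" "y \<in> carrier P" "z \<in> carrier P"
  then obtain x' y' z' where "x' \<in> R" "x = \<psi> x'" "y' \<in> R" "y = \<psi> y'" "z' \<in> R" "z = \<psi> z'"
    by (metis carrierE)
  thus "(x \<oplus>\<^bsub>P\<^esub> y) \<otimes>\<^bsub>P\<^esub> z = x \<otimes>\<^bsub>P\<^esub> z \<oplus>\<^bsub>P\<^esub> y \<otimes>\<^bsub>P\<^esub> z"
    by (simp add: psi_mult[symmetric] psi_add[symmetric] mult_mem add_mem distrib_right)
qed

sublocale P: cring P by (rule P_cring)

lemma psi_uminus: "x \<in> R \<Longrightarrow> \<psi> (- x) = \<ominus>\<^bsub>P\<^esub> \<psi> x"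
  using psi_add[of "- x" x] psi_zero uminus_mem[of x] psi_carrier P.minus_equality by force

definition pull :: "'b set \<Rightarrow> 'a set" where "pull I = {x \<in> R. \<psi> x \<in> I}"

lemma image_ideal:
  assumes J: "is_ideal J" shows "ideal (\<psi> ` J) P"
proof (rule idealI)
  have JR: "\<And>x. x \<in> J \<Longrightarrow> x \<in> R" using ideal_sub[OF J] .
  show "ring P" by (rule P.ring_axioms)
  show "subgroup (\<psi> ` J) (add_monoid P)"
  proof
    show "\<psi> ` J \<subseteq> carrier (add_monoid P)" using JR psi_carrier by auto
    show "\<one>\<^bsub>add_monoid P\<^esub> \<in> \<psi> ` J" using ideal_zero[OF J] psi_zero by force
    fix x assume x: "x \<in> \<psi> ` J"
    then obtain x' where x': "x' \<in> J" "x = \<psi> x'" by auto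
    have "inv\<^bsub>add_monoid P\<^esub> x = \<psi> (- x')" using psi_uminus[OF JR[OF x'(1)]] x'(2) by (simp add: a_inv_def)
    thus "inv\<^bsub>add_monoid P\<^esub> x \<in> \<psi> ` J" using ideal_uminus[OF J x'(1)] by simp
    fix y assume "y \<in> \<psi> ` J"
    then obtain y' where y': "y' \<in> J" "y = \<psi> y'" by auto
    have "x \<otimes>\<^bsub>add_monoid P\<^esub> y = \<psi> (x' + y')" using psi_add[OF JR JR] x' y' by simp
    thus "x \<otimes>\<^bsub>add_monoid P\<^esub> y \<in> \<psi> ` J" using ideal_add[OF J x'(1) y'(1)] by simp
  qed
  fix a x assume "a \<in> \<psi> ` J" "x \<in> carrier P"
  then obtain a' x' where ax: "a' \<in> J" "a = \<psi> a'" "x' \<in> R" "x = \<psi> x'" by (metis carrierE imageE)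
  have "x \<otimes>\<^bsub>P\<^esub> a = \<psi> (x' * a')" using psi_mult[OF ax(3) JR[OF ax(1)]] ax by simp
  thus 1: "x \<otimes>\<^bsub>P\<^esub> a \<in> \<psi> ` J" using ideal_mult[OF J ax(3,1)] by simp
  show "a \<otimes>\<^bsub>P\<^esub> x \<in> \<psi> ` J" using 1 P.m_comm[of a x] ax JR psi_carrier by simp
qed

lemma pull_ideal:
  assumes I: "ideal I P" shows "is_ideal (pull I)" "\<psi> ` pull I = I"
proof -
  interpret I: ideal I P by (rule I)
  show "is_ideal (pull I)" unfolding is_ideal_def pull_def
    using psi_zero zero_mem add_mem mult_mem psi_add psi_mult I.zero_closed I.a_closed I.I_l_closed psi_carrier by auto
  show "\<psi> ` pull I = I" unfolding pull_def using I.Icarr carrierE by blast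
qed

lemma pull_image: "J \<subseteq> R \<Longrightarrow> pull (\<psi> ` J) = J"
  unfolding pull_def using psi_inj by (auto simp: image_iff)

lemma image_prime:
  assumes "is_prime Q" shows "primeideal (\<psi> ` Q) P"
proof (rule primeidealI)
  have Q: "is_ideal Q" using assms by (rule prime_ideal)
  have QR: "Q \<subseteq> R" using ideal_sub[OF Q] by auto
  show "ideal (\<psi> ` Q) P" by (rule image_ideal[OF Q])
  show "cring P" by (rule P_cring)
  have mem: "\<psi> x \<in> \<psi> ` Q \<longleftrightarrow> x \<in> Q" if "x \<in> R" for x
    using pull_image[OF QR] that unfolding pull_def by auto
  show "carrier P \<noteq> \<psi> ` Q" using mem[OF one_mem] psi_carrier[OF one_mem] assms by (auto simp: is_prime_def)
  fix a b assume "a \<in> carrier P" "b \<in> carrier P" and ab: "a \<otimes>\<^bsub>P\<^esub> b \<in> \<psi> ` Q"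
  then obtain a' b' where 1: "a' \<in> R" "a = \<psi> a'" "b' \<in> R" "b = \<psi> b'" by (metis carrierE)
  have "\<psi> (a' * b') \<in> \<psi> ` Q" using ab 1 psi_mult by simp
  then have "a' * b' \<in> Q" using mem[OF mult_mem[OF 1(1,3)]] by simp
  then have "a' \<in> Q \<or> b' \<in> Q" using assms 1 unfolding is_prime_def by auto
  thus "a \<in> \<psi> ` Q \<or> b \<in> \<psi> ` Q" using 1 by auto
qed

lemma pull_prime:
  assumes "primeideal Q P" shows "is_prime (pull Q)"
proof -
  interpret Q: primeideal Q P by (rule assms)
  have id: "ideal Q P" by (rule Q.ideal_axioms)
  show ?thesis unfolding is_prime_def
  proof (intro conjI ballI impI)
    show "is_ideal (pull Q)" by (rule pull_ideal[OF id])
    show "1 \<notin> pull Q" using Q.one_imp_carrier Q.I_notcarr psi_one by (auto simp: pull_def)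
    fix x y assume "x \<in> R" "y \<in> R" "x * y \<in> pull Q"
    thus "x \<in> pull Q \<or> y \<in> pull Q" using Q.I_prime psi_carrier psi_mult by (auto simp: pull_def)
  qed
qed

lemma pull_maximal:
  assumes "maximalideal m P" shows "is_maximal (pull m)"
proof -
  interpret m: maximalideal m P by (rule assms)
  have id: "ideal m P" by (rule m.ideal_axioms)
  have mid: "is_ideal (pull m)" by (rule pull_ideal[OF id])
  show ?thesis unfolding is_maximal_def
  proof (intro conjI ballI)
    show "is_ideal (pull m)" by (rule mid)
    show "1 \<notin> pull m" using m.one_imp_carrier m.I_notcarr psi_one by (auto simp: pull_def)
    fix x assume x: "x \<in> R - pull m"
    have xR: "x \<in> R" using x by simp
    let ?J = "plus_mult (pull m) x R"
    have J: "is_ideal ?J" by (rule ideal_plus_mult[OF ideal_R mid xR])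
    have "ideal (\<psi> ` ?J) P" by (rule image_ideal[OF J])
    moreover have "m \<subseteq> \<psi> ` ?J" using plus_mult_base[OF ideal_R, of "pull m" x] pull_ideal(2)[OF id] by blast
    moreover have "\<psi> ` ?J \<subseteq> carrier P" using ideal_sub[OF J] psi_carrier by auto
    ultimately have "\<psi> ` ?J = m \<or> \<psi> ` ?J = carrier P" by (rule m.I_maximal)
    moreover have "\<psi> ` ?J \<noteq> m"
    proof
      assume "\<psi> ` ?J = m"
      moreover have "x * 1 \<in> ?J" using plus_mult_mult[OF mid one_mem] .
      ultimately have "x \<in> pull m" using xR by (auto simp: pull_def)
      thus False using x by simp
    qed
    ultimately have c: "\<psi> ` ?J = carrier P" by blast
    have "\<psi> 1 \<in> \<psi> ` ?J" unfolding c by (rule psi_carrier[OF one_mem])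
    then obtain w where "w \<in> ?J" "\<psi> w = \<psi> 1" by auto
    then have "1 \<in> ?J" using psi_inj[OF ideal_sub[OF J] one_mem] by auto
    then obtain u r where "u \<in> pull m" "r \<in> R" "1 = u + x * r" by (rule plus_multE)
    thus "\<exists>r\<in>R. \<exists>u\<in>pull m. 1 = u + r * x" by (metis mult.commute)
  qed
qed

lemma image_maximal:
  assumes "is_maximal m" shows "maximalideal (\<psi> ` m) P"
proof (rule maximalidealI)
  have mid: "is_ideal m" using maximal_ideal[OF assms] .
  have mR: "m \<subseteq> R" using ideal_sub[OF mid] by auto
  show "ideal (\<psi> ` m) P" by (rule image_ideal[OF mid])
  have mem: "\<psi> x \<in> \<psi> ` m \<longleftrightarrow> x \<in> m" if "x \<in> R" for x
    using pull_image[OF mR] that unfolding pull_def by auto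
  show "carrier P \<noteq> \<psi> ` m" using mem[OF one_mem] psi_carrier[OF one_mem] assms by (auto simp: is_maximal_def)
  fix J assume J: "ideal J P" "\<psi> ` m \<subseteq> J" "J \<subseteq> carrier P"
  interpret J: ideal J P by (rule J(1))
  show "J = \<psi> ` m \<or> J = carrier P"
  proof (cases "pull J \<subseteq> m")
    case True
    then have "J \<subseteq> \<psi> ` m" using pull_ideal(2)[OF J(1)] by blast
    thus ?thesis using J(2) by blast
  next
    case False
    then obtain x where x: "x \<in> R" "\<psi> x \<in> J" "x \<notin> m" by (auto simp: pull_def)
    obtain r u where ru: "r \<in> R" "u \<in> m" "1 = u + r * x" using maximalE[OF assms x(1,3)] by metis
    have pj: "is_ideal (pull J)" by (rule pull_ideal[OF J(1)])
    have "u \<in> pull J" using ru(2) J(2) mR by (auto simp: pull_def)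
    moreover have "r * x \<in> pull J" using ideal_mult[OF pj ru(1)] x by (simp add: pull_def)
    ultimately have "1 \<in> pull J" using ideal_add[OF pj] ru(3) by metis
    then have "\<one>\<^bsub>P\<^esub> \<in> J" using psi_one by (simp add: pull_def)
    thus ?thesis using J.one_imp_carrier by blast
  qed
qed

lemma image_ideal_gen:
  assumes G: "G \<subseteq> R" shows "Idl\<^bsub>P\<^esub> (\<psi> ` G) = \<psi> ` ideal_gen G"
proof
  have GP: "\<psi> ` G \<subseteq> carrier P" using G psi_carrier by auto
  show "Idl\<^bsub>P\<^esub> (\<psi> ` G) \<subseteq> \<psi> ` ideal_gen G"
    using ideal_gen_base[of G] by (intro P.genideal_minimal image_ideal ideal_gen_ideal[OF G]) auto
  have I: "ideal (Idl\<^bsub>P\<^esub> (\<psi> ` G)) P" by (rule P.genideal_ideal[OF GP])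
  have "ideal_gen G \<subseteq> pull (Idl\<^bsub>P\<^esub> (\<psi> ` G))"
    using P.genideal_self[OF GP] G by (intro ideal_gen_least pull_ideal(1)[OF I]) (auto simp: pull_def)
  thus "\<psi> ` ideal_gen G \<subseteq> Idl\<^bsub>P\<^esub> (\<psi> ` G)" by (auto simp: pull_def)
qed

lemma P_noetherian: assumes is_noetherian shows "noetherian_ring P"
proof (rule P.noetherian_ringI)
  fix I assume I: "ideal I P"
  obtain G where G: "finite G" "G \<subseteq> pull I" "\<And>J. is_ideal J \<Longrightarrow> G \<subseteq> J \<Longrightarrow> pull I \<subseteq> J"
    using noetherianE[OF assms pull_ideal(1)[OF I]] by blast
  have GR: "G \<subseteq> R" using G(2) by (auto simp: pull_def)
  have "ideal_gen G = pull I"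
    using ideal_gen_least[OF pull_ideal(1)[OF I] G(2)] G(3)[OF ideal_gen_ideal[OF GR] ideal_gen_base] by blast
  then have "I = Idl\<^bsub>P\<^esub> (\<psi> ` G)" using image_ideal_gen[OF GR] pull_ideal(2)[OF I] by simp
  moreover have "\<psi> ` G \<subseteq> carrier P" using GR psi_carrier by auto
  ultimately show "\<exists>A\<subseteq>carrier P. finite A \<and> I = Idl\<^bsub>P\<^esub> A" using G(1) by blast
qed

lemma regular_on_image:
  assumes "is_ideal I" "x \<in> R"
  shows "regular_on x R I \<longleftrightarrow> (\<forall>y\<in>carrier P. \<psi> x \<otimes>\<^bsub>P\<^esub> y \<in> \<psi> ` I \<longrightarrow> y \<in> \<psi> ` I)"
proof -
  have IR: "I \<subseteq> R" using ideal_sub[OF assms(1)] by auto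
  have mem: "\<psi> z \<in> \<psi> ` I \<longleftrightarrow> z \<in> I" if "z \<in> R" for z
    using pull_image[OF IR] that unfolding pull_def by auto
  have "(\<forall>y\<in>carrier P. \<psi> x \<otimes>\<^bsub>P\<^esub> y \<in> \<psi> ` I \<longrightarrow> y \<in> \<psi> ` I) \<longleftrightarrow>
    (\<forall>y\<in>R. \<psi> x \<otimes>\<^bsub>P\<^esub> \<psi> y \<in> \<psi> ` I \<longrightarrow> \<psi> y \<in> \<psi> ` I)"
    using carrierE psi_carrier by metis
  also have "\<dots> \<longleftrightarrow> (\<forall>y\<in>R. x * y \<in> I \<longrightarrow> y \<in> I)"
  proof (rule ball_cong[OF refl])
    fix y assume y: "y \<in> R"
    show "(\<psi> x \<otimes>\<^bsub>P\<^esub> \<psi> y \<in> \<psi> ` I \<longrightarrow> \<psi> y \<in> \<psi> ` I) \<longleftrightarrow> (x * y \<in> I \<longrightarrow> y \<in> I)"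
      unfolding psi_mult[OF assms(2) y, symmetric] mem[OF y] mem[OF mult_mem[OF assms(2) y]] ..
  qed
  finally show ?thesis by (simp add: regular_on_def)
qed

lemma image_regular_sequence:
  assumes "set xs \<subseteq> R"
  shows "regular_sequence P (map \<psi> xs) \<longleftrightarrow>
    (\<forall>i<length xs. regular_on (xs ! i) R (ideal_gen (set (take i xs)))) \<and> ideal_gen (set xs) \<noteq> R"
proof -
  have sub: "set (take i xs) \<subseteq> R" for i using assms set_take_subset[of i xs] by auto
  have I: "Idl\<^bsub>P\<^esub> (set (take i (map \<psi> xs))) = \<psi> ` ideal_gen (set (take i xs))" for i
    using image_ideal_gen[OF sub] by (simp add: take_map)
  have c: "\<psi> ` ideal_gen (set xs) = carrier P \<longleftrightarrow> ideal_gen (set xs) = R"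
  proof -
    have "ideal_gen (set xs) \<subseteq> R" using ideal_sub[OF ideal_gen_ideal[OF assms]] by auto
    from pull_image[OF this] pull_image[of R] show ?thesis using bij by (auto simp: bij_betw_def)
  qed
  have "regular_sequence P (map \<psi> xs) \<longleftrightarrow>
    (\<forall>i<length xs. \<forall>y\<in>carrier P. \<psi> (xs ! i) \<otimes>\<^bsub>P\<^esub> y \<in> \<psi> ` ideal_gen (set (take i xs)) \<longrightarrow> y \<in> \<psi> ` ideal_gen (set (take i xs)))
      \<and> \<psi> ` ideal_gen (set xs) \<noteq> carrier P"
    unfolding regular_sequence_def I using assms psi_carrier image_ideal_gen[OF assms] by auto
  also have "\<dots> \<longleftrightarrow> (\<forall>i<length xs. regular_on (xs ! i) R (ideal_gen (set (take i xs)))) \<and> ideal_gen (set xs) \<noteq> R"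
  proof -
    have "regular_on (xs ! i) R (ideal_gen (set (take i xs))) \<longleftrightarrow>
      (\<forall>y\<in>carrier P. \<psi> (xs ! i) \<otimes>\<^bsub>P\<^esub> y \<in> \<psi> ` ideal_gen (set (take i xs)) \<longrightarrow> y \<in> \<psi> ` ideal_gen (set (take i xs)))"
      if "i < length xs" for i
      by (rule regular_on_image[OF ideal_gen_ideal[OF sub]]) (use assms that in auto)
    thus ?thesis using c by simp
  qed
  finally show ?thesis .
qed

lemma regular_sequence_imp_depth:
  assumes "regular_sequence P ys" "set ys \<subseteq> \<psi> ` m" "m \<subseteq> R"
  shows "depth_ge m (length ys) R {0}"
proof -
  have "ys \<in> lists (\<psi> ` m)" using assms(2) by auto
  then have "ys \<in> map \<psi> ` lists m" by (simp only: lists_image)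
  then obtain xs where xs: "ys = map \<psi> xs" "set xs \<subseteq> m" by auto
  have "set xs \<subseteq> R" using xs assms(3) by auto
  from image_regular_sequence[OF this] assms(1) xs(1)
  have "\<And>i. i < length xs \<Longrightarrow> regular_on (xs ! i) R (ideal_gen (set (take i xs) \<union> {}))"
    by simp
  from regular_list_imp_depth_ge[OF assms(3) _ xs(2) this] show ?thesis using xs(1) ideal_gen_empty by simp
qed

lemma depth_imp_regular_sequence:
  assumes m: "is_prime m" and d: "depth_ge m n R {0}"
  obtains ys where "regular_sequence P ys" "length ys = n" "set ys \<subseteq> \<psi> ` m"
proof -
  have mid: "is_ideal m" by (rule prime_ideal[OF m])
  have mR: "m \<subseteq> R" using ideal_sub[OF mid] by auto
  have "depth_ge m n R (ideal_gen {})" using d ideal_gen_empty by simp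
  from depth_ge_imp_regular_list[OF mR empty_subsetI this]
  obtain xs where xs: "length xs = n" "set xs \<subseteq> m" "\<forall>i<n. regular_on (xs ! i) R (ideal_gen (set (take i xs) \<union> {}))"
    by (elim exE conjE)
  have "ideal_gen (set xs) \<subseteq> m" by (rule ideal_gen_least[OF mid xs(2)])
  then have "ideal_gen (set xs) \<noteq> R" using m one_mem by (auto simp: is_prime_def)
  moreover have "set xs \<subseteq> R" using xs(2) mR by (rule subset_trans)
  ultimately have "regular_sequence P (map \<psi> xs)" using image_regular_sequence xs(1,3) by simp
  thus ?thesis by (rule that) (use xs in auto)
qed

lemma prime_chain_le_height:
  assumes q: "prime_chain n q" shows "enat n \<le> height P (\<psi> ` q n)"
proof (rule le_height; (intro allI impI)?)
  show "primeideal (\<psi> ` q i) P" if "i \<le> n" for i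
    using q that image_prime by (simp add: prime_chain_def)
  fix i assume i: "i < n"
  then have 1: "q i \<subset> q (Suc i)" "is_prime (q (Suc i))" using q by (simp_all add: prime_chain_def)
  have "q (Suc i) \<subseteq> R" using ideal_sub[OF prime_ideal[OF 1(2)]] by auto
  then have "inj_on \<psi> (q (Suc i))" using bij by (metis bij_betw_def inj_on_subset)
  then show "\<psi> ` q i \<subset> \<psi> ` q (Suc i)" using 1(1) by (rule image_strict_mono)
qed simp

text \<open>Grade is at most height in every commutative Noetherian ring, because a regular sequence
  produces a chain of primes. The reverse inequality is \<open>cm\<close>, which is read over all
  chains since height is a supremum.\<close>

theorem cohen_macaulayI:
  assumes noeth: is_noetherian
    and cm: "\<And>m h q. is_maximal m \<Longrightarrow> prime_chain h q \<Longrightarrow> q h = m \<Longrightarrow> depth_ge m h R {0}"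
  shows "cohen_macaulay P"
  unfolding cohen_macaulay_def
proof (intro conjI allI impI)
  show "cring P" by (rule P_cring)
  show "noetherian_ring P" by (rule P_noetherian[OF noeth])
  fix m assume m: "maximalideal m P"
  let ?m = "pull m"
  have mx: "is_maximal ?m" by (rule pull_maximal[OF m])
  have mp: "is_prime ?m" by (rule maximal_prime[OF mx])
  have im: "\<psi> ` ?m = m" using pull_ideal(2)[of m] m by (simp add: maximalideal_def)
  show "grade P m = height P m"
  proof (rule antisym)
    show "grade P m \<le> height P m" unfolding grade_def
    proof (rule Sup_least)
      fix d assume "d \<in> {enat (length xs) | xs. regular_sequence P xs \<and> set xs \<subseteq> m}"
      then obtain xs where xs: "d = enat (length xs)" "regular_sequence P xs" "set xs \<subseteq> m" by blast
      have mR: "?m \<subseteq> R" by (auto simp: pull_def)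
      have "depth_ge ?m (length xs) R {0}" by (rule regular_sequence_imp_depth[OF xs(2) _ mR]) (use xs(3) im in simp)
      then have "loc_depth_ge (R - ?m) ?m (length xs) R {0}" by (rule depth_imp_loc_depth[OF mp])
      moreover have "{0} \<subseteq> ?m" using ideal_zero[OF prime_ideal[OF mp]] by simp
      ultimately obtain q where q: "prime_chain (length xs) q" "q (length xs) = ?m"
        using chain_of_loc_depth[OF noeth mp ideal_zero_set] by blast
      show "d \<le> height P m" using prime_chain_le_height[OF q(1)] q(2) im xs(1) by simp
    qed
    show "height P m \<le> grade P m" unfolding height_def
    proof (rule Sup_least)
      fix d assume "d \<in> {enat n | n. \<exists>Q :: nat \<Rightarrow> 'b set. (\<forall>i\<le>n. primeideal (Q i) P) \<and> (\<forall>i<n. Q i \<subset> Q (Suc i)) \<and> Q n = m}"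
      then obtain n Q where Q: "d = enat n" "\<forall>i\<le>n. primeideal (Q i) P" "\<forall>i<n. Q i \<subset> Q (Suc i)" "Q n = m" by blast
      have "prime_chain n (\<lambda>i. pull (Q i))" unfolding prime_chain_def
      proof (intro conjI allI impI)
        show "is_prime (pull (Q i))" if "i \<le> n" for i using pull_prime Q(2) that by simp
        show "pull (Q i) \<subset> pull (Q (Suc i))" if i: "i < n" for i
        proof -
          have "ideal (Q i) P" "ideal (Q (Suc i)) P" using Q(2) i by (simp_all add: primeideal_def)
          note im = pull_ideal(2)[OF this(1)] pull_ideal(2)[OF this(2)]
          have sub: "Q i \<subset> Q (Suc i)" using Q(3) i by blast
          have "pull (Q i) \<noteq> pull (Q (Suc i))"
          proof
            assume "pull (Q i) = pull (Q (Suc i))"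
            then have "Q i = Q (Suc i)" using im by metis
            with sub show False by blast
          qed
          moreover have "pull (Q i) \<subseteq> pull (Q (Suc i))" using sub unfolding pull_def by blast
          ultimately show ?thesis by blast
        qed
      qed
      then have "depth_ge ?m n R {0}" by (rule cm[OF mx]) (simp add: Q(4))
      from depth_imp_regular_sequence[OF mp this]
      obtain ys where ys: "regular_sequence P ys" "length ys = n" "set ys \<subseteq> \<psi> ` ?m" by blast
      then have "set ys \<subseteq> m" using im by simp
      then have "d \<in> {enat (length xs) | xs. regular_sequence P xs \<and> set xs \<subseteq> m}"
        unfolding Q(1) using ys(1,2) by blast
      thus "d \<le> grade P m" unfolding grade_def by (rule Sup_upper)
    qed
  qed
qed

text \<open>Grade is a supremum of lengths and can reach the finite number \<open>h\<close> only if
  some regular sequence has length at least \<open>h\<close>; this sequence is then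
  shortened.\<close>

theorem cohen_macaulayD:
  assumes cm: "cohen_macaulay P" and m: "is_maximal m" and q: "prime_chain h q" "q h = m"
  shows "depth_ge m h R {0}"
proof (cases h)
  case (Suc h')
  have mR: "m \<subseteq> R" using ideal_sub[OF maximal_ideal[OF m]] by auto
  have "enat h \<le> height P (\<psi> ` m)" using prime_chain_le_height[OF q(1)] q(2) by simp
  also have "\<dots> = grade P (\<psi> ` m)" using cm image_maximal[OF m] by (simp add: cohen_macaulay_def)
  finally have hg: "enat h \<le> grade P (\<psi> ` m)" .
  have "\<exists>ys. regular_sequence P ys \<and> set ys \<subseteq> \<psi> ` m \<and> h \<le> length ys"
  proof (rule ccontr)
    assume neg: "\<not> ?thesis"
    have "grade P (\<psi> ` m) \<le> enat h'" unfolding grade_def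
    proof (rule Sup_least)
      fix d assume "d \<in> {enat (length xs) | xs. regular_sequence P xs \<and> set xs \<subseteq> \<psi> ` m}"
      then obtain xs where xs: "d = enat (length xs)" "regular_sequence P xs" "set xs \<subseteq> \<psi> ` m" by blast
      then have "\<not> h \<le> length xs" using neg by blast
      thus "d \<le> enat h'" using xs(1) Suc by simp
    qed
    with hg have "enat h \<le> enat h'" by (rule order_trans)
    thus False using Suc by simp
  qed
  then obtain ys where ys: "regular_sequence P ys" "set ys \<subseteq> \<psi> ` m" "h \<le> length ys" by blast
  show ?thesis using regular_sequence_imp_depth[OF ys(1,2) mR] ys(3) by (rule depth_ge_mono)
qed simp

end

section \<open>The toric face ring as a monomial ring\<close>

context monomial_ring begin

lemma patch_ring_copy: "ring_copy R (patch_ring \<M> :: (int ^ 'n \<Rightarrow> 'k) ring) cf"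
proof
  have cfR: "cf x \<in> carrier (patch_ring \<M>)" if "x \<in> R" for x
    using cf_finite[OF that] cf_support[OF that] by (auto simp: patch_ring_def)
  show "bij_betw cf R (carrier (patch_ring \<M>))"
  proof (rule bij_betw_imageI)
    show "inj_on cf R" using cf_inject by (auto simp: inj_on_def)
    show "cf ` R = carrier (patch_ring \<M>)"
    proof
      show "carrier (patch_ring \<M>) \<subseteq> cf ` R"
      proof
        fix f :: "int ^ 'n \<Rightarrow> 'k" assume "f \<in> carrier (patch_ring \<M>)"
        then have f: "finite {a. f a \<noteq> 0}" "{a. f a \<noteq> 0} \<subseteq> U" by (auto simp: patch_ring_def)
        have "cf (\<Sum>a\<in>{a. f a \<noteq> 0}. kc (f a) * e a) = f"
          by (rule trans[OF cf_lincomb[OF f]]) (simp add: fun_eq_iff)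
        moreover have "(\<Sum>a\<in>{a. f a \<noteq> 0}. kc (f a) * e a) \<in> R" by (rule lincomb_mem[OF f(2)])
        ultimately show "f \<in> cf ` R" by (intro image_eqI[of f cf, OF sym])
      qed
    qed (rule image_subsetI[OF cfR])
  qed
  show "cf (x + y) = cf x \<oplus>\<^bsub>patch_ring \<M>\<^esub> cf y" if "x \<in> R" "y \<in> R" for x y
    using cf_add[OF that] by (auto simp: patch_ring_def)
  show "cf (x * y) = cf x \<otimes>\<^bsub>patch_ring \<M>\<^esub> cf y" if xy: "x \<in> R" "y \<in> R" for x y
  proof
    fix c
    let ?A = "{(a, b). cf x a \<noteq> 0 \<and> cf y b \<noteq> 0 \<and> a + b = c \<and> (\<exists>N\<in>\<M>. a \<in> N \<and> b \<in> N)}"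
    have "cf (x * y) c = (\<Sum>p\<in>supp x \<times> supp y. if compat (fst p) (snd p) \<and> fst p + snd p = c then cf x (fst p) * cf y (snd p) else 0)"
      unfolding cf_mult[OF xy] by (simp add: sum.cartesian_product case_prod_unfold)
    also have "\<dots> = (\<Sum>p\<in>?A. cf x (fst p) * cf y (snd p))"
      by (rule sum.mono_neutral_cong_right)
        (use supp_finite xy in \<open>auto simp: supp_def compat_def split: if_splits\<close>)
    finally show "cf (x * y) c = (cf x \<otimes>\<^bsub>patch_ring \<M>\<^esub> cf y) c" by (simp add: patch_ring_def)
  qed
  show "cf 0 = \<zero>\<^bsub>patch_ring \<M>\<^esub>" using cf_zero by (auto simp: patch_ring_def)
  show "cf 1 = \<one>\<^bsub>patch_ring \<M>\<^esub>"
  proof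
    show "cf 1 a = \<one>\<^bsub>patch_ring \<M>\<^esub> a" for a
      using cf_e[OF zero_U, of a] zero_U unfolding e_zero by (simp add: patch_ring_def)
  qed
qed

end

lemma sum_fun_apply: "(\<Sum>i\<in>I. f i) x = (\<Sum>i\<in>I. f i x)" for f :: "'i \<Rightarrow> 'x \<Rightarrow> 'y::comm_monoid_add"
  by (induction I rule: infinite_finite_induct) (auto simp: zero_fun_def plus_fun_def)

text \<open>The type class \<open>comm_ring_1\<close> is obtained by embedding the toric face ring into a product of
  monoid algebras of \<open>\<int>\<^sup>d\<close>, with the restriction of an element to \<open>N\<close> as its component at \<open>N \<in> \<M>\<close>. The
  components at \<open>N \<notin> \<M>\<close> are constants, so that \<open>1\<close> is the unit of the full product.\<close>

locale monoid_family =
  fixes \<M> :: "(int ^ 'n::finite) set set" and field_type :: "'k::field itself"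
  assumes finite_family: "finite \<M>" and nonempty_family: "\<M> \<noteq> {}"
    and affine_family: "N \<in> \<M> \<Longrightarrow> affine_monoid N"
    and face_family: "N \<in> \<M> \<Longrightarrow> N' \<in> \<M> \<Longrightarrow> a \<in> N \<Longrightarrow> b \<in> N \<Longrightarrow> a + b \<in> N' \<Longrightarrow> a \<in> N'"
    and pointed_family: "N \<in> \<M> \<Longrightarrow> a \<in> N \<Longrightarrow> b \<in> N \<Longrightarrow> a + b = 0 \<Longrightarrow> a = 0"
begin

definition comp :: "(int ^ 'n) set \<Rightarrow> (int ^ 'n) set" where "comp N = (if N \<in> \<M> then N else {0})"

definition const :: "'k \<Rightarrow> (int ^ 'n) set \<Rightarrow> (int ^ 'n \<Rightarrow>\<^sub>0 'k)" where
  "const c = (\<lambda>N. Poly_Mapping.single 0 c)"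

definition mon :: "int ^ 'n \<Rightarrow> (int ^ 'n) set \<Rightarrow> (int ^ 'n \<Rightarrow>\<^sub>0 'k)" where
  "mon a = (\<lambda>N. if a \<in> comp N then Poly_Mapping.single a 1 else 0)"

definition combinations :: "((int ^ 'n) set \<Rightarrow> (int ^ 'n \<Rightarrow>\<^sub>0 'k)) set" where
  "combinations = {\<Sum>a\<in>A. const (f a) * mon a | A f. finite A \<and> A \<subseteq> \<Union>\<M>}"

text \<open>The components of a combination at all members of the family that contain
  \<open>a\<close> have the same coefficient at \<open>a\<close>, so any choice of the member gives
  the same value.\<close>

definition coef :: "((int ^ 'n) set \<Rightarrow> (int ^ 'n \<Rightarrow>\<^sub>0 'k)) \<Rightarrow> int ^ 'n \<Rightarrow> 'k" where
  "coef x a = (if a \<in> \<Union>\<M> then Poly_Mapping.lookup (x (SOME N. N \<in> \<M> \<and> a \<in> N)) a else 0)"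

lemma zero_in_family: "N \<in> \<M> \<Longrightarrow> 0 \<in> N"
  using affine_monoidE[OF affine_family] by metis
lemma add_in_family: "N \<in> \<M> \<Longrightarrow> a \<in> N \<Longrightarrow> b \<in> N \<Longrightarrow> a + b \<in> N"
  using affine_monoidE[OF affine_family, of N] by metis
lemma zero_in_union: "0 \<in> \<Union>\<M>" using zero_in_family nonempty_family by auto

lemma const_zero: "const 0 = 0" by (simp add: const_def zero_fun_def)
lemma const_one: "const 1 = 1" by (simp add: const_def one_fun_def)
lemma const_add: "const (c + d) = const c + const d" by (simp add: const_def plus_fun_def single_add)
lemma const_mult: "const (c * d) = const c * const d" by (simp add: const_def times_fun_def mult_single)

lemma mon_zero: "mon 0 = 1"
proof
  show "mon 0 N = 1 N" for N
    using zero_in_family[of N] by (auto simp: mon_def comp_def one_fun_def)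
qed

text \<open>The multiplicativity of \<open>mon\<close> comes down to this equivalence. At members of
  the family it is the face property; at the constant components it says that 0 splits only as 0 +
  0, which is pointedness.\<close>

lemma comp_add:
  assumes N: "N \<in> \<M>" "a \<in> N" "b \<in> N"
  shows "a + b \<in> comp N' \<longleftrightarrow> a \<in> comp N' \<and> b \<in> comp N'"
proof (cases "N' \<in> \<M>")
  case True
  have "a \<in> N'" "b \<in> N'" if "a + b \<in> N'"
    using face_family[OF N(1) True N(2,3) that] face_family[OF N(1) True N(3,2)] that by (simp_all add: add.commute)
  then show ?thesis using True add_in_family[OF True] by (auto simp: comp_def)
next
  case False
  have "a = 0" "b = 0" if "a + b = 0"
    using pointed_family[OF N that] pointed_family[OF N(1,3,2)] that by (simp_all add: add.commute)
  then show ?thesis using False by (auto simp: comp_def)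
qed

lemma mon_mult:
  assumes "a \<in> \<Union>\<M>" "b \<in> \<Union>\<M>"
  shows "mon a * mon b = (if \<exists>N\<in>\<M>. a \<in> N \<and> b \<in> N then mon (a + b) else 0)"
proof (cases "\<exists>N\<in>\<M>. a \<in> N \<and> b \<in> N")
  case True
  then obtain N where N: "N \<in> \<M>" "a \<in> N" "b \<in> N" by blast
  have "mon a * mon b = mon (a + b)"
  proof
    show "(mon a * mon b) N' = mon (a + b) N'" for N'
      unfolding mon_def times_fun_def comp_add[OF N] by (simp add: mult_single)
  qed
  thus ?thesis using True by simp
next
  case False
  have "mon a * mon b = 0"
  proof
    show "(mon a * mon b) N' = 0 N'" for N'
      using False zero_in_union by (auto simp: mon_def times_fun_def zero_fun_def comp_def)
  qed
  then show ?thesis unfolding if_not_P[OF False] .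
qed

lemma lookup_combination:
  assumes "finite A" "a \<in> N" "N \<in> \<M>"
  shows "Poly_Mapping.lookup ((\<Sum>b\<in>A. const (f b) * mon b) N) a = (if a \<in> A then f a else 0)"
proof -
  have "Poly_Mapping.lookup ((\<Sum>b\<in>A. const (f b) * mon b) N) a
    = (\<Sum>b\<in>A. Poly_Mapping.lookup (const (f b) N * mon b N) a)"
    unfolding sum_fun_apply lookup_sum times_fun_def ..
  also have "\<dots> = (\<Sum>b\<in>A. if b = a then f b else 0)"
  proof (rule sum.cong[OF refl])
    fix b
    show "Poly_Mapping.lookup (const (f b) N * mon b N) a = (if b = a then f b else 0)"
      using assms by (simp add: const_def mon_def comp_def mult_single lookup_single when_def)
  qed
  also have "\<dots> = (if a \<in> A then f a else 0)" using assms(1) by simp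
  finally show ?thesis .
qed

lemma coef_combination:
  assumes "finite A" "A \<subseteq> \<Union>\<M>"
  shows "coef (\<Sum>a\<in>A. const (f a) * mon a) = (\<lambda>a. if a \<in> A then f a else 0)"
proof
  fix a
  show "coef (\<Sum>a\<in>A. const (f a) * mon a) a = (if a \<in> A then f a else 0)"
  proof (cases "a \<in> \<Union>\<M>")
    case True
    then have "\<exists>N. N \<in> \<M> \<and> a \<in> N" by blast
    then have "(SOME N. N \<in> \<M> \<and> a \<in> N) \<in> \<M> \<and> a \<in> (SOME N. N \<in> \<M> \<and> a \<in> N)" by (rule someI_ex)
    then show ?thesis using True lookup_combination[OF assms(1)] by (simp add: coef_def)
  qed (use assms(2) in \<open>auto simp: coef_def\<close>)
qed

lemma combinationsE:
  assumes "x \<in> combinations"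
  obtains A f where "finite A" "A \<subseteq> \<Union>\<M>" "x = (\<Sum>a\<in>A. const (f a) * mon a)"
  using assms unfolding combinations_def by blast

lemma term_combination: "a \<in> \<Union>\<M> \<Longrightarrow> const c * mon a \<in> combinations"
  unfolding combinations_def by (intro CollectI exI[of _ "{a}"] exI[of _ "\<lambda>_. c"]) simp

lemma zero_combination: "0 \<in> combinations"
  unfolding combinations_def by (intro CollectI exI[of _ "{}"]) simp

lemma add_combination:
  assumes "x \<in> combinations" "y \<in> combinations" shows "x + y \<in> combinations"
proof -
  obtain A f where A: "finite A" "A \<subseteq> \<Union>\<M>" "x = (\<Sum>a\<in>A. const (f a) * mon a)"
    using assms(1) by (rule combinationsE)
  obtain B g where B: "finite B" "B \<subseteq> \<Union>\<M>" "y = (\<Sum>a\<in>B. const (g a) * mon a)"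
    using assms(2) by (rule combinationsE)
  define f' g' where "f' a = (if a \<in> A then f a else 0)" and "g' a = (if a \<in> B then g a else 0)" for a
  have "x = (\<Sum>a\<in>A \<union> B. const (f' a) * mon a)" unfolding A(3)
    by (rule sum.mono_neutral_cong_left) (use A B in \<open>auto simp: f'_def const_zero\<close>)
  moreover have "y = (\<Sum>a\<in>A \<union> B. const (g' a) * mon a)" unfolding B(3)
    by (rule sum.mono_neutral_cong_left) (use A B in \<open>auto simp: g'_def const_zero\<close>)
  ultimately have "x + y = (\<Sum>a\<in>A \<union> B. const (f' a + g' a) * mon a)"
    by (simp only: const_add distrib_right sum.distrib)
  then show ?thesis unfolding combinations_def using A B
    by (intro CollectI exI[of _ "A \<union> B"] exI[of _ "\<lambda>a. f' a + g' a"]) simp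
qed

lemma sum_combination: "(\<And>i. i \<in> I \<Longrightarrow> f i \<in> combinations) \<Longrightarrow> sum f I \<in> combinations"
  by (induction I rule: infinite_finite_induct) (simp_all add: zero_combination add_combination)

lemma mult_combination:
  assumes "x \<in> combinations" "y \<in> combinations" shows "x * y \<in> combinations"
proof -
  obtain A f where A: "A \<subseteq> \<Union>\<M>" "x = (\<Sum>a\<in>A. const (f a) * mon a)"
    using assms(1) by (rule combinationsE)
  obtain B g where B: "B \<subseteq> \<Union>\<M>" "y = (\<Sum>a\<in>B. const (g a) * mon a)"
    using assms(2) by (rule combinationsE)
  have "(const c * mon a) * (const d * mon b) \<in> combinations" if ab: "a \<in> A" "b \<in> B" for a b c d
  proof -
    have ab': "a \<in> \<Union>\<M>" "b \<in> \<Union>\<M>" using ab A B by auto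
    have "(const c * mon a) * (const d * mon b) = const (c * d) * (mon a * mon b)"
      unfolding const_mult by (simp only: mult.assoc mult.left_commute)
    also have "\<dots> \<in> combinations"
    proof (cases "\<exists>N\<in>\<M>. a \<in> N \<and> b \<in> N")
      case True
      then have "a + b \<in> \<Union>\<M>" using add_in_family by blast
      thus ?thesis using True term_combination mon_mult[OF ab'] by simp
    next
      case False
      show ?thesis unfolding mon_mult[OF ab'] if_not_P[OF False] using zero_combination by simp
    qed
    finally show ?thesis .
  qed
  then show ?thesis unfolding A(2) B(2) sum_product by (intro sum_combination)
qed

theorem monomial_ring: "monomial_ring combinations const mon coef \<M>"
proof -
  have const_mem: "const c \<in> combinations" for c
    using term_combination[OF zero_in_union, of c] by (simp add: mon_zero)
  have coef_mem: "x = (\<Sum>a\<in>{a. coef x a \<noteq> 0}. const (coef x a) * mon a) \<and>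
      finite {a. coef x a \<noteq> 0} \<and> {a. coef x a \<noteq> 0} \<subseteq> \<Union>\<M>" if "x \<in> combinations" for x
  proof -
    obtain A f where A: "finite A" "A \<subseteq> \<Union>\<M>" "x = (\<Sum>a\<in>A. const (f a) * mon a)"
      using \<open>x \<in> combinations\<close> by (rule combinationsE)
    have c: "coef x = (\<lambda>a. if a \<in> A then f a else 0)" unfolding A(3) by (rule coef_combination[OF A(1,2)])
    then have sub: "{a. coef x a \<noteq> 0} \<subseteq> A" by auto
    have "(\<Sum>a\<in>{a. coef x a \<noteq> 0}. const (coef x a) * mon a) = (\<Sum>a\<in>A. const (f a) * mon a)"
      by (rule sum.mono_neutral_cong_left[OF A(1) sub]) (auto simp: c const_zero split: if_splits)
    then show ?thesis using A finite_subset[OF sub A(1)] sub by auto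
  qed
  show ?thesis
  proof (unfold_locales, goal_cases)
    case 1 show ?case using const_mem[of 1] by (simp add: const_one)
  next
    case (2 x y) then show ?case by (rule add_combination)
  next
    case (3 x)
    have "const (- 1) + const 1 = 0" using const_add[of "- 1" 1] by (simp add: const_zero)
    then have "const (- 1) = - 1" by (simp add: const_one add_eq_0_iff2)
    then show ?case using mult_combination[OF const_mem[of "- 1"] 3] by simp
  next
    case (4 x y) then show ?case by (rule mult_combination)
  next
    case 5 show ?case by (rule finite_family)
  next
    case 6 show ?case by (rule nonempty_family)
  next
    case (7 N) then show ?case by (rule affine_family)
  next
    case (8 N N' a b) then show ?case by (rule face_family)
  next
    case 9 show ?case by (rule const_zero)
  next
    case 10 show ?case by (rule const_one)
  next
    case (11 c d) show ?case by (rule const_add)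
  next
    case (12 c d) show ?case by (rule const_mult)
  next
    case (13 c) show ?case by (rule const_mem)
  next
    case (14 a) then show ?case using term_combination[of a 1] by (simp add: const_one)
  next
    case 15 show ?case by (rule mon_zero)
  next
    case (16 a b) then show ?case by (rule mon_mult)
  next
    case (17 x) then show ?case using coef_mem[of x] by simp
  next
    case (18 x a) then show ?case using coef_mem[of x] by blast
  next
    case (19 A f) then show ?case by (rule coef_combination)
  next
    case (20 x) then show ?case using coef_mem[of x] by blast
  qed
qed

end

section \<open>From fans to monoid families\<close>

lemma rvec_eq_zero: "rvec a = 0 \<longleftrightarrow> a = 0"
  using rvec_inject[of a 0] by (simp add: rvec_zero)

text \<open>The last two axioms are geometric: a summand in \<open>C\<close> of a point of
  \<open>C \<inter> D\<close> lies in this common face, where \<open>M C\<close> and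
  \<open>M D\<close> agree, and a pointed cone contains no opposite nonzero vectors.\<close>

lemma monoid_family_complex:
  fixes M :: "(real ^ 'n::finite) set \<Rightarrow> (int ^ 'n) set"
  assumes fan: "rational_pointed_fan \<Sigma>" and mc: "monoidal_complex \<Sigma> M" and ne: "\<Sigma> \<noteq> {}"
  shows "monoid_family (M ` \<Sigma>)"
proof
  have affine: "\<And>C. C \<in> \<Sigma> \<Longrightarrow> affine_monoid (M C)"
    and gen: "\<And>C. C \<in> \<Sigma> \<Longrightarrow> cone_gen (rvec ` M C) = C"
    and restr: "\<And>C D. C \<in> \<Sigma> \<Longrightarrow> D \<in> \<Sigma> \<Longrightarrow> D \<subseteq> C \<Longrightarrow> M D = {a \<in> M C. rvec a \<in> D}"
    using mc unfolding monoidal_complex_def by blast+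
  have cone: "rvec a \<in> C" if C: "C \<in> \<Sigma>" "a \<in> M C" for C a
  proof -
    have "rvec a \<in> cone_gen (rvec ` M C)" unfolding cone_gen_eq_hull using C(2) by (intro hull_inc imageI)
    thus ?thesis unfolding gen[OF C(1)] .
  qed
  show "finite (M ` \<Sigma>)" using fan by (simp add: rational_pointed_fan_def)
  show "M ` \<Sigma> \<noteq> {}" using ne by simp
  show "affine_monoid N" if "N \<in> M ` \<Sigma>" for N using affine that by blast
  fix N a b assume "N \<in> M ` \<Sigma>" and ab: "a \<in> N" "b \<in> N"
  then obtain C where C: "C \<in> \<Sigma>" "N = M C" by blast
  have abC: "rvec a \<in> C" "rvec b \<in> C" using cone[OF C(1)] C(2) ab by simp_all
  have rC: "rational_cone C" "pointed_cone C"
    using fan C(1) by (simp_all add: rational_pointed_fan_def rational_pointed_cone_def)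
  show "a = 0" if "a + b = 0"
  proof -
    have "rvec a + rvec b = 0" using that by (simp add: rvec_add[symmetric] rvec_zero)
    then have "rvec a = - rvec b" by (simp add: eq_neg_iff_add_eq_0)
    then have "rvec a \<in> C \<inter> uminus ` C" using abC by blast
    then have "rvec a \<in> {0}" using rC(2) by (simp only: pointed_cone_def)
    then show ?thesis by (simp add: rvec_eq_zero)
  qed
  fix N' assume "N' \<in> M ` \<Sigma>" and s: "a + b \<in> N'"
  then obtain D where D: "D \<in> \<Sigma>" "N' = M D" by blast
  let ?E = "C \<inter> D"
  have E: "?E \<in> cone_faces C" using fan C(1) D(1) by (simp add: rational_pointed_fan_def)
  then have E': "?E \<in> \<Sigma>" using fan C(1) by (auto simp: rational_pointed_fan_def)
  note cc = rational_cone_convex_cone[OF rC(1)]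
  have "rvec a + rvec b \<in> C" by (rule convex_cone_add[OF cc abC])
  moreover have "rvec a + rvec b \<in> D" using cone[OF D(1)] s D(2) by (simp add: rvec_add[symmetric])
  ultimately have "rvec a + rvec b \<in> ?E" by blast
  moreover have Ef: "?E face_of C" "?E \<noteq> {}" using E by (simp_all add: cone_faces_def)
  ultimately have "rvec a \<in> ?E" by (intro convex_cone_face(2)[OF cc Ef abC])
  moreover have "M ?E = {a \<in> M C. rvec a \<in> ?E}" by (rule restr[OF C(1) E']) blast
  moreover have "M ?E = {a \<in> M D. rvec a \<in> ?E}" by (rule restr[OF D(1) E']) blast
  ultimately show "a \<in> N'" using ab(1) C(2) D(2) by blast
qed

theorem (in fan_ring) maximal_depth:
  assumes sh: "is_shelling k \<Sigma> Cs"
    and cm: "(\<forall>C\<in>\<Sigma>. cohen_macaulay (monoid_ring (M C) :: (int ^ 'n \<Rightarrow> 'k) ring)) \<or> M = lattice_points"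
    and q: "prime_chain h q" "q h = m"
  shows "depth_ge m h R {0}"
proof (rule prime_chain_depth[OF sh _ q])
  fix k' C assume C: "C \<in> \<Sigma>" "aff_dim C = int k'" "shelled_boundary k' C"
  show "set_depth (k' - card J) (M C)"
  proof (cases "M = lattice_points")
    case True
    show ?thesis by (rule lattice_set_depth[OF True C])
  next
    case False
    have MC: "M C \<in> M ` \<Sigma>" using C(1) by (rule imageI)
    have "ring_copy (span_of (M C)) (monoid_ring (M C) :: (int ^ 'n \<Rightarrow> 'k) ring) cf"
      unfolding monoid_ring_def by (rule monomial_ring.patch_ring_copy[OF sub_monomial_ring[OF MC]])
    note D = ring_copy.cohen_macaulayD[OF this]
    have cmC: "cohen_macaulay (monoid_ring (M C) :: (int ^ 'n \<Rightarrow> 'k) ring)" using cm False C(1) by blast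
    show ?thesis by (rule face_ring_set_depth[OF C(1,2)]) (rule D[OF cmC])
  qed
qed

lemma toric_face_ring_cohen_macaulay:
  fixes M :: "(real ^ 'n::finite) set \<Rightarrow> (int ^ 'n) set"
  assumes fan: "rational_pointed_fan \<Sigma>" and mc: "monoidal_complex \<Sigma> M" and ne: "\<Sigma> \<noteq> {}"
    and sh: "is_shelling k \<Sigma> Cs"
    and cm: "(\<forall>C\<in>\<Sigma>. cohen_macaulay (monoid_ring (M C) :: (int ^ 'n \<Rightarrow> 'k::field) ring)) \<or> M = lattice_points"
  shows "cohen_macaulay (toric_face_ring \<Sigma> M :: (int ^ 'n \<Rightarrow> 'k) ring)"
proof -
  interpret F: monoid_family "M ` \<Sigma>" "TYPE('k)" by (rule monoid_family_complex[OF fan mc ne])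
  interpret monomial_ring F.combinations F.const F.mon F.coef "M ` \<Sigma>" by (rule F.monomial_ring)
  interpret P: ring_copy F.combinations "toric_face_ring \<Sigma> M :: (int ^ 'n \<Rightarrow> 'k) ring" F.coef
    unfolding toric_face_ring_def by (rule patch_ring_copy)
  show ?thesis
  proof (rule P.cohen_macaulayI[OF noetherian])
    fix m h q assume m: "is_maximal m" and q: "prime_chain h q" "q h = m"
    interpret A: monomial_at F.combinations F.const F.mon F.coef "M ` \<Sigma>" m by unfold_locales (rule m)
    obtain B l where B: "finite B" "B \<subseteq> A.units_at" "rvec ` A.units_at \<subseteq> span (rvec ` B)" "card B = dim (rvec ` A.units_at)"
      and l: "\<And>b a c. b \<in> B \<Longrightarrow> l b (a + c) = (l b a + l b c :: real)" "\<And>b. b \<in> B \<Longrightarrow> l b b = 1"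
        "\<And>b c. b \<in> B \<Longrightarrow> c \<in> B \<Longrightarrow> c \<noteq> b \<Longrightarrow> l b c = 0"
      using max_independent_lattice[of A.units_at] by blast
    obtain J where J: "J \<subseteq> B" "A.alg_free J" "\<And>b. b \<in> B - J \<Longrightarrow> \<not> A.alg_free (insert b J)"
      using A.exists_max_alg_free[OF B(1)] by blast
    interpret fan_ring F.combinations F.const F.mon F.coef M \<Sigma> m B J l
      by unfold_locales (fact fan mc B J l)+
    show "depth_ge m h F.combinations {0}" by (rule maximal_depth[OF sh cm q])
  qed
qed

text \<open>The empty fan counts as shellable and gives the zero ring, which has no maximal
  ideals.\<close>

lemma cohen_macaulay_patch_ring_empty:
  "cohen_macaulay (patch_ring {} :: (int ^ 'n::finite \<Rightarrow> 'k::field) ring)"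
proof -
  let ?P = "patch_ring {} :: (int ^ 'n \<Rightarrow> 'k) ring"
  have car: "carrier ?P = {\<lambda>a. 0}" by (auto simp: patch_ring_def fun_eq_iff)
  have ops: "\<zero>\<^bsub>?P\<^esub> = (\<lambda>a. 0)" "\<one>\<^bsub>?P\<^esub> = (\<lambda>a. 0)"
    "(\<lambda>a. 0) \<oplus>\<^bsub>?P\<^esub> (\<lambda>a. 0) = (\<lambda>a. 0)" "(\<lambda>a. 0) \<otimes>\<^bsub>?P\<^esub> (\<lambda>a. 0) = (\<lambda>a. 0)"
    by (simp_all add: patch_ring_def)
  interpret P: cring ?P
  proof (rule cringI)
    show "abelian_group ?P" by (rule abelian_groupI) (simp_all add: car ops)
    show "comm_monoid ?P" by (rule comm_monoidI) (simp_all only: car ops singleton_iff)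
  qed (simp_all only: car ops singleton_iff)
  have all: "I = carrier ?P" if "ideal I ?P" for I
  proof -
    interpret ideal I ?P by (rule that)
    show ?thesis using zero_closed Icarr unfolding car ops by blast
  qed
  have "noetherian_ring ?P"
  proof (rule P.noetherian_ringI)
    fix I assume I: "ideal I ?P"
    have "ideal (Idl\<^bsub>?P\<^esub> {}) ?P" by (rule P.genideal_ideal) simp
    then have "I = Idl\<^bsub>?P\<^esub> {}" using all I by blast
    then show "\<exists>A\<subseteq>carrier ?P. finite A \<and> I = Idl\<^bsub>?P\<^esub> A" by blast
  qed
  moreover have "\<not> maximalideal m ?P" for m
    using all[of m] maximalideal.I_notcarr[of m ?P] by (auto simp: maximalideal_def)
  ultimately show ?thesis using P.is_cring unfolding cohen_macaulay_def by blast
qed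

lemma monoidal_complex_lattice_points:
  assumes "rational_pointed_fan \<Sigma>" shows "monoidal_complex \<Sigma> lattice_points"
proof -
  have "rational_cone C" if "C \<in> \<Sigma>" for C
    using assms that by (simp add: rational_pointed_fan_def rational_pointed_cone_def)
  then show ?thesis
    by (auto simp: monoidal_complex_def affine_monoid_lattice_points cone_gen_lattice_points)
       (auto simp: lattice_points_def)
qed

theorem theorem3p2:
  fixes \<Sigma> :: "(real ^ 'n::finite) set set"
    and M :: "(real ^ 'n) set \<Rightarrow> (int ^ 'n) set"
  assumes "rational_pointed_fan \<Sigma>"
    and "shellable \<Sigma>"
  shows "(monoidal_complex \<Sigma> M
           \<and> (\<forall>C\<in>\<Sigma>. cohen_macaulay (monoid_ring (M C) :: (int ^ 'n \<Rightarrow> 'k::field) ring))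
           \<longrightarrow> cohen_macaulay (toric_face_ring \<Sigma> M :: (int ^ 'n \<Rightarrow> 'k) ring))
         \<and> cohen_macaulay (toric_face_ring \<Sigma> lattice_points :: (int ^ 'n \<Rightarrow> 'k) ring)"
proof (cases "\<Sigma> = {}")
  case True
  then show ?thesis by (simp add: toric_face_ring_def cohen_macaulay_patch_ring_empty)
next
  case False
  obtain k Cs where sh: "is_shelling k \<Sigma> Cs" using assms(2) unfolding shellable_def by blast
  note main = toric_face_ring_cohen_macaulay[OF assms(1) _ False sh]
  show ?thesis
  proof (intro conjI impI)
    show "cohen_macaulay (toric_face_ring \<Sigma> lattice_points :: (int ^ 'n \<Rightarrow> 'k) ring)"
      by (rule main[OF monoidal_complex_lattice_points[OF assms(1)] disjI2[OF refl]])
    assume "monoidal_complex \<Sigma> M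
      \<and> (\<forall>C\<in>\<Sigma>. cohen_macaulay (monoid_ring (M C) :: (int ^ 'n \<Rightarrow> 'k) ring))"
    then show "cohen_macaulay (toric_face_ring \<Sigma> M :: (int ^ 'n \<Rightarrow> 'k) ring)"
      using main[OF _ disjI1] by blast
  qed
qed

end
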